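(* Let $\Pi$ be a partition of $\mathbb N$ of type $(\infty^{k_\infty},1^{k_1},2^{k_2},\ldots)$ with finitely many finite blocks. Denote by $\lambda=\lambda(\Pi)=1^{k_1}2^{k_2}\ldots$ the Young diagram, of size $N=k_1+2k_2+3k_3+\ldots$, formed by the lengths of the finite blocks of $\Pi$. Then $$I_\Pi=\sum_{|\mu|=N,\ \mu\unrhd\lambda}K_{\mu,\lambda}\,\pi_\mu^{k_\infty},$$ where $\pi_\mu^{k_\infty}$ is the irreducible representation of $\mathfrak S_{\mathbb N}$ corresponding to the irreducible component $\pi_\mu$ of $I_{\rm fin}$ as described in the context (that is, $I_\Pi$ is unitarily equivalent to the direct sum of the irreducible representations $\pi_\mu^{k_\infty}$ with multiplicities $K_{\mu,\lambda}$).
   Context: $\mathbb N$ is the set of positive integers and $\mathfrak S_{\mathbb N}$ is the group of finite permutations of $\mathbb N$. For a partition $\Pi=(A_1,A_2,\ldots)$ of $\mathbb N$ into disjoint nonempty blocks, $\mathfrak S_\Pi=\mathfrak S_{A_1}\times\mathfrak S_{A_2}\times\cdots\subset\mathfrak S_{\mathbb N}$ is the corresponding Young subgroup, where $\mathfrak S_A$ is the group of finite permutations of the elements of $A$. The type $(\infty^{k_\infty},1^{k_1},2^{k_2},\ldots)$ of $\Pi$ records the number $k_i\in\{0,1,\ldots,\infty\}$ of blocks of cardinality $i$, $i=1,2,\ldots,\infty$. $I_\Pi=\operatorname{Ind}_{\mathfrak S_\Pi}^{\mathfrak S_{\mathbb N}}1_{\mathfrak S_\Pi}$ is the unitary representation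 by left translations in $l^2(\mathfrak S_{\mathbb N}/\mathfrak S_\Pi)$. $\pi_\mu$ is the irreducible unitary representation of $\mathfrak S_N$ corresponding to a Young diagram $\mu$ with $N$ cells. The dominance order: $\mu\unrhd\lambda$ iff $\mu_1+\ldots+\mu_i\ge\lambda_1+\ldots+\lambda_i$ for all $i\ge1$. The Kostka number $K_{\mu,\lambda}$ is the number of semistandard Young tableaux of shape $\mu$ and weight $\lambda$. Number the blocks so that $A_1,\ldots,A_n$ are the finite blocks and $A_{n+1},A_{n+2},\ldots$ are the infinite ones; put $m_i=|A_i|$ and $\mathfrak S_{\rm fin}=\mathfrak S_{A_1}\times\cdots\times\mathfrak S_{A_n}$, regarded as a Young subgroup of the group $\mathfrak S_N$ of permutations of the $N$-element set $A_1\cup\ldots\cup A_n$. Let $I_{\rm fin}=\operatorname{Ind}_{\mathfrak S_{\rm fin}}^{\mathfrak S_N}1$, acting in $l^2(\mathfrak S_N/\mathfrak S_{\rm fin})$, i.e. in functions on ordered partitions of $A_1\cup\ldots\cup A_n$ into sets of cardinalities $m_1,\ldots,m_n$; its irreducible components are the $\pi_\mu$ with $|\mu|=N$, $\mu\unrhd\lambda$, with multiplicities $K_{\mu,\lambda}$. Definition of $\pi_\mu^{k_\infty}$. The homogeneous space $X_\Pi=\mathfrak S_{\mathbb N}/\mathfrak S_\Pi$ is realized as the set of ordered partitions $r=(R_1,R_2,\ldots)$ of $\mathbb N$ into disjoint sets with $|R_i|=m_i$ that can be obtained from $(A_1,A_2,\ldots)$ by a finite permutation of $\mathbb N$, with the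 natural action of $\mathfrak S_{\mathbb N}$ by permutations. For fixed infinite blocks $R_{n+1},R_{n+2},\ldots$ the set of such $r$ is identified (through any bijection of the complement of $R_{n+1}\cup R_{n+2}\cup\ldots$ with $A_1\cup\ldots\cup A_n$) with $\mathfrak S_N/\mathfrak S_{\rm fin}$, and the functions on it with the space of $I_{\rm fin}$. Let $P_\mu$ be the projection in $I_{\rm fin}$, commuting with $\mathfrak S_N$, onto an irreducible component equivalent to $\pi_\mu$ (since $P_\mu$ commutes with $\mathfrak S_N$, the choice of bijection is immaterial). Let $\tilde P_\mu$ be the operator on $l^2(X_\Pi)$ that, for each fixed choice of $(R_{n+1},R_{n+2},\ldots)$, acts as $P_\mu$ in the coordinates $(R_1,\ldots,R_n)$ and leaves the other coordinates unchanged. Then $\pi_\mu^{k_\infty}$ is the restriction of $I_\Pi$ to the invariant subspace $\tilde P_\mu\, l^2(X_\Pi)$. *)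

theory Defs
  imports
    Complex_Main
    "HOL-Library.FuncSet"
    "HOL-Library.Disjoint_Sets"
    "HOL-Library.Multiset"
    "HOL-Combinatorics.Permutations"
    "HOL-Algebra.Left_Coset"
    "HOL-Analysis.Infinite_Sum"
begin

section \<open>Unitary representations in closed subspaces of \<open>l\<^sup>2\<close>\<close>

text \<open>
  A vector is a function \<open>'x \<Rightarrow> complex\<close> with pointwise operations. Every Hilbert space is
  isometric to some \<open>l\<^sup>2(X)\<close>, so using closed subspaces of such spaces as carriers loses nothing.
  Elements of \<open>l2 X\<close> vanish outside \<open>X\<close>, so sums over \<open>UNIV\<close> are sums over \<open>X\<close>.
\<close>

definition l2 :: "'x set \<Rightarrow> ('x \<Rightarrow> complex) set" where
  "l2 X = {f. (\<forall>x. x \<notin> X \<longrightarrow> f x = 0) \<and> (\<lambda>x. (cmod (f x))\<^sup>2) summable_on UNIV}"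

definition l2_inner :: "('x \<Rightarrow> complex) \<Rightarrow> ('x \<Rightarrow> complex) \<Rightarrow> complex" where
  "l2_inner f g = (\<Sum>\<^sub>\<infinity>x\<in>UNIV. f x * cnj (g x))"

definition l2_norm :: "('x \<Rightarrow> complex) \<Rightarrow> real" where
  "l2_norm f = sqrt (\<Sum>\<^sub>\<infinity>x\<in>UNIV. (cmod (f x))\<^sup>2)"

definition l2_closed_subspace :: "('x \<Rightarrow> complex) set \<Rightarrow> bool" where
  "l2_closed_subspace V \<longleftrightarrow>
     V \<subseteq> l2 UNIV \<and> (\<lambda>x. 0) \<in> V \<and>
     (\<forall>f\<in>V. \<forall>g\<in>V. \<forall>a b. (\<lambda>x. a * f x + b * g x) \<in> V) \<and>
     (\<forall>F. \<forall>f\<in>l2 UNIV. (\<forall>n::nat. F n \<in> V) \<and>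
        (\<lambda>n. l2_norm (\<lambda>x. F n x - f x)) \<longlonglongrightarrow> 0 \<longrightarrow> f \<in> V)"

definition linear_map_on ::
    "('x \<Rightarrow> complex) set \<Rightarrow> (('x \<Rightarrow> complex) \<Rightarrow> ('y \<Rightarrow> complex)) \<Rightarrow> bool" where
  "linear_map_on V T \<longleftrightarrow>
     (\<forall>f\<in>V. \<forall>g\<in>V. \<forall>a b. T (\<lambda>x. a * f x + b * g x) = (\<lambda>y. a * T f y + b * T g y))"

record ('g, 'x) urep =
  rep_space :: "('x \<Rightarrow> complex) set"
  rep_act :: "'g \<Rightarrow> ('x \<Rightarrow> complex) \<Rightarrow> ('x \<Rightarrow> complex)"

definition unitary_rep :: "'g monoid \<Rightarrow> ('g, 'x) urep \<Rightarrow> bool" where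
  "unitary_rep G \<rho> \<longleftrightarrow>
     group G \<and> l2_closed_subspace (rep_space \<rho>) \<and>
     (\<forall>g\<in>carrier G. rep_act \<rho> g ` rep_space \<rho> \<subseteq> rep_space \<rho> \<and>
        linear_map_on (rep_space \<rho>) (rep_act \<rho> g) \<and>
        (\<forall>f\<in>rep_space \<rho>. \<forall>f'\<in>rep_space \<rho>.
           l2_inner (rep_act \<rho> g f) (rep_act \<rho> g f') = l2_inner f f')) \<and>
     (\<forall>f\<in>rep_space \<rho>. rep_act \<rho> \<one>\<^bsub>G\<^esub> f = f) \<and>
     (\<forall>g\<in>carrier G. \<forall>h\<in>carrier G. \<forall>f\<in>rep_space \<rho>.
        rep_act \<rho> (g \<otimes>\<^bsub>G\<^esub> h) f = rep_act \<rho> g (rep_act \<rho> h f))"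

definition subrep :: "('g, 'x) urep \<Rightarrow> ('x \<Rightarrow> complex) set \<Rightarrow> ('g, 'x) urep" where
  "subrep \<rho> W = \<lparr>rep_space = W, rep_act = rep_act \<rho>\<rparr>"

definition irreducible_rep :: "'g monoid \<Rightarrow> ('g, 'x) urep \<Rightarrow> bool" where
  "irreducible_rep G \<rho> \<longleftrightarrow>
     unitary_rep G \<rho> \<and> rep_space \<rho> \<noteq> {\<lambda>x. 0} \<and>
     (\<forall>W. l2_closed_subspace W \<and> W \<subseteq> rep_space \<rho> \<and>
        (\<forall>g\<in>carrier G. rep_act \<rho> g ` W \<subseteq> W) \<longrightarrow>
        W = {\<lambda>x. 0} \<or> W = rep_space \<rho>)"

definition unitarily_equivalent ::
    "'g monoid \<Rightarrow> ('g, 'x) urep \<Rightarrow> ('g, 'y) urep \<Rightarrow> bool" where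
  "unitarily_equivalent G \<rho> \<sigma> \<longleftrightarrow>
     (\<exists>U. bij_betw U (rep_space \<rho>) (rep_space \<sigma>) \<and>
        linear_map_on (rep_space \<rho>) U \<and>
        (\<forall>f\<in>rep_space \<rho>. \<forall>f'\<in>rep_space \<rho>. l2_inner (U f) (U f') = l2_inner f f') \<and>
        (\<forall>g\<in>carrier G. \<forall>f\<in>rep_space \<rho>. U (rep_act \<rho> g f) = rep_act \<sigma> g (U f)))"

definition direct_sum_rep :: "'j set \<Rightarrow> ('j \<Rightarrow> ('g, 'x) urep) \<Rightarrow> ('g, 'j \<times> 'x) urep" where
  "direct_sum_rep J \<rho> =
     \<lparr>rep_space = {F \<in> l2 (J \<times> UNIV). \<forall>j\<in>J. (\<lambda>x. F (j, x)) \<in> rep_space (\<rho> j)},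
      rep_act = (\<lambda>g F (j, x). if j \<in> J then rep_act (\<rho> j) g (\<lambda>y. F (j, y)) x else 0)\<rparr>"

definition permutation_rep :: "'g monoid \<Rightarrow> ('g \<Rightarrow> 'x \<Rightarrow> 'x) \<Rightarrow> 'x set \<Rightarrow> ('g, 'x) urep" where
  "permutation_rep G act X =
     \<lparr>rep_space = l2 X,
      rep_act = (\<lambda>g f x. if x \<in> X then f (act (inv\<^bsub>G\<^esub> g) x) else 0)\<rparr>"

definition quasi_regular_rep :: "'g monoid \<Rightarrow> 'g set \<Rightarrow> ('g, 'g set) urep" where
  "quasi_regular_rep G H = permutation_rep G (\<lambda>g C. g <#\<^bsub>G\<^esub> C) (lcosets\<^bsub>G\<^esub> H)"

text \<open>\<open>P\<close> is the orthogonal projection of \<open>\<rho>\<close> onto an irreducible component equivalent to \<open>\<sigma>\<close>.\<close>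

definition component_projection ::
    "'g monoid \<Rightarrow> ('g, 'x) urep \<Rightarrow> ('g, 'y) urep \<Rightarrow> (('x \<Rightarrow> complex) \<Rightarrow> ('x \<Rightarrow> complex)) \<Rightarrow> bool"
  where
  "component_projection G \<rho> \<sigma> P \<longleftrightarrow>
     P ` rep_space \<rho> \<subseteq> rep_space \<rho> \<and> linear_map_on (rep_space \<rho>) P \<and>
     (\<forall>f\<in>rep_space \<rho>. P (P f) = P f) \<and>
     (\<forall>f\<in>rep_space \<rho>. \<forall>f'\<in>rep_space \<rho>. l2_inner (P f) f' = l2_inner f (P f')) \<and>
     (\<forall>g\<in>carrier G. \<forall>f\<in>rep_space \<rho>. P (rep_act \<rho> g f) = rep_act \<rho> g (P f)) \<and>
     irreducible_rep G (subrep \<rho> (P ` rep_space \<rho>)) \<and>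
     unitarily_equivalent G (subrep \<rho> (P ` rep_space \<rho>)) \<sigma>"


section \<open>Finite permutations\<close>

text \<open>Finite permutations of \<open>A\<close> are extended by the identity, so the groups of subsets are nested.\<close>

definition fin_sym :: "'a set \<Rightarrow> ('a \<Rightarrow> 'a) monoid" where
  "fin_sym A =
     \<lparr>carrier = {p. p permutes A \<and> finite {x. p x \<noteq> x}}, mult = (\<circ>), one = id\<rparr>"

definition relabel :: "('a \<Rightarrow> 'b) \<Rightarrow> ('i \<Rightarrow> 'a set) \<Rightarrow> ('i \<Rightarrow> 'b set)" where
  "relabel g r = (\<lambda>i. g ` r i)"


section \<open>Young diagrams, Kostka numbers and the representations \<open>\<pi>\<^sub>\<mu>\<close>\<close>

definition young_diagrams :: "nat \<Rightarrow> nat list set" where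
  "young_diagrams N = {\<mu>. sorted_wrt (\<ge>) \<mu> \<and> 0 \<notin> set \<mu> \<and> sum_list \<mu> = N}"

definition dominates :: "nat list \<Rightarrow> nat list \<Rightarrow> bool" where
  "dominates \<mu> \<nu> \<longleftrightarrow> (\<forall>i. sum_list (take i \<mu>) \<ge> sum_list (take i \<nu>))"

text \<open>A cell is a pair (row, column), both counted from 0.\<close>

definition cells :: "nat list \<Rightarrow> (nat \<times> nat) set" where
  "cells \<mu> = {(i, j). i < length \<mu> \<and> j < \<mu> ! i}"

text \<open>
  Entries of semistandard tableaux are positive; the value \<open>0\<close> outside the shape makes
  the representing function unique.
\<close>

definition semistandard_tableaux :: "nat list \<Rightarrow> nat list \<Rightarrow> (nat \<times> nat \<Rightarrow> nat) set" where
  "semistandard_tableaux \<mu> \<nu> =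
     {T. (\<forall>c. c \<notin> cells \<mu> \<longrightarrow> T c = 0) \<and> (\<forall>c\<in>cells \<mu>. T c \<ge> 1) \<and>
         (\<forall>i j j'. j < j' \<and> (i, j') \<in> cells \<mu> \<longrightarrow> T (i, j) \<le> T (i, j')) \<and>
         (\<forall>i i' j. i < i' \<and> (i', j) \<in> cells \<mu> \<longrightarrow> T (i, j) < T (i', j)) \<and>
         (\<forall>k. card {c \<in> cells \<mu>. T c = Suc k} = (if k < length \<nu> then \<nu> ! k else 0))}"

definition kostka :: "nat list \<Rightarrow> nat list \<Rightarrow> nat" where
  "kostka \<mu> \<nu> = card (semistandard_tableaux \<mu> \<nu>)"

text \<open>
  The irreducible representation \<open>\<pi>\<^sub>\<mu>\<close> of the symmetric group of a finite set \<open>E\<close> is realized as the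
  Specht module: the span of the polytabloids inside the functions on tabloids. A tabloid is the
  sequence of rows of a tableau. With this convention \<open>\<mu> = [N]\<close> gives the trivial representation.
\<close>

definition tableaux :: "nat list \<Rightarrow> 'a set \<Rightarrow> (nat \<times> nat \<Rightarrow> 'a) set" where
  "tableaux \<mu> E = {t \<in> extensional (cells \<mu>). bij_betw t (cells \<mu>) E}"

definition tabloid :: "nat list \<Rightarrow> (nat \<times> nat \<Rightarrow> 'a) \<Rightarrow> (nat \<Rightarrow> 'a set)" where
  "tabloid \<mu> t = (\<lambda>i. {t (i, j) | j. (i, j) \<in> cells \<mu>})"

definition column_stabilizer ::
    "nat list \<Rightarrow> 'a set \<Rightarrow> (nat \<times> nat \<Rightarrow> 'a) \<Rightarrow> ('a \<Rightarrow> 'a) set" where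
  "column_stabilizer \<mu> E t =
     {p \<in> carrier (fin_sym E).
        \<forall>j. p ` {t (i, j) | i. (i, j) \<in> cells \<mu>} = {t (i, j) | i. (i, j) \<in> cells \<mu>}}"

definition polytabloid ::
    "nat list \<Rightarrow> 'a set \<Rightarrow> (nat \<times> nat \<Rightarrow> 'a) \<Rightarrow> ((nat \<Rightarrow> 'a set) \<Rightarrow> complex)" where
  "polytabloid \<mu> E t =
     (\<lambda>r. \<Sum>p\<in>column_stabilizer \<mu> E t.
        if r = relabel p (tabloid \<mu> t) then of_int (sign p) else 0)"

definition specht_rep :: "nat list \<Rightarrow> 'a set \<Rightarrow> ('a \<Rightarrow> 'a, nat \<Rightarrow> 'a set) urep" where
  "specht_rep \<mu> E =
     subrep (permutation_rep (fin_sym E) relabel (tabloid \<mu> ` tableaux \<mu> E))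
       {(\<lambda>r. \<Sum>t\<in>tableaux \<mu> E. c t * polytabloid \<mu> E t r) | c. True}"


section \<open>Young subgroups and induced representations\<close>

text \<open>
  The ambient set is the set \<open>{1..}\<close> of positive integers. A partition is a set \<open>\<P>\<close> of blocks, and
  the blocks themselves, rather than their numbers, serve as the indices of the ordered partitions
  \<open>r = (R\<^sub>1, R\<^sub>2, \<dots>)\<close>: the component of \<open>r\<close> corresponding to the block \<open>A\<close> is \<open>r A\<close>, and
  \<open>r A = {}\<close> for indices \<open>A\<close> which are not blocks.
\<close>

abbreviation S_pos :: "(nat \<Rightarrow> nat) monoid" where
  "S_pos \<equiv> fin_sym {1..}"

definition young_subgroup :: "nat set set \<Rightarrow> (nat \<Rightarrow> nat) set" where
  "young_subgroup \<P> = {g \<in> carrier S_pos. \<forall>A\<in>\<P>. g ` A = A}"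

definition I_rep :: "nat set set \<Rightarrow> (nat \<Rightarrow> nat, (nat \<Rightarrow> nat) set) urep" where
  "I_rep \<P> = quasi_regular_rep S_pos (young_subgroup \<P>)"

definition finite_blocks :: "nat set set \<Rightarrow> nat set set" where
  "finite_blocks \<P> = {A \<in> \<P>. finite A}"

definition infinite_blocks :: "nat set set \<Rightarrow> nat set set" where
  "infinite_blocks \<P> = {A \<in> \<P>. infinite A}"

definition finite_part :: "nat set set \<Rightarrow> nat set" where
  "finite_part \<P> = \<Union>(finite_blocks \<P>)"

definition block_shape :: "nat set set \<Rightarrow> nat list" where
  "block_shape \<P> = rev (sorted_list_of_multiset (image_mset card (mset_set (finite_blocks \<P>))))"

definition X_fin :: "nat set set \<Rightarrow> (nat set \<Rightarrow> nat set) set" where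
  "X_fin \<P> =
     {s. (\<forall>A. A \<notin> finite_blocks \<P> \<longrightarrow> s A = {}) \<and>
         (\<forall>A\<in>finite_blocks \<P>. finite (s A) \<and> card (s A) = card A) \<and>
         disjoint_family_on s (finite_blocks \<P>) \<and>
         (\<Union>A\<in>finite_blocks \<P>. s A) = finite_part \<P>}"

definition I_fin_rep :: "nat set set \<Rightarrow> (nat \<Rightarrow> nat, nat set \<Rightarrow> nat set) urep" where
  "I_fin_rep \<P> = permutation_rep (fin_sym (finite_part \<P>)) relabel (X_fin \<P>)"

definition X_space :: "nat set set \<Rightarrow> (nat set \<Rightarrow> nat set) set" where
  "X_space \<P> = (\<lambda>g. relabel g (\<lambda>A. if A \<in> \<P> then A else {})) ` carrier S_pos"

text \<open>
  The operator \<open>lift_proj \<P> P\<close> acts on each fibre of \<open>X_space \<P>\<close> over a choice of the infinite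
  blocks as \<open>P\<close>. The fibre is identified with \<open>X_fin \<P>\<close> through a bijection \<open>b\<close> of the finite
  part of \<open>\<P>\<close> onto the complement of the infinite blocks; \<open>b\<close> depends only on the fibre, and its
  choice is immaterial for \<open>P\<close> commuting with the permutations of the finite part.
\<close>

definition fibre_bij :: "nat set set \<Rightarrow> (nat set \<Rightarrow> nat set) \<Rightarrow> (nat \<Rightarrow> nat)" where
  "fibre_bij \<P> r =
     (SOME b. bij_betw b (finite_part \<P>) ({1..} - (\<Union>A\<in>infinite_blocks \<P>. r A)))"

definition lift_proj ::
    "nat set set \<Rightarrow> (((nat set \<Rightarrow> nat set) \<Rightarrow> complex) \<Rightarrow> ((nat set \<Rightarrow> nat set) \<Rightarrow> complex)) \<Rightarrow>
      ((nat set \<Rightarrow> nat set) \<Rightarrow> complex) \<Rightarrow> ((nat set \<Rightarrow> nat set) \<Rightarrow> complex)" where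
  "lift_proj \<P> P f = (\<lambda>r.
     if r \<in> X_space \<P> then
       let b = fibre_bij \<P> r in
       P (\<lambda>s. if s \<in> X_fin \<P>
               then f (\<lambda>A. if A \<in> finite_blocks \<P> then b ` s A else r A) else 0)
         (\<lambda>A. if A \<in> finite_blocks \<P> then inv_into (finite_part \<P>) b ` r A else {})
     else 0)"

definition pi_rep ::
    "nat set set \<Rightarrow> (((nat set \<Rightarrow> nat set) \<Rightarrow> complex) \<Rightarrow> ((nat set \<Rightarrow> nat set) \<Rightarrow> complex)) \<Rightarrow>
      (nat \<Rightarrow> nat, nat set \<Rightarrow> nat set) urep" where
  "pi_rep \<P> P =
     subrep (permutation_rep S_pos relabel (X_space \<P>)) (lift_proj \<P> P ` l2 (X_space \<P>))"

end

theory Submission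
  imports Defs
begin

text \<open>
  The group permutes the fibres of \<open>X_space \<P>\<close> over the choices of the infinite blocks. The
  permutations that preserve every infinite block and fix the finite part of \<open>\<P>\<close> pointwise fix the
  base fibre pointwise and move every finite set of points outside it off itself. Averaging over such
  permutations therefore shows that a closed invariant subspace contains, with a vector, its restriction
  to the base fibre, and that an intertwining operator preserves the functions supported by this fibre.
  So irreducibility and inequivalence of the lifted components reduce to the finite representation
  \<open>I_fin_rep \<P>\<close>, and an orthogonal decomposition of the latter lifts fibrewise.

  The finite decomposition is Young's rule. Semistandard tableaux of shape \<open>\<mu>\<close> give linearly
  independent homomorphisms from the Specht module to \<open>I_fin_rep \<P>\<close>, and by Schur's lemma
  they can be orthonormalized. The images exhaust the space by counting: the commutation relation between
  removing a box and adding a horizontal strip gives \<open>\<Sum>\<mu>. kostka \<mu> \<nu> * kostka \<mu> [1, \<dots>, 1] = N! / \<Prod>\<nu>!\<close>.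
\<close>

section \<open>Kostka numbers\<close>

text \<open>The count closes because two one-sided bounds meet. Standard tableaux give independent
  homomorphisms into the module of singleton partitions, a copy of the regular representation, so
  the Specht module of \<mu> has dimension at least the number of standard tableaux. In the other
  direction, an orthonormal family of functions is never larger than the underlying set. The
  counting identity makes both bounds equalities. The obstacle in passing to the infinite group is
  twofold: the projections are prescribed, one for each \<mu>, while Young's rule places its copies
  elsewhere; and the coordinate on a fibre comes from an arbitrary choice. Everything is therefore
  phrased through operators on functions on one finite set: partial isometries
  \<open>\<sigma> a\<close> with initial projections \<open>P a\<close>, mutually orthogonal ranges,
  and ranges that together span the space. Equivariant operators do not see the choice of
  coordinates, and the algebraic relations between such operators and their adjoints survive the
  fibrewise lift.\<close>

definition psize :: "(nat \<Rightarrow> nat) \<Rightarrow> nat" where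
  "psize a = sum a {i. 0 < a i}"

text \<open>Partitions as eventually vanishing functions keep their type when a row appears or
  disappears, so adding or removing a box is a function update.\<close>

definition shapes :: "nat \<Rightarrow> (nat \<Rightarrow> nat) set" where
  "shapes n = {a. antimono a \<and> finite {i. 0 < a i} \<and> psize a = n}"

text \<open>The interlacing condition says that the skew shape b/a has at most one box in each
  column. It also forces both functions to be weakly decreasing
  (\<open>hstrip_antimono\<close>).\<close>

definition hstrip :: "(nat \<Rightarrow> nat) \<Rightarrow> (nat \<Rightarrow> nat) \<Rightarrow> bool" where
  "hstrip a b \<longleftrightarrow> (\<forall>i. a i \<le> b i \<and> b (Suc i) \<le> a i)"

definition hdown :: "nat \<Rightarrow> (nat \<Rightarrow> nat) \<Rightarrow> (nat \<Rightarrow> nat) set" where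
  "hdown k b = {a. hstrip a b \<and> psize a + k = psize b}"

text \<open>The content is listed in reverse order, as the boxes with the largest entry are removed first.\<close>

fun kostka_fn :: "nat list \<Rightarrow> (nat \<Rightarrow> nat) \<Rightarrow> nat" where
  "kostka_fn [] b = (if b = (\<lambda>_. 0) then 1 else 0)"
| "kostka_fn (k # \<nu>) b = (\<Sum>a\<in>hdown k b. kostka_fn \<nu> a)"

lemma psize_superset:
  assumes "finite S" "\<And>i. i \<notin> S \<Longrightarrow> a i = 0"
  shows "psize a = sum a S"
  unfolding psize_def
proof (rule sum.mono_neutral_left)
  show "{i. 0 < a i} \<subseteq> S" using assms(2) by force
qed (use assms(1) in auto)

lemma hstrip_antimono:
  assumes "hstrip a b" shows "antimono a" "antimono b"
proof -
  have *: "a i \<le> b i" "b (Suc i) \<le> a i" for i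
    using assms by (auto simp: hstrip_def)
  have "a (Suc i) \<le> a i" "b (Suc i) \<le> b i" for i
    using *(1)[of "Suc i"] *(1)[of i] *(2)[of i] by linarith+
  then show "antimono a" "antimono b" by (auto simp: antimono_iff_le_Suc)
qed

lemma hstrip_support: "hstrip a b \<Longrightarrow> {i. 0 < a i} \<subseteq> {i. 0 < b i}"
  unfolding hstrip_def using less_le_trans by fast

text \<open>A nonzero row i makes all rows up to i nonzero, which already costs i+1 boxes.\<close>

lemma shapes_support:
  assumes "a \<in> shapes n" "n \<le> i" shows "a i = 0"
proof (rule ccontr)
  assume ne: "a i \<noteq> 0"
  have am: "antimono a" and f: "finite {i. 0 < a i}" and s: "psize a = n"
    using assms by (auto simp: shapes_def)
  have pos: "1 \<le> a j" if "j \<le> i" for j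
    using antimonoD[OF am that] ne by simp
  have "(\<Sum>j\<in>{..i}. 1) \<le> sum a {..i}" by (rule sum_mono) (use pos in auto)
  also have "\<dots> \<le> psize a" unfolding psize_def
    by (rule sum_mono2) (use f pos in \<open>auto simp: Suc_le_eq\<close>)
  finally show False using s assms(2) by simp
qed

lemma shapes_sum: "a \<in> shapes n \<Longrightarrow> n \<le> m \<Longrightarrow> sum a {..<m} = n"
  by (subst psize_superset[of "{..<m}" a, symmetric]) (auto simp: shapes_support, simp add: shapes_def)

lemma parI:
  assumes "antimono a" "\<And>i. m \<le> i \<Longrightarrow> a i = 0" "sum a {..<m} = n"
  shows "a \<in> shapes n"
proof -
  have "{i. 0 < a i} \<subseteq> {..<m}" using assms(2) by (metis bot_nat_0.not_eq_extremum lessThan_iff mem_Collect_eq not_less subsetI)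
  then have "finite {i. 0 < a i}" by (rule finite_subset) simp
  then show ?thesis using psize_superset[of "{..<m}" a] assms by (simp add: shapes_def)
qed

lemma finite_shapes [simp]: "finite (shapes n)"
proof -
  have "shapes n \<subseteq> {a. \<forall>i. (i \<in> {..<n} \<longrightarrow> a i \<in> {..n}) \<and> (i \<notin> {..<n} \<longrightarrow> a i = 0)}"
  proof
    fix a assume a: "a \<in> shapes n"
    have "a i \<le> n" if "i < n" for i
      using member_le_sum[of i "{..<n}" a] that shapes_sum[OF a, of n] by simp
    then show "a \<in> {a. \<forall>i. (i \<in> {..<n} \<longrightarrow> a i \<in> {..n}) \<and> (i \<notin> {..<n} \<longrightarrow> a i = 0)}"
      using shapes_support[OF a] by simp
  qed
  then show ?thesis by (rule finite_subset) (rule finite_set_of_finite_funs, auto)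
qed

lemma hdown_shapes:
  assumes b: "b \<in> shapes n" shows "hdown k b = {a. hstrip a b \<and> a \<in> shapes (n - k) \<and> k \<le> n}"
proof -
  have "antimono a \<and> finite {i. 0 < a i}" if "hstrip a b" for a
    using hstrip_antimono(1)[OF that] finite_subset[OF hstrip_support[OF that]] b by (simp add: shapes_def)
  moreover have "psize b = n" using b by (simp add: shapes_def)
  ultimately have "a \<in> hdown k b \<longleftrightarrow> hstrip a b \<and> a \<in> shapes (n - k) \<and> k \<le> n" for a
    unfolding hdown_def shapes_def mem_Collect_eq by (cases "hstrip a b") auto
  then show ?thesis by blast
qed

lemma hdown_shapes': "b \<in> shapes (n + k) \<Longrightarrow> hdown k b = {a \<in> shapes n. hstrip a b}"
  by (auto simp: hdown_shapes)

lemma hdown_0: assumes "b \<in> shapes n" shows "hdown 0 b = {b}"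
proof -
  have "a = b" if "hstrip a b" "a \<in> shapes n" for a
  proof
    fix i
    have le: "\<And>i. a i \<le> b i" using that by (auto simp: hstrip_def)
    define m where "m = max n (Suc i)"
    have "sum a {..<m} = sum b {..<m}" using shapes_sum assms that by (simp add: m_def)
    then have "\<forall>j\<in>{..<m}. a j = b j"
      using sum_mono_inv[of a "{..<m}" b] le by blast
    then show "a i = b i" by (auto simp: m_def)
  qed
  moreover have "hstrip b b" using assms by (auto simp: hstrip_def shapes_def antimono_iff_le_Suc)
  ultimately show ?thesis using assms by (auto simp: hdown_shapes)
qed

section \<open>Adding and removing one box\<close>

lemma add_box_shapes:
  assumes "a \<in> shapes n" "antimono (a(i := Suc (a i)))"
  shows "a(i := Suc (a i)) \<in> shapes (Suc n)"
proof (rule parI[of _ "max n (Suc i)"])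
  let ?m = "max n (Suc i)"
  have "sum (a(i := Suc (a i))) {..<?m} = Suc (sum a {..<?m})"
    using sum.remove[of "{..<?m}" i "a(i := Suc (a i))"] sum.remove[of "{..<?m}" i a] by simp
  then show "sum (a(i := Suc (a i))) {..<?m} = Suc n" using shapes_sum[OF assms(1)] by simp
qed (use assms shapes_support[OF assms(1)] in auto)

lemma remove_box_shapes:
  assumes "a \<in> shapes n" "antimono (a(i := a i - 1))" "0 < a i"
  shows "a(i := a i - 1) \<in> shapes (n - 1)"
proof (rule parI[of _ "max n (Suc i)"])
  let ?m = "max n (Suc i)"
  let ?r = "a(i := a i - 1)"
  have "sum ?r {..<?m} = ?r i + sum ?r ({..<?m} - {i})" by (rule sum.remove) auto
  moreover have "sum a {..<?m} = a i + sum a ({..<?m} - {i})" by (rule sum.remove) auto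
  moreover have "sum ?r ({..<?m} - {i}) = sum a ({..<?m} - {i})" by (rule sum.cong) auto
  ultimately have "Suc (sum ?r {..<?m}) = sum a {..<?m}" using assms(3) by simp
  then show "sum (a(i := a i - 1)) {..<?m} = n - 1" using shapes_sum[OF assms(1), of ?m] by simp
qed (use assms shapes_support[OF assms(1)] in auto)

text \<open>The row differences are nonnegative integers with sum 1, so a single row
  differs.\<close>

lemma hstrip_one_box:
  assumes "a \<in> shapes n" "b \<in> shapes (Suc n)" "hstrip a b"
  obtains i where "b = a(i := Suc (a i))"
proof -
  have le: "\<And>i. a i \<le> b i" using assms by (auto simp: hstrip_def)
  have "sum b {..<Suc n} = sum a {..<Suc n} + sum (\<lambda>i. b i - a i) {..<Suc n}"
    unfolding sum.distrib[symmetric] using le by (intro sum.cong) auto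
  then have "sum (\<lambda>i. b i - a i) {..<Suc n} = Suc 0"
    using shapes_sum[OF assms(1), of "Suc n"] shapes_sum[OF assms(2), of "Suc n"] by simp
  then obtain i where i: "i < Suc n" "b i - a i = Suc 0" "\<forall>j\<in>{..<Suc n}. i \<noteq> j \<longrightarrow> b j - a j = 0"
    by (subst (asm) sum_eq_Suc0_iff) auto
  have "b j = (a(i := Suc (a i))) j" for j
    using i le[of j] shapes_support[OF assms(1), of j] shapes_support[OF assms(2), of j]
    by (cases "j < Suc n") (auto intro: antisym)
  then show ?thesis using that by blast
qed

text \<open>Neither set asks that the updated function be a shape: an end of a horizontal strip is
  automatically weakly decreasing. This is why plain sets of row indices count the shapes in
  \<open>card_up\<close> and \<open>card_down\<close>.\<close>

definition up_rows where "up_rows a c = {i. hstrip a (c(i := Suc (c i)))}"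
definition down_rows where "down_rows a c = {i. 0 < a i \<and> hstrip (a(i := a i - 1)) c}"

text \<open>
  The local rule behind the commutation relation between removing a box and adding a horizontal
  strip: an addable row \<open>i + 1\<close> corresponds to the removable row \<open>i\<close>, and row \<open>0\<close> is always addable.
\<close>

lemma rows_hstrip:
  assumes "hstrip a c"
  shows "up_rows a c = insert 0 (Suc ` down_rows a c)"
proof -
  have d: "i \<in> down_rows a c \<longleftrightarrow> c (Suc i) < a i" for i
  proof -
    have 1: "a j \<le> c j" "c (Suc j) \<le> a j" for j using assms by (auto simp: hstrip_def)
    show ?thesis
    proof
      assume "i \<in> down_rows a c"
      then have "0 < a i" "c (Suc i) \<le> (a(i := a i - 1)) i" unfolding down_rows_def hstrip_def by blast+
      then show "c (Suc i) < a i" by simp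
    next
      assume l: "c (Suc i) < a i"
      have "(a(i := a i - 1)) j \<le> c j \<and> c (Suc j) \<le> (a(i := a i - 1)) j" for j
        using 1[of j] l by auto
      then show "i \<in> down_rows a c" using l by (simp add: down_rows_def hstrip_def)
    qed
  qed
  have u: "i \<in> up_rows a c \<longleftrightarrow> i = 0 \<or> c i < a (i - 1)" for i
  proof (cases i)
    case (Suc j)
    then show ?thesis using assms unfolding up_rows_def hstrip_def
      by (auto simp: Suc_le_eq intro: le_SucI)
  next
    case 0
    then show ?thesis using assms unfolding up_rows_def hstrip_def by (auto intro: le_SucI)
  qed
  show ?thesis
  proof (intro Set.set_eqI)
    fix i show "i \<in> up_rows a c \<longleftrightarrow> i \<in> insert 0 (Suc ` down_rows a c)"
      by (cases i) (auto simp: u d)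
  qed
qed

text \<open>One box can repair the failure only in the single row where \<open>a\<close> exceeds
  \<open>c\<close>, and there by exactly one; enlarging \<open>c\<close> in that row and shrinking
  \<open>a\<close> in that row then amount to the same thing.\<close>

lemma rows_not_hstrip:
  assumes "antimono a" "antimono c" "\<not> hstrip a c"
  shows "up_rows a c = down_rows a c"
proof (intro equalityI subsetI)
  have am: "\<And>i. a (Suc i) \<le> a i" "\<And>i. c (Suc i) \<le> c i"
    using assms by (auto simp: antimono_iff_le_Suc)
  fix i
  {
    assume "i \<in> up_rows a c"
    then have lo: "a j \<le> (c(i := Suc (c i))) j" and up: "(c(i := Suc (c i))) (Suc j) \<le> a j" for j
      by (auto simp: up_rows_def hstrip_def)
    have up': "c (Suc j) \<le> a j" for j using up[of j] by (auto split: if_splits)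
    have "\<exists>j. \<not> a j \<le> c j" using assms(3) up' by (auto simp: hstrip_def)
    then have ai: "a i = Suc (c i)" using lo by (metis fun_upd_apply le_SucE)
    have "hstrip (a(i := a i - 1)) c" unfolding hstrip_def
    proof
      fix j show "(a(i := a i - 1)) j \<le> c j \<and> c (Suc j) \<le> (a(i := a i - 1)) j"
        using lo[of j] up'[of j] ai am(2)[of j] by (auto split: if_splits)
    qed
    then show "i \<in> down_rows a c" using ai by (simp add: down_rows_def)
  next
    assume "i \<in> down_rows a c"
    then have pos: "0 < a i" and lo: "(a(i := a i - 1)) j \<le> c j" and up: "c (Suc j) \<le> (a(i := a i - 1)) j" for j
      by (auto simp: down_rows_def hstrip_def)
    have up': "c (Suc j) \<le> a j" for j using up[of j] by (auto split: if_splits)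
    have "\<exists>j. \<not> a j \<le> c j" using assms(3) up' by (auto simp: hstrip_def)
    then have "\<not> a i \<le> c i" using lo by (metis fun_upd_apply)
    then have ai: "a i = Suc (c i)" using lo[of i] by simp
    have "hstrip a (c(i := Suc (c i)))" unfolding hstrip_def
    proof
      fix j show "a j \<le> (c(i := Suc (c i))) j \<and> (c(i := Suc (c i))) (Suc j) \<le> a j"
        using lo[of j] up'[of j] ai am(1)[of j] by (auto split: if_splits)
    qed
    then show "i \<in> up_rows a c" by (simp add: up_rows_def)
  }
qed

lemma card_up:
  assumes c: "c \<in> shapes m"
  shows "card {b \<in> shapes (Suc m). hstrip c b \<and> hstrip a b} = card (up_rows a c)"
proof -
  have "bij_betw (\<lambda>i. c(i := Suc (c i))) (up_rows a c) {b \<in> shapes (Suc m). hstrip c b \<and> hstrip a b}"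
    unfolding bij_betw_def
  proof (intro conjI inj_onI equalityI subsetI)
    fix i j assume "c(i := Suc (c i)) = c(j := Suc (c j))"
    then show "i = j" by (metis fun_upd_apply n_not_Suc_n)
  next
    fix b assume "b \<in> (\<lambda>i. c(i := Suc (c i))) ` up_rows a c"
    then obtain i where b: "b = c(i := Suc (c i))" and h: "hstrip a b" by (auto simp: up_rows_def)
    have am: "antimono b" using h hstrip_antimono by auto
    have "hstrip c b" unfolding hstrip_def
    proof
      fix j show "c j \<le> b j \<and> b (Suc j) \<le> c j"
      proof (cases "i = j")
        case True
        have "c (Suc i) \<le> c i" using c by (auto simp: shapes_def antimono_iff_le_Suc)
        then show ?thesis using True by (simp add: b)
      next
        case False
        then show ?thesis using am[unfolded antimono_iff_le_Suc, rule_format, of j] by (auto simp: b split: if_splits)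
      qed
    qed
    then show "b \<in> {b \<in> shapes (Suc m). hstrip c b \<and> hstrip a b}"
      using add_box_shapes[OF c] am h b by auto
  next
    fix b assume "b \<in> {b \<in> shapes (Suc m). hstrip c b \<and> hstrip a b}"
    then show "b \<in> (\<lambda>i. c(i := Suc (c i))) ` up_rows a c"
      using hstrip_one_box[OF c, of b] by (auto simp: up_rows_def)
  qed
  then show ?thesis by (simp add: bij_betw_same_card)
qed

lemma card_down:
  assumes a: "a \<in> shapes (Suc m)"
  shows "card {r \<in> shapes m. hstrip r a \<and> hstrip r c} = card (down_rows a c)"
proof -
  have "bij_betw (\<lambda>i. a(i := a i - 1)) (down_rows a c) {r \<in> shapes m. hstrip r a \<and> hstrip r c}"
    unfolding bij_betw_def
  proof (intro conjI inj_onI equalityI subsetI)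
    fix i j assume ij: "i \<in> down_rows a c" "a(i := a i - 1) = a(j := a j - 1)"
    have "0 < a i" using ij(1) by (simp add: down_rows_def)
    then show "i = j" using fun_cong[OF ij(2), of i] by (auto split: if_splits)
  next
    fix r assume "r \<in> (\<lambda>i. a(i := a i - 1)) ` down_rows a c"
    then obtain i where r: "r = a(i := a i - 1)" and h: "hstrip r c" and p: "0 < a i"
      by (auto simp: down_rows_def)
    have am: "antimono r" using h hstrip_antimono by auto
    have "hstrip r a" unfolding hstrip_def
    proof
      fix j show "r j \<le> a j \<and> a (Suc j) \<le> r j"
      proof (cases "i = Suc j")
        case True
        have "a (Suc j) \<le> a j" using a by (auto simp: shapes_def antimono_iff_le_Suc)
        then show ?thesis using True by (simp add: r)
      next
        case False
        then show ?thesis using am[unfolded antimono_iff_le_Suc, rule_format, of j] by (auto simp: r split: if_splits)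
      qed
    qed
    then show "r \<in> {r \<in> shapes m. hstrip r a \<and> hstrip r c}"
      using remove_box_shapes[OF a, of i] am h r p by auto
  next
    fix r assume r: "r \<in> {r \<in> shapes m. hstrip r a \<and> hstrip r c}"
    then obtain i where "a = r(i := Suc (r i))" using hstrip_one_box[OF _ a, of r] by auto
    then have "r = a(i := a i - 1)" "0 < a i" by auto
    then show "r \<in> (\<lambda>i. a(i := a i - 1)) ` down_rows a c"
      using r by (auto simp: down_rows_def)
  qed
  then show ?thesis by (simp add: bij_betw_same_card)
qed

section \<open>The commutation relation and the counting identity\<close>

lemma finite_down_rows: "a \<in> shapes n \<Longrightarrow> finite (down_rows a c)"
  by (rule finite_subset[of _ "{i. 0 < a i}"]) (auto simp: down_rows_def shapes_def)

text \<open>The surplus is row 0, which is always addable and is not the successor of a removable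
  row. It is the commutator term behind the recursion for \<open>ksum\<close>.\<close>

lemma card_up_down:
  assumes a: "a \<in> shapes n" and c: "c \<in> shapes m"
  shows "card (up_rows a c) = card (down_rows a c) + (if hstrip a c then 1 else 0)"
proof (cases "hstrip a c")
  case True
  then show ?thesis using finite_down_rows[OF a, of c] by (simp add: rows_hstrip card_image)
next
  case False
  then show ?thesis using rows_not_hstrip[of a c] a c by (auto simp: shapes_def)
qed

text \<open>The factor \<open>kostka_fn (replicate n 1) a\<close> counts the standard tableaux of
  shape \<open>a\<close>, as chains of shapes growing by one box.\<close>

definition ksum :: "nat \<Rightarrow> ((nat \<Rightarrow> nat) \<Rightarrow> nat) \<Rightarrow> nat" where
  "ksum n g = (\<Sum>a\<in>shapes n. kostka_fn (replicate n 1) a * g a)"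

lemma down_rows_shapes_0: "a \<in> shapes 0 \<Longrightarrow> down_rows a c = {}"
  using shapes_support[of a 0] by (auto simp: down_rows_def)

lemma sum_filter_mult: "finite A \<Longrightarrow> (\<Sum>a\<in>{a\<in>A. P a}. g a) = (\<Sum>a\<in>A. if P a then g a else (0::nat))"
  by (simp add: sum.inter_filter)

text \<open>The last box of the standard tableau is removed from \<open>b\<close> to give
  \<open>c\<close>, and the strip to give \<open>a\<close>. Counting the possible \<open>b\<close>
  for fixed \<open>a\<close> and \<open>c\<close> by \<open>card_up_down\<close> exchanges the two
  removals: either a box leaves \<open>a\<close> below the strip, or the surplus term shortens the
  strip by one. For \<open>n = 0\<close> the shape \<open>a\<close> is empty and has no box to
  lose.\<close>

lemma ksum_strip_step:
  shows "ksum (Suc n + k) (\<lambda>b. \<Sum>a\<in>hdown (Suc k) b. g a) =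
     (case n of 0 \<Rightarrow> 0 | Suc n' \<Rightarrow> ksum (n' + Suc k) (\<lambda>c. \<Sum>r\<in>hdown (Suc k) c. \<Sum>a\<in>{a\<in>shapes n. hstrip r a}. g a))
     + ksum (n + k) (\<lambda>c. \<Sum>a\<in>hdown k c. g a)"
proof -
  let ?f = "kostka_fn (replicate (n + k) 1)"
  have "ksum (Suc n + k) (\<lambda>b. \<Sum>a\<in>hdown (Suc k) b. g a) =
     (\<Sum>b\<in>shapes (Suc (n + k)). (\<Sum>c\<in>shapes (n + k). if hstrip c b then ?f c else 0)
          * (\<Sum>a\<in>shapes n. if hstrip a b then g a else 0))"
    unfolding ksum_def One_nat_def
  proof (rule sum.cong)
    fix b assume "b \<in> shapes (Suc (n + k))"
    then have "hdown (Suc 0) b = {c\<in>shapes (n + k). hstrip c b}" "hdown (Suc k) b = {a\<in>shapes n. hstrip a b}"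
      using hdown_shapes'[of b "n + k" "Suc 0"] hdown_shapes'[of b n "Suc k"] by auto
    then show "kostka_fn (replicate (Suc n + k) (Suc 0)) b * (\<Sum>a\<in>hdown (Suc k) b. g a) =
       (\<Sum>c\<in>shapes (n + k). if hstrip c b then kostka_fn (replicate (n + k) (Suc 0)) c else 0) * (\<Sum>a\<in>shapes n. if hstrip a b then g a else 0)"
      by (simp add: sum_filter_mult)
  qed simp
  also have "\<dots> = (\<Sum>b\<in>shapes (Suc (n + k)). \<Sum>c\<in>shapes (n + k). \<Sum>a\<in>shapes n. 
       (if hstrip c b \<and> hstrip a b then ?f c * g a else 0))"
    unfolding sum_product by (intro sum.cong) auto
  also have "\<dots> = (\<Sum>c\<in>shapes (n + k). \<Sum>a\<in>shapes n. \<Sum>b\<in>shapes (Suc (n + k)). 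
       (if hstrip c b \<and> hstrip a b then ?f c * g a else 0))"
    by (subst sum.swap, rule sum.cong[OF refl], subst sum.swap, rule refl)
  also have "\<dots> = (\<Sum>c\<in>shapes (n + k). \<Sum>a\<in>shapes n. ?f c * g a * card (up_rows a c))"
  proof (intro sum.cong refl)
    fix c a assume "c \<in> shapes (n + k)" "a \<in> shapes n"
    then show "(\<Sum>b\<in>shapes (Suc (n + k)). (if hstrip c b \<and> hstrip a b then ?f c * g a else 0))
       = ?f c * g a * card (up_rows a c)"
      by (simp flip: card_up sum_filter_mult)
  qed
  also have "\<dots> = (\<Sum>c\<in>shapes (n + k). \<Sum>a\<in>shapes n. ?f c * g a * card (down_rows a c)) +
      (\<Sum>c\<in>shapes (n + k). \<Sum>a\<in>shapes n. ?f c * (if hstrip a c then g a else 0))"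
    unfolding sum.distrib[symmetric]
    by (intro sum.cong refl) (simp add: card_up_down algebra_simps)
  also have "(\<Sum>c\<in>shapes (n + k). \<Sum>a\<in>shapes n. ?f c * (if hstrip a c then g a else 0)) = 
     ksum (n + k) (\<lambda>c. \<Sum>a\<in>hdown k c. g a)"
    unfolding ksum_def by (intro sum.cong refl) (simp add: hdown_shapes' sum_filter_mult sum_distrib_left)
  also have "(\<Sum>c\<in>shapes (n + k). \<Sum>a\<in>shapes n. ?f c * g a * card (down_rows a c)) = 
    (case n of 0 \<Rightarrow> 0 | Suc n' \<Rightarrow> ksum (n' + Suc k) (\<lambda>c. \<Sum>r\<in>hdown (Suc k) c. \<Sum>a\<in>{a\<in>shapes n. hstrip r a}. g a))"
  proof (cases n)
    case 0
    then show ?thesis by (simp add: down_rows_shapes_0)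
  next
    case (Suc n')
    have "(\<Sum>a\<in>shapes n. ?f c * g a * card (down_rows a c)) = 
       ?f c * (\<Sum>r\<in>hdown (Suc k) c. \<Sum>a\<in>{a\<in>shapes n. hstrip r a}. g a)" if c: "c \<in> shapes (n + k)" for c
    proof -
      have "hdown (Suc k) c = {r \<in> shapes n'. hstrip r c}" using c hdown_shapes'[of c n' "Suc k"] Suc by simp
      then have "(\<Sum>r\<in>hdown (Suc k) c. \<Sum>a\<in>{a\<in>shapes n. hstrip r a}. g a) =
         (\<Sum>r\<in>shapes n'. \<Sum>a\<in>shapes n. if hstrip r a \<and> hstrip r c then g a else 0)"
        by (simp add: sum_filter_mult) (intro sum.cong refl, auto)
      also have "\<dots> = (\<Sum>a\<in>shapes n. \<Sum>r\<in>shapes n'. if hstrip r a \<and> hstrip r c then g a else 0)"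
        by (rule sum.swap)
      also have "\<dots> = (\<Sum>a\<in>shapes n. g a * card (down_rows a c))"
        by (intro sum.cong refl) (use Suc in \<open>simp flip: card_down sum_filter_mult\<close>)
      finally show ?thesis by (simp add: sum_distrib_left mult.assoc)
    qed
    then show ?thesis using Suc by (simp add: ksum_def)
  qed
  finally show ?thesis .
qed

text \<open>The two terms of \<open>ksum_strip_step\<close> combine by Pascal's rule. The induction
  keeps \<open>g\<close> arbitrary because the first term replaces it by its sum over one-box
  extensions.\<close>

lemma ksum_strip:
  "ksum (n + k) (\<lambda>b. \<Sum>a\<in>hdown k b. g a) = ((n + k) choose k) * ksum n g"
proof (induction "n + k" arbitrary: n k g rule: less_induct)
  case less
  show ?case
  proof (cases k)
    case 0
    then show ?thesis by (simp add: ksum_def hdown_0)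
  next
    case (Suc k')
    have 2: "ksum (n + k') (\<lambda>c. \<Sum>a\<in>hdown k' c. g a) = ((n + k') choose k') * ksum n g"
      using less[of n k'] Suc by simp
    show ?thesis
    proof (cases n)
      case 0
      then show ?thesis using 2 ksum_strip_step[of n k' g] Suc by simp
    next
      case (Suc n')
      \<comment> \<open>Exchanging the sums turns a standard tableau of shape r followed by one more
        box into a standard tableau with n boxes, so that \<open>ksum n' ?D\<close> is
        \<open>ksum n g\<close> again.\<close>
      let ?D = "\<lambda>r. \<Sum>a\<in>{a\<in>shapes n. hstrip r a}. g a"
      have "ksum n' ?D = (\<Sum>r\<in>shapes n'. \<Sum>a\<in>shapes n. if hstrip r a then kostka_fn (replicate n' 1) r * g a else 0)"
        by (simp add: ksum_def sum_filter_mult sum_distrib_left) (intro sum.cong refl, auto)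
      also have "\<dots> = (\<Sum>a\<in>shapes n. \<Sum>r\<in>shapes n'. if hstrip r a then kostka_fn (replicate n' 1) r * g a else 0)"
        by (rule sum.swap)
      also have "\<dots> = ksum n g" unfolding ksum_def
      proof (intro sum.cong refl)
        fix a assume "a \<in> shapes n"
        then have "hdown (Suc 0) a = {r\<in>shapes n'. hstrip r a}" using hdown_shapes'[of a n' "Suc 0"] Suc by simp
        then show "(\<Sum>r\<in>shapes n'. if hstrip r a then kostka_fn (replicate n' 1) r * g a else 0) = kostka_fn (replicate n 1) a * g a"
          using Suc by (simp add: sum_filter_mult sum_distrib_right) (intro sum.cong refl, auto)
      qed
      finally have D: "ksum n' ?D = ksum n g" .
      have "ksum (n' + Suc k') (\<lambda>c. \<Sum>r\<in>hdown (Suc k') c. ?D r) = ((n' + Suc k') choose Suc k') * ksum n' ?D"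
        using less[of n' "Suc k'" ?D] Suc \<open>k = Suc k'\<close> by simp
      then show ?thesis using 2 D ksum_strip_step[of n k' g] Suc \<open>k = Suc k'\<close>
        by (simp add: algebra_simps)
    qed
  qed
qed

lemma shapes_0: "shapes 0 = {\<lambda>_. 0}"
  using shapes_support[of _ 0] parI[of "\<lambda>_. 0" 0 0] by (auto simp: antimono_def)

text \<open>Each part of the content contributes one binomial coefficient, and these multiply to the
  multinomial coefficient; the product form avoids division.\<close>

lemma ksum_fact:
  "ksum (sum_list \<nu>) (kostka_fn \<nu>) * prod_list (map fact \<nu>) = fact (sum_list \<nu>)"
proof (induction \<nu>)
  case Nil
  then show ?case by (simp add: ksum_def shapes_0)
next
  case (Cons k \<nu>)
  have "ksum (sum_list (k # \<nu>)) (kostka_fn (k # \<nu>)) = ((sum_list \<nu> + k) choose k) * ksum (sum_list \<nu>) (kostka_fn \<nu>)"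
    using ksum_strip[of "sum_list \<nu>" k "kostka_fn \<nu>"] by (simp add: add.commute ksum_def)
  then have "ksum (sum_list (k # \<nu>)) (kostka_fn (k # \<nu>)) * prod_list (map fact (k # \<nu>)) = 
     ((sum_list \<nu> + k) choose k) * fact k * (ksum (sum_list \<nu>) (kostka_fn \<nu>) * prod_list (map fact \<nu>))"
    by (simp add: algebra_simps)
  also have "\<dots> = fact k * fact (sum_list \<nu>) * ((sum_list \<nu> + k) choose k)" using Cons by simp
  also have "\<dots> = fact (sum_list (k # \<nu>))" 
    using binomial_fact_lemma[of k "sum_list \<nu> + k"] by (simp add: add.commute)
  finally show ?case .
qed

subsection \<open>Dominance\<close>

lemma kostka_fn_size: "b \<in> shapes n \<Longrightarrow> 0 < kostka_fn \<nu> b \<Longrightarrow> n = sum_list \<nu>"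
proof (induction \<nu> arbitrary: b n)
  case Nil
  then show ?case by (auto simp: shapes_def psize_def split: if_splits)
next
  case (Cons k \<nu>)
  then obtain a where "a \<in> hdown k b" "0 < kostka_fn \<nu> a"
    by (metis (no_types, lifting) kostka_fn.simps(2) bot_nat_0.not_eq_extremum sum.neutral)
  then show ?case using Cons by (fastforce simp: hdown_shapes)
qed

text \<open>The bound on the number of rows is carried through the induction because it settles the
  last comparison: once m exceeds the length of the shortened content, the first m rows contain the
  whole shape.\<close>

lemma kostka_fn_dominance:
  "b \<in> shapes n \<Longrightarrow> 0 < kostka_fn (rev \<nu>) b \<Longrightarrow>
   (\<forall>m. sum_list (take m \<nu>) \<le> sum b {..<m}) \<and> (\<forall>i\<ge>length \<nu>. b i = 0)"
proof (induction \<nu> arbitrary: b n rule: rev_induct)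
  case Nil
  then show ?case by (auto split: if_splits)
next
  case (snoc k \<nu>)
  then obtain a where a: "a \<in> hdown k b" "0 < kostka_fn (rev \<nu>) a"
    by (metis (no_types, lifting) kostka_fn.simps(2) bot_nat_0.not_eq_extremum sum.neutral rev_eq_Cons_iff rev_rev_ident)
  then have h: "hstrip a b" and ap: "a \<in> shapes (n - k)" "k \<le> n" using hdown_shapes[OF snoc(2)] by auto
  have IH: "sum_list (take m \<nu>) \<le> sum a {..<m}" "i \<ge> length \<nu> \<Longrightarrow> a i = 0" for m i
    using snoc(1)[OF ap(1) a(2)] by auto
  have z: "b i = 0" if "i \<ge> Suc (length \<nu>)" for i
    using that IH(2)[of "i - 1"] h[unfolded hstrip_def, rule_format, of "i - 1"] by auto
  have tot: "sum b {..<m} = sum_list \<nu> + k" if "m \<ge> Suc (length \<nu>)" for m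
  proof -
    have "sum b {..<m} = n" using psize_superset[of "{..<m}" b] z that snoc(2) by (auto simp: shapes_def)
    then show ?thesis using kostka_fn_size[OF snoc(2) snoc(3)] by simp
  qed
  show ?case
  proof (intro conjI allI impI)
    fix m show "sum_list (take m (\<nu> @ [k])) \<le> sum b {..<m}"
    proof (cases "m \<le> length \<nu>")
      case True
      have "sum a {..<m} \<le> sum b {..<m}" using h by (auto intro: sum_mono simp: hstrip_def)
      then show ?thesis using True IH(1)[of m] by simp
    next
      case False
      then show ?thesis using tot[of m] by simp
    qed
  qed (use z in simp)
qed

text \<open>Greedy construction: the strip for the largest entry is taken from the leftmost columns.
  As the last part is the smallest one, the remaining shape still dominates the remaining
  content.\<close>

lemma dominance_kostka_fn:
  "b \<in> shapes (sum_list \<nu>) \<Longrightarrow> sorted_wrt (\<ge>) \<nu> \<Longrightarrow> \<forall>m. sum_list (take m \<nu>) \<le> sum b {..<m} \<Longrightarrow>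
    0 < kostka_fn (rev \<nu>) b"
proof (induction \<nu> arbitrary: b rule: rev_induct)
  case Nil
  then show ?case by (auto simp: shapes_0)
next
  case (snoc k \<nu>)
  \<comment> \<open>This removes the bottom box of each of the first k columns: row i loses
    \<open>min (b i) k - min (b (Suc i)) k\<close> boxes, and
    \<open>b i - min (b i) k = max (b i) k - k\<close>.\<close>
  define a where "a i = max (b i) k + min (b (Suc i)) k - k" for i
  have am: "\<And>i. b (Suc i) \<le> b i" using snoc(2) by (auto simp: shapes_def antimono_iff_le_Suc)
  have h: "hstrip a b" unfolding hstrip_def
  proof
    fix i show "a i \<le> b i \<and> b (Suc i) \<le> a i" using am[of i] by (auto simp: a_def max_def min_def)
  qed
  have b0: "k \<le> b 0"
  proof -
    have "k \<le> (\<nu> @ [k]) ! 0" using snoc(3) by (cases \<nu>) (auto simp: sorted_wrt_append)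
    also have "\<dots> = sum_list (take 1 (\<nu> @ [k]))" by (cases \<nu>) auto
    also have "\<dots> \<le> b 0" using snoc(4)[rule_format, of 1] by simp
    finally show ?thesis .
  qed
  \<comment> \<open>The losses telescope to \<open>k - min (b m) k\<close>, because
    \<open>b 0\<close> is at least k.\<close>
  have pre: "sum a {..<m} + k = sum b {..<m} + min (b m) k" for m
  proof (induction m)
    case 0 then show ?case using b0 by simp
  next
    case (Suc m)
    have "a m + min (b m) k = b m + min (b (Suc m)) k" unfolding a_def by (auto simp: max_def min_def)
    then show ?case using Suc by simp
  qed
  have ap: "a \<in> shapes (sum_list \<nu>)"
  proof (rule parI[of _ "sum_list (\<nu> @ [k])"])
    show "antimono a" using h hstrip_antimono by auto
    show "a i = 0" if "sum_list (\<nu> @ [k]) \<le> i" for i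
      using shapes_support[OF snoc(2), of i] shapes_support[OF snoc(2), of "Suc i"] that by (simp add: a_def)
    show "sum a {..<sum_list (\<nu> @ [k])} = sum_list \<nu>"
      using pre[of "sum_list (\<nu> @ [k])"] shapes_sum[OF snoc(2), of "sum_list (\<nu> @ [k])"] shapes_support[OF snoc(2), of "sum_list (\<nu> @ [k])"] by simp
  qed
  \<comment> \<open>If row m has at least k boxes, the rows above it lose nothing. Otherwise the
    first m rows of \<open>a\<close> hold as much as the first m+1 rows of \<open>b\<close> less k,
    and the entry number m of the content pays for this loss, being at least k.\<close>
  have dom: "sum_list (take m \<nu>) \<le> sum a {..<m}" if m: "m \<le> length \<nu>" for m
  proof (cases "k \<le> b m")
    case True
    then show ?thesis using pre[of m] snoc(4)[rule_format, of m] m by simp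
  next
    case False
    have "k \<le> (\<nu> @ [k]) ! m" using snoc(3) m by (cases "m = length \<nu>") (auto simp: nth_append sorted_wrt_append)
    moreover have "sum_list (take (Suc m) (\<nu> @ [k])) = sum_list (take m \<nu>) + (\<nu> @ [k]) ! m"
      using m by (subst take_Suc_conv_app_nth) auto
    ultimately show ?thesis using pre[of m] snoc(4)[rule_format, of "Suc m"] False by simp
  qed
  have "sum_list (take m \<nu>) \<le> sum a {..<m}" for m
  proof (cases "m \<le> length \<nu>")
    case False
    have "sum_list (take m \<nu>) = sum_list (take (length \<nu>) \<nu>)" using False by simp
    also have "\<dots> \<le> sum a {..<length \<nu>}" by (rule dom) simp
    also have "\<dots> \<le> sum a {..<m}" using False by (intro sum_mono2) auto
    finally show ?thesis .
  qed (use dom in auto)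
  then have "0 < kostka_fn (rev \<nu>) a" using snoc(1)[OF ap] snoc(3) by (auto simp: sorted_wrt_append)
  moreover have "a \<in> hdown k b" using h ap snoc(2) by (auto simp: hdown_shapes)
  moreover have "finite (hdown k b)" using snoc(2) by (simp add: hdown_shapes)
  ultimately show ?case by (simp add: sum_pos2)
qed

subsection \<open>Tableaux\<close>

definition rows_of :: "nat list \<Rightarrow> nat \<Rightarrow> nat" where
  "rows_of \<mu> i = (if i < length \<mu> then \<mu> ! i else 0)"

text \<open>The shape is a function of the row index, so that it can shrink when the boxes with the
  largest entry are peeled off. One equivalence covers both positivity on the shape and vanishing
  outside it.\<close>

definition ssyt :: "(nat \<Rightarrow> nat) \<Rightarrow> nat list \<Rightarrow> (nat \<times> nat \<Rightarrow> nat) set" where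
  "ssyt a \<nu> = {T. (\<forall>i j. (1 \<le> T (i, j)) = (j < a i)) \<and>
         (\<forall>i j j'. j < j' \<and> j' < a i \<longrightarrow> T (i, j) \<le> T (i, j')) \<and>
         (\<forall>i i' j. i < i' \<and> j < a i' \<longrightarrow> T (i, j) < T (i', j)) \<and>
         (\<forall>k. card {(i, j). j < a i \<and> T (i, j) = Suc k} = (if k < length \<nu> then \<nu> ! k else 0))}"

lemma cells_rows_of: "c \<in> cells \<mu> \<longleftrightarrow> snd c < rows_of \<mu> (fst c)"
  by (cases c) (auto simp: cells_def rows_of_def)

lemma semistandard_tableaux_eq_ssyt: "semistandard_tableaux \<mu> \<nu> = ssyt (rows_of \<mu>) \<nu>"
proof -
  have eq: "{c \<in> cells \<mu>. T c = Suc k} = {(i, j). j < rows_of \<mu> i \<and> T (i, j) = Suc k}" for T k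
    by (auto simp: cells_rows_of)
  have main: "(\<forall>c. c \<notin> cells \<mu> \<longrightarrow> T c = 0) \<and> (\<forall>c\<in>cells \<mu>. T c \<ge> 1) \<longleftrightarrow>
    (\<forall>i j. (1 \<le> T (i, j)) = (j < rows_of \<mu> i))" for T :: "nat \<times> nat \<Rightarrow> nat"
  proof
    assume L: "(\<forall>c. c \<notin> cells \<mu> \<longrightarrow> T c = 0) \<and> (\<forall>c\<in>cells \<mu>. T c \<ge> 1)"
    show "\<forall>i j. (1 \<le> T (i, j)) = (j < rows_of \<mu> i)"
    proof (intro allI)
      fix i j show "(1 \<le> T (i, j)) = (j < rows_of \<mu> i)"
        using L[unfolded Ball_def cells_rows_of, THEN conjunct1, rule_format, of "(i, j)"]
          L[unfolded Ball_def cells_rows_of, THEN conjunct2, rule_format, of "(i, j)"] by fastforce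
    qed
  next
    assume R: "\<forall>i j. (1 \<le> T (i, j)) = (j < rows_of \<mu> i)"
    show "(\<forall>c. c \<notin> cells \<mu> \<longrightarrow> T c = 0) \<and> (\<forall>c\<in>cells \<mu>. T c \<ge> 1)"
    proof (intro conjI allI ballI impI)
      fix c assume "c \<notin> cells \<mu>"
      then show "T c = 0" using R[rule_format, of "fst c" "snd c"] by (simp add: cells_rows_of)
    next
      fix c assume "c \<in> cells \<mu>"
      then show "1 \<le> T c" using R[rule_format, of "fst c" "snd c"] by (simp add: cells_rows_of)
    qed
  qed
  show ?thesis unfolding semistandard_tableaux_def ssyt_def eq
    by (simp only: conj_assoc[symmetric] main) (simp only: cells_rows_of fst_conv snd_conv)
qed

lemma finite_cells_fun: "finite {i. 0 < a i} \<Longrightarrow> finite {(i, j). j < (a i :: nat)}"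
  by (rule finite_subset[of _ "Sigma {i. 0 < a i} (\<lambda>i. {..<a i})"]) auto

lemma card_cells_fun:
  assumes "finite {i. 0 < a i}" shows "card {(i, j). j < (a i :: nat)} = psize a"
proof -
  have "{(i, j). j < a i} = Sigma {i. 0 < a i} (\<lambda>i. {..<a i})" by auto
  then show ?thesis using assms by (simp add: psize_def)
qed

text \<open>Entries beyond the content have prescribed multiplicity 0; finiteness of the shape is
  what turns cardinality 0 into absence.\<close>

lemma ssyt_entry_le:
  assumes T: "T \<in> ssyt a \<nu>" and f: "finite {i. 0 < a i}"
  shows "T (i, j) \<le> length \<nu>"
proof (rule ccontr)
  assume n: "\<not> ?thesis"
  define k where "k = T (i, j) - 1"
  have k: "T (i, j) = Suc k" "length \<nu> \<le> k" using n by (auto simp: k_def)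
  have "(1 \<le> T (i, j)) = (j < a i)" using T by (simp add: ssyt_def)
  then have c: "j < a i" using k by simp
  have "card {(i, j). j < a i \<and> T (i, j) = Suc k} = 0" using T k by (simp add: ssyt_def)
  moreover have "finite {(i, j). j < a i \<and> T (i, j) = Suc k}"
    by (rule finite_subset[OF _ finite_cells_fun[OF f]]) auto
  ultimately have "{(i, j). j < a i \<and> T (i, j) = Suc k} = {}" by (simp only: card_0_eq)
  then show False using k c by blast
qed

definition fill_strip where
  "fill_strip b l = (\<lambda>(a, T) (i, j). if j < a i then T (i, j) else if j < b i then Suc l else (0::nat))"

text \<open>Columns stay strict because the strip has at most one box per column: a box of
  \<open>b\<close> with another box of \<open>b\<close> below it lies in \<open>a\<close>.\<close>

lemma fill_strip_ssyt:
  assumes b: "b \<in> shapes n" and a: "a \<in> hdown k b" and T: "T \<in> ssyt a \<nu>"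
  shows "fill_strip b (length \<nu>) (a, T) \<in> ssyt b (\<nu> @ [k])"
proof -
  let ?l = "length \<nu>" let ?F = "fill_strip b ?l (a, T)"
  have h: "hstrip a b" and ap: "a \<in> shapes (n - k)" "k \<le> n" using a hdown_shapes[OF b] by auto
  have fa: "finite {i. 0 < a i}" and fb: "finite {i. 0 < b i}" using ap b by (auto simp: shapes_def)
  have le: "a i \<le> b i" "b (Suc i) \<le> a i" for i using h by (auto simp: hstrip_def)
  have ama: "i \<le> i' \<Longrightarrow> a i' \<le> a i" for i i' using ap by (auto simp: shapes_def antimono_def)
  have amb: "i \<le> i' \<Longrightarrow> b i' \<le> b i" for i i' using b by (auto simp: shapes_def antimono_def)
  have T1: "(0 < T (i, j)) = (j < a i)" for i j using T by (auto simp: ssyt_def Suc_le_eq)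
  have T2: "j < j' \<Longrightarrow> j' < a i \<Longrightarrow> T (i, j) \<le> T (i, j')" for i j j' using T by (auto simp: ssyt_def)
  have T3: "i < i' \<Longrightarrow> j < a i' \<Longrightarrow> T (i, j) < T (i', j)" for i i' j using T by (auto simp: ssyt_def)
  have T4: "card {(i, j). j < a i \<and> T (i, j) = Suc q} = (if q < ?l then \<nu> ! q else 0)" for q 
    using T by (auto simp: ssyt_def)
  have Tl: "T c \<le> ?l" for c using ssyt_entry_le[OF T fa] by (cases c) auto
  have F: "?F (i, j) = (if j < a i then T (i, j) else if j < b i then Suc ?l else 0)" for i j
    by (simp add: fill_strip_def)
  have cnt: "card {(i, j). j < b i \<and> ?F (i, j) = Suc q} = (if q < length (\<nu> @ [k]) then (\<nu> @ [k]) ! q else 0)" for q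
  proof (cases "q = ?l")
    case True
    have sub: "{(i, j). j < a i} \<subseteq> {(i, j). j < b i}"
    proof safe
      fix i j assume "j < a i" then show "j < b i" using le(1)[of i] by linarith
    qed
    have "{(i, j). j < b i \<and> ?F (i, j) = Suc q} = {(i, j). j < b i} - {(i, j). j < a i}"
      using Tl True by (auto simp: F split: if_splits) (metis Suc_n_not_le_n)+
    then have "card {(i, j). j < b i \<and> ?F (i, j) = Suc q} = card {(i, j). j < b i} - card {(i, j). j < a i}"
      using card_Diff_subset[OF finite_cells_fun[OF fa], of "{(i, j). j < b i}"] sub by simp
    then show ?thesis using True a by (auto simp: card_cells_fun fa fb hdown_def)
  next
    case False
    have "{(i, j). j < b i \<and> ?F (i, j) = Suc q} = {(i, j). j < a i \<and> T (i, j) = Suc q}"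
      using False le(1) by (auto simp: F split: if_splits intro: less_le_trans)
    then show ?thesis using T4 False by (auto simp: nth_append)
  qed
  have 1: "(1 \<le> ?F (i, j)) = (j < b i)" for i j
    using T1[of i j] le(1)[of i] by (auto simp: F)
  have 2: "?F (i, j) \<le> ?F (i, j')" if "j < j'" "j' < b i" for i j j'
    using that T2[of j j' i] Tl[of "(i, j)"] by (auto simp: F)
  have 3: "?F (i, j) < ?F (i', j)" if "i < i'" "j < b i'" for i i' j
  proof -
    have "b i' \<le> b (Suc i)" using that by (intro amb) auto
    then have "j < a i" using le(2)[of i] that by linarith
    then show ?thesis using that T3[of i i' j] Tl[of "(i, j)"] by (auto simp: F)
  qed
  show ?thesis unfolding ssyt_def using 1 2 3 cnt by blast
qed

lemma ssyt_fill_strip: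
  assumes b: "b \<in> shapes n" and F: "F \<in> ssyt b (\<nu> @ [k])"
  shows "\<exists>a\<in>hdown k b. \<exists>T\<in>ssyt a \<nu>. F = fill_strip b (length \<nu>) (a, T)"
proof -
  let ?l = "length \<nu>"
  have fb: "finite {i. 0 < b i}" using b by (auto simp: shapes_def)
  have amb: "i \<le> i' \<Longrightarrow> b i' \<le> b i" for i i' using b by (auto simp: shapes_def antimono_def)
  have F1: "(0 < F (i, j)) = (j < b i)" for i j using F by (auto simp: ssyt_def Suc_le_eq)
  have F2: "j < j' \<Longrightarrow> j' < b i \<Longrightarrow> F (i, j) \<le> F (i, j')" for i j j' using F by (auto simp: ssyt_def)
  have F3: "i < i' \<Longrightarrow> j < b i' \<Longrightarrow> F (i, j) < F (i', j)" for i i' j using F by (auto simp: ssyt_def)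
  have F4: "card {(i, j). j < b i \<and> F (i, j) = Suc q} = (if q < Suc ?l then (\<nu> @ [k]) ! q else 0)" for q 
    using F by (auto simp: ssyt_def)
  have Fl: "F c \<le> Suc ?l" for c using ssyt_entry_le[OF F fb] by (cases c) auto
  \<comment> \<open>Rows increase weakly, so the entries up to \<open>?l\<close> form an initial
    segment of each row. Its length is the first position that fails; positions outside the shape
    fail too, so the minimum exists.\<close>
  define a where "a i = (LEAST j. \<not> (j < b i \<and> F (i, j) \<le> ?l))" for i
  have a1: "j < a i \<Longrightarrow> j < b i \<and> F (i, j) \<le> ?l" for i j
    unfolding a_def using not_less_Least by blast
  have a2: "\<not> (a i < b i \<and> F (i, a i) \<le> ?l)" for i
    unfolding a_def by (rule LeastI[of _ "b i"]) simp
  have a3: "j < a i \<longleftrightarrow> j < b i \<and> F (i, j) \<le> ?l" for i j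
  proof
    assume j: "j < b i \<and> F (i, j) \<le> ?l"
    show "j < a i"
    proof (rule ccontr)
      assume "\<not> j < a i"
      then have "a i < j \<or> a i = j" by auto
      then show False using a2[of i] j F2[of "a i" j i] by auto
    qed
  qed (use a1 in blast)
  have ale: "a i \<le> b i" for i using a1 by (meson linorder_not_less less_irrefl)
  have h: "hstrip a b" unfolding hstrip_def
  proof
    fix i
    have "j < a i" if "j < b (Suc i)" for j
      using F3[of i "Suc i" j] that Fl[of "(Suc i, j)"] amb[of i "Suc i"] a3[of j i] by auto
    then show "a i \<le> b i \<and> b (Suc i) \<le> a i" using ale by (meson linorder_not_less less_irrefl)
  qed
  have fa: "finite {i. 0 < a i}" using hstrip_support[OF h] fb finite_subset by blast
  define T where "T = (\<lambda>(i, j). if j < a i then F (i, j) else 0)"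
  have ama: "i \<le> i' \<Longrightarrow> a i' \<le> a i" for i i' using hstrip_antimono[OF h] by (auto simp: antimono_def)
  have "{(i, j). j < b i} = {(i, j). j < a i} \<union> {(i, j). j < b i \<and> F (i, j) = Suc ?l}"
    using Fl ale by (auto simp: a3 le_Suc_eq)
  moreover have "{(i, j). j < a i} \<inter> {(i, j). j < b i \<and> F (i, j) = Suc ?l} = {}" using a1 by fastforce
  moreover have "finite {(i, j). j < b i \<and> F (i, j) = Suc ?l}"
    by (rule finite_subset[OF _ finite_cells_fun[OF fb]]) auto
  ultimately have "card {(i, j). j < b i} = card {(i, j). j < a i} + card {(i, j). j < b i \<and> F (i, j) = Suc ?l}"
    using finite_cells_fun[OF fa] by (simp add: card_Un_disjoint)
  then have "psize a + k = psize b" using F4[of ?l] by (simp add: card_cells_fun fa fb)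
  then have ah: "a \<in> hdown k b" using h by (simp add: hdown_def)
  have cnt: "card {(i, j). j < a i \<and> T (i, j) = Suc q} = (if q < ?l then \<nu> ! q else 0)" for q
  proof (cases "q < ?l")
    case True
    have "{(i, j). j < a i \<and> T (i, j) = Suc q} = {(i, j). j < b i \<and> F (i, j) = Suc q}"
      using True by (auto simp: T_def a3)
    then show ?thesis using F4[of q] True by (simp add: nth_append)
  next
    case False
    have "{(i, j). j < a i \<and> T (i, j) = Suc q} = {}" using False by (auto simp: T_def a3)
    then have "card {(i, j). j < a i \<and> T (i, j) = Suc q} = 0" by (simp only: card.empty)
    then show ?thesis using False by simp
  qed
  have 1: "(1 \<le> T (i, j)) = (j < a i)" for i j using F1[of i j] ale[of i] by (auto simp: T_def Suc_le_eq)
  have 2: "T (i, j) \<le> T (i, j')" if "j < j'" "j' < a i" for i j j'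
    using that F2[of j j' i] ale[of i] by (auto simp: T_def)
  have 3: "T (i, j) < T (i', j)" if "i < i'" "j < a i'" for i i' j
    using that F3[of i i' j] ale[of i'] ama[of i i'] by (auto simp: T_def)
  have "T \<in> ssyt a \<nu>" unfolding ssyt_def using 1 2 3 cnt by blast
  moreover have "F = fill_strip b ?l (a, T)"
  proof
    fix c :: "nat \<times> nat"
    obtain i j where c: "c = (i, j)" by force
    show "F c = fill_strip b ?l (a, T) c"
      using F1[of i j] Fl[of c] a3[of j i] by (auto simp: c fill_strip_def T_def le_Suc_eq)
  qed
  ultimately show ?thesis using ah by blast
qed

text \<open>The values between 1 and \<open>length \<nu>\<close> mark exactly the cells of
  \<open>a\<close>, so both \<open>a\<close> and \<open>T\<close> can be read off the filled
  tableau.\<close>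

lemma fill_strip_inj:
  assumes b: "b \<in> shapes n"
  shows "inj_on (fill_strip b (length \<nu>)) (SIGMA a:hdown k b. ssyt a \<nu>)"
proof (rule inj_onI, safe)
  fix a T a' T' assume a: "a \<in> hdown k b" "a' \<in> hdown k b" and T: "T \<in> ssyt a \<nu>" "T' \<in> ssyt a' \<nu>"
    and eq: "fill_strip b (length \<nu>) (a, T) = fill_strip b (length \<nu>) (a', T')"
  have key: "(j < a i) = (1 \<le> fill_strip b (length \<nu>) (a, T) (i, j) \<and> fill_strip b (length \<nu>) (a, T) (i, j) \<le> length \<nu>)
    \<and> T (i, j) = (if j < a i then fill_strip b (length \<nu>) (a, T) (i, j) else 0)"
    if "a \<in> hdown k b" "T \<in> ssyt a \<nu>" for a T i j
  proof -
    have "finite {i. 0 < a i}" using that b by (auto simp: hdown_shapes shapes_def)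
    then have "T (i, j) \<le> length \<nu>" using ssyt_entry_le that by blast
    moreover have "(1 \<le> T (i, j)) = (j < a i)" using that by (auto simp: ssyt_def)
    ultimately show ?thesis by (auto simp: fill_strip_def)
  qed
  have *: "(j < a i) = (j < a' i)" "T (i, j) = T' (i, j)" for i j
    using key[OF a(1) T(1), of j i] key[OF a(2) T(2), of j i] eq by auto
  have "a i = a' i" for i using *(1) by (meson linorder_neq_iff)
  then show "a = a'" by blast
  show "T = T'" using *(2) by auto
qed

lemma card_ssyt: "b \<in> shapes n \<Longrightarrow> finite (ssyt b \<nu>) \<and> card (ssyt b \<nu>) = kostka_fn (rev \<nu>) b"
proof (induction \<nu> arbitrary: b n rule: rev_induct)
  case Nil
  have f: "finite {i. 0 < b i}" using Nil by (auto simp: shapes_def)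
  have "ssyt b [] = (if b = (\<lambda>_. 0) then {\<lambda>_. 0} else {})"
  proof (cases "b = (\<lambda>_. 0)")
    case True
    have "T = (\<lambda>_. 0)" if "\<forall>i j. \<not> Suc 0 \<le> T (i, j)" for T :: "nat \<times> nat \<Rightarrow> nat"
      using that by (auto simp: fun_eq_iff Suc_le_eq)
    then show ?thesis using True by (auto simp: ssyt_def)
  next
    case False
    then obtain i where i: "0 < b i" by (auto simp: fun_eq_iff)
    have "T \<notin> ssyt b []" for T
    proof
      assume T: "T \<in> ssyt b []"
      have "T (i, 0) \<le> 0" using ssyt_entry_le[OF T f] by simp
      moreover have "(1 \<le> T (i, 0)) = (0 < b i)" using T by (simp add: ssyt_def)
      ultimately show False using i by simp
    qed
    then show ?thesis using False by auto
  qed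
  then show ?case by simp
next
  case (snoc k \<nu>)
  have eq: "ssyt b (\<nu> @ [k]) = fill_strip b (length \<nu>) ` (SIGMA a:hdown k b. ssyt a \<nu>)"
    using fill_strip_ssyt[OF snoc(2)] ssyt_fill_strip[OF snoc(2)] by fastforce
  have fin: "finite (hdown k b)" using snoc(2) by (simp add: hdown_shapes)
  have IH: "finite (ssyt a \<nu>) \<and> card (ssyt a \<nu>) = kostka_fn (rev \<nu>) a" if "a \<in> hdown k b" for a
    using snoc(1)[of a "n - k"] that by (auto simp: hdown_shapes[OF snoc(2)])
  then have "card (ssyt b (\<nu> @ [k])) = (\<Sum>a\<in>hdown k b. kostka_fn (rev \<nu>) a)"
    unfolding eq card_image[OF fill_strip_inj[OF snoc(2)]] using fin by simp
  moreover have "finite (ssyt b (\<nu> @ [k]))" unfolding eq using fin IH by auto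
  ultimately show ?case by simp
qed

lemma sum_rows_of: "sum (rows_of \<mu>) {..<m} = sum_list (take m \<mu>)"
proof (induction m)
  case (Suc m)
  then show ?case by (cases "m < length \<mu>") (auto simp: rows_of_def take_Suc_conv_app_nth)
qed simp

lemma rows_of_shapes: "\<mu> \<in> young_diagrams N \<Longrightarrow> rows_of \<mu> \<in> shapes N"
proof (rule parI[of _ "length \<mu>"])
  assume m: "\<mu> \<in> young_diagrams N"
  have "rows_of \<mu> (Suc i) \<le> rows_of \<mu> i" for i
    using m sorted_wrt_nth_less[of "(\<ge>)" \<mu> i "Suc i"] by (auto simp: rows_of_def young_diagrams_def)
  then show "antimono (rows_of \<mu>)" by (simp add: antimono_iff_le_Suc)
  show "sum (rows_of \<mu>) {..<length \<mu>} = N" using m by (simp add: sum_rows_of young_diagrams_def)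
qed (simp add: rows_of_def)

lemma rows_of_bij: "bij_betw rows_of (young_diagrams N) (shapes N)"
  unfolding bij_betw_def
proof (intro conjI inj_onI equalityI subsetI)
  fix \<mu> \<nu> assume mn: "\<mu> \<in> young_diagrams N" "\<nu> \<in> young_diagrams N" and eq: "rows_of \<mu> = rows_of \<nu>"
  have len: "(i < length \<mu>) = (0 < rows_of \<mu> i)" if "\<mu> \<in> young_diagrams N" for i \<mu>
  proof -
    have "i < length \<mu> \<Longrightarrow> \<mu> ! i \<noteq> 0" using that nth_mem[of i \<mu>] by (metis (mono_tags, lifting) young_diagrams_def mem_Collect_eq)
    then show ?thesis by (auto simp: rows_of_def)
  qed
  have "(i < length \<mu>) = (i < length \<nu>)" for i using len[OF mn(1), of i] len[OF mn(2), of i] eq by simp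
  then have "length \<mu> = length \<nu>" by (meson linorder_neq_iff)
  moreover have "\<mu> ! i = \<nu> ! i" if "i < length \<mu>" for i 
    using fun_cong[OF eq, of i] that \<open>length \<mu> = length \<nu>\<close> by (simp add: rows_of_def)
  ultimately show "\<mu> = \<nu>" by (rule nth_equalityI)
next
  fix a assume "a \<in> rows_of ` young_diagrams N"
  then show "a \<in> shapes N" using rows_of_shapes by auto
next
  fix a assume a: "a \<in> shapes N"
  then have am: "antimono a" by (simp add: shapes_def)
  define m where "m = (LEAST m. a m = 0)"
  have m0: "a m = 0" unfolding m_def by (rule LeastI[of _ N]) (use shapes_support[OF a] in auto)
  have mp: "0 < a i" if "i < m" for i using that not_less_Least m_def by blast
  have z: "a i = 0" if "m \<le> i" for i using antimonoD[OF am that] m0 by simp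
  let ?\<mu> = "map a [0..<m]"
  have r: "rows_of ?\<mu> = a" using z by (auto simp: rows_of_def fun_eq_iff)
  have "sum_list ?\<mu> = sum a {..<m}" by (simp add: interv_sum_list_conv_sum_set_nat atLeast0LessThan)
  also have "\<dots> = N" using psize_superset[of "{..<m}" a] z a by (auto simp: shapes_def)
  finally have "sum_list ?\<mu> = N" .
  moreover have "sorted_wrt (\<ge>) ?\<mu>"
    unfolding sorted_wrt_iff_nth_less using antimonoD[OF am] by simp
  ultimately have "?\<mu> \<in> young_diagrams N" using mp by (force simp: young_diagrams_def)
  then show "a \<in> rows_of ` young_diagrams N" using r by (metis imageI)
qed

lemma finite_young_diagrams [simp]: "finite (young_diagrams N)"
  using rows_of_bij[of N] bij_betw_finite finite_shapes by blast

lemma kostka_eq_kostka_fn: "\<mu> \<in> young_diagrams N \<Longrightarrow> kostka \<mu> \<nu> = kostka_fn (rev \<nu>) (rows_of \<mu>)"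
  using card_ssyt[OF rows_of_shapes] by (simp add: kostka_def semistandard_tableaux_eq_ssyt)

lemma finite_semistandard_tableaux: "\<mu> \<in> young_diagrams N \<Longrightarrow> finite (semistandard_tableaux \<mu> \<nu>)"
  using card_ssyt[OF rows_of_shapes] by (simp add: semistandard_tableaux_eq_ssyt)

lemma kostka_pos_dominates:
  "\<mu> \<in> young_diagrams N \<Longrightarrow> 0 < kostka \<mu> \<nu> \<Longrightarrow> dominates \<mu> \<nu>"
  using kostka_fn_dominance[OF rows_of_shapes, of \<mu> N \<nu>]
  by (auto simp: kostka_eq_kostka_fn dominates_def sum_rows_of)

lemma dominates_kostka_pos:
  "\<mu> \<in> young_diagrams (sum_list \<nu>) \<Longrightarrow> sorted_wrt (\<ge>) \<nu> \<Longrightarrow> dominates \<mu> \<nu> \<Longrightarrow> 0 < kostka \<mu> \<nu>"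
  using dominance_kostka_fn[OF rows_of_shapes] by (auto simp: kostka_eq_kostka_fn dominates_def sum_rows_of)

text \<open>The quotient of the factorials is the dimension of the permutation module, so this is
  the numerical half of Young's rule: multiplicities times numbers of standard tableaux fill that
  dimension.\<close>

lemma kostka_sum_fact:
  "(\<Sum>\<mu>\<in>young_diagrams (sum_list \<nu>). kostka \<mu> \<nu> * kostka \<mu> (replicate (sum_list \<nu>) 1))
     * prod_list (map fact \<nu>) = fact (sum_list \<nu>)"
proof -
  let ?N = "sum_list \<nu>"
  have "(\<Sum>\<mu>\<in>young_diagrams ?N. kostka \<mu> \<nu> * kostka \<mu> (replicate ?N 1)) =
     (\<Sum>\<mu>\<in>young_diagrams ?N. kostka_fn (replicate ?N 1) (rows_of \<mu>) * kostka_fn (rev \<nu>) (rows_of \<mu>))"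
    by (intro sum.cong refl) (simp add: kostka_eq_kostka_fn mult.commute)
  also have "\<dots> = ksum ?N (kostka_fn (rev \<nu>))" unfolding ksum_def
    by (rule sum.reindex_bij_betw[OF rows_of_bij])
  finally show ?thesis using ksum_fact[of "rev \<nu>"] by (simp add: rev_map[symmetric])
qed

section \<open>Functions on a finite set\<close>

definition funs_on :: "'x set \<Rightarrow> ('x \<Rightarrow> complex) set" where
  "funs_on X = {f. \<forall>x. x \<notin> X \<longrightarrow> f x = 0}"

definition ip :: "'x set \<Rightarrow> ('x \<Rightarrow> complex) \<Rightarrow> ('x \<Rightarrow> complex) \<Rightarrow> complex" where
  "ip X f g = (\<Sum>x\<in>X. f x * cnj (g x))"

definition lin_subspace :: "('x \<Rightarrow> complex) set \<Rightarrow> bool" where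
  "lin_subspace S \<longleftrightarrow> (\<lambda>_. 0) \<in> S \<and> (\<forall>f\<in>S. \<forall>g\<in>S. \<forall>a b. (\<lambda>x. a * f x + b * g x) \<in> S)"

lemma lin_subspace_comb: "lin_subspace S \<Longrightarrow> f \<in> S \<Longrightarrow> g \<in> S \<Longrightarrow> (\<lambda>x. a * f x + b * g x) \<in> S"
  by (simp add: lin_subspace_def)

lemma lin_subspace_scale: "lin_subspace S \<Longrightarrow> f \<in> S \<Longrightarrow> (\<lambda>x. a * f x) \<in> S"
  using lin_subspace_comb[of S f f a 0] by simp

lemma lin_subspace_diff: "lin_subspace S \<Longrightarrow> f \<in> S \<Longrightarrow> g \<in> S \<Longrightarrow> (\<lambda>x. f x - g x) \<in> S"
  using lin_subspace_comb[of S f g 1 "-1"] by simp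

lemma lin_subspace_sum:
  assumes "lin_subspace S" "\<And>i. i \<in> A \<Longrightarrow> f i \<in> S"
  shows "(\<lambda>x. \<Sum>i\<in>A. c i * f i x) \<in> S"
  using assms(2)
proof (induction A rule: infinite_finite_induct)
  case (insert i A)
  then show ?case using lin_subspace_comb[OF assms(1), of "f i" "\<lambda>x. \<Sum>i\<in>A. c i * f i x" "c i" 1] by simp
qed (use assms(1) in \<open>simp_all add: lin_subspace_def\<close>)

lemma linear_map_on_comb:
  "linear_map_on S T \<Longrightarrow> f \<in> S \<Longrightarrow> g \<in> S \<Longrightarrow> T (\<lambda>x. a * f x + b * g x) = (\<lambda>y. a * T f y + b * T g y)"
  by (simp add: linear_map_on_def)

lemma linear_map_on_scale: "linear_map_on S T \<Longrightarrow> f \<in> S \<Longrightarrow> T (\<lambda>x. a * f x) = (\<lambda>y. a * T f y)"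
  using linear_map_on_comb[of S T f f a 0] by simp

lemma linear_map_on_zero: "linear_map_on S T \<Longrightarrow> f \<in> S \<Longrightarrow> T (\<lambda>_. 0) = (\<lambda>_. 0)"
  using linear_map_on_comb[of S T f f 0 0] by simp

lemma linear_map_on_sum:
  assumes "lin_subspace S" "linear_map_on S T" "\<And>i. i \<in> A \<Longrightarrow> f i \<in> S"
  shows "T (\<lambda>x. \<Sum>i\<in>A. c i * f i x) = (\<lambda>y. \<Sum>i\<in>A. c i * T (f i) y)"
  using assms(3)
proof (induction A rule: infinite_finite_induct)
  case (insert i A)
  have "(\<lambda>x. \<Sum>i\<in>A. c i * f i x) \<in> S" by (rule lin_subspace_sum[OF assms(1)]) (use insert in auto)
  then show ?case
    using linear_map_on_comb[OF assms(2), of "f i" "\<lambda>x. \<Sum>i\<in>A. c i * f i x" "c i" 1] insert by simp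
qed (use assms in \<open>auto simp: lin_subspace_def intro: linear_map_on_zero\<close>)

lemma lin_subspace_funs_on: "lin_subspace (funs_on X)"
  by (auto simp: lin_subspace_def funs_on_def)

lemma ip_comb_left: "ip X (\<lambda>x. a * f x + b * g x) h = a * ip X f h + b * ip X g h"
  by (simp add: ip_def algebra_simps sum.distrib sum_distrib_left)

lemma ip_cnj: "ip X g f = cnj (ip X f g)"
  by (simp add: ip_def mult.commute)

lemma ip_sum_left: "ip X (\<lambda>x. \<Sum>i\<in>A. c i * f i x) h = (\<Sum>i\<in>A. c i * ip X (f i) h)"
  unfolding ip_def sum_distrib_right sum_distrib_left
  by (subst sum.swap) (simp add: mult.assoc)

lemma ip_sum_right: "ip X h (\<lambda>x. \<Sum>i\<in>A. c i * f i x) = (\<Sum>i\<in>A. cnj (c i) * ip X h (f i))"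
  by (subst ip_cnj) (simp add: ip_sum_left, simp add: ip_cnj[of X h])

lemma ip_scale_left: "ip X (\<lambda>x. a * f x) h = a * ip X f h"
  by (simp add: ip_def sum_distrib_left mult.assoc)

lemma ip_scale_right: "ip X h (\<lambda>x. a * f x) = cnj a * ip X h f"
  by (simp add: ip_def sum_distrib_left mult_ac)

lemma ip_diff_left: "ip X (\<lambda>x. f x - g x) h = ip X f h - ip X g h"
  by (simp add: ip_def algebra_simps sum_subtractf)

lemma ip_diff_right: "ip X h (\<lambda>x. f x - g x) = ip X h f - ip X h g"
  by (simp add: ip_def algebra_simps sum_subtractf)

lemma ip_self: "ip X f f = of_real (\<Sum>x\<in>X. (cmod (f x))\<^sup>2)"
  by (simp add: ip_def complex_norm_square[symmetric] del: of_real_sum) (simp add: complex_norm_square)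

lemma ip_self_eq_0:
  assumes "finite X" "f \<in> funs_on X" "ip X f f = 0" shows "f = (\<lambda>_. 0)"
proof
  fix x
  have "(\<Sum>x\<in>X. (cmod (f x))\<^sup>2) = 0" using assms(3) unfolding ip_self of_real_eq_0_iff .
  then have "\<forall>x\<in>X. (cmod (f x))\<^sup>2 = 0" using assms(1) by (subst (asm) sum_nonneg_eq_0_iff) auto
  then show "f x = 0" using assms(2) by (cases "x \<in> X") (auto simp: funs_on_def)
qed

lemma ip_ext:
  assumes "finite X" "f \<in> S" "g \<in> S" "lin_subspace S" "S \<subseteq> funs_on X" "\<And>h. h \<in> S \<Longrightarrow> ip X f h = ip X g h"
  shows "f = g"
proof -
  have d: "(\<lambda>x. f x - g x) \<in> S" using assms by (intro lin_subspace_diff) auto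
  then have "ip X (\<lambda>x. f x - g x) (\<lambda>x. f x - g x) = 0" using assms(6)[OF d] by (simp add: ip_diff_left)
  then have "(\<lambda>x. f x - g x) = (\<lambda>_. 0)" using ip_self_eq_0[OF assms(1)] d assms(5) by blast
  then show ?thesis by (simp add: fun_eq_iff)
qed

section \<open>Orthonormal families and linear independence\<close>

definition orthonormal :: "'x set \<Rightarrow> 'i set \<Rightarrow> ('i \<Rightarrow> 'x \<Rightarrow> complex) \<Rightarrow> bool" where
  "orthonormal X A b \<longleftrightarrow> (\<forall>i\<in>A. \<forall>j\<in>A. ip X (b i) (b j) = (if i = j then 1 else 0))"

lemma orthonormal_coeff:
  assumes "orthonormal X A b" "finite A" "j \<in> A"
  shows "ip X (\<lambda>x. \<Sum>i\<in>A. c i * b i x) (b j) = c j"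
proof -
  have "(\<Sum>i\<in>A. c i * ip X (b i) (b j)) = (\<Sum>i\<in>A. if i = j then c j else 0)"
    using assms by (intro sum.cong) (auto simp: orthonormal_def)
  then show ?thesis using assms by (simp add: ip_sum_left)
qed

lemma orthonormal_residual:
  fixes f :: "'x \<Rightarrow> complex"
  assumes "orthonormal X A b" "finite A"
  defines "r \<equiv> \<lambda>x. f x - (\<Sum>i\<in>A. ip X f (b i) * b i x)"
  shows "j \<in> A \<Longrightarrow> ip X r (b j) = 0" and
    "ip X r r = ip X f f - of_real (\<Sum>i\<in>A. (cmod (ip X f (b i)))\<^sup>2)"
proof -
  show 1: "ip X r (b j) = 0" if "j \<in> A" for j
    using orthonormal_coeff[OF assms(1,2) that] by (simp add: r_def ip_diff_left)
  have "ip X r (\<lambda>x. \<Sum>i\<in>A. ip X f (b i) * b i x) = 0"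
    using 1 by (simp add: ip_sum_right)
  then have "ip X r r = ip X r f" by (subst (2) r_def) (simp add: ip_diff_right)
  also have "\<dots> = ip X f f - (\<Sum>i\<in>A. ip X f (b i) * ip X (b i) f)"
    by (simp add: r_def ip_diff_left ip_sum_left)
  also have "(\<Sum>i\<in>A. ip X f (b i) * ip X (b i) f) = of_real (\<Sum>i\<in>A. (cmod (ip X f (b i)))\<^sup>2)"
    unfolding of_real_sum complex_norm_square
    by (intro sum.cong refl) (simp add: ip_cnj[of X f])
  finally show "ip X r r = ip X f f - of_real (\<Sum>i\<in>A. (cmod (ip X f (b i)))\<^sup>2)" .
qed

lemma ip_delta:
  assumes "finite X" "x \<in> X"
  shows "ip X (\<lambda>y. if y = x then 1 else 0) g = cnj (g x)"
  using assms by (simp add: ip_def if_distrib[of "\<lambda>z. z * _"] cong: if_cong)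

text \<open>
  Summing the squared norms of the residuals of the delta functions gives \<open>card X - card A\<close>; this
  yields both the bound on the size of an orthonormal family and completeness in the extreme case.
\<close>

lemma orthonormal_residual_sum:
  assumes X: "finite X" and A: "finite A" and o: "orthonormal X A b"
  shows "(\<Sum>x\<in>X. ip X (\<lambda>y. (if y = x then 1 else 0) - (\<Sum>i\<in>A. cnj (b i x) * b i y))
      (\<lambda>y. (if y = x then 1 else 0) - (\<Sum>i\<in>A. cnj (b i x) * b i y))) = of_nat (card X) - of_nat (card A)"
proof -
  have "ip X (\<lambda>y. (if y = x then 1 else 0) - (\<Sum>i\<in>A. cnj (b i x) * b i y))
      (\<lambda>y. (if y = x then 1 else 0) - (\<Sum>i\<in>A. cnj (b i x) * b i y)) = 1 - (\<Sum>i\<in>A. b i x * cnj (b i x))" if "x \<in> X" for x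
    using orthonormal_residual(2)[OF o A, of "\<lambda>y. if y = x then 1 else 0"]
    by (simp add: ip_delta[OF X that] complex_norm_square[symmetric] mult.commute)
  then have "(\<Sum>x\<in>X. ip X (\<lambda>y. (if y = x then 1 else 0) - (\<Sum>i\<in>A. cnj (b i x) * b i y))
      (\<lambda>y. (if y = x then 1 else 0) - (\<Sum>i\<in>A. cnj (b i x) * b i y))) = 
       of_nat (card X) - (\<Sum>x\<in>X. \<Sum>i\<in>A. b i x * cnj (b i x))"
    by (simp add: sum_subtractf)
  also have "(\<Sum>x\<in>X. \<Sum>i\<in>A. b i x * cnj (b i x)) = (\<Sum>i\<in>A. ip X (b i) (b i))"
    unfolding ip_def by (rule sum.swap)
  also have "\<dots> = of_nat (card A)" using o by (simp add: orthonormal_def)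
  finally show ?thesis .
qed

lemma orthonormal_card_le:
  assumes X: "finite X" and A: "finite A" and o: "orthonormal X A b"
  shows "card A \<le> card X"
proof -
  define r where "r x = (\<lambda>y. (if y = x then 1 else 0) - (\<Sum>i\<in>A. cnj (b i x) * b i y))" for x
  have "(\<Sum>x\<in>X. ip X (r x) (r x)) = of_nat (card X) - of_nat (card A)"
    unfolding r_def by (rule orthonormal_residual_sum[OF assms])
  then have "complex_of_real (\<Sum>x\<in>X. \<Sum>y\<in>X. (cmod (r x y))\<^sup>2) = of_real (real (card X) - real (card A))"
    unfolding ip_self by simp
  then have "(\<Sum>x\<in>X. \<Sum>y\<in>X. (cmod (r x y))\<^sup>2) = real (card X) - real (card A)"
    by (simp only: of_real_eq_iff)
  moreover have "0 \<le> (\<Sum>x\<in>X. \<Sum>y\<in>X. (cmod (r x y))\<^sup>2)" by (intro sum_nonneg) auto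
  ultimately show ?thesis by simp
qed

lemma orthonormal_complete:
  assumes X: "finite X" and A: "finite A" and o: "orthonormal X A b"
    and sub: "\<And>i. i \<in> A \<Longrightarrow> b i \<in> funs_on X" and ge: "card X \<le> card A" and f: "f \<in> funs_on X"
  shows "f = (\<lambda>y. \<Sum>i\<in>A. ip X f (b i) * b i y)"
proof -
  define r where "r x = (\<lambda>y. (if y = x then 1 else 0) - (\<Sum>i\<in>A. cnj (b i x) * b i y))" for x
  have "card A = card X" using ge orthonormal_card_le[OF X A o] by simp
  then have "(\<Sum>x\<in>X. ip X (r x) (r x)) = 0"
    unfolding r_def using orthonormal_residual_sum[OF X A o] by simp
  then have "complex_of_real (\<Sum>x\<in>X. \<Sum>y\<in>X. (cmod (r x y))\<^sup>2) = 0"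
    unfolding ip_self by simp
  then have "(\<Sum>x\<in>X. \<Sum>y\<in>X. (cmod (r x y))\<^sup>2) = 0" by (simp only: of_real_eq_0_iff)
  then have z: "\<forall>x\<in>X. \<forall>y\<in>X. r x y = 0"
    using X by (subst (asm) sum_nonneg_eq_0_iff; simp add: sum_nonneg sum_nonneg_eq_0_iff)
  show ?thesis
  proof
    fix y
    show "f y = (\<Sum>i\<in>A. ip X f (b i) * b i y)"
    proof (cases "y \<in> X")
      case True
      have "(\<Sum>i\<in>A. ip X f (b i) * b i y) = (\<Sum>x\<in>X. f x * (\<Sum>i\<in>A. cnj (b i x) * b i y))"
        unfolding ip_def sum_distrib_left sum_distrib_right by (subst sum.swap) (simp add: mult.assoc)
      also have "\<dots> = (\<Sum>x\<in>X. f x * (if y = x then 1 else 0))"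
        using z True by (intro sum.cong refl) (simp add: r_def)
      also have "\<dots> = f y" using X True by (simp add: if_distrib[of "\<lambda>z. _ * z"] cong: if_cong)
      finally show ?thesis by simp
    next
      case False
      then show ?thesis using f sub by (auto simp: funs_on_def intro!: sum.neutral[symmetric])
    qed
  qed
qed

text \<open>A longest orthonormal family in S exists because lengths are bounded by
  \<open>orthonormal_card_le\<close>. If some vector were not expanded by it, its normalized
  residual would prolong the family.\<close>

lemma orthonormal_basis_exists:
  assumes X: "finite X" and S: "lin_subspace S" "S \<subseteq> funs_on X"
  obtains d :: nat and b where "\<And>i. i < d \<Longrightarrow> b i \<in> S" "orthonormal X {..<d} b"
    "\<And>u. u \<in> S \<Longrightarrow> u = (\<lambda>x. \<Sum>i<d. ip X u (b i) * b i x)"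
proof -
  let ?P = "\<lambda>d::nat. \<exists>b. (\<forall>i<d. b i \<in> S) \<and> orthonormal X {..<d} b"
  have "?P 0" by (intro exI[of _ "\<lambda>_ _. 0"]) (simp add: orthonormal_def)
  moreover have bd: "d \<le> card X" if "?P d" for d
    using that orthonormal_card_le[OF X, of "{..<d}"] by auto
  ultimately obtain d where d: "?P d" "\<And>e. ?P e \<Longrightarrow> e \<le> d"
    using Nat.ex_has_greatest_nat[of ?P 0 "card X"] by auto
  then obtain b where b: "\<forall>i<d. b i \<in> S" and o: "orthonormal X {..<d} b" by auto
  have "u = (\<lambda>x. \<Sum>i<d. ip X u (b i) * b i x)" if u: "u \<in> S" for u
  proof (rule ccontr)
    assume ne: "u \<noteq> (\<lambda>x. \<Sum>i<d. ip X u (b i) * b i x)"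
    define r where "r = (\<lambda>x. u x - (\<Sum>i\<in>{..<d}. ip X u (b i) * b i x))"
    have rS: "r \<in> S" unfolding r_def
      by (intro lin_subspace_diff S u lin_subspace_sum) (use b in auto)
    have "r \<noteq> (\<lambda>_. 0)" using ne by (auto simp: r_def fun_eq_iff)
    then have rr: "ip X r r \<noteq> 0" using ip_self_eq_0[OF X] rS S by blast
    define n where "n = sqrt (\<Sum>x\<in>X. (cmod (r x))\<^sup>2)"
    have nn: "ip X r r = of_real n * of_real n" unfolding ip_self n_def
      by (simp flip: of_real_mult add: sum_nonneg)
    define c where "c = (\<lambda>x. (1 / of_real n) * r x)"
    have n0: "n \<noteq> 0" using rr nn by auto
    have cc: "ip X c c = 1" unfolding c_def ip_scale_left ip_scale_right nn using n0 by simp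
    have rb: "ip X r (b j) = 0" if "j < d" for j
      using orthonormal_residual(1)[OF o, of j u] that by (simp add: r_def)
    have cb: "ip X c (b j) = 0" if "j < d" for j
      unfolding c_def ip_scale_left using rb[OF that] by simp
    have bc: "ip X (b j) c = 0" if "j < d" for j
      using cb[OF that] ip_cnj[of X "b j" c] by simp
    have "orthonormal X {..<Suc d} (b(d := c))"
      using o cc cb bc unfolding orthonormal_def by (auto simp: less_Suc_eq)
    moreover have "c \<in> S" unfolding c_def by (rule lin_subspace_scale[OF S(1) rS])
    then have "\<forall>i<Suc d. (b(d := c)) i \<in> S"
      using b by (auto simp: less_Suc_eq)
    ultimately have "?P (Suc d)" by blast
    from d(2)[OF this] show False by simp
  qed
  then show ?thesis using b o that by blast
qed

text \<open>Gaussian elimination: an unknown \<open>t0\<close> that occurs in the new equation is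
  eliminated from the other equations and then solved for.\<close>

lemma homogeneous_system_solution:
  fixes M :: "'t \<Rightarrow> 'i \<Rightarrow> complex"
  assumes "finite A" "finite B" "card B < card A"
  shows "\<exists>a. (\<exists>t\<in>A. a t \<noteq> 0) \<and> (\<forall>i\<in>B. (\<Sum>t\<in>A. a t * M t i) = 0)"
  using assms(2,1,3)
proof (induction B arbitrary: A M rule: finite_induct)
  case empty
  then have "A \<noteq> {}" by auto
  then show ?case by (intro exI[of _ "\<lambda>_. 1"]) auto
next
  case (insert i B)
  show ?case
  proof (cases "\<forall>t\<in>A. M t i = 0")
    case True
    have "card B < card A" using insert by simp
    from insert.IH[OF insert.prems(1) this, of M] obtain a
      where a: "\<exists>t\<in>A. a t \<noteq> 0" "\<forall>i\<in>B. (\<Sum>t\<in>A. a t * M t i) = 0" by auto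
    then show ?thesis using True by (intro exI[of _ a]) auto
  next
    case False
    then obtain t0 where t0: "t0 \<in> A" "M t0 i \<noteq> 0" by auto
    have c: "card B < card (A - {t0})" using insert t0 by simp
    have "\<exists>a. (\<exists>t\<in>A - {t0}. a t \<noteq> 0) \<and> (\<forall>j\<in>B. (\<Sum>t\<in>A - {t0}. a t * (M t j - M t i / M t0 i * M t0 j)) = 0)"
      using insert.IH[of "A - {t0}" "\<lambda>t j. M t j - M t i / M t0 i * M t0 j"] insert.prems(1) c by simp
    then obtain a where a: "\<exists>t\<in>A - {t0}. a t \<noteq> 0"
        "\<forall>j\<in>B. (\<Sum>t\<in>A - {t0}. a t * (M t j - M t i / M t0 i * M t0 j)) = 0"
      by auto
    define s where "s = (\<Sum>t\<in>A - {t0}. a t * M t i)"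
    \<comment> \<open>This value makes equation i hold; the reduced equations were set up so that
      the others follow from it.\<close>
    define a' where "a' = a(t0 := - s / M t0 i)"
    have split: "(\<Sum>t\<in>A. a' t * M t j) = - s / M t0 i * M t0 j + (\<Sum>t\<in>A - {t0}. a t * M t j)" for j
      using t0 insert.prems(1) by (subst sum.remove[of A t0]) (auto simp: a'_def intro!: sum.cong)
    have "(\<Sum>t\<in>A. a' t * M t i) = 0" unfolding split using t0 by (simp add: s_def)
    moreover have "(\<Sum>t\<in>A. a' t * M t j) = 0" if "j \<in> B" for j
    proof -
      have "0 = (\<Sum>t\<in>A - {t0}. a t * (M t j - M t i / M t0 i * M t0 j))" using a that by simp
      also have "\<dots> = (\<Sum>t\<in>A - {t0}. a t * M t j) - (\<Sum>t\<in>A - {t0}. a t * M t i) / M t0 i * M t0 j"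
        by (simp add: algebra_simps sum_subtractf sum_distrib_left sum_divide_distrib sum_distrib_right)
      finally show ?thesis unfolding split s_def by simp
    qed
    moreover have "\<exists>t\<in>A. a' t \<noteq> 0" using a(1) by (auto simp: a'_def)
    ultimately show ?thesis by (intro exI[of _ a']) auto
  qed
qed

lemma independent_le_orthonormal:
  assumes T: "finite T" and o: "orthonormal X {..<d::nat} b"
    and exp: "\<And>t. t \<in> T \<Longrightarrow> v t = (\<lambda>x. \<Sum>i<d. ip X (v t) (b i) * b i x)"
    and ind: "\<And>a. (\<lambda>x. \<Sum>t\<in>T. a t * v t x) = (\<lambda>_. 0) \<Longrightarrow> \<forall>t\<in>T. a t = 0"
  shows "card T \<le> d"
proof (rule ccontr)
  assume "\<not> ?thesis"
  then have "card {..<d} < card T" by simp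
  then obtain a where a: "\<exists>t\<in>T. a t \<noteq> 0" "\<forall>i\<in>{..<d}. (\<Sum>t\<in>T. a t * ip X (v t) (b i)) = 0"
    using homogeneous_system_solution[OF T, of "{..<d}" "\<lambda>t i. ip X (v t) (b i)"] by auto
  have "(\<lambda>x. \<Sum>t\<in>T. a t * v t x) = (\<lambda>x. \<Sum>t\<in>T. a t * (\<Sum>i<d. ip X (v t) (b i) * b i x))"
    by (intro ext sum.cong refl arg_cong2[of _ _ _ _ "(*)"]) (metis exp)
  also have "\<dots> = (\<lambda>x. \<Sum>i<d. (\<Sum>t\<in>T. a t * ip X (v t) (b i)) * b i x)"
    unfolding sum_distrib_left sum_distrib_right by (subst sum.swap) (simp add: mult.assoc)
  also have "\<dots> = (\<lambda>_. 0)" using a(2) by simp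
  finally show False using ind a(1) by blast
qed

section \<open>Permutation modules\<close>

text \<open>Covers both modules that occur: \<open>X_fin\<close> is the case of the finite blocks
  with their cardinalities, and N one-point blocks of an N-element set give a copy of the regular
  representation.\<close>

definition ordered_partitions :: "'i set \<Rightarrow> ('i \<Rightarrow> nat) \<Rightarrow> 'a set \<Rightarrow> ('i \<Rightarrow> 'a set) set" where
  "ordered_partitions I m E =
     {s. (\<forall>i. i \<notin> I \<longrightarrow> s i = {}) \<and> (\<forall>i\<in>I. finite (s i) \<and> card (s i) = m i) \<and>
         disjoint_family_on s I \<and> (\<Union>i\<in>I. s i) = E}"

text \<open>Unlike \<open>rep_act\<close> of a permutation representation, this does not mention the
  underlying set, so one operator serves tabloids and ordered partitions alike. The two agree on
  functions supported by an invariant set (\<open>sym_rep_act\<close>).\<close>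

definition pact :: "('a \<Rightarrow> 'a) \<Rightarrow> (('i \<Rightarrow> 'a set) \<Rightarrow> complex) \<Rightarrow> (('i \<Rightarrow> 'a set) \<Rightarrow> complex)" where
  "pact p f = (\<lambda>r. f (relabel (inv_into UNIV p) r))"

lemma relabel_comp: "relabel p (relabel q r) = relabel (p \<circ> q) r"
  by (simp add: relabel_def image_comp)

lemma relabel_id [simp]: "relabel id r = r"
  by (simp add: relabel_def)

lemma relabel_inv [simp]:
  assumes "p permutes E"
  shows "relabel (inv_into UNIV p) (relabel p r) = r" "relabel p (relabel (inv_into UNIV p) r) = r"
  using permutes_inv_o[OF assms] by (simp_all add: relabel_comp)

lemma relabel_inv_eq_iff:
  "p permutes E \<Longrightarrow> relabel (inv_into UNIV p) r = s \<longleftrightarrow> r = relabel p s"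
  by auto

lemma pact_comp:
  "p permutes E \<Longrightarrow> q permutes E \<Longrightarrow> pact p (pact q f) = pact (p \<circ> q) f"
  by (simp add: pact_def relabel_comp o_inv_distrib permutes_bij)

definition perm_invariant :: "'a set \<Rightarrow> ('i \<Rightarrow> 'a set) set \<Rightarrow> bool" where
  "perm_invariant E X \<longleftrightarrow> (\<forall>p r. p permutes E \<longrightarrow> r \<in> X \<longrightarrow> relabel p r \<in> X)"

lemma perm_invariant_iff:
  assumes "perm_invariant E X" "p permutes E" shows "relabel p r \<in> X \<longleftrightarrow> r \<in> X"
  using assms permutes_inv[OF assms(2)] relabel_inv(1)[OF assms(2), of r]
  unfolding perm_invariant_def by metis

lemma pact_funs_on:
  assumes "perm_invariant E X" "p permutes E" "f \<in> funs_on X" shows "pact p f \<in> funs_on X"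
  using assms perm_invariant_iff[OF assms(1) permutes_inv[OF assms(2)]] by (auto simp: pact_def funs_on_def)

lemma sum_relabel:
  assumes "perm_invariant E X" "p permutes E" shows "(\<Sum>x\<in>X. g (relabel p x)) = (\<Sum>x\<in>X. g x)"
  by (rule sum.reindex_bij_witness[of _ "relabel (inv_into UNIV p)" "relabel p"])
     (use assms perm_invariant_iff[OF assms(1)] permutes_inv[OF assms(2)] in auto)

lemma ip_pact:
  assumes "perm_invariant E X" "p permutes E"
  shows "ip X (pact p f) g = ip X f (pact (inv_into UNIV p) g)"
  using sum_relabel[OF assms, of "\<lambda>x. pact p f x * cnj (g x)"] assms(2)
  by (simp add: ip_def pact_def permutes_inv_inv)

lemma finite_ordered_partitions:
  assumes "finite I" "finite E" shows "finite (ordered_partitions I m E)"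
proof -
  have "ordered_partitions I m E \<subseteq> {s. \<forall>i. (i \<in> I \<longrightarrow> s i \<in> Pow E) \<and> (i \<notin> I \<longrightarrow> s i = {})}"
    by (auto simp: ordered_partitions_def)
  then show ?thesis by (rule finite_subset) (rule finite_set_of_finite_funs, use assms in auto)
qed

lemma perm_invariant_ordered_partitions: "perm_invariant E (ordered_partitions I m E)"
  unfolding perm_invariant_def
proof (intro allI impI)
  fix p r assume p: "p permutes E" and r: "r \<in> ordered_partitions I m E"
  have inj: "inj p" using p by (rule permutes_inj)
  have "(\<Union>i\<in>I. p ` r i) = p ` E" using r by (auto simp: ordered_partitions_def)
  then have "(\<Union>i\<in>I. p ` r i) = E" using permutes_image[OF p] by simp
  moreover have "disjoint_family_on (\<lambda>i. p ` r i) I"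
    using r inj unfolding ordered_partitions_def disjoint_family_on_def
    by (simp add: image_Int[symmetric])
  ultimately show "relabel p r \<in> ordered_partitions I m E"
    using r inj_on_subset[OF inj subset_UNIV] by (auto simp: ordered_partitions_def relabel_def card_image)
qed

lemma ordered_partitions_insert:
  assumes "finite I" "i \<notin> I" "finite E"
  shows "card (ordered_partitions (insert i I) m E) =
    (\<Sum>A\<in>{A. A \<subseteq> E \<and> card A = m i}. card (ordered_partitions I m (E - A)))"
proof -
  let ?S = "{A. A \<subseteq> E \<and> card A = m i}"
  let ?f = "\<lambda>(A, r). r(i := A)"
  have "bij_betw ?f (SIGMA A:?S. ordered_partitions I m (E - A)) (ordered_partitions (insert i I) m E)"
  proof (rule bij_betwI[where g = "\<lambda>r. (r i, r(i := {}))"])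
    show "?f \<in> (SIGMA A:?S. ordered_partitions I m (E - A)) \<rightarrow> ordered_partitions (insert i I) m E"
    proof safe
      fix A r assume A: "A \<subseteq> E" "card A = m i" and r: "r \<in> ordered_partitions I m (E - A)"
      have fA: "finite A" using A assms finite_subset by blast
      have "r j \<inter> A = {}" "r j \<subseteq> E - A" if "j \<in> I" for j using r that by (auto simp: ordered_partitions_def)
      then show "r(i := A) \<in> ordered_partitions (insert i I) m E"
        using A r assms fA unfolding ordered_partitions_def disjoint_family_on_def
        by (auto split: if_splits)
    qed
    show "(\<lambda>r. (r i, r(i := {}))) \<in> ordered_partitions (insert i I) m E \<rightarrow> (SIGMA A:?S. ordered_partitions I m (E - A))"
    proof
      fix r assume r: "r \<in> ordered_partitions (insert i I) m E"
      have d: "r j \<inter> r k = {}" if "j \<in> insert i I" "k \<in> insert i I" "j \<noteq> k" for j k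
        using r that unfolding ordered_partitions_def disjoint_family_on_def by blast
      have U: "(\<Union>j\<in>I. r j) = E - r i"
      proof -
        have "E = r i \<union> (\<Union>j\<in>I. r j)" using r by (auto simp: ordered_partitions_def)
        moreover have "r i \<inter> (\<Union>j\<in>I. r j) = {}" using d[of i] assms(2) by blast
        ultimately show ?thesis by blast
      qed
      have "(\<Union>j\<in>I. (r(i := {})) j) = (\<Union>j\<in>I. r j)" using assms(2) by (intro SUP_cong) auto
      then have "r(i := {}) \<in> ordered_partitions I m (E - r i)"
        using r U d assms(2) by (auto simp: ordered_partitions_def disjoint_family_on_def)
      moreover have "r i \<subseteq> E" "card (r i) = m i" using r by (auto simp: ordered_partitions_def)
      ultimately show "(r i, r(i := {})) \<in> (SIGMA A:?S. ordered_partitions I m (E - A))" by blast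
    qed
    show "(\<lambda>r. (r i, r(i := {}))) (?f x) = x" if x: "x \<in> (SIGMA A:?S. ordered_partitions I m (E - A))" for x
    proof -
      have "snd x i = {}" using x assms(2) by (auto simp: ordered_partitions_def)
      then have "(snd x)(i := {}) = snd x" by (simp add: fun_upd_idem)
      then show ?thesis by (simp add: case_prod_beta)
    qed
  qed auto
  then have "card (ordered_partitions (insert i I) m E) = card (SIGMA A:?S. ordered_partitions I m (E - A))"
    by (simp add: bij_betw_same_card)
  also have "\<dots> = (\<Sum>A\<in>?S. card (ordered_partitions I m (E - A)))"
    by (rule card_SigmaI) (auto simp: assms intro: finite_ordered_partitions)
  finally show ?thesis .
qed

lemma card_ordered_partitions:
  assumes "finite I" "finite E" "sum m I = card E"
  shows "card (ordered_partitions I m E) * (\<Prod>i\<in>I. fact (m i)) = fact (card E)"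
  using assms
proof (induction I arbitrary: E rule: finite_induct)
  case empty
  then have "E = {}" by simp
  then have "ordered_partitions {} m E = {\<lambda>_. {}}" by (auto simp: ordered_partitions_def disjoint_family_on_def)
  then show ?case using empty by simp
next
  case (insert i I)
  have le: "m i \<le> card E" using insert by simp
  have "card (ordered_partitions I m (E - A)) * (\<Prod>i\<in>I. fact (m i)) = fact (card E - m i)"
    if "A \<in> {A. A \<subseteq> E \<and> card A = m i}" for A
  proof -
    have "card (E - A) = card E - m i" using that card_Diff_subset[of A E] finite_subset[OF _ insert.prems(1), of A] by simp
    then show ?thesis using insert.IH[of "E - A"] insert.prems insert.hyps by simp
  qed
  then have "card (ordered_partitions (insert i I) m E) * (\<Prod>i\<in>I. fact (m i)) =
     (\<Sum>A\<in>{A. A \<subseteq> E \<and> card A = m i}. fact (card E - m i))"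
    by (simp add: ordered_partitions_insert insert sum_distrib_right)
  also have "\<dots> = (card E choose m i) * fact (card E - m i)"
    using n_subsets[OF insert.prems(1)] by simp
  finally show ?case using insert binomial_fact_lemma[OF le] by (simp add: mult_ac)
qed

definition perm_submodule :: "'a set \<Rightarrow> (('i \<Rightarrow> 'a set) \<Rightarrow> complex) set \<Rightarrow> bool" where
  "perm_submodule E S \<longleftrightarrow> lin_subspace S \<and> (\<forall>p. p permutes E \<longrightarrow> (\<forall>u\<in>S. pact p u \<in> S))"

definition perm_hom :: "'a set \<Rightarrow> (('i \<Rightarrow> 'a set) \<Rightarrow> complex) set \<Rightarrow> ('j \<Rightarrow> 'a set) set \<Rightarrow>
    ((('i \<Rightarrow> 'a set) \<Rightarrow> complex) \<Rightarrow> (('j \<Rightarrow> 'a set) \<Rightarrow> complex)) \<Rightarrow> bool" where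
  "perm_hom E S X \<phi> \<longleftrightarrow> (\<forall>u\<in>S. \<phi> u \<in> funs_on X) \<and> linear_map_on S \<phi> \<and>
     (\<forall>p. p permutes E \<longrightarrow> (\<forall>u\<in>S. \<phi> (pact p u) = pact p (\<phi> u)))"

section \<open>Specht modules\<close>

definition tabloids :: "nat list \<Rightarrow> 'a set \<Rightarrow> (nat \<Rightarrow> 'a set) set" where
  "tabloids \<mu> E = tabloid \<mu> ` tableaux \<mu> E"

definition specht :: "nat list \<Rightarrow> 'a set \<Rightarrow> ((nat \<Rightarrow> 'a set) \<Rightarrow> complex) set" where
  "specht \<mu> E = {(\<lambda>r. \<Sum>t\<in>tableaux \<mu> E. c t * polytabloid \<mu> E t r) | c. True}"

definition move_tableau :: "nat list \<Rightarrow> ('a \<Rightarrow> 'a) \<Rightarrow> (nat \<times> nat \<Rightarrow> 'a) \<Rightarrow> (nat \<times> nat \<Rightarrow> 'a)" where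
  "move_tableau \<mu> p t = restrict (p \<circ> t) (cells \<mu>)"

lemma finite_cells [simp]: "finite (cells \<mu>)"
proof -
  have "cells \<mu> = Sigma {..<length \<mu>} (\<lambda>i. {..<\<mu> ! i})" by (auto simp: cells_def)
  then show ?thesis by simp
qed

lemma card_cells: "\<mu> \<in> young_diagrams N \<Longrightarrow> card (cells \<mu>) = N"
proof -
  assume m: "\<mu> \<in> young_diagrams N"
  have "cells \<mu> = Sigma {..<length \<mu>} (\<lambda>i. {..<\<mu> ! i})" by (auto simp: cells_def)
  then have "card (cells \<mu>) = (\<Sum>i<length \<mu>. \<mu> ! i)" by simp
  also have "\<dots> = sum_list \<mu>" by (simp add: sum_list_sum_nth atLeast0LessThan)
  finally show ?thesis using m by (simp add: young_diagrams_def)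
qed

lemma tableaux_nonempty:
  assumes "finite E" "\<mu> \<in> young_diagrams (card E)" shows "tableaux \<mu> E \<noteq> {}"
proof -
  obtain t where "bij_betw t (cells \<mu>) E"
    using finite_same_card_bij[of "cells \<mu>" E] assms card_cells by auto
  then have "restrict t (cells \<mu>) \<in> tableaux \<mu> E"
    by (simp add: tableaux_def bij_betw_restrict_eq)
  then show ?thesis by blast
qed

lemma finite_tableaux [simp]: "finite E \<Longrightarrow> finite (tableaux \<mu> E)"
proof (rule finite_subset[of _ "cells \<mu> \<rightarrow>\<^sub>E E"])
  show "tableaux \<mu> E \<subseteq> cells \<mu> \<rightarrow>\<^sub>E E" by (auto simp: tableaux_def PiE_def bij_betw_def)
qed (auto intro: finite_PiE)

lemma move_tableau_tableaux:
  assumes "p permutes E" "t \<in> tableaux \<mu> E" shows "move_tableau \<mu> p t \<in> tableaux \<mu> E"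
  using assms bij_betw_trans[of t "cells \<mu>" E p E]
  by (simp add: tableaux_def move_tableau_def bij_betw_restrict_eq permutes_imp_bij)

lemma tabloid_move: "tabloid \<mu> (move_tableau \<mu> p t) = relabel p (tabloid \<mu> t)"
  unfolding tabloid_def relabel_def move_tableau_def by (intro ext) auto

lemma tableaux_transitive:
  assumes "t \<in> tableaux \<mu> E" "t' \<in> tableaux \<mu> E"
  obtains p where "p permutes E" "t' = move_tableau \<mu> p t"
proof -
  have b: "bij_betw t (cells \<mu>) E" "bij_betw t' (cells \<mu>) E" and e: "t' \<in> extensional (cells \<mu>)"
    using assms by (auto simp: tableaux_def)
  define p where "p = (\<lambda>x. if x \<in> E then t' (inv_into (cells \<mu>) t x) else x)"
  have "bij_betw (t' \<circ> inv_into (cells \<mu>) t) E E"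
    using bij_betw_trans[OF bij_betw_inv_into[OF b(1)] b(2)] .
  then have "bij_betw p E E" by (rule bij_betw_cong[THEN iffD1, rotated]) (simp add: p_def)
  then have "p permutes E" by (rule bij_imp_permutes) (simp add: p_def)
  moreover have "t' = move_tableau \<mu> p t"
  proof
    fix c show "t' c = move_tableau \<mu> p t c"
    proof (cases "c \<in> cells \<mu>")
      case True
      then have "t c \<in> E" using bij_betwE[OF b(1)] by blast
      then show ?thesis using True b(1) by (simp add: move_tableau_def p_def bij_betw_inv_into_left)
    next
      case False
      then show ?thesis using extensional_arb[OF e] by (simp add: move_tableau_def)
    qed
  qed
  ultimately show ?thesis using that by blast
qed

lemma perm_invariant_tabloids: "perm_invariant E (tabloids \<mu> E)"
  unfolding perm_invariant_def tabloids_def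
  using move_tableau_tableaux tabloid_move by (metis (no_types, lifting) image_iff)

lemma finite_tabloids [simp]: "finite E \<Longrightarrow> finite (tabloids \<mu> E)"
  by (simp add: tabloids_def)

section \<open>The column antisymmetrizer of a tableau\<close>

locale young_tableau =
  fixes \<mu> :: "nat list" and E :: "'a set" and t :: "nat \<times> nat \<Rightarrow> 'a"
  assumes finE: "finite E" and mu: "\<mu> \<in> young_diagrams (card E)" and t: "t \<in> tableaux \<mu> E"
begin

definition col :: "nat \<Rightarrow> 'a set" where "col j = {t (i, j) | i. (i, j) \<in> cells \<mu>}"

definition C :: "('a \<Rightarrow> 'a) set" where "C = column_stabilizer \<mu> E t"

text \<open>The signed sum over the column stabilizer. The index type of the blocks is left open so
  that the same antisymmetrizer acts on the source and on the target of a homomorphism between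
  different permutation modules.\<close>

definition kap :: "(('i \<Rightarrow> 'a set) \<Rightarrow> complex) \<Rightarrow> (('i \<Rightarrow> 'a set) \<Rightarrow> complex)" where
  "kap f = (\<lambda>r. \<Sum>p\<in>C. of_int (sign p) * pact p f r)"

definition e :: "(nat \<Rightarrow> 'a set) \<Rightarrow> complex" where "e = polytabloid \<mu> E t"

lemma t_bij: "bij_betw t (cells \<mu>) E" using t by (simp add: tableaux_def)

lemma t_eq_iff: "c \<in> cells \<mu> \<Longrightarrow> c' \<in> cells \<mu> \<Longrightarrow> t c = t c' \<longleftrightarrow> c = c'"
  using t_bij by (auto simp: bij_betw_def inj_on_def)

lemma t_in_E: "c \<in> cells \<mu> \<Longrightarrow> t c \<in> E" using t_bij by (auto simp: bij_betw_def)

lemma E_cases: assumes "x \<in> E" obtains i j where "(i, j) \<in> cells \<mu>" "x = t (i, j)"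
  using assms t_bij by (auto simp: bij_betw_def)

lemma t_in_col: "(i, j) \<in> cells \<mu> \<Longrightarrow> t (i, j) \<in> col j' \<longleftrightarrow> j = j'"
  by (auto simp: col_def t_eq_iff)

lemma t_in_row: "(i, j) \<in> cells \<mu> \<Longrightarrow> t (i, j) \<in> tabloid \<mu> t i' \<longleftrightarrow> i = i'"
  by (auto simp: tabloid_def t_eq_iff)

lemma col_E: "col j \<subseteq> E" by (auto simp: col_def t_in_E)

lemma C_iff: "p \<in> C \<longleftrightarrow> p permutes E \<and> (\<forall>j. p ` col j = col j)"
proof -
  have "finite {x. p x \<noteq> x}" if "p permutes E"
    by (rule finite_subset[OF _ finE]) (use that in \<open>auto simp: permutes_def\<close>)
  then show ?thesis by (auto simp: C_def column_stabilizer_def fin_sym_def col_def)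
qed

lemma C_permutes: "p \<in> C \<Longrightarrow> p permutes E" by (simp add: C_iff)

lemma C_permutation: "p \<in> C \<Longrightarrow> permutation p"
  using C_permutes finE permutes_imp_permutation by blast

lemma finite_C: "finite C"
  by (rule finite_subset[OF _ finite_permutations[OF finE]]) (auto simp: C_iff)

lemma C_id: "id \<in> C" by (simp add: C_iff permutes_id)

lemma C_comp: "p \<in> C \<Longrightarrow> q \<in> C \<Longrightarrow> p \<circ> q \<in> C"
  unfolding C_iff image_comp[symmetric] by (simp add: permutes_compose)

lemma C_inv: "p \<in> C \<Longrightarrow> inv_into UNIV p \<in> C"
proof -
  assume p: "p \<in> C"
  have "inv_into UNIV p ` col j = col j" for j
  proof -
    have "inv_into UNIV p ` col j = inv_into UNIV p ` p ` col j" using p by (simp add: C_iff)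
    also have "\<dots> = col j" using permutes_inv_o(2)[OF C_permutes[OF p]] by (simp add: image_comp)
    finally show ?thesis .
  qed
  then show ?thesis using p by (simp add: C_iff permutes_inv)
qed

lemma sum_C_inv: "(\<Sum>p\<in>C. g (inv_into UNIV p)) = (\<Sum>p\<in>C. g p)"
  by (rule sum.reindex_bij_witness[of _ "inv_into UNIV" "inv_into UNIV"])
     (auto simp: C_inv permutes_inv_inv[OF C_permutes])

lemma kap_relabel:
  assumes q: "q \<in> C" shows "kap f (relabel q r) = of_int (sign q) * kap f r"
proof -
  have "kap f (relabel q r) = (\<Sum>p\<in>C. of_int (sign (q \<circ> p)) * pact (q \<circ> p) f (relabel q r))"
    unfolding kap_def
  proof (rule sum.reindex_bij_witness[of _ "\<lambda>p. q \<circ> p" "\<lambda>p. inv_into UNIV q \<circ> p"])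
    fix a :: "'a \<Rightarrow> 'a"
    show 1: "q \<circ> (inv_into UNIV q \<circ> a) = a" "inv_into UNIV q \<circ> (q \<circ> a) = a"
      using permutes_inv_o[OF C_permutes[OF q]] by (simp_all add: o_assoc)
    show "of_int (sign (q \<circ> (inv_into UNIV q \<circ> a))) * pact (q \<circ> (inv_into UNIV q \<circ> a)) f (relabel q r) =
         of_int (sign a) * pact a f (relabel q r)" by (simp only: 1)
  qed (use q C_comp C_inv in auto)
  also have "\<dots> = (\<Sum>p\<in>C. of_int (sign q) * (of_int (sign p) * pact p f r))"
  proof (rule sum.cong[OF refl])
    fix p assume p: "p \<in> C"
    have "pact (q \<circ> p) f (relabel q r) = pact p f r"
      using pact_comp[OF C_permutes[OF q] C_permutes[OF p], of f] C_permutes[OF q]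
      by (metis pact_def relabel_inv(1))
    then show "of_int (sign (q \<circ> p)) * pact (q \<circ> p) f (relabel q r) = of_int (sign q) * (of_int (sign p) * pact p f r)"
      using p q by (simp add: sign_compose C_permutation)
  qed
  finally show ?thesis by (simp add: kap_def sum_distrib_left)
qed

definition col_inj :: "('i \<Rightarrow> 'a set) \<Rightarrow> bool" where
  "col_inj r \<longleftrightarrow> (\<forall>k j x y. x \<in> r k \<inter> col j \<longrightarrow> y \<in> r k \<inter> col j \<longrightarrow> x = y)"

text \<open>A transposition inside a column and a block fixes \<open>r\<close> and changes the sign of \<open>kap f\<close>.\<close>

lemma kap_not_col_inj:
  assumes "\<not> col_inj r" "disjoint_family r" shows "kap f r = 0"
proof -
  obtain k j x y where xy: "x \<in> r k" "x \<in> col j" "y \<in> r k" "y \<in> col j" "x \<noteq> y"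
    using assms(1) by (auto simp: col_inj_def)
  let ?q = "transpose x y"
  have "?q permutes E" using xy col_E by (intro permutes_swap_id) auto
  moreover have "?q ` col j' = col j'" for j'
  proof -
    have "x \<in> col j' \<longleftrightarrow> y \<in> col j'" using xy by (auto simp: col_def t_eq_iff)
    then show ?thesis by (rule transpose_image_eq)
  qed
  ultimately have q: "?q \<in> C" by (simp add: C_iff)
  have "relabel ?q r = r" unfolding relabel_def
  proof
    fix i
    have "r i \<inter> r k = {}" if "i \<noteq> k" using assms(2) that by (simp add: disjoint_family_on_def)
    then have "x \<in> r i \<longleftrightarrow> y \<in> r i" using xy by blast
    then show "?q ` r i = r i" by (rule transpose_image_eq)
  qed
  then have "kap f r = - kap f r" using kap_relabel[OF q, of f r] xy by (simp add: sign_swap_id)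
  then show ?thesis by simp
qed

text \<open>The length of column j, that is, a part of the conjugate diagram.\<close>

definition h :: "nat \<Rightarrow> nat" where "h j = card {k. j < rows_of \<mu> k}"

lemma less_h: "k < h j \<longleftrightarrow> (k, j) \<in> cells \<mu>"
proof -
  let ?S = "{k. j < rows_of \<mu> k}"
  have fin: "finite ?S" by (rule finite_subset[of _ "{..<length \<mu>}"]) (auto simp: rows_of_def split: if_splits)
  have am: "antimono (rows_of \<mu>)" using rows_of_shapes[OF mu] by (simp add: shapes_def)
  define n where "n = (LEAST k. k \<notin> ?S)"
  have n: "n \<notin> ?S" unfolding n_def by (rule LeastI_ex) (use ex_new_if_finite[OF infinite_UNIV_nat fin] in blast)
  have "?S = {..<n}"
  proof (intro equalityI subsetI)
    fix k assume k: "k \<in> ?S"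
    show "k \<in> {..<n}"
    proof (rule ccontr)
      assume "k \<notin> {..<n}"
      then have "rows_of \<mu> k \<le> rows_of \<mu> n" using am by (auto intro: antimonoD)
      then show False using k n by auto
    qed
  qed (use not_less_Least n_def in auto)
  then have "h j = n" "?S = {..<n}" by (simp_all add: h_def)
  then show ?thesis by (metis (mono_tags, lifting) cells_rows_of fst_conv lessThan_iff mem_Collect_eq snd_conv)
qed

lemma col_eq: "col j = (\<lambda>k. t (k, j)) ` {..<h j}"
  by (auto simp: col_def less_h)

lemma card_col: "card (col j) = h j"
  unfolding col_eq by (subst card_image) (auto simp: inj_on_def less_h t_eq_iff)

lemma finite_col: "finite (col j)" by (simp add: col_eq)

definition J :: "nat set" where "J = {..<rows_of \<mu> 0}"

lemma cells_J: "(i, j) \<in> cells \<mu> \<Longrightarrow> j \<in> J"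
  using rows_of_shapes[OF mu] antimonoD[of "rows_of \<mu>" 0 i] by (auto simp: J_def cells_rows_of shapes_def)

text \<open>Count the boxes of the first i rows column by column.\<close>

lemma sum_rows_min: "sum (rows_of \<mu>) {..<i} = (\<Sum>j\<in>J. min i (h j))"
proof -
  have "rows_of \<mu> k = (\<Sum>j\<in>J. if k < h j then 1 else 0)" for k
  proof -
    have "{j \<in> J. k < h j} = {..<rows_of \<mu> k}" using cells_J by (auto simp: less_h cells_rows_of)
    then show ?thesis by (simp add: J_def sum.If_cases Int_def)
  qed
  then have "sum (rows_of \<mu>) {..<i} = (\<Sum>j\<in>J. \<Sum>k<i. if k < h j then 1 else 0)"
    by (subst sum.swap) simp
  also have "\<dots> = (\<Sum>j\<in>J. min i (h j))"
  proof (rule sum.cong[OF refl])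
    fix j
    have "{..<i} \<inter> {k. k < h j} = {..<min i (h j)}" by auto
    then show "(\<Sum>k<i. if k < h j then 1 else 0) = min i (h j)" by (simp add: sum.If_cases)
  qed
  finally show ?thesis .
qed

context
  fixes r :: "nat \<Rightarrow> 'a set"
  assumes disj: "disjoint_family r" and rE: "\<And>k. r k \<subseteq> E" and ci: "col_inj r"
begin

lemma card_first_col: "card ((\<Union>k<i. r k) \<inter> col j) \<le> min i (h j)"
proof -
  have "card (r k \<inter> col j) \<le> 1" for k
    using ci finite_col[of j] by (intro card_le_Suc0_iff_eq[THEN iffD2, unfolded One_nat_def[symmetric]]) (auto simp: col_inj_def)
  then have "card (\<Union>k<i. r k \<inter> col j) \<le> (\<Sum>k<i. 1)"
    by (intro order_trans[OF card_UN_le] sum_mono) auto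
  moreover have "(\<Union>k<i. r k \<inter> col j) = (\<Union>k<i. r k) \<inter> col j" by auto
  moreover have "card ((\<Union>k<i. r k) \<inter> col j) \<le> h j"
    unfolding card_col[symmetric] by (rule card_mono) (auto simp: finite_col)
  ultimately show ?thesis by simp
qed

lemma card_first_cols: "sum (\<lambda>k. card (r k)) {..<i} = (\<Sum>j\<in>J. card ((\<Union>k<i. r k) \<inter> col j))"
proof -
  have "(\<Union>k<i. r k) = (\<Union>j\<in>J. (\<Union>k<i. r k) \<inter> col j)"
    using rE cells_J by (fastforce elim!: E_cases simp: t_in_col)
  then have "card (\<Union>k<i. r k) = card (\<Union>j\<in>J. (\<Union>k<i. r k) \<inter> col j)" by simp
  also have "\<dots> = (\<Sum>j\<in>J. card ((\<Union>k<i. r k) \<inter> col j))"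
  proof (rule card_UN_disjoint)
    have "col j \<inter> col j' = {}" if "j \<noteq> j'" for j j' using that by (auto simp: col_def t_eq_iff)
    then show "\<forall>j\<in>J. \<forall>j'\<in>J. j \<noteq> j' \<longrightarrow> (\<Union>k<i. r k) \<inter> col j \<inter> ((\<Union>k<i. r k) \<inter> col j') = {}" by blast
  qed (simp_all add: J_def finite_col)
  finally have "card (\<Union>k<i. r k) = (\<Sum>j\<in>J. card ((\<Union>k<i. r k) \<inter> col j))" .
  moreover have "card (\<Union>k<i. r k) = (\<Sum>k<i. card (r k))"
    by (rule card_UN_disjoint) (use disj finite_subset[OF rE finE] in \<open>auto simp: disjoint_family_on_def\<close>)
  ultimately show ?thesis by simp
qed

text \<open>The first i blocks have at most one point each in a given column, hence at most
  \<open>min i (h j)\<close> points in column j; summing over the columns compares this with the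
  first i rows.\<close>

lemma col_inj_dominance: "sum (\<lambda>k. card (r k)) {..<i} \<le> sum (rows_of \<mu>) {..<i}"
  unfolding card_first_cols sum_rows_min by (rule sum_mono) (rule card_first_col)

text \<open>For equal shapes all the column estimates of \<open>card_first_col\<close> are
  equalities. Hence block i meets each column that is longer than i in exactly one point, and
  sending the cell (i, j) to this point permutes every column.\<close>

lemma col_inj_same_shape:
  assumes shape: "\<And>k. card (r k) = rows_of \<mu> k"
  obtains p where "p \<in> C" "r = relabel p (tabloid \<mu> t)"
proof -
  have eq: "card ((\<Union>k<i. r k) \<inter> col j) = min i (h j)" if "j \<in> J" for i j
  proof (rule sum_mono_inv[OF _ card_first_col that])
    show "(\<Sum>j\<in>J. card ((\<Union>k<i. r k) \<inter> col j)) = (\<Sum>j\<in>J. min i (h j))"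
      using card_first_cols[of i] sum_rows_min[of i] shape by simp
  qed (simp add: J_def)
  have "\<exists>x. r i \<inter> col j = {x}" if c: "(i, j) \<in> cells \<mu>" for i j
  proof -
    have "(\<Union>k<Suc i. r k) \<inter> col j = ((\<Union>k<i. r k) \<inter> col j) \<union> (r i \<inter> col j)"
      by (auto simp: lessThan_Suc)
    moreover have "((\<Union>k<i. r k) \<inter> col j) \<inter> (r i \<inter> col j) = {}"
    proof -
      have "r k \<inter> r i = {}" if "k < i" for k using disj that by (simp add: disjoint_family_on_def)
      then show ?thesis by blast
    qed
    ultimately have "card ((\<Union>k<Suc i. r k) \<inter> col j) = card ((\<Union>k<i. r k) \<inter> col j) + card (r i \<inter> col j)"
      using finite_col by (simp add: card_Un_disjoint)
    then have "card (r i \<inter> col j) = 1"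
      using eq[OF cells_J[OF c], of i] eq[OF cells_J[OF c], of "Suc i"] c by (simp add: less_h[symmetric])
    then show ?thesis by (simp add: card_1_singleton_iff)
  qed
  then have "\<forall>c\<in>cells \<mu>. \<exists>x. r (fst c) \<inter> col (snd c) = {x}" by (metis prod.collapse)
  then obtain t' where "\<And>c. c \<in> cells \<mu> \<Longrightarrow> r (fst c) \<inter> col (snd c) = {t' c}" by metis
  then have t': "\<And>i j. (i, j) \<in> cells \<mu> \<Longrightarrow> r i \<inter> col j = {t' (i, j)}" by fastforce
  define p where "p = (\<lambda>x. if x \<in> E then t' (inv_into (cells \<mu>) t x) else x)"
  have pt: "p (t c) = t' c" if "c \<in> cells \<mu>" for c
    using that t_bij by (simp add: p_def t_in_E bij_betw_inv_into_left)
  have t'r: "t' (i, j) \<in> r i" and t'c: "t' (i, j) \<in> col j" if "(i, j) \<in> cells \<mu>" for i j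
    using t'[OF that] by auto
  have inj: "inj_on p E"
  proof (rule inj_onI)
    fix x y assume xy: "x \<in> E" "y \<in> E" "p x = p y"
    obtain i j where x: "(i, j) \<in> cells \<mu>" "x = t (i, j)" using xy(1) by (rule E_cases)
    obtain i' j' where y: "(i', j') \<in> cells \<mu>" "y = t (i', j')" using xy(2) by (rule E_cases)
    have eq: "t' (i, j) = t' (i', j')" using xy(3) x y pt by simp
    have "i = i'" using t'r[OF x(1)] t'r[OF y(1)] eq disj by (auto simp: disjoint_family_on_def)
    moreover have "j = j'" using t'c[OF x(1)] t'c[OF y(1)] eq by (auto simp: col_def t_eq_iff)
    ultimately show "x = y" using x y by simp
  qed
  have "p ` E \<subseteq> E" using rE t'r pt by (fastforce elim!: E_cases)
  then have "bij_betw p E E" using inj endo_inj_surj[OF finE _ inj] by (simp add: bij_betw_def)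
  then have perm: "p permutes E" by (rule bij_imp_permutes) (simp add: p_def)
  have pcol: "p ` col j = col j" for j
  proof (rule card_subset_eq[OF finite_col])
    show "p ` col j \<subseteq> col j"
    proof (rule image_subsetI)
      fix x assume "x \<in> col j"
      then obtain i where "(i, j) \<in> cells \<mu>" "x = t (i, j)" by (auto simp: col_def)
      then show "p x \<in> col j" using t'c pt by simp
    qed
    show "card (p ` col j) = card (col j)" by (rule card_image) (rule inj_on_subset[OF inj col_E])
  qed
  have row: "p ` tabloid \<mu> t i = r i" for i
  proof (rule card_subset_eq)
    show "finite (r i)" using rE finE finite_subset by blast
    show "p ` tabloid \<mu> t i \<subseteq> r i" using t'r pt by (auto simp: tabloid_def)
    have "tabloid \<mu> t i = (\<lambda>j. t (i, j)) ` {..<rows_of \<mu> i}" by (auto simp: tabloid_def cells_rows_of)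
    moreover have "card \<dots> = rows_of \<mu> i" by (rule card_image[THEN trans]) (auto simp: inj_on_def t_eq_iff cells_rows_of)
    moreover have "tabloid \<mu> t i \<subseteq> E" by (auto simp: tabloid_def t_in_E)
    ultimately show "card (p ` tabloid \<mu> t i) = card (r i)"
      using card_image[OF inj_on_subset[OF inj]] shape by metis
  qed
  show ?thesis
    by (rule that[of p]) (use perm pcol row in \<open>auto simp: C_iff relabel_def\<close>)
qed

end

section \<open>The antisymmetrizer on tabloids\<close>

lemma tabloid_props:
  assumes "r \<in> tabloids \<nu> E"
  shows "disjoint_family r" "r k \<subseteq> E" "card (r k) = rows_of \<nu> k" "(\<Union>k. r k) = E"
proof -
  obtain s where s: "s \<in> tableaux \<nu> E" and r: "r = tabloid \<nu> s" using assms by (auto simp: tabloids_def)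
  have b: "bij_betw s (cells \<nu>) E" using s by (simp add: tableaux_def)
  have inj: "s c = s c' \<longleftrightarrow> c = c'" if "c \<in> cells \<nu>" "c' \<in> cells \<nu>" for c c'
    using b that by (auto simp: bij_betw_def inj_on_def)
  show "disjoint_family r" by (auto simp: r tabloid_def disjoint_family_on_def inj)
  show "r k \<subseteq> E" using b by (auto simp: r tabloid_def bij_betw_def)
  have "r k = (\<lambda>j. s (k, j)) ` {..<rows_of \<nu> k}" by (auto simp: r tabloid_def cells_rows_of)
  moreover have "card \<dots> = rows_of \<nu> k" by (rule card_image[THEN trans]) (auto simp: inj_on_def inj cells_rows_of)
  ultimately show "card (r k) = rows_of \<nu> k" by simp
  show "(\<Union>k. r k) = E" using b by (force simp: r tabloid_def bij_betw_def)
qed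

lemma tabloid_t: "tabloid \<mu> t \<in> tabloids \<mu> E" using t by (simp add: tabloids_def)

text \<open>The image of an entry stays both in its row and in its column, and these meet in one
  cell.\<close>

lemma C_fixes_tabloid:
  assumes p: "p \<in> C" and fix': "relabel p (tabloid \<mu> t) = tabloid \<mu> t" shows "p = id"
proof
  fix x show "p x = id x"
  proof (cases "x \<in> E")
    case True
    then obtain i j where x: "(i, j) \<in> cells \<mu>" "x = t (i, j)" by (rule E_cases)
    have "p x \<in> p ` col j" using x t_in_col[OF x(1)] by simp
    then have "p x \<in> col j" using p by (simp add: C_iff)
    moreover have "p x \<in> p ` tabloid \<mu> t i" using x t_in_row[OF x(1)] by simp
    then have "p x \<in> tabloid \<mu> t i" using fun_cong[OF fix', of i] by (simp add: relabel_def)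
    ultimately show ?thesis using x by (auto simp: col_def tabloid_def t_eq_iff)
  qed (use C_permutes[OF p] in \<open>simp add: permutes_def\<close>)
qed

lemma e_kap: "e = kap (\<lambda>r. if r = tabloid \<mu> t then 1 else 0)"
  unfolding e_def kap_def polytabloid_def C_def[symmetric] pact_def
  by (intro ext sum.cong refl) (simp add: relabel_inv_eq_iff[OF C_permutes])

lemma e_tabloid: "e (tabloid \<mu> t) = 1"
proof -
  have "e (tabloid \<mu> t) = (\<Sum>p\<in>C. if p = id then 1 else 0)"
    unfolding e_def polytabloid_def C_def[symmetric]
    by (intro sum.cong refl) (use C_fixes_tabloid in \<open>fastforce\<close>)
  then show ?thesis using finite_C C_id by simp
qed

lemma kap_funs_on: "perm_invariant E X \<Longrightarrow> f \<in> funs_on X \<Longrightarrow> kap f \<in> funs_on X"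
  unfolding kap_def by (rule lin_subspace_sum[OF lin_subspace_funs_on]) (auto intro: pact_funs_on C_permutes)

lemma e_funs_on: "e \<in> funs_on (tabloids \<mu> E)"
  unfolding e_kap by (rule kap_funs_on[OF perm_invariant_tabloids]) (use tabloid_t in \<open>auto simp: funs_on_def\<close>)

text \<open>Without dominance every tabloid of shape \<nu> has two elements of one column in the
  same row, and the antisymmetrizer vanishes there.\<close>

lemma kap_eq_0:
  assumes f: "f \<in> funs_on (tabloids \<nu> E)" and nd: "\<not> dominates \<mu> \<nu>"
  shows "kap f = (\<lambda>_. 0)"
proof
  fix r show "kap f r = 0"
  proof (cases "r \<in> tabloids \<nu> E")
    case True
    have "\<not> col_inj r"
    proof
      assume "col_inj r"
      then have "sum (\<lambda>k. card (r k)) {..<i} \<le> sum (rows_of \<mu>) {..<i}" for i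
        using tabloid_props[OF True] by (intro col_inj_dominance) auto
      then show False using nd tabloid_props(3)[OF True] by (simp add: dominates_def sum_rows_of)
    qed
    then show ?thesis using tabloid_props(1)[OF True] by (rule kap_not_col_inj)
  next
    case False
    then show ?thesis using kap_funs_on[OF perm_invariant_tabloids f] by (auto simp: funs_on_def)
  qed
qed

text \<open>The antisymmetrizer has rank one here. A tabloid on which it can be nonzero is a column
  translate of \<open>tabloid \<mu> t\<close>, so \<open>kap f\<close> is determined up to sign by
  its value at that single tabloid, and that value is the inner product with
  \<open>e\<close>.\<close>

lemma kap_eq:
  assumes f: "f \<in> funs_on (tabloids \<mu> E)"
  shows "kap f = (\<lambda>r. ip (tabloids \<mu> E) f e * e r)"
proof
  let ?T = "tabloid \<mu> t" let ?X = "tabloids \<mu> E"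
  have "kap f ?T = (\<Sum>p\<in>C. of_int (sign (inv_into UNIV p)) * f (relabel (inv_into UNIV p) ?T))"
    unfolding kap_def pact_def by (intro sum.cong refl) (simp add: sign_inverse C_permutation)
  also have "\<dots> = (\<Sum>p\<in>C. of_int (sign p) * f (relabel p ?T))" by (rule sum_C_inv)
  also have "\<dots> = (\<Sum>p\<in>C. \<Sum>r\<in>?X. if r = relabel p ?T then f r * of_int (sign p) else 0)"
    using perm_invariant_tabloids[of E \<mu>] tabloid_t C_permutes finE
    by (intro sum.cong refl) (auto simp: perm_invariant_def)
  also have "\<dots> = ip ?X f e" unfolding ip_def e_def polytabloid_def C_def[symmetric] cnj_sum sum_distrib_left
    by (subst sum.swap) (intro sum.cong refl, simp)
  finally have k: "kap f ?T = ip ?X f e" .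
  fix r show "kap f r = ip ?X f e * e r"
  proof (cases "r \<in> ?X \<and> col_inj r")
    case True
    then obtain p where p: "p \<in> C" "r = relabel p ?T"
      using tabloid_props[of r \<mu>] col_inj_same_shape[of r] by metis
    have "e r = of_int (sign p) * e ?T" unfolding p(2) e_kap by (rule kap_relabel[OF p(1)])
    then have "e r = of_int (sign p)" by (simp add: e_tabloid)
    then show ?thesis using kap_relabel[OF p(1), of f ?T] k p(2) by simp
  next
    case False
    then consider "r \<notin> ?X" | "r \<in> ?X" "\<not> col_inj r" by blast
    then show ?thesis
    proof cases
      case 1
      then show ?thesis using kap_funs_on[OF perm_invariant_tabloids f] e_funs_on by (auto simp: funs_on_def)
    next
      case 2
      then show ?thesis using kap_not_col_inj[OF 2(2) tabloid_props(1)[OF 2(1)]] by (simp add: e_kap)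
    qed
  qed
qed

text \<open>The adjoint of a permutation is its inverse, and inversion preserves both the column
  stabilizer and the sign.\<close>

lemma ip_kap:
  assumes "perm_invariant E X" shows "ip X (kap f) g = ip X f (kap g)"
proof -
  have "ip X (kap f) g = (\<Sum>p\<in>C. of_int (sign p) * ip X f (pact (inv_into UNIV p) g))"
    unfolding kap_def ip_sum_left using ip_pact[OF assms C_permutes] by simp
  also have "\<dots> = (\<Sum>p\<in>C. of_int (sign (inv_into UNIV p)) * ip X f (pact (inv_into UNIV p) g))"
    by (intro sum.cong refl) (simp add: sign_inverse C_permutation)
  also have "\<dots> = (\<Sum>p\<in>C. of_int (sign p) * ip X f (pact p g))" by (rule sum_C_inv)
  finally show ?thesis by (simp add: kap_def ip_sum_right)
qed

lemma kap_hom: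
  assumes "perm_submodule E S" "perm_hom E S X \<phi>" "u \<in> S" shows "\<phi> (kap u) = kap (\<phi> u)"
proof -
  have "\<phi> (kap u) = (\<lambda>r. \<Sum>p\<in>C. of_int (sign p) * \<phi> (pact p u) r)"
    unfolding kap_def
    by (rule linear_map_on_sum[where T = \<phi> and S = S and f = "\<lambda>p. pact p u" and c = "\<lambda>p. of_int (sign p)"])
      (use assms C_permutes in \<open>auto simp: perm_submodule_def perm_hom_def\<close>)
  also have "\<dots> = kap (\<phi> u)" unfolding kap_def
    using assms(2,3) C_permutes by (intro ext sum.cong refl) (simp add: perm_hom_def)
  finally show ?thesis .
qed

lemma ip_e_e: "ip (tabloids \<mu> E) e e \<noteq> 0"
  using ip_self_eq_0[OF finite_tabloids[OF finE] e_funs_on] e_tabloid by auto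

lemma kap_e: "kap e = (\<lambda>r. ip (tabloids \<mu> E) e e * e r)"
  by (rule kap_eq[OF e_funs_on])

lemma e_specht: "e \<in> specht \<mu> E"
  unfolding specht_def e_def
  by (rule CollectI, rule exI[of _ "\<lambda>s. if s = t then 1 else 0"]) (use t finE in \<open>simp add: if_distrib[of "\<lambda>z. z * _"] cong: if_cong\<close>)

lemma col_move:
  assumes "p permutes E"
  shows "{move_tableau \<mu> p t (i, j) | i. (i, j) \<in> cells \<mu>} = p ` col j"
  by (auto simp: move_tableau_def col_def)

lemma young_tableau_move: "p permutes E \<Longrightarrow> young_tableau \<mu> E (move_tableau \<mu> p t)"
  using finE mu move_tableau_tableaux[OF _ t] by unfold_locales

text \<open>The column stabilizer of the moved tableau is the conjugate by p, and conjugation does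
  not change the sign.\<close>

lemma pact_e:
  assumes p: "p permutes E" shows "pact p e = polytabloid \<mu> E (move_tableau \<mu> p t)"
proof -
  interpret m: young_tableau \<mu> E "move_tableau \<mu> p t" by (rule young_tableau_move[OF p])
  let ?i = "inv_into UNIV p"
  have ii: "?i \<circ> p = id" "p \<circ> ?i = id" using permutes_inv_o[OF p] by auto
  have i1: "?i (p x) = x" "p (?i x) = x" for x using permutes_inverses[OF p] by auto
  have mC: "q \<in> m.C \<longleftrightarrow> q permutes E \<and> (\<forall>j. q ` p ` col j = p ` col j)" for q
    unfolding m.C_iff m.col_def col_move[OF p] ..
  have conj1: "p \<circ> q \<circ> ?i \<in> m.C" if q: "q \<in> C" for q
    using q p by (auto simp: mC C_iff image_image i1 intro!: permutes_compose permutes_inv) 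
      (auto simp: image_comp[symmetric, unfolded o_def])
  have conj2: "?i \<circ> q \<circ> p \<in> C" if q: "q \<in> m.C" for q
  proof -
    have "(?i \<circ> q \<circ> p) ` col j = col j" for j
    proof -
      have "(?i \<circ> q \<circ> p) ` col j = ?i ` q ` p ` col j" by (simp add: image_comp o_assoc)
      also have "\<dots> = ?i ` p ` col j" using q by (simp add: mC)
      also have "\<dots> = col j" using ii by (simp add: image_comp)
      finally show ?thesis .
    qed
    then show ?thesis using q p by (auto simp: mC C_iff intro!: permutes_compose permutes_inv)
  qed
  have "polytabloid \<mu> E (move_tableau \<mu> p t) r = pact p e r" for r
  proof -
    have "polytabloid \<mu> E (move_tableau \<mu> p t) r =
       (\<Sum>q\<in>m.C. if r = relabel q (relabel p (tabloid \<mu> t)) then of_int (sign q) else 0)"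
      by (simp add: polytabloid_def m.C_def tabloid_move)
    also have "\<dots> = (\<Sum>q\<in>C. if relabel ?i r = relabel q (tabloid \<mu> t) then of_int (sign q) else 0)"
    proof (rule sum.reindex_bij_witness[of _ "\<lambda>q. p \<circ> q \<circ> ?i" "\<lambda>q. ?i \<circ> q \<circ> p"])
      fix q assume q: "q \<in> m.C"
      show "p \<circ> (?i \<circ> q \<circ> p) \<circ> ?i = q" by (simp add: fun_eq_iff i1)
      show "?i \<circ> q \<circ> p \<in> C" by (rule conj2[OF q])
      have s: "sign (?i \<circ> q \<circ> p) = sign q"
        using permutes_imp_permutation[OF finE p] m.C_permutation[OF q]
        by (simp add: sign_compose sign_inverse permutation_compose permutation_inverse)
      have "relabel ?i r = relabel (?i \<circ> q \<circ> p) (tabloid \<mu> t) \<longleftrightarrow> r = relabel q (relabel p (tabloid \<mu> t))"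
        unfolding relabel_inv_eq_iff[OF p] by (simp add: relabel_comp o_assoc ii)
      then show "(if relabel ?i r = relabel (?i \<circ> q \<circ> p) (tabloid \<mu> t) then of_int (sign (?i \<circ> q \<circ> p)) else 0) =
         (if r = relabel q (relabel p (tabloid \<mu> t)) then of_int (sign q) else 0)" by (simp add: s)
    next
      fix q assume q: "q \<in> C"
      show "?i \<circ> (p \<circ> q \<circ> ?i) \<circ> p = q" by (simp add: fun_eq_iff i1)
      show "p \<circ> q \<circ> ?i \<in> m.C" by (rule conj1[OF q])
    qed
    also have "\<dots> = pact p e r" by (simp add: pact_def e_def polytabloid_def C_def)
    finally show ?thesis .
  qed
  then show ?thesis by auto
qed

lemma polytabloid_pact:
  assumes "t' \<in> tableaux \<mu> E" obtains p where "p permutes E" "polytabloid \<mu> E t' = pact p e"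
  using tableaux_transitive[OF t assms] pact_e by metis

end

lemma lin_subspace_specht: "lin_subspace (specht \<mu> E)"
  unfolding lin_subspace_def
proof (intro conjI ballI allI)
  show "(\<lambda>_. 0) \<in> specht \<mu> E" unfolding specht_def by (rule CollectI, rule exI[of _ "\<lambda>_. 0"]) simp
  fix f g a b assume "f \<in> specht \<mu> E" "g \<in> specht \<mu> E"
  then obtain c d where "f = (\<lambda>r. \<Sum>t\<in>tableaux \<mu> E. c t * polytabloid \<mu> E t r)"
    "g = (\<lambda>r. \<Sum>t\<in>tableaux \<mu> E. d t * polytabloid \<mu> E t r)" by (auto simp: specht_def)
  then have "(\<lambda>x. a * f x + b * g x) = (\<lambda>r. \<Sum>t\<in>tableaux \<mu> E. (a * c t + b * d t) * polytabloid \<mu> E t r)"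
    by (simp add: sum_distrib_left sum.distrib[symmetric] algebra_simps)
  then show "(\<lambda>x. a * f x + b * g x) \<in> specht \<mu> E" unfolding specht_def by (intro CollectI exI conjI TrueI)
qed

section \<open>Schur's lemma and irreducibility for Specht modules\<close>

context
  fixes E :: "'a set" and \<mu> :: "nat list"
  assumes finE: "finite E" and mu: "\<mu> \<in> young_diagrams (card E)"
begin

lemma young_tableauI: "t \<in> tableaux \<mu> E \<Longrightarrow> young_tableau \<mu> E t"
  using finE mu by unfold_locales

lemma polytabloid_specht: "t \<in> tableaux \<mu> E \<Longrightarrow> polytabloid \<mu> E t \<in> specht \<mu> E"
  using young_tableau.e_specht[OF young_tableauI] young_tableau.e_def[OF young_tableauI] by metis

lemma specht_subset: "lin_subspace S \<Longrightarrow> (\<And>t. t \<in> tableaux \<mu> E \<Longrightarrow> polytabloid \<mu> E t \<in> S) \<Longrightarrow> specht \<mu> E \<subseteq> S"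
  unfolding specht_def by (auto intro: lin_subspace_sum)

lemma specht_funs_on: "specht \<mu> E \<subseteq> funs_on (tabloids \<mu> E)"
  using young_tableau.e_funs_on[OF young_tableauI] young_tableau.e_def[OF young_tableauI]
  by (intro specht_subset lin_subspace_funs_on) metis

lemma perm_submodule_specht: "perm_submodule E (specht \<mu> E)"
  unfolding perm_submodule_def
proof (intro conjI allI impI ballI lin_subspace_specht)
  fix p u assume p: "p permutes E" and "u \<in> specht \<mu> E"
  then obtain c where u: "u = (\<lambda>r. \<Sum>t\<in>tableaux \<mu> E. c t * polytabloid \<mu> E t r)" by (auto simp: specht_def)
  have "pact p (polytabloid \<mu> E t) \<in> specht \<mu> E" if t: "t \<in> tableaux \<mu> E" for t
    using young_tableau.pact_e[OF young_tableauI[OF t] p] young_tableau.e_def[OF young_tableauI[OF t]]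
      polytabloid_specht[OF move_tableau_tableaux[OF p t]] by simp
  then have "(\<lambda>r. \<Sum>t\<in>tableaux \<mu> E. c t * pact p (polytabloid \<mu> E t) r) \<in> specht \<mu> E"
    by (intro lin_subspace_sum lin_subspace_specht)
  then show "pact p u \<in> specht \<mu> E" by (simp add: u pact_def)
qed

lemma perm_hom_specht_sum:
  assumes "perm_hom E (specht \<mu> E) X \<phi>"
  shows "\<phi> (\<lambda>r. \<Sum>t\<in>tableaux \<mu> E. c t * polytabloid \<mu> E t r) =
    (\<lambda>r. \<Sum>t\<in>tableaux \<mu> E. c t * \<phi> (polytabloid \<mu> E t) r)"
  by (rule linear_map_on_sum[where S = "specht \<mu> E"])
     (use assms polytabloid_specht in \<open>auto simp: perm_hom_def lin_subspace_specht\<close>)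

text \<open>Schur's lemma in terms of invariant sesquilinear forms; \<open>kap\<close> moves to the other argument.\<close>

lemma specht_ip_eq_0:
  assumes X: "perm_invariant E X" and nd: "\<not> dominates \<mu> \<nu>"
    and V: "perm_submodule E V" "V \<subseteq> funs_on (tabloids \<nu> E)"
    and \<phi>: "perm_hom E (specht \<mu> E) X \<phi>" and \<psi>: "perm_hom E V X \<psi>"
    and u: "u \<in> specht \<mu> E" and v: "v \<in> V"
  shows "ip X (\<phi> u) (\<psi> v) = 0"
proof -
  have 0: "ip X (\<phi> (polytabloid \<mu> E t)) (\<psi> v) = 0" if t: "t \<in> tableaux \<mu> E" for t
  proof -
    interpret young_tableau \<mu> E t by (rule young_tableauI[OF t])
    let ?n = "ip (tabloids \<mu> E) e e"
    have "?n * ip X (\<phi> e) (\<psi> v) = ip X (\<phi> (kap e)) (\<psi> v)"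
      using linear_map_on_scale[of "specht \<mu> E" \<phi> e ?n] \<phi> e_specht
      by (simp add: kap_e perm_hom_def ip_scale_left)
    also have "\<dots> = ip X (\<phi> e) (\<psi> (kap v))"
      using kap_hom[OF perm_submodule_specht \<phi> e_specht] kap_hom[OF V(1) \<psi> v] ip_kap[OF X] by simp
    also have "kap v = (\<lambda>_. 0)" using kap_eq_0[OF _ nd] V(2) v by blast
    also have "\<psi> (\<lambda>_. 0) = (\<lambda>_. 0)" using linear_map_on_zero[of V \<psi> v] v \<psi> by (simp add: perm_hom_def)
    finally show ?thesis using ip_e_e by (simp add: ip_def e_def)
  qed
  obtain c where "u = (\<lambda>r. \<Sum>t\<in>tableaux \<mu> E. c t * polytabloid \<mu> E t r)" using u by (auto simp: specht_def)
  then show ?thesis using 0 by (simp add: perm_hom_specht_sum[OF \<phi>] ip_sum_left)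
qed

text \<open>The rank-one formula \<open>kap_eq\<close> evaluates the form when the first argument is
  \<open>e\<close>; invariance under permutations extends this to every polytabloid, and
  sesquilinearity to the span. Because the constant depends only on the pairing of
  \<open>\<phi> e\<close> with \<open>\<psi> e\<close>, orthogonality of whole homomorphisms can be
  tested on one vector.\<close>

lemma specht_ip_scalar:
  assumes X: "perm_invariant E X" and t: "t \<in> tableaux \<mu> E"
    and \<phi>: "perm_hom E (specht \<mu> E) X \<phi>" and \<psi>: "perm_hom E (specht \<mu> E) X \<psi>"
    and u: "u \<in> specht \<mu> E" and v: "v \<in> specht \<mu> E"
  defines "e \<equiv> polytabloid \<mu> E t"
  shows "ip X (\<phi> u) (\<psi> v) = ip X (\<phi> e) (\<psi> e) / ip (tabloids \<mu> E) e e * ip (tabloids \<mu> E) u v"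
proof -
  interpret t: young_tableau \<mu> E t by (rule young_tableauI[OF t])
  have e: "e = t.e" by (simp add: e_def t.e_def)
  let ?T = "tabloids \<mu> E" let ?n = "ip ?T e e" let ?c = "ip X (\<phi> e) (\<psi> e) / ?n"
  have n0: "?n \<noteq> 0" using t.ip_e_e e by simp
  have eS: "e \<in> specht \<mu> E" using t.e_specht e by simp
  have sub: "perm_submodule E (specht \<mu> E)" by (rule perm_submodule_specht)
  have 1: "ip X (\<phi> e) (\<psi> v) = ?c * ip ?T e v" if v: "v \<in> specht \<mu> E" for v
  proof -
    have "?n * ip X (\<phi> e) (\<psi> v) = ip X (\<phi> (t.kap e)) (\<psi> v)"
      using linear_map_on_scale[of "specht \<mu> E" \<phi> e ?n] \<phi> eS
      by (simp add: e t.kap_e perm_hom_def ip_scale_left)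
    also have "\<dots> = ip X (\<phi> e) (\<psi> (t.kap v))"
      using t.kap_hom[OF sub \<phi> eS] t.kap_hom[OF sub \<psi> v] t.ip_kap[OF X] by simp
    also have "t.kap v = (\<lambda>r. ip ?T v e * e r)" using t.kap_eq specht_funs_on v e by blast
    also have "\<psi> (\<lambda>r. ip ?T v e * e r) = (\<lambda>r. ip ?T v e * \<psi> e r)"
      using linear_map_on_scale[of "specht \<mu> E" \<psi> e "ip ?T v e"] \<psi> eS by (simp add: perm_hom_def)
    finally show ?thesis using n0 ip_cnj[of ?T e v] by (simp add: ip_scale_right) (simp add: field_simps)
  qed
  have 2: "ip X (\<phi> (polytabloid \<mu> E t')) (\<psi> v) = ?c * ip ?T (polytabloid \<mu> E t') v" if t': "t' \<in> tableaux \<mu> E" for t'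
  proof -
    obtain p where p: "p permutes E" "polytabloid \<mu> E t' = pact p e"
      using t.polytabloid_pact[OF t'] e by metis
    have i: "inv_into UNIV p permutes E" using permutes_inv[OF p(1)] .
    have iv: "pact (inv_into UNIV p) v \<in> specht \<mu> E" using sub v i by (simp add: perm_submodule_def)
    have "ip X (\<phi> (pact p e)) (\<psi> v) = ip X (\<phi> e) (pact (inv_into UNIV p) (\<psi> v))"
      using \<phi> eS p(1) ip_pact[OF X p(1)] by (simp add: perm_hom_def)
    also have "\<dots> = ip X (\<phi> e) (\<psi> (pact (inv_into UNIV p) v))"
      using \<psi> v i by (simp add: perm_hom_def)
    also have "\<dots> = ?c * ip ?T (pact p e) v" using 1[OF iv] ip_pact[OF perm_invariant_tabloids p(1)] by simp
    finally show ?thesis using p by simp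
  qed
  obtain c where "u = (\<lambda>r. \<Sum>t\<in>tableaux \<mu> E. c t * polytabloid \<mu> E t r)" using u by (auto simp: specht_def)
  then show ?thesis using 2
    by (simp add: perm_hom_specht_sum[OF \<phi>] ip_sum_left sum_distrib_left mult_ac)
qed

text \<open>A nonzero w cannot be orthogonal to all polytabloids, since it is a combination of them.
  Antisymmetrizing w over a tableau t with nonzero pairing gives a nonzero multiple of its
  polytabloid, whose translates span the module.\<close>

lemma specht_irreducible:
  assumes W: "perm_submodule E W" "W \<subseteq> specht \<mu> E" and w: "w \<in> W" "w \<noteq> (\<lambda>_. 0)"
  shows "W = specht \<mu> E"
proof -
  let ?T = "tabloids \<mu> E"
  have "\<exists>t\<in>tableaux \<mu> E. ip ?T w (polytabloid \<mu> E t) \<noteq> 0"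
  proof (rule ccontr)
    assume n: "\<not> ?thesis"
    obtain c where c: "w = (\<lambda>r. \<Sum>t\<in>tableaux \<mu> E. c t * polytabloid \<mu> E t r)"
      using w W by (auto simp: specht_def)
    have "ip ?T w w = 0" using n by (subst (2) c) (simp add: ip_sum_right)
    then show False using ip_self_eq_0[OF finite_tabloids[OF finE]] specht_funs_on W w by blast
  qed
  then obtain t where t: "t \<in> tableaux \<mu> E" "ip ?T w (polytabloid \<mu> E t) \<noteq> 0" by blast
  interpret t: young_tableau \<mu> E t by (rule young_tableauI[OF t(1)])
  have "t.kap w \<in> W" unfolding t.kap_def
    by (rule lin_subspace_sum) (use W(1) w t.C_permutes in \<open>auto simp: perm_submodule_def\<close>)
  moreover have "t.kap w = (\<lambda>r. ip ?T w t.e * t.e r)" using t.kap_eq specht_funs_on W w by blast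
  ultimately have "(\<lambda>r. ip ?T w t.e * t.e r) \<in> W" by simp
  then have "(\<lambda>r. (1 / ip ?T w t.e) * (ip ?T w t.e * t.e r)) \<in> W"
    using W(1) lin_subspace_scale[of W "\<lambda>r. ip ?T w t.e * t.e r" "1 / ip ?T w t.e"] unfolding perm_submodule_def by blast
  moreover have "(\<lambda>r. (1 / ip ?T w t.e) * (ip ?T w t.e * t.e r)) = t.e"
    using t(2) by (simp add: t.e_def[symmetric])
  ultimately have eW: "t.e \<in> W" by simp
  have "specht \<mu> E \<subseteq> W"
  proof (rule specht_subset)
    fix t' assume "t' \<in> tableaux \<mu> E"
    then obtain p where "p permutes E" "polytabloid \<mu> E t' = pact p t.e" by (rule t.polytabloid_pact)
    then show "polytabloid \<mu> E t' \<in> W" using W(1) eW by (simp add: perm_submodule_def)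
  qed (use W(1) in \<open>simp add: perm_submodule_def\<close>)
  then show ?thesis using W(2) by blast
qed

end

lemma dominates_antisym:
  assumes "\<mu> \<in> young_diagrams N" "\<nu> \<in> young_diagrams N" "dominates \<mu> \<nu>" "dominates \<nu> \<mu>"
  shows "\<mu> = \<nu>"
proof -
  have s: "sum (rows_of \<mu>) {..<i} = sum (rows_of \<nu>) {..<i}" for i
    using assms(3,4) by (auto simp: dominates_def sum_rows_of intro: antisym)
  have "rows_of \<mu> i = rows_of \<nu> i" for i using s[of i] s[of "Suc i"] by simp
  then have "rows_of \<mu> = rows_of \<nu>" by blast
  then show ?thesis using rows_of_bij[of N] assms(1,2) by (auto simp: bij_betw_def inj_on_def)
qed

text \<open>Distinct diagrams cannot dominate each other both ways, so \<open>specht_ip_eq_0\<close>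
  applies in at least one order; conjugate symmetry of the inner product covers the other.\<close>

lemma specht_ip_distinct:
  assumes "finite E" "\<mu> \<in> young_diagrams (card E)" "\<nu> \<in> young_diagrams (card E)" "\<mu> \<noteq> \<nu>"
    and "perm_invariant E X"
    and "perm_hom E (specht \<mu> E) X \<phi>" "perm_hom E (specht \<nu> E) X \<psi>"
    and "u \<in> specht \<mu> E" "v \<in> specht \<nu> E"
  shows "ip X (\<phi> u) (\<psi> v) = 0"
proof (cases "dominates \<mu> \<nu>")
  case False
  then show ?thesis
    using specht_ip_eq_0[OF assms(1,2,5)] perm_submodule_specht specht_funs_on assms by metis
next
  case True
  then have "\<not> dominates \<nu> \<mu>" using dominates_antisym assms by blast
  then have "ip X (\<psi> v) (\<phi> u) = 0"
    using specht_ip_eq_0[OF assms(1,3,5)] perm_submodule_specht specht_funs_on assms by metis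
  then show ?thesis using ip_cnj[of X "\<phi> u" "\<psi> v"] by simp
qed

section \<open>Rearrangements\<close>

text \<open>The rearrangement inequality with its equality case. Moving the value indexed by n from
  its position k to the last place reduces the length by one.\<close>

lemma rearrangement:
  fixes g :: "nat \<Rightarrow> nat"
  assumes "\<And>i j. i < j \<Longrightarrow> j < n \<Longrightarrow> g i \<le> g j" "\<pi> permutes {..<n}"
  shows "(\<Sum>j<n. int j * int (g (\<pi> j))) \<le> (\<Sum>j<n. int j * int (g j)) \<and>
    ((\<Sum>j<n. int j * int (g (\<pi> j))) = (\<Sum>j<n. int j * int (g j)) \<longrightarrow> (\<forall>j<n. g (\<pi> j) = g j))"
  using assms
proof (induction n arbitrary: \<pi>)
  case (Suc n)
  define k where "k = inv_into UNIV \<pi> n"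
  have k: "\<pi> k = n" using permutes_inverses[OF Suc.prems(2)] by (simp add: k_def)
  have kn: "k \<le> n"
    using permutes_in_image[OF Suc.prems(2), of k] k by simp
  define \<pi>' where "\<pi>' = \<pi> \<circ> Transposition.transpose k n"
  have p1: "\<pi>' permutes {..<Suc n}"
    unfolding \<pi>'_def by (rule permutes_compose[OF permutes_swap_id Suc.prems(2)]) (use kn in auto)
  have p2: "\<pi>' n = n" by (simp add: \<pi>'_def k)
  have p3: "\<pi>' permutes {..<n}" by (rule permutes_superset[OF p1]) (use p2 in \<open>auto simp: less_Suc_eq\<close>)
  have IH: "(\<Sum>j<n. int j * int (g (\<pi>' j))) \<le> (\<Sum>j<n. int j * int (g j))"
     "(\<Sum>j<n. int j * int (g (\<pi>' j))) = (\<Sum>j<n. int j * int (g j)) \<Longrightarrow> \<forall>j<n. g (\<pi>' j) = g j"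
    using Suc.IH[OF _ p3] Suc.prems(1) by (auto simp: less_Suc_eq)
  have gn: "g (\<pi> n) \<le> g n"
    using permutes_in_image[OF Suc.prems(2), of n] Suc.prems(1)[of "\<pi> n" n] by (cases "\<pi> n = n") auto
  \<comment> \<open>The exchange changes the sum by a product of two nonnegative factors. Equality
    in the inequality therefore forces \<open>k = n\<close> or equal values at the two exchanged
    places. The integers are used because of these differences.\<close>
  have S: "(\<Sum>j<Suc n. int j * int (g (\<pi> j))) + (int n - int k) * (int (g n) - int (g (\<pi> n))) =
     (\<Sum>j<Suc n. int j * int (g (\<pi>' j)))"
  proof (cases "k = n")
    case True
    then show ?thesis by (simp add: \<pi>'_def)
  next
    case False
    then have kl: "k < n" using kn by simp
    have 1: "(\<Sum>j<Suc n. int j * int (f j)) = int n * int (f n) + (int k * int (f k) + (\<Sum>j\<in>{..<n} - {k}. int j * int (f j)))"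
      for f :: "nat \<Rightarrow> nat" using kl sum.remove[of "{..<n}" k "\<lambda>j. int j * int (f j)"] by simp
    have 2: "(\<Sum>j\<in>{..<n} - {k}. int j * int (g (\<pi>' j))) = (\<Sum>j\<in>{..<n} - {k}. int j * int (g (\<pi> j)))"
      by (rule sum.cong) (auto simp: \<pi>'_def transpose_def)
    have 3: "\<pi>' k = \<pi> n" by (simp add: \<pi>'_def)
    show ?thesis unfolding 1[of "\<lambda>j. g (\<pi> j)"] 1[of "\<lambda>j. g (\<pi>' j)"] 2 3 p2 k by (simp add: algebra_simps)
  qed
  have nn: "0 \<le> (int n - int k) * (int (g n) - int (g (\<pi> n)))" using kn gn by simp
  have T: "(\<Sum>j<Suc n. int j * int (g (\<pi>' j))) = (\<Sum>j<n. int j * int (g (\<pi>' j))) + int n * int (g n)"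
    by (simp add: p2)
  show ?case
  proof (intro conjI impI)
    show "(\<Sum>j<Suc n. int j * int (g (\<pi> j))) \<le> (\<Sum>j<Suc n. int j * int (g j))"
      using S nn IH(1) unfolding T by simp
    assume eq: "(\<Sum>j<Suc n. int j * int (g (\<pi> j))) = (\<Sum>j<Suc n. int j * int (g j))"
    have e1: "(\<Sum>j<n. int j * int (g (\<pi>' j))) = (\<Sum>j<n. int j * int (g j))"
      and e2: "(int n - int k) * (int (g n) - int (g (\<pi> n))) = 0"
      using S[unfolded T] nn IH(1) eq sum.lessThan_Suc[of "\<lambda>j. int j * int (g j)" n] by linarith+
    have g': "\<forall>j<n. g (\<pi>' j) = g j" by (rule IH(2)[OF e1])
    have e3: "k = n \<or> g (\<pi> n) = g n" using e2 by auto
    show "\<forall>j<Suc n. g (\<pi> j) = g j"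
    proof (intro allI impI)
      fix j assume j: "j < Suc n"
      consider "j = n" | "j = k" "j \<noteq> n" | "j \<noteq> k" "j \<noteq> n" by blast
      then show "g (\<pi> j) = g j"
      proof cases
        case 1
        then show ?thesis using e3 k by auto
      next
        case 2
        then have "g (\<pi>' k) = g k" using g' j by simp
        moreover have "\<pi>' k = \<pi> n" by (simp add: \<pi>'_def)
        ultimately have "g (\<pi>' k) = g k" "\<pi>' k = \<pi> n" by simp_all
        then show ?thesis using 2 e3 k by simp
      next
        case 3
        then have "\<pi>' j = \<pi> j" "j < n" using j by (auto simp: \<pi>'_def transpose_def)
        then show ?thesis using g' by metis
      qed
    qed
  qed
qed simp

text \<open>Rows of fillings are known only through the multiplicities of their entries; equal
  multiplicities supply the permutation for \<open>rearrangement\<close>.\<close>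

lemma rearrangement_count:
  fixes f g :: "nat \<Rightarrow> nat"
  assumes mono: "\<And>i j. i < j \<Longrightarrow> j < n \<Longrightarrow> g i \<le> g j"
    and cnt: "\<And>v. card {j. j < n \<and> f j = v} = card {j. j < n \<and> g j = v}"
  shows "(\<Sum>j<n. j * f j) \<le> (\<Sum>j<n. j * g j)"
    and "(\<Sum>j<n. j * f j) = (\<Sum>j<n. j * g j) \<Longrightarrow> j < n \<Longrightarrow> f j = g j"
proof -
  have "image_mset f (mset_set {..<n}) = image_mset g (mset_set {..<n})"
    using cnt by (intro multiset_eqI) (simp add: count_image_mset_eq_card_vimage)
  then obtain \<pi> where p: "\<pi> permutes {..<n}" "\<forall>j\<in>{..<n}. f j = g (\<pi> j)"
    using image_mset_eq_implies_permutes[of "{..<n}" f g] by auto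
  have eq: "int (\<Sum>j<n. j * f j) = (\<Sum>j<n. int j * int (g (\<pi> j)))" "int (\<Sum>j<n. j * g j) = (\<Sum>j<n. int j * int (g j))"
    using p(2) by simp_all
  have R: "(\<Sum>j<n. int j * int (g (\<pi> j))) \<le> (\<Sum>j<n. int j * int (g j))"
    "(\<Sum>j<n. int j * int (g (\<pi> j))) = (\<Sum>j<n. int j * int (g j)) \<longrightarrow> (\<forall>j<n. g (\<pi> j) = g j)"
    using rearrangement[of n g, OF mono p(1)] by simp_all
  show "(\<Sum>j<n. j * f j) \<le> (\<Sum>j<n. j * g j)" using R(1) eq by (metis of_nat_le_iff)
  show "f j = g j" if "(\<Sum>j<n. j * f j) = (\<Sum>j<n. j * g j)" "j < n"
    using R(2) eq that p(2) by (metis lessThan_iff)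
qed

lemma strict_mono_image_unique:
  fixes f g :: "nat \<Rightarrow> nat"
  assumes "\<And>i j. i < j \<Longrightarrow> j < n \<Longrightarrow> f i < f j" "\<And>i j. i < j \<Longrightarrow> j < n \<Longrightarrow> g i < g j"
    and "f ` {..<n} = g ` {..<n}" and "i < n"
  shows "f i = g i"
proof -
  have s: "sorted (map h [0..<n])" "distinct (map h [0..<n])"
    if h: "\<And>i j. i < j \<Longrightarrow> j < n \<Longrightarrow> h i < h j" for h :: "nat \<Rightarrow> nat"
  proof -
    have "sorted_wrt (<) (map h [0..<n])" unfolding sorted_wrt_iff_nth_less using h by simp
    then show "sorted (map h [0..<n])" "distinct (map h [0..<n])" by (auto simp: strict_sorted_iff)
  qed
  have "map f [0..<n] = map g [0..<n]"
    using s[of f] s[of g] assms by (intro sorted_distinct_set_unique) (auto simp: atLeast0LessThan)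
  then show ?thesis using assms(4) by (metis map_eq_conv atLeastLessThan_iff set_upt zero_le)
qed

section \<open>Homomorphisms from tableaux\<close>

text \<open>The numbers of common points of rows and blocks label the orbits of the permutations of
  E on pairs (s, r). Thus \<open>inc_map\<close> below is the operator whose kernel is the indicator
  function of such an orbit, which explains its equivariance; T enters only through the
  multiplicities of its entries in each row.\<close>

definition inc_match :: "nat list \<Rightarrow> nat \<Rightarrow> (nat \<Rightarrow> 'i) \<Rightarrow> (nat \<times> nat \<Rightarrow> nat) \<Rightarrow>
    (nat \<Rightarrow> 'a set) \<Rightarrow> ('i \<Rightarrow> 'a set) \<Rightarrow> bool" where
  "inc_match \<mu> L \<iota> T s r \<longleftrightarrow>
     (\<forall>i. \<forall>k<L. card (s i \<inter> r (\<iota> k)) = card {j. j < rows_of \<mu> i \<and> T (i, j) = Suc k})"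

definition inc_map :: "nat list \<Rightarrow> 'a set \<Rightarrow> ('i \<Rightarrow> 'a set) set \<Rightarrow> nat \<Rightarrow> (nat \<Rightarrow> 'i) \<Rightarrow>
    (nat \<times> nat \<Rightarrow> nat) \<Rightarrow> ((nat \<Rightarrow> 'a set) \<Rightarrow> complex) \<Rightarrow> (('i \<Rightarrow> 'a set) \<Rightarrow> complex)" where
  "inc_map \<mu> E X L \<iota> T f = (\<lambda>r. if r \<in> X
     then \<Sum>s\<in>tabloids \<mu> E. if inc_match \<mu> L \<iota> T s r then f s else 0 else 0)"

lemma inc_match_relabel:
  assumes p: "p permutes E"
  shows "inc_match \<mu> L \<iota> T (relabel p s) r \<longleftrightarrow> inc_match \<mu> L \<iota> T s (relabel (inv_into UNIV p) r)"
proof -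
  have "card (p ` A \<inter> B) = card (A \<inter> inv_into UNIV p ` B)" for A B
  proof -
    have "p ` A \<inter> B = p ` (A \<inter> inv_into UNIV p ` B)"
      using permutes_inverses[OF p] by (auto simp: image_iff) (metis IntI image_iff)
    then show ?thesis by (simp add: card_image permutes_inj_on[OF p])
  qed
  then show ?thesis by (simp add: inc_match_def relabel_def)
qed

lemma inc_map_hom:
  assumes X: "perm_invariant E X" shows "perm_hom E S X (inc_map \<mu> E X L \<iota> T)"
  unfolding perm_hom_def
proof (intro conjI ballI allI impI)
  show "inc_map \<mu> E X L \<iota> T u \<in> funs_on X" for u by (simp add: inc_map_def funs_on_def)
  show "linear_map_on S (inc_map \<mu> E X L \<iota> T)"
    unfolding linear_map_on_def inc_map_def sum_distrib_left
    by (auto simp: fun_eq_iff sum.distrib[symmetric] sum_distrib_left intro!: sum.cong)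
  fix p u assume p: "p permutes E"
  show "inc_map \<mu> E X L \<iota> T (pact p u) = pact p (inc_map \<mu> E X L \<iota> T u)"
  proof
    fix r
    have "(\<Sum>s\<in>tabloids \<mu> E. if inc_match \<mu> L \<iota> T s r then pact p u s else 0) =
      (\<Sum>s\<in>tabloids \<mu> E. if inc_match \<mu> L \<iota> T s (relabel (inv_into UNIV p) r) then u s else 0)"
      using sum_relabel[OF perm_invariant_tabloids p, of "\<lambda>s. if inc_match \<mu> L \<iota> T s r then pact p u s else 0" \<mu>]
      unfolding inc_match_relabel[OF p] pact_def relabel_inv[OF p] by simp
    then show "inc_map \<mu> E X L \<iota> T (pact p u) r = pact p (inc_map \<mu> E X L \<iota> T u) r"
      unfolding inc_map_def pact_def by (simp add: perm_invariant_iff[OF X permutes_inv[OF p]])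
  qed
qed

context young_tableau
begin

definition weight :: "(nat \<times> nat \<Rightarrow> nat) \<Rightarrow> nat" where
  "weight F = (\<Sum>c\<in>cells \<mu>. snd c * F c)"

lemma weight_rows: "weight F = (\<Sum>i<length \<mu>. \<Sum>j<rows_of \<mu> i. j * F (i, j))"
proof -
  have "cells \<mu> = Sigma {..<length \<mu>} (\<lambda>i. {..<rows_of \<mu> i})" by (auto simp: cells_def rows_of_def)
  then show ?thesis unfolding weight_def by (simp add: sum.Sigma case_prod_beta)
qed

definition cell_perm :: "('a \<Rightarrow> 'a) \<Rightarrow> nat \<times> nat \<Rightarrow> nat \<times> nat" where
  "cell_perm p c = inv_into (cells \<mu>) t (p (t c))"

lemma t_cell_perm:
  assumes "p \<in> C" "c \<in> cells \<mu>"
  shows "cell_perm p c \<in> cells \<mu>" "t (cell_perm p c) = p (t c)" "snd (cell_perm p c) = snd c"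
proof -
  have E: "p (t c) \<in> E" using permutes_in_image[OF C_permutes[OF assms(1)]] t_in_E[OF assms(2)] by simp
  then have im: "p (t c) \<in> t ` cells \<mu>" using t_bij by (simp add: bij_betw_def)
  show 1: "cell_perm p c \<in> cells \<mu>" unfolding cell_perm_def by (rule inv_into_into[OF im])
  show 2: "t (cell_perm p c) = p (t c)" unfolding cell_perm_def by (rule f_inv_into_f[OF im])
  obtain i j where c: "c = (i, j)" by force
  have "p (t c) \<in> p ` col j" using t_in_col[of i j j] assms(2) c by auto
  then have "t (cell_perm p c) \<in> col j" using assms(1) 2 by (simp add: C_iff)
  then show "snd (cell_perm p c) = snd c" using 1 t_in_col[of "fst (cell_perm p c)" "snd (cell_perm p c)" j] c by simp
qed

lemma cell_perm_bij: assumes p: "p \<in> C" shows "bij_betw (cell_perm p) (cells \<mu>) (cells \<mu>)"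
proof -
  have "bij_betw p E E" by (rule permutes_imp_bij[OF C_permutes[OF p]])
  then have "bij_betw (inv_into (cells \<mu>) t \<circ> (p \<circ> t)) (cells \<mu>) (cells \<mu>)"
    using bij_betw_trans[OF bij_betw_trans[OF t_bij] bij_betw_inv_into[OF t_bij]] by blast
  then show ?thesis by (rule bij_betw_cong[THEN iffD1, rotated]) (simp add: cell_perm_def)
qed

lemma weight_cell_perm: "p \<in> C \<Longrightarrow> weight (T \<circ> cell_perm p) = weight T"
  unfolding weight_def
  using sum.reindex_bij_betw[OF cell_perm_bij, of p "\<lambda>c. snd c * T c"] t_cell_perm(3)
  by (simp cong: sum.cong)

context
  fixes I :: "'i set" and m :: "'i \<Rightarrow> nat" and \<iota> :: "nat \<Rightarrow> 'i" and \<nu> :: "nat list"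
  assumes \<iota>: "bij_betw \<iota> {..<length \<nu>} I" and m: "\<And>k. k < length \<nu> \<Longrightarrow> m (\<iota> k) = \<nu> ! k"
begin

lemma ssyt_props:
  assumes "T \<in> ssyt (rows_of \<mu>) \<nu>"
  shows "c \<in> cells \<mu> \<Longrightarrow> 1 \<le> T c" "c \<notin> cells \<mu> \<Longrightarrow> T c = 0" "T c \<le> length \<nu>"
    "j < j' \<Longrightarrow> (i, j') \<in> cells \<mu> \<Longrightarrow> T (i, j) \<le> T (i, j')"
    "i < i' \<Longrightarrow> (i', j) \<in> cells \<mu> \<Longrightarrow> T (i, j) < T (i', j)"
    "k < length \<nu> \<Longrightarrow> card {c \<in> cells \<mu>. T c = Suc k} = \<nu> ! k"
proof -
  have T: "T \<in> semistandard_tableaux \<mu> \<nu>" using assms by (simp add: semistandard_tableaux_eq_ssyt)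
  show "c \<in> cells \<mu> \<Longrightarrow> 1 \<le> T c" "c \<notin> cells \<mu> \<Longrightarrow> T c = 0"
    "j < j' \<Longrightarrow> (i, j') \<in> cells \<mu> \<Longrightarrow> T (i, j) \<le> T (i, j')"
    "i < i' \<Longrightarrow> (i', j) \<in> cells \<mu> \<Longrightarrow> T (i, j) < T (i', j)"
    "k < length \<nu> \<Longrightarrow> card {c \<in> cells \<mu>. T c = Suc k} = \<nu> ! k" for c
    using T unfolding semistandard_tableaux_def mem_Collect_eq by (meson, meson, meson, meson, simp)
  show "T c \<le> length \<nu>"
    using ssyt_entry_le[OF assms, of "fst c" "snd c"] rows_of_shapes[OF mu] by (simp add: shapes_def)
qed

text \<open>The evaluation point attached to T in the triangularity argument: the ordered partition
  read off from the positions of equal entries.\<close>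

definition blocks_of :: "(nat \<times> nat \<Rightarrow> nat) \<Rightarrow> 'i \<Rightarrow> 'a set" where
  "blocks_of T b = (if b \<in> I then t ` {c \<in> cells \<mu>. T c = Suc (inv_into {..<length \<nu>} \<iota> b)} else {})"

lemma blocks_of_\<iota>: "k < length \<nu> \<Longrightarrow> blocks_of T (\<iota> k) = t ` {c \<in> cells \<mu>. T c = Suc k}"
  using \<iota> by (auto simp: blocks_of_def bij_betw_def inv_into_f_f)

lemma blocks_of_partition:
  assumes T: "T \<in> ssyt (rows_of \<mu>) \<nu>" shows "blocks_of T \<in> ordered_partitions I m E"
proof -
  have I: "\<exists>k<length \<nu>. b = \<iota> k" if "b \<in> I" for b using \<iota> that by (auto simp: bij_betw_def)
  have c: "card (blocks_of T (\<iota> k)) = \<nu> ! k" if "k < length \<nu>" for k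
    unfolding blocks_of_\<iota>[OF that] ssyt_props(6)[OF T that, symmetric]
    by (rule card_image) (auto simp: inj_on_def t_eq_iff)
  have 1: "\<forall>b\<in>I. finite (blocks_of T b) \<and> card (blocks_of T b) = m b"
  proof
    fix b assume "b \<in> I"
    then obtain k where k: "k < length \<nu>" "b = \<iota> k" using I by blast
    then show "finite (blocks_of T b) \<and> card (blocks_of T b) = m b"
      using c[OF k(1)] m[OF k(1)] blocks_of_\<iota>[OF k(1)] by simp
  qed
  have 2: "disjoint_family_on (blocks_of T) I"
  proof (unfold disjoint_family_on_def, intro ballI impI)
    fix a b assume ab: "a \<in> I" "b \<in> I" "a \<noteq> b"
    then obtain k l where "k < length \<nu>" "a = \<iota> k" "l < length \<nu>" "b = \<iota> l" using I by meson
    then show "blocks_of T a \<inter> blocks_of T b = {}" using ab(3) by (auto simp: blocks_of_\<iota> t_eq_iff)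
  qed
  have 3: "(\<Union>b\<in>I. blocks_of T b) = E"
  proof (intro equalityI subsetI)
    fix x assume "x \<in> E"
    then obtain i j where x: "(i, j) \<in> cells \<mu>" "x = t (i, j)" by (rule E_cases)
    define k where "k = T (i, j) - 1"
    have k: "k < length \<nu>" "T (i, j) = Suc k"
      using ssyt_props(1)[OF T x(1)] ssyt_props(3)[OF T, of "(i, j)"] by (auto simp: k_def)
    then have "x \<in> blocks_of T (\<iota> k)" using x by (auto simp: blocks_of_\<iota>)
    moreover have "\<iota> k \<in> I" using \<iota> k by (auto simp: bij_betw_def)
    ultimately show "x \<in> (\<Union>b\<in>I. blocks_of T b)" by blast
  qed (auto simp: blocks_of_def t_in_E split: if_splits)
  have "\<forall>b. b \<notin> I \<longrightarrow> blocks_of T b = {}" by (simp add: blocks_of_def)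
  then show ?thesis using 1 2 3 unfolding ordered_partitions_def by blast
qed

lemma card_row_blocks_of:
  assumes p: "p \<in> C" and k: "k < length \<nu>"
  shows "card (relabel p (tabloid \<mu> t) i \<inter> blocks_of T (\<iota> k)) =
    card {j. j < rows_of \<mu> i \<and> (T \<circ> cell_perm p) (i, j) = Suc k}"
proof -
  have "relabel p (tabloid \<mu> t) i \<inter> blocks_of T (\<iota> k) =
     (\<lambda>j. p (t (i, j))) ` {j. j < rows_of \<mu> i \<and> (T \<circ> cell_perm p) (i, j) = Suc k}"
  proof (intro equalityI subsetI)
    fix x assume x: "x \<in> relabel p (tabloid \<mu> t) i \<inter> blocks_of T (\<iota> k)"
    then obtain j where j: "(i, j) \<in> cells \<mu>" "x = p (t (i, j))" by (auto simp: relabel_def tabloid_def)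
    obtain c where c: "c \<in> cells \<mu>" "T c = Suc k" "x = t c" using x by (auto simp: blocks_of_\<iota>[OF k])
    have "cell_perm p (i, j) = c" using t_cell_perm(1,2)[OF p j(1)] c j by (simp add: t_eq_iff[symmetric])
    then show "x \<in> (\<lambda>j. p (t (i, j))) ` {j. j < rows_of \<mu> i \<and> (T \<circ> cell_perm p) (i, j) = Suc k}"
      using j c by (auto simp: cells_rows_of)
  next
    fix x assume "x \<in> (\<lambda>j. p (t (i, j))) ` {j. j < rows_of \<mu> i \<and> (T \<circ> cell_perm p) (i, j) = Suc k}"
    then obtain j where j: "(i, j) \<in> cells \<mu>" "T (cell_perm p (i, j)) = Suc k" "x = p (t (i, j))"
      by (auto simp: cells_rows_of)
    show "x \<in> relabel p (tabloid \<mu> t) i \<inter> blocks_of T (\<iota> k)"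
    proof
      show "x \<in> relabel p (tabloid \<mu> t) i" using j by (auto simp: relabel_def tabloid_def)
      show "x \<in> blocks_of T (\<iota> k)" unfolding blocks_of_\<iota>[OF k]
        using t_cell_perm(1,2)[OF p j(1)] j by (intro image_eqI[of _ _ "cell_perm p (i, j)"]) auto
    qed
  qed
  moreover have "inj_on (\<lambda>j. p (t (i, j))) {j. j < rows_of \<mu> i \<and> (T \<circ> cell_perm p) (i, j) = Suc k}"
    using inj_eq[OF permutes_inj[OF C_permutes[OF p]]] by (auto simp: inj_on_def t_eq_iff cells_rows_of)
  ultimately show ?thesis by (simp add: card_image)
qed

text \<open>
  Row-increasing tableaux maximize the weight among the fillings with the same rows, while column
  permutations preserve the weight: this makes the matrix of the vectors \<open>inc_map T e\<close> triangular.
\<close>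

lemma inc_match_weight:
  assumes T: "T \<in> ssyt (rows_of \<mu>) \<nu>" and T': "T' \<in> ssyt (rows_of \<mu>) \<nu>" and p: "p \<in> C"
    and mt: "inc_match \<mu> (length \<nu>) \<iota> T' (relabel p (tabloid \<mu> t)) (blocks_of T)"
  shows "weight T \<le> weight T'" "weight T = weight T' \<Longrightarrow> T = T' \<and> p = id"
proof -
  let ?S = "T \<circ> cell_perm p"
  have cnt: "card {j. j < rows_of \<mu> i \<and> ?S (i, j) = v} = card {j. j < rows_of \<mu> i \<and> T' (i, j) = v}" for i v
  proof (cases "1 \<le> v \<and> v \<le> length \<nu>")
    case True
    then obtain k where k: "v = Suc k" "k < length \<nu>" by (cases v) auto
    then show ?thesis using mt card_row_blocks_of[OF p k(2), of i T] by (simp add: inc_match_def)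
  next
    case False
    have "?S (i, j) \<noteq> v" "T' (i, j) \<noteq> v" if "j < rows_of \<mu> i" for j
    proof -
      have c: "(i, j) \<in> cells \<mu>" using that by (simp add: cells_rows_of)
      show "?S (i, j) \<noteq> v" "T' (i, j) \<noteq> v"
        using False ssyt_props(1)[OF T t_cell_perm(1)[OF p c]] ssyt_props(3)[OF T, of "cell_perm p (i, j)"]
          ssyt_props(1)[OF T' c] ssyt_props(3)[OF T', of "(i, j)"] by auto
    qed
    then have "{j. j < rows_of \<mu> i \<and> ?S (i, j) = v} = {}" "{j. j < rows_of \<mu> i \<and> T' (i, j) = v} = {}" by auto
    then show ?thesis by (simp only: card.empty)
  qed
  have mono: "T' (i, j) \<le> T' (i, j')" if "j < j'" "j' < rows_of \<mu> i" for i j j'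
    using ssyt_props(4)[OF T'] that by (simp add: cells_rows_of)
  have row: "(\<Sum>j<rows_of \<mu> i. j * ?S (i, j)) \<le> (\<Sum>j<rows_of \<mu> i. j * T' (i, j))" for i
    by (rule rearrangement_count(1)[OF mono cnt])
  have "weight ?S \<le> weight T'" unfolding weight_rows by (rule sum_mono) (rule row)
  then show "weight T \<le> weight T'" using weight_cell_perm[OF p] by simp
  assume eq: "weight T = weight T'"
  have "(\<Sum>i<length \<mu>. \<Sum>j<rows_of \<mu> i. j * ?S (i, j)) = (\<Sum>i<length \<mu>. \<Sum>j<rows_of \<mu> i. j * T' (i, j))"
    using eq weight_cell_perm[OF p, of T] unfolding weight_rows by simp
  then have roweq: "(\<Sum>j<rows_of \<mu> i. j * ?S (i, j)) = (\<Sum>j<rows_of \<mu> i. j * T' (i, j))" if "i < length \<mu>" for i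
    by (rule sum_mono_inv) (use row that in auto)
  have ST': "T (cell_perm p c) = T' c" if c: "c \<in> cells \<mu>" for c
  proof -
    obtain i j where ij: "c = (i, j)" by force
    have "i < length \<mu>" "j < rows_of \<mu> i" using c ij by (auto simp: cells_def rows_of_def)
    then have "?S (i, j) = T' (i, j)" using rearrangement_count(2)[OF mono cnt roweq] by blast
    then show ?thesis by (simp add: ij)
  qed
  \<comment> \<open>Equality of the weights gives equality in every row, so T moved by p is T'. As p
    only permutes within columns, T and T' have the same set of entries in each column, and strict
    increase leaves one order for them.\<close>
  have col_image: "(\<lambda>i. T (i, j)) ` {..<h j} = (\<lambda>i. T' (i, j)) ` {..<h j}" for j
  proof -
    let ?K = "{c \<in> cells \<mu>. snd c = j}"
    have K: "?K = (\<lambda>i. (i, j)) ` {..<h j}" by (force simp: less_h)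
    have "cell_perm p ` ?K = ?K"
    proof (rule card_subset_eq)
      show "cell_perm p ` ?K \<subseteq> ?K" using t_cell_perm[OF p] by auto
      show "card (cell_perm p ` ?K) = card ?K"
        using cell_perm_bij[OF p] by (intro card_image) (auto simp: bij_betw_def inj_on_def)
    qed simp
    then have "T ` ?K = T ` cell_perm p ` ?K" by simp
    also have "\<dots> = T' ` ?K" using ST' by (force simp: image_image)
    finally show ?thesis by (simp add: K image_image)
  qed
  have TT': "T c = T' c" if c: "c \<in> cells \<mu>" for c
  proof -
    obtain i j where ij: "c = (i, j)" by force
    have "T (i, j) = T' (i, j)"
      by (rule strict_mono_image_unique[of "h j" "\<lambda>i. T (i, j)" "\<lambda>i. T' (i, j)" i])
         (use ssyt_props(5)[OF T] ssyt_props(5)[OF T'] col_image c ij in \<open>auto simp: less_h\<close>)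
    then show ?thesis by (simp add: ij)
  qed
  show "T = T' \<and> p = id"
  proof
    show "T = T'" using TT' ssyt_props(2)[OF T] ssyt_props(2)[OF T'] by (metis ext)
    \<comment> \<open>A column contains each value at most once, so a move inside the column that
      keeps the entry is trivial.\<close>
    have "cell_perm p c = c" if c: "c \<in> cells \<mu>" for c
    proof -
      have "T (cell_perm p c) = T c" using ST'[OF c] TT'[OF c] by simp
      moreover have "snd (cell_perm p c) = snd c" by (rule t_cell_perm(3)[OF p c])
      ultimately show ?thesis using ssyt_props(5)[OF T] t_cell_perm(1)[OF p c] c
        by (metis less_irrefl linorder_neqE_nat prod.collapse)
    qed
    then have "p (t c) = t c" if "c \<in> cells \<mu>" for c using t_cell_perm(2)[OF p that] that by simp
    then have "p x = x" for x
      using permutes_not_in[OF C_permutes[OF p], of x] by (cases "x \<in> E") (auto elim!: E_cases)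
    then show "p = id" by auto
  qed
qed

lemma inc_match_self: "inc_match \<mu> (length \<nu>) \<iota> T (tabloid \<mu> t) (blocks_of T)"
proof -
  have "cell_perm id c = c" if "c \<in> cells \<mu>" for c
    using that t_bij by (simp add: cell_perm_def bij_betw_inv_into_left)
  then have "{j. j < rows_of \<mu> i \<and> (T \<circ> cell_perm id) (i, j) = Suc k} = {j. j < rows_of \<mu> i \<and> T (i, j) = Suc k}" for i k
    by (auto simp: cells_rows_of)
  then show ?thesis using card_row_blocks_of[OF C_id] by (simp add: inc_match_def)
qed

lemma inc_map_e:
  assumes "r \<in> X"
  shows "inc_map \<mu> E X L \<iota> T e r = (\<Sum>p\<in>C. if inc_match \<mu> L \<iota> T (relabel p (tabloid \<mu> t)) r then of_int (sign p) else 0)"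
proof -
  have "inc_map \<mu> E X L \<iota> T e r = (\<Sum>s\<in>tabloids \<mu> E. \<Sum>p\<in>C.
      if s = relabel p (tabloid \<mu> t) then (if inc_match \<mu> L \<iota> T s r then of_int (sign p) else 0) else 0)"
    using assms unfolding inc_map_def e_def polytabloid_def C_def[symmetric]
    by (auto intro!: sum.cong sum.neutral)
  also have "\<dots> = (\<Sum>p\<in>C. \<Sum>s\<in>tabloids \<mu> E.
      if s = relabel p (tabloid \<mu> t) then (if inc_match \<mu> L \<iota> T s r then of_int (sign p) else 0) else 0)"
    by (rule sum.swap)
  also have "\<dots> = (\<Sum>p\<in>C. if inc_match \<mu> L \<iota> T (relabel p (tabloid \<mu> t)) r then of_int (sign p) else 0)"
    using perm_invariant_tabloids[of E \<mu>] tabloid_t C_permutes finE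
    by (intro sum.cong refl) (auto simp: perm_invariant_def)
  finally show ?thesis .
qed

text \<open>Take a T of largest weight among the nonzero coefficients and evaluate at
  \<open>blocks_of T\<close>: by \<open>inc_match_weight\<close> only the coefficient of T itself
  survives, through the identity permutation alone.\<close>

lemma inc_maps_independent:
  assumes z: "\<And>r. r \<in> ordered_partitions I m E \<Longrightarrow>
     (\<Sum>T\<in>ssyt (rows_of \<mu>) \<nu>. a T * inc_map \<mu> E (ordered_partitions I m E) (length \<nu>) \<iota> T e r) = 0"
  shows "\<forall>T\<in>ssyt (rows_of \<mu>) \<nu>. a T = 0"
proof (rule ccontr)
  let ?Y = "ssyt (rows_of \<mu>) \<nu>"
  let ?A = "{T \<in> ?Y. a T \<noteq> 0}"
  assume "\<not> ?thesis"
  then have ne: "?A \<noteq> {}" by blast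
  have finY: "finite ?Y" using card_ssyt[OF rows_of_shapes[OF mu]] by blast
  then have fin: "finite ?A" by simp
  have "Max (weight ` ?A) \<in> weight ` ?A" by (rule Max_in) (use ne fin in auto)
  then obtain T where T: "T \<in> ?Y" "a T \<noteq> 0" and "weight T = Max (weight ` ?A)" by auto
  then have max: "weight T' \<le> weight T" if "T' \<in> ?Y" "a T' \<noteq> 0" for T' using fin that by auto
  let ?r = "blocks_of T"
  have r: "?r \<in> ordered_partitions I m E" by (rule blocks_of_partition[OF T(1)])
  have "a T' * inc_map \<mu> E (ordered_partitions I m E) (length \<nu>) \<iota> T' e ?r = (if T' = T then a T else 0)"
    if T': "T' \<in> ?Y" for T'
  proof (cases "a T' = 0")
    case False
    have key: "T = T' \<and> p = id" if "p \<in> C" "inc_match \<mu> (length \<nu>) \<iota> T' (relabel p (tabloid \<mu> t)) ?r" for p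
      using inc_match_weight[OF T(1) T' that] max[OF T' False] by simp
    show ?thesis
    proof (cases "T' = T")
      case True
      have "inc_map \<mu> E (ordered_partitions I m E) (length \<nu>) \<iota> T' e ?r = (\<Sum>p\<in>C. if p = id then 1 else 0)"
        unfolding inc_map_e[OF r] using key inc_match_self True by (intro sum.cong refl) auto
      also have "\<dots> = 1" using finite_C C_id by simp
      finally show ?thesis using True by simp
    next
      case False
      then show ?thesis unfolding inc_map_e[OF r] using key by (auto intro!: sum.neutral)
    qed
  qed (use T in auto)
  then have "(\<Sum>T'\<in>?Y. a T' * inc_map \<mu> E (ordered_partitions I m E) (length \<nu>) \<iota> T' e ?r) = (\<Sum>T'\<in>?Y. if T' = T then a T else 0)"
    by (rule sum.cong[OF refl])
  also have "\<dots> = a T" using finY T(1) by simp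
  finally show False using z[OF r] T(2) by simp
qed

end

end

section \<open>Young's rule\<close>

lemma perm_hom_sum:
  assumes "\<And>i. i \<in> A \<Longrightarrow> perm_hom E S X (\<phi> i)"
  shows "perm_hom E S X (\<lambda>u r. \<Sum>i\<in>A. c i * \<phi> i u r)"
  unfolding perm_hom_def
proof (intro conjI ballI allI impI)
  fix u assume u: "u \<in> S"
  show "(\<lambda>r. \<Sum>i\<in>A. c i * \<phi> i u r) \<in> funs_on X"
    by (rule lin_subspace_sum[OF lin_subspace_funs_on]) (use assms u in \<open>auto simp: perm_hom_def\<close>)
  fix p assume p: "p permutes E"
  have "\<phi> i (pact p u) = pact p (\<phi> i u)" if "i \<in> A" for i
    using assms[OF that] p u by (simp add: perm_hom_def)
  then show "(\<lambda>r. \<Sum>i\<in>A. c i * \<phi> i (pact p u) r) = pact p (\<lambda>r. \<Sum>i\<in>A. c i * \<phi> i u r)"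
    unfolding pact_def by (intro ext sum.cong refl) simp
next
  show "linear_map_on S (\<lambda>u r. \<Sum>i\<in>A. c i * \<phi> i u r)"
    unfolding linear_map_on_def
  proof (intro ballI allI ext)
    fix f g a b y assume fg: "f \<in> S" "g \<in> S"
    have "\<phi> i (\<lambda>x. a * f x + b * g x) y = a * \<phi> i f y + b * \<phi> i g y" if "i \<in> A" for i
      using linear_map_on_comb[of S "\<phi> i" f g a b] assms[OF that] fg by (simp add: perm_hom_def)
    then show "(\<Sum>i\<in>A. c i * \<phi> i (\<lambda>x. a * f x + b * g x) y) = a * (\<Sum>i\<in>A. c i * \<phi> i f y) + b * (\<Sum>i\<in>A. c i * \<phi> i g y)"
      by (simp add: sum_distrib_left sum.distrib[symmetric] algebra_simps)
  qed
qed

context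
  fixes E :: "'a set" and I :: "'i set" and m :: "'i \<Rightarrow> nat" and \<iota> :: "nat \<Rightarrow> 'i" and \<nu> :: "nat list"
  assumes finE: "finite E" and \<iota>: "bij_betw \<iota> {..<length \<nu>} I" and m: "\<And>k. k < length \<nu> \<Longrightarrow> m (\<iota> k) = \<nu> ! k"
begin

text \<open>By \<open>specht_ip_scalar\<close> the inner products of homomorphisms are governed by
  their values on the single vector \<open>e\<close>. Hence it suffices to orthonormalize the span
  of the vectors \<open>\<phi> T e\<close>, which are independent, and to use the same coefficients
  for the homomorphisms.\<close>

lemma specht_isometries:
  assumes mu: "\<mu> \<in> young_diagrams (card E)"
  shows "\<exists>\<psi>. (\<forall>j<kostka \<mu> \<nu>. perm_hom E (specht \<mu> E) (ordered_partitions I m E) (\<psi> j)) \<and>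
    (\<forall>j<kostka \<mu> \<nu>. \<forall>k<kostka \<mu> \<nu>. \<forall>u\<in>specht \<mu> E. \<forall>v\<in>specht \<mu> E.
       ip (ordered_partitions I m E) (\<psi> j u) (\<psi> k v) = (if j = k then ip (tabloids \<mu> E) u v else 0))"
proof -
  let ?X = "ordered_partitions I m E" let ?S = "specht \<mu> E" let ?T = "tabloids \<mu> E"
  let ?Y = "ssyt (rows_of \<mu>) \<nu>" let ?L = "length \<nu>"
  have finI: "finite I" using \<iota> bij_betw_finite by blast
  have X: "perm_invariant E ?X" by (rule perm_invariant_ordered_partitions)
  have finX: "finite ?X" by (rule finite_ordered_partitions[OF finI finE])
  obtain t where t: "t \<in> tableaux \<mu> E" using tableaux_nonempty[OF finE mu] by blast
  interpret young_tableau \<mu> E t by (rule young_tableauI[OF finE mu t])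
  have finY: "finite ?Y" and cardY: "card ?Y = kostka \<mu> \<nu>"
    using finite_semistandard_tableaux[OF mu] by (auto simp: kostka_def semistandard_tableaux_eq_ssyt)
  define \<phi> where "\<phi> T = inc_map \<mu> E ?X ?L \<iota> T" for T
  have \<phi>: "perm_hom E ?S ?X (\<phi> T)" for T unfolding \<phi>_def by (rule inc_map_hom[OF X])
  have \<phi>e: "\<phi> T e \<in> funs_on ?X" for T using \<phi>[of T] e_specht by (simp add: perm_hom_def)
  define W where "W = {(\<lambda>r. \<Sum>T\<in>?Y. a T * \<phi> T e r) | a. True}"
  have W: "lin_subspace W" unfolding lin_subspace_def
  proof (intro conjI ballI allI)
    show "(\<lambda>_. 0) \<in> W" unfolding W_def by (intro CollectI exI[of _ "\<lambda>_. 0"]) simp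
    fix f g a b assume "f \<in> W" "g \<in> W"
    then obtain c d where "f = (\<lambda>r. \<Sum>T\<in>?Y. c T * \<phi> T e r)" "g = (\<lambda>r. \<Sum>T\<in>?Y. d T * \<phi> T e r)"
      by (auto simp: W_def)
    then have "(\<lambda>x. a * f x + b * g x) = (\<lambda>r. \<Sum>T\<in>?Y. (a * c T + b * d T) * \<phi> T e r)"
      by (simp add: sum_distrib_left sum.distrib[symmetric] algebra_simps)
    then show "(\<lambda>x. a * f x + b * g x) \<in> W" unfolding W_def by (intro CollectI exI conjI TrueI)
  qed
  have WX: "W \<subseteq> funs_on ?X" unfolding W_def using \<phi>e by (auto intro: lin_subspace_sum[OF lin_subspace_funs_on])
  obtain d :: nat and b where b: "\<And>i. i < d \<Longrightarrow> b i \<in> W" "orthonormal ?X {..<d} b"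
    "\<And>u. u \<in> W \<Longrightarrow> u = (\<lambda>x. \<Sum>i<d. ip ?X u (b i) * b i x)"
    using orthonormal_basis_exists[OF finX W WX] by blast
  have "card ?Y \<le> d"
  proof (rule independent_le_orthonormal[OF finY b(2)])
    fix T assume T: "T \<in> ?Y"
    have "\<phi> T e \<in> W" unfolding W_def
      by (intro CollectI exI[of _ "\<lambda>S. if S = T then 1 else 0"])
         (use finY T in \<open>simp add: if_distrib[of "\<lambda>z. z * _"] cong: if_cong\<close>)
    then show "\<phi> T e = (\<lambda>x. \<Sum>i<d. ip ?X (\<phi> T e) (b i) * b i x)" by (rule b(3))
  next
    fix a assume "(\<lambda>x. \<Sum>T\<in>?Y. a T * \<phi> T e x) = (\<lambda>_. 0)"
    then have "(\<Sum>T\<in>?Y. a T * \<phi> T e r) = 0" for r by (simp add: fun_eq_iff)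
    then show "\<forall>T\<in>?Y. a T = 0"
      using inc_maps_independent[OF \<iota> m] unfolding \<phi>_def by blast
  qed
  then have Kd: "kostka \<mu> \<nu> \<le> d" by (simp add: cardY)
  have "\<forall>i\<in>{..<d}. \<exists>a. b i = (\<lambda>r. \<Sum>T\<in>?Y. a T * \<phi> T e r)" using b(1) by (auto simp: W_def)
  from bchoice[OF this] obtain a where "\<forall>i\<in>{..<d}. b i = (\<lambda>r. \<Sum>T\<in>?Y. a i T * \<phi> T e r)" by blast
  then have a: "\<And>i. i < d \<Longrightarrow> b i = (\<lambda>r. \<Sum>T\<in>?Y. a i T * \<phi> T e r)" by simp
  define n where "n = (\<Sum>x\<in>?T. (cmod (e x))\<^sup>2)"
  have n: "ip ?T e e = of_real n" unfolding n_def by (rule ip_self)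
  have n0: "n \<noteq> 0" using ip_e_e n by auto
  have npos: "0 \<le> n" unfolding n_def by (rule sum_nonneg) simp
  \<comment> \<open>The norm of \<open>e\<close> is \<open>sqrt n\<close>; with this factor
    \<open>\<psi> j\<close> sends \<open>e\<close> to a vector of the same norm and is isometric by
    \<open>specht_ip_scalar\<close>.\<close>
  define \<psi> where "\<psi> j u = (\<lambda>r. \<Sum>T\<in>?Y. (of_real (sqrt n) * a j T) * \<phi> T u r)" for j u
  have \<psi>: "perm_hom E ?S ?X (\<psi> j)" for j unfolding \<psi>_def by (rule perm_hom_sum) (rule \<phi>)
  have \<psi>e: "\<psi> j e = (\<lambda>r. of_real (sqrt n) * b j r)" if "j < d" for j
    unfolding \<psi>_def a[OF that] by (simp add: sum_distrib_left mult.assoc)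
  have "ip ?X (\<psi> j u) (\<psi> k v) = (if j = k then ip ?T u v else 0)"
    if jk: "j < kostka \<mu> \<nu>" "k < kostka \<mu> \<nu>" and uv: "u \<in> ?S" "v \<in> ?S" for j k u v
  proof -
    have jd: "j < d" "k < d" using jk Kd by auto
    have "ip ?X (\<psi> j e) (\<psi> k e) = of_real (sqrt n * sqrt n) * ip ?X (b j) (b k)"
      unfolding \<psi>e[OF jd(1)] \<psi>e[OF jd(2)] ip_scale_left ip_scale_right
      by (simp only: complex_cnj_complex_of_real of_real_mult mult.assoc)
    also have "\<dots> = (if j = k then of_real n else 0)"
      using b(2) jd npos by (simp add: orthonormal_def)
    finally show ?thesis
      using specht_ip_scalar[OF finE mu X t \<psi> \<psi> uv, of j k] n0 n unfolding e_def by (simp split: if_splits)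
  qed
  then show ?thesis using \<psi> by blast
qed

end

lemma singleton_partitions_transitive:
  assumes "x \<in> ordered_partitions {..<N} (\<lambda>_. 1) E" "y \<in> ordered_partitions {..<N} (\<lambda>_. 1) E"
  shows "\<exists>p. p permutes E \<and> y = relabel p x"
proof -
  have bij: "\<exists>g. bij_betw g {..<N} E \<and> (\<forall>i<N. x i = {g i})" if x: "x \<in> ordered_partitions {..<N} (\<lambda>_. 1) E" for x
  proof -
    have "\<forall>i<N. \<exists>a. x i = {a}" using x by (auto simp: ordered_partitions_def card_1_singleton_iff)
    then obtain g where g: "\<forall>i<N. x i = {g i}" by metis
    have "g ` {..<N} = E" using x g by (auto simp: ordered_partitions_def)
    moreover have "inj_on g {..<N}"
    proof (rule inj_onI)
      fix i j assume ij: "i \<in> {..<N}" "j \<in> {..<N}" "g i = g j"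
      show "i = j"
      proof (rule ccontr)
        assume "i \<noteq> j"
        then have "x i \<inter> x j = {}" using x ij by (auto simp: ordered_partitions_def disjoint_family_on_def)
        then show False using g ij by auto
      qed
    qed
    ultimately show ?thesis using g by (auto simp: bij_betw_def)
  qed
  obtain g h where g: "bij_betw g {..<N} E" "\<forall>i<N. x i = {g i}" and h: "bij_betw h {..<N} E" "\<forall>i<N. y i = {h i}"
    using bij[OF assms(1)] bij[OF assms(2)] by blast
  define p where "p = (\<lambda>z. if z \<in> E then h (inv_into {..<N} g z) else z)"
  have "bij_betw (h \<circ> inv_into {..<N} g) E E"
    using bij_betw_trans[OF bij_betw_inv_into[OF g(1)] h(1)] .
  then have "bij_betw p E E" by (rule bij_betw_cong[THEN iffD1, rotated]) (simp add: p_def)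
  then have "p permutes E" by (rule bij_imp_permutes) (simp add: p_def)
  moreover have "y i = p ` x i" for i
  proof (cases "i < N")
    case True
    then have "g i \<in> E" using g(1) by (auto simp: bij_betw_def)
    then show ?thesis using True g h by (simp add: p_def bij_betw_inv_into_left)
  next
    case False
    then show ?thesis using assms by (simp add: ordered_partitions_def)
  qed
  ultimately show ?thesis unfolding relabel_def by blast
qed

text \<open>With fewer than K vectors, some nontrivial combination of the K independent
  homomorphisms into the singleton module would vanish at one point x0 on all of them, hence on the
  whole Specht module. Permutations carry x0 to every other point, which contradicts
  independence.\<close>

lemma specht_dimension:
  assumes finE: "finite E" and mu: "\<mu> \<in> young_diagrams (card E)"
    and b: "\<And>i. i < d \<Longrightarrow> b i \<in> specht \<mu> E"
    and exp: "\<And>u. u \<in> specht \<mu> E \<Longrightarrow> u = (\<lambda>x. \<Sum>i<d. ip (tabloids \<mu> E) u (b i) * b i x)"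
  shows "kostka \<mu> (replicate (card E) 1) \<le> d"
proof (rule ccontr)
  let ?N = "card E" let ?\<nu> = "replicate ?N (1::nat)"
  let ?X = "ordered_partitions {..<?N} (\<lambda>_. 1) E" let ?S = "specht \<mu> E"
  let ?Y = "ssyt (rows_of \<mu>) ?\<nu>"
  assume "\<not> ?thesis"
  then have lt: "card {..<d} < card ?Y" by (simp add: kostka_def semistandard_tableaux_eq_ssyt)
  have X: "perm_invariant E ?X" by (rule perm_invariant_ordered_partitions)
  obtain t where t: "t \<in> tableaux \<mu> E" using tableaux_nonempty[OF finE mu] by blast
  interpret young_tableau \<mu> E t by (rule young_tableauI[OF finE mu t])
  have finY: "finite ?Y"
    using finite_semistandard_tableaux[OF mu] by (auto simp: semistandard_tableaux_eq_ssyt)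
  have "card ?X * (\<Prod>i<?N. fact 1) = fact ?N"
    using card_ordered_partitions[of "{..<?N}" E "\<lambda>_. 1"] finE by simp
  then have "card ?X \<noteq> 0" by (intro notI) simp
  then obtain x0 where x0: "x0 \<in> ?X" by (metis card.empty ex_in_conv)
  define \<phi> where "\<phi> T = inc_map \<mu> E ?X (length ?\<nu>) id T" for T
  have \<phi>: "perm_hom E ?S ?X (\<phi> T)" for T unfolding \<phi>_def by (rule inc_map_hom[OF X])
  obtain a where a: "\<exists>T\<in>?Y. a T \<noteq> 0" "\<forall>i\<in>{..<d}. (\<Sum>T\<in>?Y. a T * \<phi> T (b i) x0) = 0"
    using homogeneous_system_solution[OF finY _ lt, of "\<lambda>T i. \<phi> T (b i) x0"] by auto
  have 0: "(\<Sum>T\<in>?Y. a T * \<phi> T u x0) = 0" if u: "u \<in> ?S" for u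
  proof -
    have "\<phi> T u x0 = (\<Sum>i<d. ip (tabloids \<mu> E) u (b i) * \<phi> T (b i) x0)" for T
    proof -
      have "\<phi> T (\<lambda>x. \<Sum>i<d. ip (tabloids \<mu> E) u (b i) * b i x) = (\<lambda>x. \<Sum>i<d. ip (tabloids \<mu> E) u (b i) * \<phi> T (b i) x)"
        by (rule linear_map_on_sum[where S = ?S])
           (use \<phi>[of T] b in \<open>auto simp: perm_hom_def lin_subspace_specht\<close>)
      then show ?thesis using exp[OF u] by metis
    qed
    then have "(\<Sum>T\<in>?Y. a T * \<phi> T u x0) = (\<Sum>i<d. ip (tabloids \<mu> E) u (b i) * (\<Sum>T\<in>?Y. a T * \<phi> T (b i) x0))"
      unfolding sum_distrib_left by (subst sum.swap) (simp add: sum_distrib_left mult_ac)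
    then show ?thesis using a(2) by simp
  qed
  have "(\<Sum>T\<in>?Y. a T * \<phi> T e r) = 0" if r: "r \<in> ?X" for r
  proof -
    obtain p where p: "p permutes E" "r = relabel p x0"
      using singleton_partitions_transitive[OF x0 r] by blast
    let ?i = "inv_into UNIV p"
    have i: "?i permutes E" by (rule permutes_inv[OF p(1)])
    have "\<phi> T e r = \<phi> T (pact ?i e) x0" for T
    proof -
      have "\<phi> T (pact ?i e) = pact ?i (\<phi> T e)" using \<phi>[of T] i e_specht by (simp add: perm_hom_def)
      then show ?thesis by (simp only: pact_def permutes_inv_inv[OF p(1)] p(2))
    qed
    moreover have "pact ?i e \<in> ?S" using perm_submodule_specht[OF finE mu] i e_specht by (simp add: perm_submodule_def)
    ultimately show ?thesis using 0[of "pact ?i e"] by simp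
  qed
  moreover have "bij_betw id {..<length ?\<nu>} {..<?N}" by simp
  ultimately have "\<forall>T\<in>?Y. a T = 0"
    unfolding \<phi>_def by (intro inc_maps_independent[where I = "{..<?N}" and m = "\<lambda>_. 1" and \<iota> = id]) auto
  then show False using a(1) by blast
qed

text \<open>The conclusion speaks of isometric homomorphisms instead of subspaces because each copy
  has to be matched later with a prescribed projection.\<close>

theorem young_rule:
  fixes E :: "'a set" and I :: "'i set" and m :: "'i \<Rightarrow> nat" and \<iota> :: "nat \<Rightarrow> 'i" and \<nu> :: "nat list"
  assumes finE: "finite E" and \<iota>: "bij_betw \<iota> {..<length \<nu>} I" and m: "\<And>k. k < length \<nu> \<Longrightarrow> m (\<iota> k) = \<nu> ! k"
    and size: "sum_list \<nu> = card E"
  defines "X \<equiv> ordered_partitions I m E" and "J \<equiv> SIGMA \<mu>:young_diagrams (card E). {..<kostka \<mu> \<nu>}"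
  obtains \<psi> where "\<And>a. a \<in> J \<Longrightarrow> perm_hom E (specht (fst a) E) X (\<psi> a)"
    "\<And>a b u v. a \<in> J \<Longrightarrow> b \<in> J \<Longrightarrow> u \<in> specht (fst a) E \<Longrightarrow> v \<in> specht (fst b) E \<Longrightarrow>
        ip X (\<psi> a u) (\<psi> b v) = (if a = b then ip (tabloids (fst a) E) u v else 0)"
    "\<And>f. f \<in> funs_on X \<Longrightarrow> \<exists>v. (\<forall>a\<in>J. v a \<in> specht (fst a) E) \<and> f = (\<lambda>r. \<Sum>a\<in>J. \<psi> a (v a) r)"
proof -
  let ?Y = "young_diagrams (card E)"
  have finI: "finite I" using \<iota> bij_betw_finite by blast
  have X: "perm_invariant E X" unfolding X_def by (rule perm_invariant_ordered_partitions)
  have finX: "finite X" unfolding X_def by (rule finite_ordered_partitions[OF finI finE])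
  have "\<forall>\<mu>. \<exists>\<psi>. \<mu> \<in> ?Y \<longrightarrow> (\<forall>j<kostka \<mu> \<nu>. perm_hom E (specht \<mu> E) X (\<psi> j)) \<and>
    (\<forall>j<kostka \<mu> \<nu>. \<forall>k<kostka \<mu> \<nu>. \<forall>u\<in>specht \<mu> E. \<forall>v\<in>specht \<mu> E.
       ip X (\<psi> j u) (\<psi> k v) = (if j = k then ip (tabloids \<mu> E) u v else 0))"
    using specht_isometries[OF finE \<iota> m] unfolding X_def by blast
  then obtain \<psi> where \<psi>: "\<And>\<mu> j. \<mu> \<in> ?Y \<Longrightarrow> j < kostka \<mu> \<nu> \<Longrightarrow> perm_hom E (specht \<mu> E) X (\<psi> \<mu> j)"
    and \<psi>ip: "\<And>\<mu> j k u v. \<mu> \<in> ?Y \<Longrightarrow> j < kostka \<mu> \<nu> \<Longrightarrow> k < kostka \<mu> \<nu> \<Longrightarrow> u \<in> specht \<mu> E \<Longrightarrow> v \<in> specht \<mu> E \<Longrightarrow>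
       ip X (\<psi> \<mu> j u) (\<psi> \<mu> k v) = (if j = k then ip (tabloids \<mu> E) u v else 0)"
    by metis
  have "\<forall>\<mu>. \<exists>d b. \<mu> \<in> ?Y \<longrightarrow> (\<forall>i<d. b i \<in> specht \<mu> E) \<and> orthonormal (tabloids \<mu> E) {..<d} b \<and>
     kostka \<mu> (replicate (card E) 1) \<le> d"
  proof
    fix \<mu>
    show "\<exists>d b. \<mu> \<in> ?Y \<longrightarrow> (\<forall>i<d. b i \<in> specht \<mu> E) \<and> orthonormal (tabloids \<mu> E) {..<d} b \<and>
     kostka \<mu> (replicate (card E) 1) \<le> d"
    proof (cases "\<mu> \<in> ?Y")
      case True
      obtain d :: nat and b where db: "\<And>i. i < d \<Longrightarrow> b i \<in> specht \<mu> E" "orthonormal (tabloids \<mu> E) {..<d} b"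
        "\<And>u. u \<in> specht \<mu> E \<Longrightarrow> u = (\<lambda>x. \<Sum>i<d. ip (tabloids \<mu> E) u (b i) * b i x)"
        using orthonormal_basis_exists[OF finite_tabloids[OF finE] lin_subspace_specht specht_funs_on[OF finE True]] by blast
      then show ?thesis using specht_dimension[OF finE True, of d b] by blast
    qed blast
  qed
  then obtain d :: "nat list \<Rightarrow> nat" and b
    where b: "\<And>\<mu> i. \<mu> \<in> ?Y \<Longrightarrow> i < d \<mu> \<Longrightarrow> b \<mu> i \<in> specht \<mu> E"
    and bo: "\<And>\<mu>. \<mu> \<in> ?Y \<Longrightarrow> orthonormal (tabloids \<mu> E) {..<d \<mu>} (b \<mu>)"
    and bd: "\<And>\<mu>. \<mu> \<in> ?Y \<Longrightarrow> kostka \<mu> (replicate (card E) 1) \<le> d \<mu>"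
    by metis
  define \<Psi> where "\<Psi> a = \<psi> (fst a) (snd a)" for a
  have 1: "perm_hom E (specht (fst a) E) X (\<Psi> a)" if "a \<in> J" for a
    using \<psi> that by (auto simp: J_def \<Psi>_def)
  have 2: "ip X (\<Psi> a u) (\<Psi> c v) = (if a = c then ip (tabloids (fst a) E) u v else 0)"
    if ac: "a \<in> J" "c \<in> J" and uv: "u \<in> specht (fst a) E" "v \<in> specht (fst c) E" for a c u v
  proof (cases "fst a = fst c")
    case True
    then obtain \<mu> j k where eq: "a = (\<mu>, j)" "c = (\<mu>, k)" by (metis prod.collapse)
    have "ip X (\<psi> \<mu> j u) (\<psi> \<mu> k v) = (if j = k then ip (tabloids \<mu> E) u v else 0)"
      by (rule \<psi>ip) (use ac uv eq in \<open>auto simp: J_def\<close>)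
    then show ?thesis by (simp add: eq \<Psi>_def)
  next
    case False
    then have "ip X (\<Psi> a u) (\<Psi> c v) = 0"
      using specht_ip_distinct[OF finE _ _ False X 1[OF ac(1)] 1[OF ac(2)] uv] ac by (auto simp: J_def)
    then show ?thesis using False by auto
  qed
  define A where "A = (SIGMA a:J. {..<d (fst a)})"
  define B where "B = (\<lambda>(a, i). \<Psi> a (b (fst a) i))"
  have finJ: "finite J" unfolding J_def by auto
  have finA: "finite A" unfolding A_def using finJ by auto
  have JY: "fst a \<in> ?Y" if "a \<in> J" for a using that by (auto simp: J_def)
  have "orthonormal X A B" unfolding orthonormal_def
  proof (intro ballI)
    fix x y assume "x \<in> A" "y \<in> A"
    then obtain a i c k where xy: "x = (a, i)" "y = (c, k)" "a \<in> J" "c \<in> J" "i < d (fst a)" "k < d (fst c)"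
      by (auto simp: A_def)
    have "ip X (B x) (B y) = (if a = c then ip (tabloids (fst a) E) (b (fst a) i) (b (fst c) k) else 0)"
      using 2[OF xy(3,4)] b JY xy by (simp add: B_def)
    also have "\<dots> = (if x = y then 1 else 0)" using bo[OF JY[OF xy(3)]] xy by (auto simp: orthonormal_def)
    finally show "ip X (B x) (B y) = (if x = y then 1 else 0)" .
  qed
  moreover have "B x \<in> funs_on X" if "x \<in> A" for x
    using that 1 b JY by (auto simp: A_def B_def perm_hom_def)
  \<comment> \<open>The product of the factorials of the parts cancels from the two expressions for
    the factorial of \<open>card E\<close>, which leaves \<open>card X\<close> as the sum in
    \<open>kostka_sum_fact\<close>; then \<open>bd\<close> replaces numbers of standard tableaux by
    dimensions.\<close>
  moreover have "card X \<le> card A"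
  proof -
    have "(\<Prod>i\<in>I. fact (m i) :: nat) = (\<Prod>k<length \<nu>. fact (\<nu> ! k))"
      using prod.reindex_bij_betw[OF \<iota>, of "\<lambda>i. fact (m i) :: nat"] m by simp
    also have "\<dots> = prod_list (map fact \<nu>)"
      by (simp add: prod.list_conv_set_nth atLeast0LessThan)
    finally have P: "(\<Prod>i\<in>I. fact (m i) :: nat) = prod_list (map fact \<nu>)" .
    have "sum m I = (\<Sum>k<length \<nu>. \<nu> ! k)" using sum.reindex_bij_betw[OF \<iota>, of m] m by simp
    also have "\<dots> = card E" using size by (simp add: sum_list_sum_nth atLeast0LessThan)
    finally have "card X * prod_list (map fact \<nu>) = fact (card E)"
      using card_ordered_partitions[OF finI finE, of m] by (simp add: X_def P)
    also have "\<dots> = (\<Sum>\<mu>\<in>?Y. kostka \<mu> \<nu> * kostka \<mu> (replicate (card E) 1)) * prod_list (map fact \<nu>)"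
      using kostka_sum_fact[of \<nu>] by (simp add: size)
    moreover have "prod_list (map fact \<nu>) \<noteq> (0::nat)" by (induction \<nu>) simp_all
    ultimately have "card X = (\<Sum>\<mu>\<in>?Y. kostka \<mu> \<nu> * kostka \<mu> (replicate (card E) 1))" by simp
    also have "\<dots> \<le> (\<Sum>\<mu>\<in>?Y. kostka \<mu> \<nu> * d \<mu>)" by (intro sum_mono mult_left_mono bd) auto
    also have "\<dots> = (\<Sum>\<mu>\<in>?Y. \<Sum>j<kostka \<mu> \<nu>. d \<mu>)" by simp
    also have "\<dots> = (\<Sum>a\<in>J. d (fst a))" unfolding J_def by (subst sum.Sigma) (auto simp: case_prod_beta)
    also have "\<dots> = card A" unfolding A_def using finJ by simp
    finally show ?thesis .
  qed
  ultimately have complete: "f = (\<lambda>y. \<Sum>x\<in>A. ip X f (B x) * B x y)" if "f \<in> funs_on X" for f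
    using orthonormal_complete[OF finX finA] that by blast
  have 3: "\<exists>v. (\<forall>a\<in>J. v a \<in> specht (fst a) E) \<and> f = (\<lambda>r. \<Sum>a\<in>J. \<Psi> a (v a) r)" if f: "f \<in> funs_on X" for f
  proof (intro exI conjI ballI)
    let ?v = "\<lambda>a r. \<Sum>i<d (fst a). ip X f (B (a, i)) * b (fst a) i r"
    show "?v a \<in> specht (fst a) E" if "a \<in> J" for a
      by (rule lin_subspace_sum[OF lin_subspace_specht]) (use b JY[OF that] in auto)
    have "\<Psi> a (?v a) = (\<lambda>r. \<Sum>i<d (fst a). ip X f (B (a, i)) * B (a, i) r)" if a: "a \<in> J" for a
    proof -
      have "\<Psi> a (\<lambda>r. \<Sum>i<d (fst a). ip X f (B (a, i)) * b (fst a) i r) =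
          (\<lambda>r. \<Sum>i<d (fst a). ip X f (B (a, i)) * \<Psi> a (b (fst a) i) r)"
        by (rule linear_map_on_sum[where S = "specht (fst a) E"])
           (use 1[OF a] b JY[OF a] in \<open>auto simp: perm_hom_def lin_subspace_specht\<close>)
      then show ?thesis by (simp add: B_def)
    qed
    then have "(\<lambda>r. \<Sum>a\<in>J. \<Psi> a (?v a) r) = (\<lambda>r. \<Sum>a\<in>J. \<Sum>i<d (fst a). ip X f (B (a, i)) * B (a, i) r)"
      by simp
    also have "\<dots> = (\<lambda>y. \<Sum>x\<in>A. ip X f (B x) * B x y)"
      unfolding A_def by (subst sum.Sigma) (auto simp: finJ case_prod_beta)
    finally show "f = (\<lambda>r. \<Sum>a\<in>J. \<Psi> a (?v a) r)" using complete[OF f] by simp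
  qed
  show ?thesis by (rule that[OF 1 2 3])
qed

section \<open>Square-summable functions\<close>

definition nsq :: "('x \<Rightarrow> complex) \<Rightarrow> real" where
  "nsq f = (\<Sum>\<^sub>\<infinity>x\<in>UNIV. (cmod (f x))\<^sup>2)"

lemma l2D: "f \<in> l2 X \<Longrightarrow> x \<notin> X \<Longrightarrow> f x = 0" "f \<in> l2 X \<Longrightarrow> (\<lambda>x. (cmod (f x))\<^sup>2) summable_on UNIV"
  by (auto simp: l2_def)

lemma l2_UNIV: "f \<in> l2 X \<Longrightarrow> f \<in> l2 UNIV"
  by (simp add: l2_def)

lemma l2_norm_nsq: "l2_norm f = sqrt (nsq f)"
  by (simp add: l2_norm_def nsq_def)

lemma nsq_nonneg: "0 \<le> nsq f"
  unfolding nsq_def by (rule infsum_nonneg) simp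

lemma summable_on_le:
  fixes f g :: "'x \<Rightarrow> real"
  assumes "f summable_on A" "\<And>x. x \<in> A \<Longrightarrow> g x \<le> f x" "\<And>x. x \<in> A \<Longrightarrow> 0 \<le> g x"
  shows "g summable_on A"
  using assms by (rule summable_on_comparison_test)

lemma l2I:
  assumes "\<And>x. x \<notin> X \<Longrightarrow> f x = 0" "g summable_on UNIV" "\<And>x. (cmod (f x))\<^sup>2 \<le> g x"
  shows "f \<in> l2 X"
  unfolding l2_def using assms summable_on_le[OF assms(2), of "\<lambda>x. (cmod (f x))\<^sup>2"] by auto

lemma cmod_add_sq: "(cmod (a + b))\<^sup>2 \<le> 2 * (cmod a)\<^sup>2 + 2 * (cmod b)\<^sup>2"
proof -
  have "(cmod (a + b))\<^sup>2 \<le> (cmod a + cmod b)\<^sup>2" by (intro power_mono norm_triangle_ineq) auto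
  also have "\<dots> \<le> 2 * (cmod a)\<^sup>2 + 2 * (cmod b)\<^sup>2"
    using zero_le_power2[of "cmod a - cmod b"] by (simp add: power2_eq_square algebra_simps)
  finally show ?thesis .
qed

lemma lin_subspace_l2: "lin_subspace (l2 X)"
  unfolding lin_subspace_def
proof (intro conjI ballI allI)
  show "(\<lambda>_. 0) \<in> l2 X" by (simp add: l2_def)
  fix f g a b assume f: "f \<in> l2 X" and g: "g \<in> l2 X"
  show "(\<lambda>x. a * f x + b * g x) \<in> l2 X"
  proof (rule l2I)
    show "(\<lambda>x. (2 * (cmod a)\<^sup>2) * (cmod (f x))\<^sup>2 + (2 * (cmod b)\<^sup>2) * (cmod (g x))\<^sup>2) summable_on UNIV"
      by (intro summable_on_add summable_on_cmult_right l2D(2)[OF f] l2D(2)[OF g])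
    show "(cmod (a * f x + b * g x))\<^sup>2 \<le> (2 * (cmod a)\<^sup>2) * (cmod (f x))\<^sup>2 + (2 * (cmod b)\<^sup>2) * (cmod (g x))\<^sup>2" for x
      using cmod_add_sq[of "a * f x" "b * g x"] by (simp add: norm_mult power_mult_distrib)
  qed (use l2D(1)[OF f] l2D(1)[OF g] in auto)
qed

lemma l2_mult_summable:
  assumes f: "f \<in> l2 UNIV" and g: "g \<in> l2 UNIV"
  shows "(\<lambda>x. f x * cnj (g x)) summable_on UNIV"
proof -
  have "(\<lambda>x. (cmod (f x))\<^sup>2 + (cmod (g x))\<^sup>2) summable_on UNIV"
    by (intro summable_on_add l2D(2)[OF f] l2D(2)[OF g])
  then have "(\<lambda>x. norm (f x * cnj (g x))) summable_on UNIV"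
  proof (rule summable_on_le)
    fix x
    have "0 \<le> cmod (f x) * cmod (g x)" by simp
    then show "norm (f x * cnj (g x)) \<le> (cmod (f x))\<^sup>2 + (cmod (g x))\<^sup>2"
      using sum_squares_bound[of "cmod (f x)" "cmod (g x)"] unfolding norm_mult complex_mod_cnj by linarith
  qed simp
  then show ?thesis by (rule abs_summable_summable)
qed

lemma l2_inner_comb_left:
  assumes "f \<in> l2 UNIV" "g \<in> l2 UNIV" "h \<in> l2 UNIV"
  shows "l2_inner (\<lambda>x. a * f x + b * g x) h = a * l2_inner f h + b * l2_inner g h"
proof -
  have "l2_inner (\<lambda>x. a * f x + b * g x) h = (\<Sum>\<^sub>\<infinity>x\<in>UNIV. a * (f x * cnj (h x)) + b * (g x * cnj (h x)))"
    by (simp add: l2_inner_def algebra_simps)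
  also have "\<dots> = (\<Sum>\<^sub>\<infinity>x\<in>UNIV. a * (f x * cnj (h x))) + (\<Sum>\<^sub>\<infinity>x\<in>UNIV. b * (g x * cnj (h x)))"
    by (intro infsum_add summable_on_cmult_right l2_mult_summable assms)
  finally show ?thesis
    by (simp add: infsum_cmult_right' l2_inner_def)
qed

lemma l2_inner_cnj: "l2_inner g f = cnj (l2_inner f g)"
  by (simp add: l2_inner_def mult.commute flip: infsum_cnj)

lemma l2_inner_zero_left [simp]: "l2_inner (\<lambda>_. 0) g = 0"
  by (simp add: l2_inner_def)

lemma l2_inner_sum_left:
  assumes "\<And>i. i \<in> A \<Longrightarrow> f i \<in> l2 UNIV" "h \<in> l2 UNIV"
  shows "l2_inner (\<lambda>x. \<Sum>i\<in>A. c i * f i x) h = (\<Sum>i\<in>A. c i * l2_inner (f i) h)"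
  using assms(1)
proof (induction A rule: infinite_finite_induct)
  case (insert i A)
  have "(\<lambda>x. \<Sum>i\<in>A. c i * f i x) \<in> l2 UNIV" by (rule lin_subspace_sum[OF lin_subspace_l2]) (use insert in auto)
  then show ?case
    using l2_inner_comb_left[of "f i" "\<lambda>x. \<Sum>i\<in>A. c i * f i x" h "c i" 1] insert assms(2) by simp
qed simp_all

lemma l2_inner_sum_right:
  assumes "\<And>i. i \<in> A \<Longrightarrow> f i \<in> l2 UNIV" "h \<in> l2 UNIV"
  shows "l2_inner h (\<lambda>x. \<Sum>i\<in>A. c i * f i x) = (\<Sum>i\<in>A. cnj (c i) * l2_inner h (f i))"
  by (subst l2_inner_cnj) (simp add: l2_inner_sum_left[OF assms], simp add: l2_inner_cnj[of h])

lemma nsq_bound: "f \<in> l2 UNIV \<Longrightarrow> finite A \<Longrightarrow> (\<Sum>x\<in>A. (cmod (f x))\<^sup>2) \<le> nsq f"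
  unfolding nsq_def by (rule finite_sum_le_infsum) (auto dest: l2D(2))

lemma l2_inner_self: "f \<in> l2 UNIV \<Longrightarrow> l2_inner f f = of_real (nsq f)"
proof -
  assume f: "f \<in> l2 UNIV"
  have "l2_inner f f = (\<Sum>\<^sub>\<infinity>x\<in>UNIV. of_real ((cmod (f x))\<^sup>2))"
    unfolding l2_inner_def by (intro infsum_cong) (simp add: complex_norm_square[symmetric])
  also have "\<dots> = of_real (nsq f)"
    unfolding nsq_def
    by (rule infsumI[OF has_sum_bounded_linear[OF bounded_linear_of_real has_sum_infsum[OF l2D(2)[OF f]]]])
  finally show ?thesis .
qed

lemma l2_pointwise_limit:
  assumes F: "\<And>n. (\<lambda>x. F n x - f x) \<in> l2 UNIV" and lim: "(\<lambda>n::nat. l2_norm (\<lambda>x. F n x - f x)) \<longlonglongrightarrow> 0"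
  shows "(\<lambda>n. F n x) \<longlonglongrightarrow> f x"
proof -
  have "(\<lambda>n. F n x - f x) \<longlonglongrightarrow> 0"
  proof (rule tendsto_0_le[OF lim, of _ 1], rule always_eventually, rule allI)
    fix n
    have "(cmod (F n x - f x))\<^sup>2 \<le> nsq (\<lambda>x. F n x - f x)" using nsq_bound[OF F, of "{x}" n] by simp
    then have "norm (F n x - f x) \<le> l2_norm (\<lambda>x. F n x - f x)"
      unfolding l2_norm_nsq by (rule real_le_rsqrt)
    then show "norm (F n x - f x) \<le> norm (l2_norm (\<lambda>x. F n x - f x)) * 1" by simp
  qed
  then show ?thesis by (rule LIM_zero_cancel)
qed

lemma l2_closed_lin: "l2_closed_subspace V \<Longrightarrow> lin_subspace V"
  by (simp add: l2_closed_subspace_def lin_subspace_def)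

text \<open>Norm convergence implies pointwise convergence. Testing pointwise limits suits the
  subspaces below, which are given by linear conditions on finitely many values at a time.\<close>

lemma l2_closedI:
  assumes "lin_subspace V" "V \<subseteq> l2 UNIV"
    and "\<And>F f. (\<And>n::nat. F n \<in> V) \<Longrightarrow> f \<in> l2 UNIV \<Longrightarrow> (\<And>x. (\<lambda>n. F n x) \<longlonglongrightarrow> f x) \<Longrightarrow> f \<in> V"
  shows "l2_closed_subspace V"
  unfolding l2_closed_subspace_def
proof (intro conjI allI ballI impI)
  show "(\<lambda>_. 0) \<in> V" using assms(1) by (simp add: lin_subspace_def)
  show "V \<subseteq> l2 UNIV" by fact
  show "(\<lambda>x. a * f x + b * g x) \<in> V" if "f \<in> V" "g \<in> V" for f g a b
    by (rule lin_subspace_comb[OF assms(1) that])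
  fix F :: "nat \<Rightarrow> 'a \<Rightarrow> complex" and f assume f: "f \<in> l2 UNIV"
    and "(\<forall>n. F n \<in> V) \<and> (\<lambda>n. l2_norm (\<lambda>x. F n x - f x)) \<longlonglongrightarrow> 0"
  then have F: "\<And>n. F n \<in> V" and lim: "(\<lambda>n. l2_norm (\<lambda>x. F n x - f x)) \<longlonglongrightarrow> 0" by auto
  have d: "(\<lambda>x. F n x - f x) \<in> l2 UNIV" for n
    by (rule lin_subspace_diff[OF lin_subspace_l2]) (use F assms(2) f in auto)
  show "f \<in> V" by (rule assms(3)[OF F f l2_pointwise_limit[OF d lim]])
qed

lemma l2_closed_approx:
  assumes V: "l2_closed_subspace V" and f: "f \<in> l2 UNIV"
    and ap: "\<And>\<epsilon>. 0 < \<epsilon> \<Longrightarrow> \<exists>v\<in>V. nsq (\<lambda>x. v x - f x) \<le> \<epsilon>"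
  shows "f \<in> V"
proof -
  have "\<exists>v. v \<in> V \<and> nsq (\<lambda>x. v x - f x) \<le> 1 / real (Suc n)" for n using ap[of "1 / real (Suc n)"] by auto
  then obtain v where "\<forall>n. v n \<in> V \<and> nsq (\<lambda>x. v n x - f x) \<le> 1 / real (Suc n)"
    using choice[of "\<lambda>n v. v \<in> V \<and> nsq (\<lambda>x. v x - f x) \<le> 1 / real (Suc n)"] by blast
  then have v: "\<And>n. v n \<in> V" "\<And>n. nsq (\<lambda>x. v n x - f x) \<le> 1 / real (Suc n)" by auto
  have "(\<lambda>n. nsq (\<lambda>x. v n x - f x)) \<longlonglongrightarrow> 0"
  proof (rule tendsto_sandwich[OF _ _ tendsto_const])
    show "(\<lambda>n. 1 / real (Suc n)) \<longlonglongrightarrow> 0" by (rule LIMSEQ_Suc[OF lim_1_over_n])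
  qed (use v nsq_nonneg in \<open>auto intro: always_eventually\<close>)
  then have "(\<lambda>n. l2_norm (\<lambda>x. v n x - f x)) \<longlonglongrightarrow> sqrt 0"
    unfolding l2_norm_nsq by (rule tendsto_real_sqrt)
  then have lim: "(\<lambda>n. l2_norm (\<lambda>x. v n x - f x)) \<longlonglongrightarrow> 0" by simp
  have "\<forall>F. \<forall>f\<in>l2 UNIV. (\<forall>n::nat. F n \<in> V) \<and> (\<lambda>n. l2_norm (\<lambda>x. F n x - f x)) \<longlonglongrightarrow> 0 \<longrightarrow> f \<in> V"
    by (rule V[unfolded l2_closed_subspace_def, THEN conjunct2, THEN conjunct2, THEN conjunct2])
  from this[rule_format, OF f, of v] show ?thesis using v(1) lim by blast
qed

lemma l2_inner_restrict: "f \<in> l2 X \<Longrightarrow> l2_inner f g = (\<Sum>\<^sub>\<infinity>x\<in>X. f x * cnj (g x))"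
  unfolding l2_inner_def by (rule infsum_cong_neutral) (auto dest: l2D(1))

lemma l2_finite: "finite X \<Longrightarrow> l2 X = funs_on X"
proof -
  assume "finite X"
  then have "(\<lambda>x. (cmod (f x))\<^sup>2) summable_on UNIV" if "f \<in> funs_on X" for f
    using that summable_on_finite[of X "\<lambda>x. (cmod (f x))\<^sup>2"]
    by (subst summable_on_cong_neutral[of X UNIV]) (auto simp: funs_on_def)
  then show ?thesis by (auto simp: l2_def funs_on_def)
qed

lemma l2_inner_finite: "finite X \<Longrightarrow> f \<in> funs_on X \<Longrightarrow> l2_inner f g = ip X f g"
  using l2_inner_restrict[of f X g] by (simp add: l2_finite ip_def)

text \<open>Each vector is a finite combination of an orthonormal basis whose coefficients are
  finite sums of values, so the expansion passes to pointwise limits.\<close>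

lemma funs_on_closed:
  assumes X: "finite X" and V: "lin_subspace V" "V \<subseteq> funs_on X" shows "l2_closed_subspace V"
proof (rule l2_closedI[OF V(1)])
  show "V \<subseteq> l2 UNIV" using V(2) l2_finite[OF X] l2_UNIV by blast
  fix F :: "nat \<Rightarrow> 'a \<Rightarrow> complex" and f assume F: "\<And>n. F n \<in> V" and lim: "\<And>x. (\<lambda>n. F n x) \<longlonglongrightarrow> f x"
  obtain d :: nat and b where b: "\<And>i. i < d \<Longrightarrow> b i \<in> V" "orthonormal X {..<d} b"
    "\<And>u. u \<in> V \<Longrightarrow> u = (\<lambda>x. \<Sum>i<d. ip X u (b i) * b i x)"
    using orthonormal_basis_exists[OF X V] by blast
  have "f x = (\<Sum>i<d. ip X f (b i) * b i x)" for x
  proof (rule LIMSEQ_unique[OF lim])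
    have "(\<lambda>n. \<Sum>i<d. ip X (F n) (b i) * b i x) \<longlonglongrightarrow> (\<Sum>i<d. ip X f (b i) * b i x)"
      unfolding ip_def by (intro tendsto_sum tendsto_mult tendsto_const lim)
    then show "(\<lambda>n. F n x) \<longlonglongrightarrow> (\<Sum>i<d. ip X f (b i) * b i x)"
      using b(3)[OF F] by (metis (no_types, lifting) ext)
  qed
  then have "f = (\<lambda>x. \<Sum>i<d. ip X f (b i) * b i x)" by blast
  moreover have "(\<lambda>x. \<Sum>i<d. ip X f (b i) * b i x) \<in> V" by (rule lin_subspace_sum[OF V(1)]) (use b in auto)
  ultimately show "f \<in> V" by simp
qed

section \<open>Permutation representations\<close>

locale perm_action =
  fixes G :: "'g monoid" and act :: "'g \<Rightarrow> 'x \<Rightarrow> 'x" and X :: "'x set"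
  assumes grp: "group G"
    and act_in: "g \<in> carrier G \<Longrightarrow> x \<in> X \<Longrightarrow> act g x \<in> X"
    and act_one: "x \<in> X \<Longrightarrow> act \<one>\<^bsub>G\<^esub> x = x"
    and act_mult: "g \<in> carrier G \<Longrightarrow> h \<in> carrier G \<Longrightarrow> x \<in> X \<Longrightarrow> act (g \<otimes>\<^bsub>G\<^esub> h) x = act g (act h x)"
begin

interpretation group G by (rule grp)

abbreviation "\<rho> \<equiv> permutation_rep G act X"
abbreviation "ract \<equiv> rep_act \<rho>"

lemma ract: "ract g f = (\<lambda>x. if x \<in> X then f (act (inv\<^bsub>G\<^esub> g) x) else 0)"
  by (simp add: permutation_rep_def)

lemma act_inv [simp]: "g \<in> carrier G \<Longrightarrow> x \<in> X \<Longrightarrow> act (inv\<^bsub>G\<^esub> g) (act g x) = x"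
  "g \<in> carrier G \<Longrightarrow> x \<in> X \<Longrightarrow> act g (act (inv\<^bsub>G\<^esub> g) x) = x"
  using act_mult[of "inv\<^bsub>G\<^esub> g" g x] act_mult[of g "inv\<^bsub>G\<^esub> g" x] act_one by (simp_all add: l_inv r_inv)

lemma act_bij: "g \<in> carrier G \<Longrightarrow> bij_betw (act g) X X"
  by (rule bij_betwI[where g = "act (inv\<^bsub>G\<^esub> g)"]) (auto simp: act_in)

lemma ract_act: "g \<in> carrier G \<Longrightarrow> x \<in> X \<Longrightarrow> ract g f (act g x) = f x"
  by (simp add: ract act_in)

lemma ract_l2: assumes g: "g \<in> carrier G" and f: "f \<in> l2 X" shows "ract g f \<in> l2 X"
proof -
  have "(\<lambda>x. (cmod (f x))\<^sup>2) summable_on X" using l2D(2)[OF f] by (rule summable_on_subset_banach) simp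
  then have "(\<lambda>x. (cmod (f (act (inv\<^bsub>G\<^esub> g) x)))\<^sup>2) summable_on X"
    using summable_on_reindex_bij_betw[OF act_bij, of "inv\<^bsub>G\<^esub> g" "\<lambda>x. (cmod (f x))\<^sup>2"] g by simp
  then have "(\<lambda>x. (cmod (ract g f x))\<^sup>2) summable_on UNIV"
    by (subst summable_on_cong_neutral[where g = "\<lambda>x. (cmod (f (act (inv\<^bsub>G\<^esub> g) x)))\<^sup>2" and T = X]) (auto simp: ract)
  then show ?thesis by (simp add: l2_def) (simp add: ract)
qed

lemma ract_inner:
  assumes g: "g \<in> carrier G" and f: "f \<in> l2 X" and h: "h \<in> l2 X"
  shows "l2_inner (ract g f) (ract g h) = l2_inner f h"
proof -
  have "l2_inner (ract g f) (ract g h) = (\<Sum>\<^sub>\<infinity>x\<in>X. f (act (inv\<^bsub>G\<^esub> g) x) * cnj (h (act (inv\<^bsub>G\<^esub> g) x)))"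
    unfolding l2_inner_restrict[OF ract_l2[OF g f]] by (intro infsum_cong) (simp add: ract)
  also have "\<dots> = (\<Sum>\<^sub>\<infinity>x\<in>X. f x * cnj (h x))"
    using infsum_reindex_bij_betw[OF act_bij, of "inv\<^bsub>G\<^esub> g" "\<lambda>x. f x * cnj (h x)"] g by simp
  finally show ?thesis using l2_inner_restrict[OF f] by simp
qed

lemma ract_nsq: "g \<in> carrier G \<Longrightarrow> f \<in> l2 X \<Longrightarrow> nsq (ract g f) = nsq f"
  using ract_inner[of g f f] l2_inner_self[OF l2_UNIV[of f]] l2_inner_self[OF l2_UNIV[OF ract_l2[of g f]]]
  by simp

lemma ract_linear: "linear_map_on V (ract g)"
  by (auto simp: linear_map_on_def ract fun_eq_iff)

lemma ract_mult: "g \<in> carrier G \<Longrightarrow> h \<in> carrier G \<Longrightarrow> ract (g \<otimes>\<^bsub>G\<^esub> h) f = ract g (ract h f)"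
  by (auto simp: ract fun_eq_iff inv_mult_group act_mult act_in)

lemma ract_one: "f \<in> l2 X \<Longrightarrow> ract \<one>\<^bsub>G\<^esub> f = f"
  by (auto simp: ract fun_eq_iff act_one dest: l2D(1))

lemma unitary_subrep:
  assumes "l2_closed_subspace V" "V \<subseteq> l2 X" "\<And>g f. g \<in> carrier G \<Longrightarrow> f \<in> V \<Longrightarrow> ract g f \<in> V"
  shows "unitary_rep G (subrep \<rho> V)"
  unfolding unitary_rep_def subrep_def
  using assms grp ract_linear ract_inner ract_mult ract_one by (auto simp: subset_iff)

end

section \<open>Fibrations with finite fibres\<close>

text \<open>
  \<open>co r\<close> is the coordinate of \<open>r\<close> in its fibre, and \<open>gl r s\<close> is the point of the fibre of \<open>r\<close> with the
  coordinate \<open>s\<close>.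
\<close>

locale fibration =
  fixes X :: "'x set" and F :: "'y set" and co :: "'x \<Rightarrow> 'y" and gl :: "'x \<Rightarrow> 'y \<Rightarrow> 'x"
  assumes finF: "finite F"
    and co_in: "r \<in> X \<Longrightarrow> co r \<in> F"
    and gl_in: "r \<in> X \<Longrightarrow> s \<in> F \<Longrightarrow> gl r s \<in> X"
    and co_gl: "r \<in> X \<Longrightarrow> s \<in> F \<Longrightarrow> co (gl r s) = s"
    and gl_co: "r \<in> X \<Longrightarrow> gl r (co r) = r"
    and gl_gl: "r \<in> X \<Longrightarrow> s \<in> F \<Longrightarrow> s' \<in> F \<Longrightarrow> gl (gl r s) s' = gl r s'"
begin

definition fib :: "('x \<Rightarrow> complex) \<Rightarrow> 'x \<Rightarrow> ('y \<Rightarrow> complex)" where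
  "fib f r = (\<lambda>s. if s \<in> F then f (gl r s) else 0)"

definition lift :: "(('y \<Rightarrow> complex) \<Rightarrow> ('y \<Rightarrow> complex)) \<Rightarrow> ('x \<Rightarrow> complex) \<Rightarrow> ('x \<Rightarrow> complex)" where
  "lift T f = (\<lambda>r. if r \<in> X then T (fib f r) (co r) else 0)"

text \<open>The lift of a matrix unit. By \<open>lift_swap\<close> every lifted operator is a finite
  combination of these, which reduces square summability and adjoints to bijections between level
  sets of \<open>co\<close>.\<close>

definition swap :: "'y \<Rightarrow> 'y \<Rightarrow> ('x \<Rightarrow> complex) \<Rightarrow> ('x \<Rightarrow> complex)" where
  "swap s s' f = (\<lambda>r. if r \<in> X \<and> co r = s then f (gl r s') else 0)"

definition delta :: "'y \<Rightarrow> 'y \<Rightarrow> complex" where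
  "delta s = (\<lambda>s'. if s' = s then 1 else 0)"

definition op_on :: "(('y \<Rightarrow> complex) \<Rightarrow> ('y \<Rightarrow> complex)) \<Rightarrow> bool" where
  "op_on T \<longleftrightarrow> linear_map_on (funs_on F) T \<and> (\<forall>u\<in>funs_on F. T u \<in> funs_on F)"

lemma fib_funs_on: "fib f r \<in> funs_on F" by (simp add: fib_def funs_on_def)

lemma delta_funs_on: "s \<in> F \<Longrightarrow> delta s \<in> funs_on F" by (simp add: delta_def funs_on_def)

lemma op_kernel:
  assumes "op_on T" "u \<in> funs_on F" shows "T u = (\<lambda>s. \<Sum>s'\<in>F. u s' * T (delta s') s)"
proof -
  have "u = (\<lambda>s. \<Sum>s'\<in>F. u s' * delta s' s)"
    using assms(2) finF by (auto simp: fun_eq_iff delta_def funs_on_def if_distrib[of "\<lambda>z. _ * z"] cong: if_cong)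
  then have "T u = T (\<lambda>s. \<Sum>s'\<in>F. u s' * delta s' s)" by simp
  also have "\<dots> = (\<lambda>s. \<Sum>s'\<in>F. u s' * T (delta s') s)"
    by (rule linear_map_on_sum[where S = "funs_on F"])
       (use assms(1) delta_funs_on in \<open>auto simp: op_on_def lin_subspace_funs_on\<close>)
  finally show ?thesis .
qed

lemma fib_gl: "r \<in> X \<Longrightarrow> s \<in> F \<Longrightarrow> fib f (gl r s) = fib f r"
  by (auto simp: fib_def gl_gl fun_eq_iff)

lemma fib_lift: assumes "op_on T" "r \<in> X" shows "fib (lift T f) r = T (fib f r)"
proof
  fix s show "fib (lift T f) r s = T (fib f r) s"
  proof (cases "s \<in> F")
    case True
    then have "fib (lift T f) r s = lift T f (gl r s)" by (simp add: fib_def)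
    then show ?thesis using assms(2) True fib_gl[OF assms(2) True, of f]
      by (simp add: lift_def gl_in co_gl)
  next
    case False
    have "T (fib f r) \<in> funs_on F" using assms(1) fib_funs_on by (simp add: op_on_def)
    then show ?thesis using False by (simp add: fib_def[of "lift T f"] funs_on_def)
  qed
qed

lemma lift_lift: "op_on T \<Longrightarrow> lift S (lift T f) = lift (\<lambda>u. S (T u)) f"
  by (auto simp: lift_def[of S] lift_def[of "\<lambda>u. S (T u)"] fib_lift fun_eq_iff)

lemma lift_cong: "(\<And>u. u \<in> funs_on F \<Longrightarrow> S u = T u) \<Longrightarrow> lift S f = lift T f"
  by (auto simp: lift_def fib_funs_on fun_eq_iff)

lemma lift_id: "(\<And>x. x \<notin> X \<Longrightarrow> f x = 0) \<Longrightarrow> lift (\<lambda>u. u) f = f"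
  by (auto simp: lift_def fib_def co_in gl_co fun_eq_iff)

lemma swap_bij: "s \<in> F \<Longrightarrow> s' \<in> F \<Longrightarrow> bij_betw (\<lambda>r. gl r s') {r \<in> X. co r = s} {r \<in> X. co r = s'}"
  by (rule bij_betwI[where g = "\<lambda>r. gl r s"]) (auto simp: gl_in co_gl gl_gl, metis gl_co, metis gl_co)

lemma swap_l2:
  assumes s: "s \<in> F" "s' \<in> F" and f: "f \<in> l2 X" shows "swap s s' f \<in> l2 X"
proof -
  have "(\<lambda>x. (cmod (f x))\<^sup>2) summable_on {r \<in> X. co r = s'}"
    using l2D(2)[OF f] by (rule summable_on_subset_banach) simp
  then have "(\<lambda>r. (cmod (f (gl r s')))\<^sup>2) summable_on {r \<in> X. co r = s}"
    using summable_on_reindex_bij_betw[OF swap_bij[OF s], of "\<lambda>x. (cmod (f x))\<^sup>2"] by simp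
  then have "(\<lambda>x. (cmod (swap s s' f x))\<^sup>2) summable_on UNIV"
    by (subst summable_on_cong_neutral[where g = "\<lambda>r. (cmod (f (gl r s')))\<^sup>2" and T = "{r \<in> X. co r = s}"])
       (auto simp: swap_def)
  then show ?thesis by (simp add: l2_def) (simp add: swap_def)
qed

lemma swap_inner:
  assumes s: "s \<in> F" "s' \<in> F"
  shows "l2_inner (swap s s' f) g = l2_inner f (swap s' s g)"
proof -
  have "l2_inner (swap s s' f) g = (\<Sum>\<^sub>\<infinity>r\<in>{r \<in> X. co r = s}. f (gl r s') * cnj (g (gl (gl r s') s)))"
    unfolding l2_inner_def by (rule infsum_cong_neutral) (auto simp: swap_def gl_gl s gl_co)
  also have "\<dots> = (\<Sum>\<^sub>\<infinity>r\<in>{r \<in> X. co r = s'}. f r * cnj (g (gl r s)))"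
    using infsum_reindex_bij_betw[OF swap_bij[OF s], of "\<lambda>r. f r * cnj (g (gl r s))"] by simp
  also have "\<dots> = l2_inner f (swap s' s g)"
    unfolding l2_inner_def by (rule infsum_cong_neutral) (auto simp: swap_def)
  finally show ?thesis .
qed

lemma lift_swap:
  assumes "op_on T"
  shows "lift T f = (\<lambda>r. \<Sum>c\<in>F \<times> F. T (delta (snd c)) (fst c) * swap (fst c) (snd c) f r)"
proof
  fix r
  have "(\<Sum>c\<in>F \<times> F. T (delta (snd c)) (fst c) * swap (fst c) (snd c) f r) =
     (\<Sum>s\<in>F. \<Sum>s'\<in>F. T (delta s') s * swap s s' f r)"
    by (simp add: sum.cartesian_product case_prod_beta)
  also have "\<dots> = lift T f r"
  proof (cases "r \<in> X")
    case True
    have "(\<Sum>s\<in>F. \<Sum>s'\<in>F. T (delta s') s * swap s s' f r) =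
        (\<Sum>s\<in>F. if s = co r then (\<Sum>s'\<in>F. T (delta s') s * f (gl r s')) else 0)"
      using True by (intro sum.cong refl) (auto simp: swap_def intro!: sum.neutral)
    also have "\<dots> = (\<Sum>s'\<in>F. T (delta s') (co r) * f (gl r s'))" using finF co_in[OF True] by simp
    also have "\<dots> = T (fib f r) (co r)"
      by (subst op_kernel[OF assms fib_funs_on]) (simp add: fib_def mult.commute)
    finally show ?thesis using True by (simp add: lift_def)
  next
    case False
    then show ?thesis by (simp add: swap_def lift_def)
  qed
  finally show "lift T f r = (\<Sum>c\<in>F \<times> F. T (delta (snd c)) (fst c) * swap (fst c) (snd c) f r)" ..
qed

lemma lift_l2: "op_on T \<Longrightarrow> f \<in> l2 X \<Longrightarrow> lift T f \<in> l2 X"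
  unfolding lift_swap by (rule lin_subspace_sum[OF lin_subspace_l2]) (auto intro: swap_l2)

lemma lift_inner:
  assumes T: "op_on T" "op_on T'" and adj: "\<And>u v. u \<in> funs_on F \<Longrightarrow> v \<in> funs_on F \<Longrightarrow> ip F (T u) v = ip F u (T' v)"
    and f: "f \<in> l2 X" and g: "g \<in> l2 X"
  shows "l2_inner (lift T f) g = l2_inner f (lift T' g)"
proof -
  have k: "cnj (T' (delta s) s') = T (delta s') s" if "s \<in> F" "s' \<in> F" for s s'
  proof -
    have "ip F (T (delta s')) (delta s) = T (delta s') s"
      using finF that by (simp add: ip_def delta_def if_distrib[of "\<lambda>z. _ * cnj z"] cong: if_cong)
    moreover have "ip F (delta s') (T' (delta s)) = cnj (T' (delta s) s')"
      using finF that by (simp add: ip_def delta_def if_distrib[of "\<lambda>z. z * _"] cong: if_cong)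
    ultimately show ?thesis using adj[OF delta_funs_on delta_funs_on] that by simp
  qed
  have sw: "swap (fst c) (snd c) h \<in> l2 UNIV" if "c \<in> F \<times> F" "h \<in> l2 X" for c h
    using swap_l2[of "fst c" "snd c" h] that l2_UNIV by auto
  have "l2_inner (lift T f) g = (\<Sum>c\<in>F \<times> F. T (delta (snd c)) (fst c) * l2_inner (swap (fst c) (snd c) f) g)"
    unfolding lift_swap[OF T(1)] by (rule l2_inner_sum_left) (use sw f g l2_UNIV in auto)
  also have "\<dots> = (\<Sum>c\<in>F \<times> F. cnj (T' (delta (fst c)) (snd c)) * l2_inner f (swap (snd c) (fst c) g))"
    by (intro sum.cong refl) (auto simp: k swap_inner)
  also have "\<dots> = (\<Sum>c\<in>F \<times> F. cnj (T' (delta (snd c)) (fst c)) * l2_inner f (swap (fst c) (snd c) g))"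
    by (rule sum.reindex_bij_witness[of _ prod.swap prod.swap]) auto
  also have "\<dots> = l2_inner f (lift T' g)"
    unfolding lift_swap[OF T(2)] by (rule l2_inner_sum_right[symmetric]) (use sw f g l2_UNIV in auto)
  finally show ?thesis .
qed

lemma lift_linear: "op_on T \<Longrightarrow> linear_map_on V (lift T)"
  unfolding linear_map_on_def
proof (intro ballI allI ext)
  fix f g a b r assume T: "op_on T"
  have "fib (\<lambda>x. a * f x + b * g x) r = (\<lambda>s. a * fib f r s + b * fib g r s)" by (auto simp: fib_def)
  then show "lift T (\<lambda>x. a * f x + b * g x) r = a * lift T f r + b * lift T g r"
    using linear_map_on_comb[of "funs_on F" T "fib f r" "fib g r" a b] T fib_funs_on
    by (simp add: lift_def op_on_def)
qed

lemma lift_sum_op: "lift (\<lambda>u s. \<Sum>a\<in>A. T a u s) f = (\<lambda>r. \<Sum>a\<in>A. lift (T a) f r)"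
  by (auto simp: lift_def fun_eq_iff)

lemma lift_limit:
  assumes "op_on T" "\<And>x. (\<lambda>n. f n x) \<longlonglongrightarrow> g x" shows "(\<lambda>n::nat. lift T (f n) r) \<longlonglongrightarrow> lift T g r"
proof -
  have "lift T h r = (if r \<in> X then \<Sum>s\<in>F. h (gl r s) * T (delta s) (co r) else 0)" for h
    unfolding lift_def by (subst op_kernel[OF assms(1) fib_funs_on]) (simp add: fib_def)
  then show ?thesis by (auto intro!: tendsto_intros assms(2))
qed

text \<open>Describing the range of a projection as its set of fixed vectors turns closedness into a
  condition that is stable under pointwise limits.\<close>

lemma lift_image:
  assumes P: "op_on P" and idem: "\<And>u. u \<in> funs_on F \<Longrightarrow> P (P u) = P u"
  shows "lift P ` l2 X = {f \<in> l2 X. lift P f = f}"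
proof -
  have "lift P (lift P f) = lift P f" for f
    unfolding lift_lift[OF P] by (rule lift_cong[OF idem])
  then show ?thesis using lift_l2[OF P] by force
qed

lemma lift_fixed_closed:
  assumes P: "op_on P" shows "l2_closed_subspace {f \<in> l2 X. lift P f = f}"
proof -
  define V where "V = {f \<in> l2 X. lift P f = f}"
  have lin: "lin_subspace V"
    unfolding lin_subspace_def
  proof (intro conjI ballI allI)
    have "(\<lambda>_. 0) \<in> l2 X" using lin_subspace_l2 by (auto simp: lin_subspace_def)
    then show "(\<lambda>_. 0) \<in> V"
      using linear_map_on_zero[OF lift_linear[OF P], of _ UNIV] by (auto simp: V_def)
    fix f g a b assume "f \<in> V" "g \<in> V"
    then show "(\<lambda>x. a * f x + b * g x) \<in> V"
      using lin_subspace_comb[OF lin_subspace_l2, of f X g a b]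
        linear_map_on_comb[OF lift_linear[OF P], of f UNIV g a b] by (auto simp: V_def)
  qed
  have sub: "V \<subseteq> l2 UNIV" unfolding V_def using l2_UNIV by blast
  have "l2_closed_subspace V"
  proof (rule l2_closedI[OF lin sub])
    fix S :: "nat \<Rightarrow> 'x \<Rightarrow> complex" and f
    assume S: "\<And>n. S n \<in> V" and f: "f \<in> l2 UNIV" and lim: "\<And>x. (\<lambda>n. S n x) \<longlonglongrightarrow> f x"
    have "f x = 0" if "x \<notin> X" for x
    proof (rule LIMSEQ_unique[OF lim])
      have "S n x = 0" for n using S[of n] that l2D(1) by (auto simp: V_def)
      then show "(\<lambda>n. S n x) \<longlonglongrightarrow> 0" by simp
    qed
    then have "f \<in> l2 X" using f by (simp add: l2_def)
    moreover have "lift P f x = f x" for x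
    proof (rule LIMSEQ_unique[OF _ lim])
      show "(\<lambda>n. S n x) \<longlonglongrightarrow> lift P f x" using lift_limit[of P S f x, OF P lim] S by (simp add: V_def)
    qed
    ultimately show "f \<in> V" by (auto simp: V_def)
  qed
  then show ?thesis by (simp add: V_def)
qed

lemma lift_image_closed:
  assumes P: "op_on P" and idem: "\<And>u. u \<in> funs_on F \<Longrightarrow> P (P u) = P u"
  shows "l2_closed_subspace (lift P ` l2 X)"
proof -
  have eq: "lift P ` l2 X = {f \<in> l2 X. lift P f = f}" by (rule lift_image[OF P]) (rule idem)
  show ?thesis unfolding eq by (rule lift_fixed_closed[OF P])
qed

end

section \<open>Representations induced along a fibration\<close>

lemma has_sum_finite_sum:
  fixes f :: "'i \<Rightarrow> 'x \<Rightarrow> 'b :: topological_comm_monoid_add"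
  assumes "\<And>i. i \<in> A \<Longrightarrow> (f i has_sum s i) B"
  shows "((\<lambda>x. \<Sum>i\<in>A. f i x) has_sum (\<Sum>i\<in>A. s i)) B"
  using assms
proof (induction A rule: infinite_finite_induct)
  case (insert i A)
  have "((\<lambda>x. f i x + (\<Sum>i\<in>A. f i x)) has_sum (s i + (\<Sum>i\<in>A. s i))) B"
    by (rule has_sum_add) (use insert in auto)
  then show ?case using insert by simp
qed simp_all

lemma nsq_has_sum: "f \<in> l2 X \<Longrightarrow> ((\<lambda>x. (cmod (f x))\<^sup>2) has_sum nsq f) UNIV"
  unfolding nsq_def by (rule has_sum_infsum) (rule l2D(2))

lemma nsq_le:
  assumes "(g has_sum s) UNIV" "\<And>x. (cmod (f x))\<^sup>2 \<le> g x" shows "nsq f \<le> s"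
proof -
  have "g summable_on UNIV" using assms(1) by (rule has_sum_imp_summable)
  then have "(\<lambda>x. (cmod (f x))\<^sup>2) summable_on UNIV" by (rule summable_on_le) (use assms(2) in auto)
  then have "((\<lambda>x. (cmod (f x))\<^sup>2) has_sum nsq f) UNIV" unfolding nsq_def by (rule has_sum_infsum)
  then show ?thesis using assms by (rule has_sum_mono)
qed

text \<open>Cauchy-Schwarz against the constant vector. In the induction the cross term is split by
  the arithmetic-geometric mean inequality with weight \<open>sqrt n\<close>, which yields exactly
  the terms missing for n+1.\<close>

lemma cmod_sum_sq: "(cmod (\<Sum>i<n::nat. a i))\<^sup>2 \<le> real n * (\<Sum>i<n. (cmod (a i))\<^sup>2)"
proof (induction n)
  case (Suc n)
  let ?s = "\<Sum>i<n. a i" let ?q = "\<Sum>i<n. (cmod (a i))\<^sup>2"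
  have q: "0 \<le> ?q" by (rule sum_nonneg) simp
  have 1: "(cmod (?s + a n))\<^sup>2 \<le> (cmod ?s)\<^sup>2 + 2 * (cmod ?s * cmod (a n)) + (cmod (a n))\<^sup>2"
    using power_mono[OF norm_triangle_ineq[of ?s "a n"], of 2] by (simp add: power2_eq_square algebra_simps)
  have "2 * (cmod ?s * cmod (a n)) \<le> ?q + real n * (cmod (a n))\<^sup>2"
  proof (cases "n = 0")
    case False
    define r where "r = sqrt (real n)"
    have r: "r > 0" "r * r = real n" using False by (auto simp: r_def)
    have "2 * (cmod ?s / r) * (r * cmod (a n)) \<le> (cmod ?s / r)\<^sup>2 + (r * cmod (a n))\<^sup>2"
      by (rule sum_squares_bound)
    moreover have "2 * (cmod ?s / r) * (r * cmod (a n)) = 2 * (cmod ?s * cmod (a n))" using r(1) by simp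
    moreover have "(cmod ?s / r)\<^sup>2 = (cmod ?s)\<^sup>2 / real n" by (simp add: power_divide power2_eq_square r(2))
    moreover have "(r * cmod (a n))\<^sup>2 = real n * (cmod (a n))\<^sup>2"
      by (simp add: power_mult_distrib) (simp add: power2_eq_square r(2))
    moreover have "(cmod ?s)\<^sup>2 / real n \<le> ?q" using Suc False by (simp add: field_simps)
    ultimately show ?thesis by linarith
  qed simp
  then show ?case using 1 Suc q by (simp add: algebra_simps)
qed simp

text \<open>By \<open>act_gl\<close> and \<open>realize\<close> the stabilizer of the fibre of
  \<open>r0\<close> acts on its coordinates exactly by the permutations of E, so the fibre carries
  the finite representation. \<open>K_fix\<close> and \<open>K_move\<close> let K distinguish this
  fibre from the rest of X; \<open>act_transitive\<close> moves any other fibre to it.\<close>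

locale fibred_rep = perm_action G act X + fibration X F co gl
  for G :: "'g monoid" and act :: "'g \<Rightarrow> 'x \<Rightarrow> 'x" and X :: "'x set"
    and F :: "('i \<Rightarrow> 'a set) set" and co :: "'x \<Rightarrow> ('i \<Rightarrow> 'a set)" and gl :: "'x \<Rightarrow> ('i \<Rightarrow> 'a set) \<Rightarrow> 'x" +
  fixes E :: "'a set" and K :: "'g set" and r0 :: 'x
  assumes F_inv: "perm_invariant E F"
    and act_gl: "g \<in> carrier G \<Longrightarrow> r \<in> X \<Longrightarrow>
      \<exists>p. p permutes E \<and> (\<forall>s\<in>F. act g (gl r s) = gl (act g r) (relabel p s))"
    and r0: "r0 \<in> X"
    and act_transitive: "r \<in> X \<Longrightarrow> \<exists>g\<in>carrier G. act g r \<in> gl r0 ` F"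
    and realize: "p permutes E \<Longrightarrow> \<exists>g\<in>carrier G. \<forall>s\<in>F. act g (gl r0 s) = gl r0 (relabel p s)"
    and K_sub: "K \<subseteq> carrier G"
    and K_fix: "k \<in> K \<Longrightarrow> s \<in> F \<Longrightarrow> act k (gl r0 s) = gl r0 s"
    and K_move: "finite S \<Longrightarrow> S \<subseteq> X - gl r0 ` F \<Longrightarrow> \<exists>k\<in>K. act k ` S \<inter> S = {}"
begin

definition F0 where "F0 = gl r0 ` F"

definition ext :: "(('i \<Rightarrow> 'a set) \<Rightarrow> complex) \<Rightarrow> 'x \<Rightarrow> complex" where
  "ext u = (\<lambda>r. if r \<in> F0 then u (co r) else 0)"

definition cut :: "('x \<Rightarrow> complex) \<Rightarrow> 'x \<Rightarrow> complex" where
  "cut f = (\<lambda>r. if r \<in> F0 then f r else 0)"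

definition op_equiv :: "((('i \<Rightarrow> 'a set) \<Rightarrow> complex) \<Rightarrow> (('i \<Rightarrow> 'a set) \<Rightarrow> complex)) \<Rightarrow> bool" where
  "op_equiv T \<longleftrightarrow> op_on T \<and> (\<forall>p u. p permutes E \<longrightarrow> u \<in> funs_on F \<longrightarrow> T (pact p u) = pact p (T u))"

lemma op_equiv_on: "op_equiv T \<Longrightarrow> op_on T" by (simp add: op_equiv_def)

lemma F0_X: "F0 \<subseteq> X" using gl_in r0 by (auto simp: F0_def)

lemma finite_F0: "finite F0" using finF by (simp add: F0_def)

lemma F0_gl: "r \<in> F0 \<Longrightarrow> gl r0 (co r) = r" using co_gl r0 by (auto simp: F0_def)

lemma gl_F0: "r \<in> X \<Longrightarrow> s \<in> F \<Longrightarrow> gl r s \<in> F0 \<longleftrightarrow> r \<in> F0"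
proof -
  have *: "gl r s \<in> F0" if "r \<in> F0" "s \<in> F" for r s
    using that gl_gl[OF r0] by (auto simp: F0_def)
  assume r: "r \<in> X" and s: "s \<in> F"
  have "r = gl (gl r s) (co r)" using r s gl_gl[OF r s co_in[OF r]] gl_co by simp
  then show ?thesis using *[of r s] *[of "gl r s" "co r"] r s co_in by metis
qed

lemma fib_ext: "u \<in> funs_on F \<Longrightarrow> r \<in> X \<Longrightarrow> fib (ext u) r = (if r \<in> F0 then u else (\<lambda>_. 0))"
  by (auto simp: fib_def ext_def gl_F0 co_gl fun_eq_iff funs_on_def)

lemma r0_F0: "r0 \<in> F0" using co_in[OF r0] gl_co[OF r0] unfolding F0_def by (metis imageI)

lemma cut_ext: "cut f = ext (fib f r0)"
  using co_in F0_X by (auto simp: cut_def ext_def fib_def F0_gl fun_eq_iff)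

lemma cut_l2: "cut f \<in> l2 X"
proof -
  have "cut f \<in> funs_on F0" by (simp add: cut_def funs_on_def)
  then have "cut f \<in> l2 F0" using l2_finite[OF finite_F0] by simp
  then show ?thesis using F0_X by (auto simp: l2_def)
qed

lemma ext_fib: "u \<in> funs_on F \<Longrightarrow> ext u = cut (ext u)"
  by (auto simp: cut_def ext_def)

lemma ext_l2: "u \<in> funs_on F \<Longrightarrow> ext u \<in> l2 X"
  using ext_fib[of u] cut_l2[of "ext u"] by simp

lemma ext_inj: "u \<in> funs_on F \<Longrightarrow> v \<in> funs_on F \<Longrightarrow> ext u = ext v \<Longrightarrow> u = v"
  using fib_ext[OF _ r0] r0_F0 by metis

lemma ext_inner:
  assumes "u \<in> funs_on F" "v \<in> funs_on F" shows "l2_inner (ext u) (ext v) = ip F u v"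
proof -
  have "ext u \<in> funs_on F0" by (simp add: ext_def funs_on_def)
  then have "l2_inner (ext u) (ext v) = (\<Sum>r\<in>F0. u (co r) * cnj (v (co r)))"
    by (simp add: l2_inner_finite[OF finite_F0] ip_def ext_def)
  also have "\<dots> = (\<Sum>s\<in>F. u (co (gl r0 s)) * cnj (v (co (gl r0 s))))"
    unfolding F0_def by (rule sum.reindex[THEN trans]) (auto simp: inj_on_def dest: arg_cong[of _ _ co] simp: co_gl[OF r0])
  also have "\<dots> = ip F u v" by (simp add: ip_def co_gl[OF r0])
  finally show ?thesis .
qed

lemma lift_ext: assumes T: "op_on T" and u: "u \<in> funs_on F" shows "lift T (ext u) = ext (T u)"
proof
  fix r
  have "T (\<lambda>_. 0) = (\<lambda>_. 0)" using T linear_map_on_zero[of "funs_on F" T u] u by (simp add: op_on_def)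
  then show "lift T (ext u) r = ext (T u) r"
    using F0_X by (auto simp: lift_def fib_ext[OF u] ext_def[of "T u"])
qed

text \<open>A group element carries a fibre to a fibre and acts between their coordinates by some
  permutation of E. The permutation depends on the chosen coordinates, but an equivariant T commutes
  with all of them.\<close>

lemma lift_ract:
  assumes T: "op_equiv T" and g: "g \<in> carrier G"
  shows "lift T (ract g f) = ract g (lift T f)"
proof
  fix r show "lift T (ract g f) r = ract g (lift T f) r"
  proof (cases "r \<in> X")
    case True
    let ?i = "inv\<^bsub>G\<^esub> g"
    have i: "?i \<in> carrier G" using g grp by (simp add: group.inv_closed)
    have ir: "act ?i r \<in> X" by (rule act_in[OF i True])
    obtain p where p: "p permutes E" and pg: "\<forall>s\<in>F. act ?i (gl r s) = gl (act ?i r) (relabel p s)"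
      using act_gl[OF i True] by blast
    let ?p = "inv_into UNIV p"
    have rp: "relabel p s \<in> F \<longleftrightarrow> s \<in> F" for s by (rule perm_invariant_iff[OF F_inv p])
    have "fib (ract g f) r = pact ?p (fib f (act ?i r))"
      using pg True by (auto simp: fib_def pact_def ract gl_in permutes_inv_inv[OF p] rp fun_eq_iff)
    then have "lift T (ract g f) r = pact ?p (T (fib f (act ?i r))) (co r)"
      using T True permutes_inv[OF p] fib_funs_on by (simp add: lift_def op_equiv_def)
    also have "\<dots> = T (fib f (act ?i r)) (relabel p (co r))"
      by (simp add: pact_def permutes_inv_inv[OF p])
    also have "relabel p (co r) = co (act ?i r)"
    proof -
      have "act ?i r = gl (act ?i r) (relabel p (co r))"
        using pg co_in[OF True] gl_co[OF True] by metis
      then show ?thesis using co_gl[OF ir] rp co_in[OF True] by metis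
    qed
    finally show ?thesis using True ir by (simp add: ract lift_def)
  next
    case False
    then show ?thesis by (simp add: ract lift_def)
  qed
qed

lemma K_F0: "k \<in> K \<Longrightarrow> x \<in> X \<Longrightarrow> act k x \<in> F0 \<longleftrightarrow> x \<in> F0"
proof -
  assume k: "k \<in> K" and x: "x \<in> X"
  have kG: "k \<in> carrier G" using k K_sub by blast
  have f: "act k y = y" if "y \<in> F0" for y using that K_fix[OF k] by (auto simp: F0_def)
  have "x \<in> F0" if "act k x \<in> F0"
  proof -
    have "act k (act k x) = act k x" by (rule f[OF that])
    then have "act k x = x" using act_bij[OF kG] x act_in[OF kG x] by (auto simp: bij_betw_def inj_on_def)
    then show ?thesis using that by simp
  qed
  then show ?thesis using f by metis
qed

text \<open>Apply \<open>K_move\<close> repeatedly to the union of S and the translates found so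
  far. Elements of K preserve the complement of the base fibre, so the hypothesis on this union
  persists.\<close>

lemma K_moves:
  assumes S: "finite S" "S \<subseteq> X - F0"
  shows "\<exists>k. (\<forall>i<n::nat. k i \<in> K) \<and> (\<forall>i<n. \<forall>j<i. act (k i) ` S \<inter> act (k j) ` S = {})"
proof (induction n)
  case (Suc n)
  then obtain k where k: "\<forall>i<n. k i \<in> K" "\<forall>i<n. \<forall>j<i. act (k i) ` S \<inter> act (k j) ` S = {}" by blast
  let ?S = "S \<union> (\<Union>i<n. act (k i) ` S)"
  have "act (k i) ` S \<subseteq> X - F0" if "i < n" for i
    using S(2) k(1) that K_F0 act_in K_sub by blast
  then have "finite ?S" "?S \<subseteq> X - gl r0 ` F" using S by (auto simp: F0_def)
  from K_move[OF this] obtain c where c: "c \<in> K" "act c ` ?S \<inter> ?S = {}" by (rule bexE)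
  have "act c ` S \<inter> act (k j) ` S = {}" if "j < n" for j using c(2) that by blast
  then have "\<forall>i<Suc n. \<forall>j<i. act ((k(n := c)) i) ` S \<inter> act ((k(n := c)) j) ` S = {}"
    using k(2) by (auto simp: less_Suc_eq)
  moreover have "\<forall>i<Suc n. (k(n := c)) i \<in> K" using k(1) c(1) by (auto simp: less_Suc_eq)
  ultimately show ?case by blast
qed auto

text \<open>A nonzero value outside the base fibre would recur at arbitrarily many distinct
  translates of the point, contrary to square summability.\<close>

lemma K_fixed_cut:
  assumes f: "f \<in> l2 X" and fx: "\<And>k. k \<in> K \<Longrightarrow> ract k f = f" shows "f = cut f"
proof (rule ccontr)
  assume "f \<noteq> cut f"
  then obtain x where x: "x \<notin> F0" "f x \<noteq> 0" by (auto simp: cut_def fun_eq_iff split: if_splits)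
  then have xX: "x \<in> X" using l2D(1)[OF f] by blast
  define c where "c = (cmod (f x))\<^sup>2"
  have c: "c > 0" using x by (simp add: c_def)
  obtain n :: nat where n: "nsq f < real n * c" using reals_Archimedean3[OF c] by blast
  obtain k where k: "\<forall>i<n. k i \<in> K" "\<forall>i<n. \<forall>j<i. act (k i) ` {x} \<inter> act (k j) ` {x} = {}"
    using K_moves[of "{x}" n] x xX by auto
  have fk: "f (act (k i) x) = f x" if "i < n" for i
    using ract_act[of "k i" x f] fx[of "k i"] k(1) K_sub xX that by auto
  have inj: "inj_on (\<lambda>i. act (k i) x) {..<n}"
  proof (rule inj_onI)
    fix i j assume ij: "i \<in> {..<n}" "j \<in> {..<n}" "act (k i) x = act (k j) x"
    then show "i = j" using k(2)[rule_format, of i j] k(2)[rule_format, of j i] by (cases i j rule: linorder_cases) auto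
  qed
  have "(\<Sum>y\<in>(\<lambda>i. act (k i) x) ` {..<n}. (cmod (f y))\<^sup>2) = real n * c"
    unfolding sum.reindex[OF inj] using fk by (simp add: c_def)
  then show False using nsq_bound[OF l2_UNIV[OF f], of "(\<lambda>i. act (k i) x) ` {..<n}"] n by simp
qed

lemma ract_cut: "k \<in> K \<Longrightarrow> ract k (cut f) = cut f"
proof
  fix r assume k: "k \<in> K"
  have kG: "k \<in> carrier G" using k K_sub by blast
  show "ract k (cut f) r = cut f r"
  proof (cases "r \<in> X")
    case True
    then obtain x where x: "x \<in> X" "r = act k x" using act_bij[OF kG] by (auto simp: bij_betw_def)
    have "act k x = x" if "x \<in> F0" using that K_fix[OF k] by (auto simp: F0_def)
    then show ?thesis using ract_act[OF kG x(1), of "cut f"] x K_F0[OF k x(1)] by (auto simp: cut_def)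
  next
    case False
    then show ?thesis using F0_X by (auto simp: ract cut_def)
  qed
qed

text \<open>
  Averaging over elements of \<open>K\<close> that make a finite set disjoint from itself: the average of a vector
  converges to its restriction to the fibre of \<open>r0\<close>.
\<close>

lemma cut_in_invariant:
  assumes W: "l2_closed_subspace W" "W \<subseteq> l2 X" and inv: "\<And>g f. g \<in> carrier G \<Longrightarrow> f \<in> W \<Longrightarrow> ract g f \<in> W"
    and w: "w \<in> W"
  shows "cut w \<in> W"
proof (rule l2_closed_approx[OF W(1) l2_UNIV[OF cut_l2]])
  fix \<epsilon> :: real assume \<epsilon>: "0 < \<epsilon>"
  have wl: "w \<in> l2 X" using w W by blast
  define d where "d = (\<lambda>x. w x - cut w x)"
  have dl: "d \<in> l2 X" unfolding d_def by (rule lin_subspace_diff[OF lin_subspace_l2 wl cut_l2])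
  have d0: "d x = 0" if "x \<notin> X - F0" for x
    using that l2D(1)[OF wl, of x] F0_X by (auto simp: d_def cut_def)
  \<comment> \<open>The tail and the averaged main part will each contribute at most a quarter of
    \<epsilon>, and \<open>cmod_add_sq\<close> doubles both.\<close>
  obtain S0 where S0: "finite S0" "dist (\<Sum>x\<in>S0. (cmod (d x))\<^sup>2) (nsq d) \<le> \<epsilon> / 4"
    using infsum_finite_approximation[OF l2D(2)[OF dl], of "\<epsilon> / 4"] \<epsilon> unfolding nsq_def by auto
  define S where "S = S0 \<inter> (X - F0)"
  have S: "finite S" "S \<subseteq> X - F0" using S0 by (auto simp: S_def)
  have "(\<Sum>x\<in>S0. (cmod (d x))\<^sup>2) = (\<Sum>x\<in>S. (cmod (d x))\<^sup>2)"
    unfolding S_def by (rule sum.mono_neutral_right) (use S0 d0 in auto)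
  then have tail: "nsq d - (\<Sum>x\<in>S. (cmod (d x))\<^sup>2) \<le> \<epsilon> / 4"
    using S0(2) abs_ge_minus_self[of "(\<Sum>x\<in>S0. (cmod (d x))\<^sup>2) - nsq d"] unfolding dist_real_def by linarith
  define u where "u = (\<lambda>x. if x \<in> S then d x else 0)"
  define v where "v = (\<lambda>x. if x \<in> S then 0 else d x)"
  have ul: "u \<in> l2 X"
  proof (rule l2I)
    show "(\<lambda>x. (cmod (d x))\<^sup>2) summable_on UNIV" by (rule l2D(2)[OF dl])
  qed (use d0 in \<open>auto simp: u_def\<close>)
  have vl: "v \<in> l2 X"
  proof (rule l2I)
    show "(\<lambda>x. (cmod (d x))\<^sup>2) summable_on UNIV" by (rule l2D(2)[OF dl])
  qed (use d0 in \<open>auto simp: v_def\<close>)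
  have "((\<lambda>x. (cmod (u x))\<^sup>2) has_sum (\<Sum>x\<in>S. (cmod (d x))\<^sup>2)) UNIV"
    by (rule has_sum_finite_neutralI[of S]) (use S in \<open>auto simp: u_def\<close>)
  then have nu: "nsq u = (\<Sum>x\<in>S. (cmod (d x))\<^sup>2)" unfolding nsq_def by (rule infsumI)
  have "((\<lambda>x. (cmod (u x))\<^sup>2 + (cmod (v x))\<^sup>2) has_sum (nsq u + nsq v)) UNIV"
    by (intro has_sum_add nsq_has_sum[OF ul] nsq_has_sum[OF vl])
  moreover have "(\<lambda>x. (cmod (u x))\<^sup>2 + (cmod (v x))\<^sup>2) = (\<lambda>x. (cmod (d x))\<^sup>2)" by (auto simp: u_def v_def)
  ultimately have "((\<lambda>x. (cmod (d x))\<^sup>2) has_sum (nsq u + nsq v)) UNIV" by simp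
  then have "nsq d = nsq u + nsq v" unfolding nsq_def[of d] by (rule infsumI)
  then have nv: "nsq v \<le> \<epsilon> / 4" using tail nu by simp
  obtain n0 :: nat where n0: "nsq u < real n0 * (\<epsilon> / 4)" using reals_Archimedean3[of "\<epsilon> / 4"] \<epsilon> by auto
  \<comment> \<open>The successor keeps n positive, since the average divides by n.\<close>
  define n where "n = Suc n0"
  have n: "nsq u \<le> real n * (\<epsilon> / 4)" "0 < real n" using n0 \<epsilon> by (auto simp: n_def field_simps)
  obtain k where k: "\<forall>i<n. k i \<in> K" "\<forall>i<n. \<forall>j<i. act (k i) ` S \<inter> act (k j) ` S = {}"
    using K_moves[OF S] by blast
  have kG: "k i \<in> carrier G" if "i < n" for i using k(1) K_sub that by blast
  define av where "av f = (\<lambda>x. \<Sum>i<n. (1 / of_nat n) * ract (k i) f x)" for f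
  have avW: "av w \<in> W" unfolding av_def
    by (rule lin_subspace_sum[OF l2_closed_lin[OF W(1)]]) (use inv kG w in auto)
  have "av w x - cut w x = av u x + av v x" for x
  proof -
    have wx: "ract (k i) w x = cut w x + (ract (k i) u x + ract (k i) v x)" if "i < n" for i
    proof -
      have "w y = cut w y + (u y + v y)" for y by (simp add: u_def v_def d_def)
      then have "ract (k i) w x = ract (k i) (cut w) x + (ract (k i) u x + ract (k i) v x)"
        unfolding ract by simp
      then show ?thesis using ract_cut k(1) that by simp
    qed
    have "av w x = (\<Sum>i<n. (1 / of_nat n) * (cut w x + (ract (k i) u x + ract (k i) v x)))"
      unfolding av_def using wx by simp
    also have "\<dots> = cut w x + (av u x + av v x)"
      using n(2) by (simp add: av_def distrib_left sum.distrib add_divide_distrib)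
    finally show ?thesis by simp
  qed
  then have eq: "(\<lambda>x. av w x - cut w x) = (\<lambda>x. av u x + av v x)" by blast
  \<comment> \<open>The translates of u have disjoint supports, so at most one summand is nonzero at
    x and averaging divides the squared norm by n. The translates of v may overlap; for them
    \<open>avv\<close> only says that averaging does not increase the squared norm.\<close>
  have au: "(cmod (av u x))\<^sup>2 = (\<Sum>i<n. (1 / real n)\<^sup>2 * (cmod (ract (k i) u x))\<^sup>2)" for x
  proof (cases "\<exists>i<n. ract (k i) u x \<noteq> 0")
    case True
    then obtain i where i: "i < n" "ract (k i) u x \<noteq> 0" by blast
    have supp: "x \<in> act (k j) ` S" if jn: "j < n" and nz: "ract (k j) u x \<noteq> 0" for j
    proof -
      have "x \<in> X" using nz by (auto simp: ract split: if_splits)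
      then obtain y where y: "y \<in> X" "x = act (k j) y" using act_bij[OF kG[OF jn]] by (auto simp: bij_betw_def)
      then have "u y \<noteq> 0" using ract_act[OF kG[OF jn] y(1), of u] nz by simp
      then show ?thesis using y by (auto simp: u_def split: if_splits)
    qed
    have z: "ract (k j) u x = 0" if "j < n" "j \<noteq> i" for j
    proof (rule ccontr)
      assume "ract (k j) u x \<noteq> 0"
      then have "x \<in> act (k j) ` S \<inter> act (k i) ` S" using supp that(1) i by blast
      then show False using k(2) that i(1) by (metis Int_commute empty_iff linorder_neqE_nat)
    qed
    have "av u x = (1 / of_nat n) * ract (k i) u x"
      unfolding av_def using z i(1) by (subst sum.remove[of _ i]) (auto intro!: sum.neutral)
    moreover have "(\<Sum>j<n. (1 / real n)\<^sup>2 * (cmod (ract (k j) u x))\<^sup>2) = (1 / real n)\<^sup>2 * (cmod (ract (k i) u x))\<^sup>2"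
      using z i(1) by (subst sum.remove[of _ i]) (auto intro!: sum.neutral)
    ultimately show ?thesis by (simp add: norm_mult norm_divide power_mult_distrib power_divide)
  qed (auto simp: av_def)
  have avv: "(cmod (av v x))\<^sup>2 \<le> (\<Sum>i<n. (1 / real n) * (cmod (ract (k i) v x))\<^sup>2)" for x
  proof -
    have "av v x = (1 / of_nat n) * (\<Sum>i<n. ract (k i) v x)" by (simp add: av_def sum_distrib_left)
    then have "(cmod (av v x))\<^sup>2 = (1 / real n)\<^sup>2 * (cmod (\<Sum>i<n. ract (k i) v x))\<^sup>2"
      by (simp add: norm_mult norm_divide power_divide)
    also have "\<dots> \<le> (1 / real n)\<^sup>2 * (real n * (\<Sum>i<n. (cmod (ract (k i) v x))\<^sup>2))"
      by (intro mult_left_mono cmod_sum_sq) simp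
    also have "\<dots> = (1 / real n) * (\<Sum>i<n. (cmod (ract (k i) v x))\<^sup>2)"
      using n(2) by (simp add: power2_eq_square)
    finally show ?thesis by (simp add: sum_distrib_left)
  qed
  have "nsq (\<lambda>x. av u x + av v x) \<le> 2 * (\<Sum>i<n. (1 / real n)\<^sup>2 * nsq u) + 2 * (\<Sum>i<n. (1 / real n) * nsq v)"
  proof (rule nsq_le)
    have hu: "((\<lambda>x. (cmod (ract (k i) u x))\<^sup>2) has_sum nsq u) UNIV" if "i < n" for i
      using nsq_has_sum[OF ract_l2[OF kG[OF that] ul]] ract_nsq[OF kG[OF that] ul] by simp
    have hv: "((\<lambda>x. (cmod (ract (k i) v x))\<^sup>2) has_sum nsq v) UNIV" if "i < n" for i
      using nsq_has_sum[OF ract_l2[OF kG[OF that] vl]] ract_nsq[OF kG[OF that] vl] by simp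
    show "((\<lambda>x. 2 * (\<Sum>i<n. (1 / real n)\<^sup>2 * (cmod (ract (k i) u x))\<^sup>2) + 2 * (\<Sum>i<n. (1 / real n) * (cmod (ract (k i) v x))\<^sup>2))
       has_sum (2 * (\<Sum>i<n. (1 / real n)\<^sup>2 * nsq u) + 2 * (\<Sum>i<n. (1 / real n) * nsq v))) UNIV"
      by (intro has_sum_add has_sum_cmult_right has_sum_finite_sum) (auto intro: hu hv)
    show "(cmod (av u x + av v x))\<^sup>2 \<le> 2 * (\<Sum>i<n. (1 / real n)\<^sup>2 * (cmod (ract (k i) u x))\<^sup>2) + 2 * (\<Sum>i<n. (1 / real n) * (cmod (ract (k i) v x))\<^sup>2)" for x
      using cmod_add_sq[of "av u x" "av v x"] au[of x] avv[of x] by linarith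
  qed
  also have "\<dots> = 2 * (nsq u / real n) + 2 * nsq v"
    using n(2) by (simp add: power2_eq_square field_simps)
  also have "\<dots> \<le> \<epsilon>"
  proof -
    have "nsq u / real n \<le> \<epsilon> / 4" using n by (simp add: field_simps)
    then show ?thesis using nv by linarith
  qed
  finally have "nsq (\<lambda>x. av w x - cut w x) \<le> \<epsilon>" unfolding eq .
  then show "\<exists>v\<in>W. nsq (\<lambda>x. v x - cut w x) \<le> \<epsilon>" using avW by (rule bexI)
qed

lemma ract_ext:
  assumes "g \<in> carrier G" "\<forall>s\<in>F. act g (gl r0 s) = gl r0 (relabel p s)" "p permutes E"
  shows "ract g (ext u) = ext (pact p u)"
proof
  fix r
  have rp: "relabel p s \<in> F \<longleftrightarrow> s \<in> F" for s by (rule perm_invariant_iff[OF F_inv assms(3)])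
  have F0: "act g x \<in> F0 \<longleftrightarrow> x \<in> F0" if x: "x \<in> X" for x
  proof
    assume "x \<in> F0" then show "act g x \<in> F0" using assms(2) rp by (auto simp: F0_def)
  next
    assume "act g x \<in> F0"
    then obtain s where s: "s \<in> F" "act g x = gl r0 s" by (auto simp: F0_def)
    let ?s = "relabel (inv_into UNIV p) s"
    have s': "?s \<in> F" using perm_invariant_iff[OF F_inv permutes_inv[OF assms(3)]] s by blast
    have "act g (gl r0 ?s) = act g x" using assms(2,3) s s' by simp
    then have "x = gl r0 ?s" using act_bij[OF assms(1)] x gl_in[OF r0 s'] by (auto simp: bij_betw_def inj_on_def)
    then show "x \<in> F0" using s' by (simp add: F0_def)
  qed
  show "ract g (ext u) r = ext (pact p u) r"
  proof (cases "r \<in> X")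
    case True
    then obtain x where x: "x \<in> X" "r = act g x" using act_bij[OF assms(1)] by (auto simp: bij_betw_def)
    have "co (act g x) = relabel p (co x)" if "x \<in> F0"
      using that assms(2) co_gl[OF r0] rp by (auto simp: F0_def)
    then show ?thesis using ract_act[OF assms(1) x(1), of "ext u"] x F0[OF x(1)] assms(3)
      by (simp add: ext_def pact_def)
  next
    case False
    then show ?thesis using F0_X by (auto simp: ract ext_def)
  qed
qed

section \<open>The lift of one component\<close>

context
  fixes P :: "(('i \<Rightarrow> 'a set) \<Rightarrow> complex) \<Rightarrow> (('i \<Rightarrow> 'a set) \<Rightarrow> complex)"
  assumes P: "op_equiv P" and idem: "\<And>u. u \<in> funs_on F \<Longrightarrow> P (P u) = P u"
begin

abbreviation "V \<equiv> lift P ` l2 X"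

lemma V_iff: "f \<in> V \<longleftrightarrow> f \<in> l2 X \<and> lift P f = f"
proof -
  have "V = {f \<in> l2 X. lift P f = f}" by (rule lift_image[OF op_equiv_on[OF P]]) (rule idem)
  then show ?thesis by blast
qed

lemma V_closed: "l2_closed_subspace V"
  by (rule lift_image_closed[OF op_equiv_on[OF P]]) (rule idem)

lemma V_invariant: "g \<in> carrier G \<Longrightarrow> f \<in> V \<Longrightarrow> ract g f \<in> V"
  using lift_ract[OF P] ract_l2 by (simp add: V_iff)

lemma V_unitary: "unitary_rep G (subrep \<rho> V)"
proof (rule unitary_subrep[OF V_closed])
  show "V \<subseteq> l2 X" using V_iff by blast
qed (rule V_invariant)

lemma P_funs_on: "u \<in> funs_on F \<Longrightarrow> P u \<in> funs_on F"
  using P by (simp add: op_equiv_def op_on_def)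

lemma image_P_iff: "u \<in> P ` funs_on F \<longleftrightarrow> u \<in> funs_on F \<and> P u = u"
proof
  assume "u \<in> P ` funs_on F"
  then obtain v where "v \<in> funs_on F" "u = P v" by blast
  then show "u \<in> funs_on F \<and> P u = u" using idem P_funs_on by simp
next
  assume "u \<in> funs_on F \<and> P u = u"
  then show "u \<in> P ` funs_on F" by (intro image_eqI[of u P u]) auto
qed

lemma ext_V: "u \<in> funs_on F \<Longrightarrow> ext u \<in> V \<longleftrightarrow> P u = u"
proof -
  assume u: "u \<in> funs_on F"
  have "ext u \<in> V \<longleftrightarrow> ext (P u) = ext u"
    using ext_l2[OF u] by (simp only: V_iff lift_ext[OF op_equiv_on[OF P] u] simp_thms)
  then show ?thesis using ext_inj[OF P_funs_on[OF u] u] by auto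
qed

lemma V_fib: "f \<in> V \<Longrightarrow> r \<in> X \<Longrightarrow> P (fib f r) = fib f r"
proof -
  assume f: "f \<in> V" and r: "r \<in> X"
  have "P (fib f r) = fib (lift P f) r" by (rule fib_lift[OF op_equiv_on[OF P] r, symmetric])
  then show ?thesis using f by (simp only: V_iff)
qed

text \<open>It suffices to reach the parts of \<open>f\<close> on the single fibres, which are translates of \<open>ext u\<close>.\<close>

lemma V_generated:
  assumes W: "l2_closed_subspace W" "W \<subseteq> l2 X" and inv: "\<And>g f. g \<in> carrier G \<Longrightarrow> f \<in> W \<Longrightarrow> ract g f \<in> W"
    and ext: "\<And>u. u \<in> P ` funs_on F \<Longrightarrow> ext u \<in> W"
  shows "V \<subseteq> W"
proof
  fix f assume f: "f \<in> V"
  then have fl: "f \<in> l2 X" by (simp add: V_iff)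
  have fl': "f \<in> l2 UNIV" by (rule l2_UNIV[OF fl])
  define part where "part y = (\<lambda>x. if x \<in> gl y ` F then f x else 0)" for y
  have part: "part y \<in> W" if y: "y \<in> X" for y
  proof -
    obtain g where g: "g \<in> carrier G" "act g y \<in> F0" using act_transitive[OF y] by (auto simp: F0_def)
    have ig: "inv\<^bsub>G\<^esub> g \<in> carrier G" using g grp by (simp add: group.inv_closed)
    obtain p where p: "p permutes E" "\<forall>s\<in>F. act g (gl y s) = gl (act g y) (relabel p s)"
      using act_gl[OF g(1) y] by blast
    have rp: "relabel p s \<in> F \<longleftrightarrow> s \<in> F" for s by (rule perm_invariant_iff[OF F_inv p(1)])
    have F0: "act g x \<in> F0 \<longleftrightarrow> x \<in> gl y ` F" if x: "x \<in> X" for x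
    proof
      assume "x \<in> gl y ` F"
      then obtain s where s: "s \<in> F" "x = gl y s" by blast
      then show "act g x \<in> F0" using p(2) gl_F0[OF act_in[OF g(1) y], of "relabel p s"] rp g(2) by simp
    next
      assume a: "act g x \<in> F0"
      then obtain s where s: "s \<in> F" "act g x = gl r0 s" by (auto simp: F0_def)
      obtain s1 where s1: "s1 \<in> F" "act g y = gl r0 s1" using g(2) by (auto simp: F0_def)
      let ?s = "relabel (inv_into UNIV p) s"
      have s': "?s \<in> F" using perm_invariant_iff[OF F_inv permutes_inv[OF p(1)]] s by blast
      have "act g (gl y ?s) = gl (gl r0 s1) s" using p s' s1 by simp
      also have "\<dots> = act g x" using gl_gl[OF r0 s1(1) s(1)] s by simp
      finally have "x = gl y ?s" using act_bij[OF g(1)] x gl_in[OF y s'] by (auto simp: bij_betw_def inj_on_def)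
      then show "x \<in> gl y ` F" using s' by simp
    qed
    have gf: "ract g f \<in> V" by (rule V_invariant[OF g(1) f])
    have "ext (fib (ract g f) r0) \<in> W"
      by (rule ext) (use V_fib[OF gf r0] fib_funs_on image_P_iff in auto)
    then have "cut (ract g f) \<in> W" by (simp add: cut_ext)
    then have "ract (inv\<^bsub>G\<^esub> g) (cut (ract g f)) \<in> W" by (rule inv[OF ig])
    moreover have "ract (inv\<^bsub>G\<^esub> g) (cut (ract g f)) = part y"
    proof
      fix x
      show "ract (inv\<^bsub>G\<^esub> g) (cut (ract g f)) x = part y x"
      proof (cases "x \<in> X")
        case True
        have "inv\<^bsub>G\<^esub> (inv\<^bsub>G\<^esub> g) = g" using g grp by (simp add: group.inv_inv)
        then have "ract (inv\<^bsub>G\<^esub> g) (cut (ract g f)) x = cut (ract g f) (act g x)" using True by (simp add: ract)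
        also have "\<dots> = part y x" using F0[OF True] ract_act[OF g(1) True] by (simp add: cut_def part_def)
        finally show ?thesis .
      next
        case False
        then show ?thesis using l2D(1)[OF fl False] by (simp add: ract part_def)
      qed
    qed
    ultimately show ?thesis by simp
  qed
  show "f \<in> W"
  proof (rule l2_closed_approx[OF W(1) fl'])
    fix \<epsilon> :: real assume \<epsilon>: "0 < \<epsilon>"
    obtain S0 where S0: "finite S0" "dist (\<Sum>x\<in>S0. (cmod (f x))\<^sup>2) (nsq f) \<le> \<epsilon>"
      using infsum_finite_approximation[OF l2D(2)[OF fl] \<epsilon>] unfolding nsq_def by auto
    \<comment> \<open>The point \<open>gl x s0\<close> is the same for all x in one fibre, so Y has
      exactly one representative of each fibre that meets \<open>S0\<close>.\<close>
    define s0 where "s0 = co r0"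
    have s0: "s0 \<in> F" using co_in[OF r0] by (simp add: s0_def)
    define Y where "Y = (\<lambda>x. gl x s0) ` (S0 \<inter> X)"
    have Y: "finite Y" "Y \<subseteq> X" using S0(1) gl_in s0 by (auto simp: Y_def)
    have rep: "x \<in> gl y ` F \<longleftrightarrow> y = gl x s0" if xX: "x \<in> X" and yY: "y \<in> Y" for x y
    proof -
      obtain z where z: "z \<in> X" "y = gl z s0" using yY by (auto simp: Y_def)
      have y: "y \<in> X" using z gl_in s0 by simp
      show ?thesis
      proof
        assume "x \<in> gl y ` F"
        then obtain s where "s \<in> F" "x = gl y s" by blast
        then show "y = gl x s0" using gl_gl[OF y _ s0] z gl_gl[OF z(1) s0 s0] by simp
      next
        assume "y = gl x s0"
        then have "x = gl y (co x)" using gl_gl[OF xX s0 co_in[OF xX]] gl_co[OF xX] by simp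
        then show "x \<in> gl y ` F" using co_in[OF xX] by blast
      qed
    qed
    define v where "v = (\<lambda>x. \<Sum>y\<in>Y. 1 * part y x)"
    have vW: "v \<in> W" unfolding v_def
      by (rule lin_subspace_sum[OF l2_closed_lin[OF W(1)]]) (use part Y in auto)
    have vx: "v x = (if x \<in> X \<and> gl x s0 \<in> Y then f x else 0)" for x
    proof (cases "x \<in> X")
      case True
      have "v x = (\<Sum>y\<in>Y. if y = gl x s0 then f x else 0)"
        unfolding v_def using rep[OF True] by (intro sum.cong refl) (simp add: part_def)
      then show ?thesis using True Y(1) by simp
    next
      case False
      then show ?thesis using l2D(1)[OF fl False] by (auto simp: v_def part_def intro!: sum.neutral)
    qed
    let ?S = "S0 \<inter> X"
    have S: "(\<Sum>x\<in>S0. (cmod (f x))\<^sup>2) = (\<Sum>x\<in>?S. (cmod (f x))\<^sup>2)"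
      by (rule sum.mono_neutral_right) (use S0 l2D(1)[OF fl] in auto)
    have "((\<lambda>x. if x \<in> ?S then (cmod (f x))\<^sup>2 else 0) has_sum (\<Sum>x\<in>?S. (cmod (f x))\<^sup>2)) UNIV"
      by (rule has_sum_finite_neutralI[of ?S]) (use S0 in auto)
    then have hs: "((\<lambda>x. (cmod (f x))\<^sup>2 + (-1) * (if x \<in> ?S then (cmod (f x))\<^sup>2 else 0)) has_sum
        (nsq f + (-1) * (\<Sum>x\<in>?S. (cmod (f x))\<^sup>2))) UNIV"
      by (intro has_sum_add has_sum_cmult_right nsq_has_sum[OF fl])
    have "nsq (\<lambda>x. v x - f x) \<le> nsq f + (-1) * (\<Sum>x\<in>?S. (cmod (f x))\<^sup>2)"
      by (rule nsq_le[OF hs]) (auto simp: vx Y_def norm_minus_commute)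
    then have "nsq (\<lambda>x. v x - f x) \<le> \<epsilon>"
      using S0(2) S abs_ge_minus_self[of "(\<Sum>x\<in>S0. (cmod (f x))\<^sup>2) - nsq f"] unfolding dist_real_def by linarith
    then show "\<exists>v\<in>W. nsq (\<lambda>x. v x - f x) \<le> \<epsilon>" using vW by blast
  qed
qed

text \<open>Some vector of a nonzero W is nonzero at a point, which can be moved into the base
  fibre. Restriction to this fibre stays in W by \<open>cut_in_invariant\<close>, so the part of W
  living on the fibre is a nonzero submodule, hence the whole component, and its translates generate
  V.\<close>

lemma V_irreducible:
  assumes irr: "\<And>W. perm_submodule E W \<Longrightarrow> W \<subseteq> P ` funs_on F \<Longrightarrow> W = {\<lambda>_. 0} \<or> W = P ` funs_on F"
    and ne: "P ` funs_on F \<noteq> {\<lambda>_. 0}"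
  shows "irreducible_rep G (subrep \<rho> V)"
  unfolding irreducible_rep_def
proof (intro conjI allI impI)
  show "unitary_rep G (subrep \<rho> V)" by (rule V_unitary)
  have z: "(\<lambda>_. 0) \<in> funs_on F" by (simp add: funs_on_def)
  have "(\<lambda>_. 0) \<in> P ` funs_on F"
    using P linear_map_on_zero[OF _ z, of P] z by (simp add: image_P_iff op_equiv_def op_on_def)
  then obtain u where u: "u \<in> funs_on F" "P u = u" "u \<noteq> (\<lambda>_. 0)" using ne image_P_iff by blast
  have e0: "ext (\<lambda>_. 0) = (\<lambda>_. 0)" by (simp add: ext_def)
  have "ext u \<noteq> (\<lambda>_. 0)" using ext_inj[OF u(1) z] e0 u(3) by auto
  moreover have "ext u \<in> V" using ext_V u by simp
  ultimately show "rep_space (subrep \<rho> V) \<noteq> {\<lambda>x. 0}" unfolding subrep_def by auto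
  fix W assume "l2_closed_subspace W \<and> W \<subseteq> rep_space (subrep \<rho> V) \<and> (\<forall>g\<in>carrier G. rep_act (subrep \<rho> V) g ` W \<subseteq> W)"
  then have W: "l2_closed_subspace W" "W \<subseteq> V" and inv: "\<And>g f. g \<in> carrier G \<Longrightarrow> f \<in> W \<Longrightarrow> ract g f \<in> W"
    by (auto simp: subrep_def)
  have Wl: "W \<subseteq> l2 X" using W(2) V_iff by blast
  have "W = V" if Wne: "W \<noteq> {\<lambda>x. 0}"
  proof -
    have "(\<lambda>x. 0) \<in> W" using W(1) by (simp add: l2_closed_subspace_def)
    then obtain w x where w: "w \<in> W" "w x \<noteq> 0" using Wne by fastforce
    have x: "x \<in> X" using l2D(1)[of w X x] w Wl by blast
    obtain g where g: "g \<in> carrier G" "act g x \<in> F0" using act_transitive[OF x] by (auto simp: F0_def)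
    have gw: "ract g w \<in> W" by (rule inv[OF g(1) w(1)])
    define u0 where "u0 = fib (ract g w) r0"
    have u0: "ext u0 \<in> W" using cut_in_invariant[OF W(1) Wl inv gw] by (simp add: cut_ext u0_def)
    have "cut (ract g w) (act g x) \<noteq> 0" using ract_act[OF g(1) x, of w] g(2) w(2) by (simp add: cut_def)
    then have u0ne: "u0 \<noteq> (\<lambda>_. 0)" by (auto simp: cut_ext u0_def ext_def split: if_splits)
    \<comment> \<open>The trace of W on the base fibre. Through \<open>realize\<close> the
      invariance of W becomes invariance of \<open>W0\<close> under all permutations of E.\<close>
    define W0 where "W0 = {u \<in> funs_on F. ext u \<in> W}"
    have u0W: "u0 \<in> W0" using u0 fib_funs_on by (simp add: W0_def u0_def)
    have lin: "lin_subspace W0" unfolding lin_subspace_def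
    proof (intro conjI ballI allI)
      show "(\<lambda>_. 0) \<in> W0" using z e0 W(1) by (simp add: W0_def l2_closed_subspace_def)
      fix f h a b assume fh: "f \<in> W0" "h \<in> W0"
      have "ext (\<lambda>s. a * f s + b * h s) = (\<lambda>r. a * ext f r + b * ext h r)" by (auto simp: ext_def)
      then show "(\<lambda>s. a * f s + b * h s) \<in> W0"
        using fh lin_subspace_comb[OF l2_closed_lin[OF W(1)], of "ext f" "ext h" a b]
          lin_subspace_comb[OF lin_subspace_funs_on, of f F h a b] by (simp add: W0_def)
    qed
    have "perm_submodule E W0" unfolding perm_submodule_def
    proof (intro conjI lin allI impI ballI)
      fix p u assume p: "p permutes E" and u: "u \<in> W0"
      obtain h where h: "h \<in> carrier G" "\<forall>s\<in>F. act h (gl r0 s) = gl r0 (relabel p s)" using realize[OF p] by blast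
      have "ract h (ext u) \<in> W" using inv[OF h(1)] u by (simp add: W0_def)
      then show "pact p u \<in> W0" using ract_ext[OF h p] pact_funs_on[OF F_inv p] u by (simp add: W0_def)
    qed
    moreover have "W0 \<subseteq> P ` funs_on F"
    proof
      fix u assume "u \<in> W0"
      then have "u \<in> funs_on F" "ext u \<in> V" using W(2) by (auto simp: W0_def)
      then show "u \<in> P ` funs_on F" using ext_V image_P_iff by simp
    qed
    ultimately have "W0 = {\<lambda>_. 0} \<or> W0 = P ` funs_on F" by (rule irr)
    then have "W0 = P ` funs_on F" using u0W u0ne by blast
    then have "ext u \<in> W" if "u \<in> P ` funs_on F" for u using that by (auto simp: W0_def)
    then have "V \<subseteq> W" using V_generated[OF W(1) Wl inv] by blast
    then show ?thesis using W(2) by blast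
  qed
  then show "W = {\<lambda>x. 0} \<or> W = rep_space (subrep \<rho> V)" by (auto simp: subrep_def)
qed

end

text \<open>An equivalence maps \<open>K\<close>-fixed vectors to \<open>K\<close>-fixed vectors, that is, functions on the fibre of \<open>r0\<close>.\<close>

lemma V_equivalent:
  assumes P: "op_equiv P" "\<And>u. u \<in> funs_on F \<Longrightarrow> P (P u) = P u"
    and Q: "op_equiv Q" "\<And>u. u \<in> funs_on F \<Longrightarrow> Q (Q u) = Q u"
    and eq: "unitarily_equivalent G (subrep \<rho> (lift P ` l2 X)) (subrep \<rho> (lift Q ` l2 X))"
  shows "\<exists>T. perm_hom E (P ` funs_on F) F T \<and> (\<forall>u\<in>P ` funs_on F. T u \<in> Q ` funs_on F) \<and>
    (\<forall>u\<in>P ` funs_on F. \<forall>v\<in>P ` funs_on F. ip F (T u) (T v) = ip F u v)"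
proof -
  have Pi: "u \<in> P ` funs_on F \<longleftrightarrow> u \<in> funs_on F \<and> P u = u" for u by (rule image_P_iff[OF P(1)]) (rule P(2))
  have Qi: "u \<in> Q ` funs_on F \<longleftrightarrow> u \<in> funs_on F \<and> Q u = u" for u by (rule image_P_iff[OF Q(1)]) (rule Q(2))
  have PV: "ext u \<in> lift P ` l2 X \<longleftrightarrow> P u = u" if "u \<in> funs_on F" for u
    by (rule ext_V[OF P(1) _ that]) (rule P(2))
  have QV: "ext u \<in> lift Q ` l2 X \<longleftrightarrow> Q u = u" if "u \<in> funs_on F" for u
    by (rule ext_V[OF Q(1) _ that]) (rule Q(2))
  have QI: "f \<in> lift Q ` l2 X \<longleftrightarrow> f \<in> l2 X \<and> lift Q f = f" for f by (rule V_iff[OF Q(1)]) (rule Q(2))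
  let ?V = "lift P ` l2 X" let ?W = "lift Q ` l2 X"
  obtain U where U0: "bij_betw U (rep_space (subrep \<rho> ?V)) (rep_space (subrep \<rho> ?W)) \<and>
        linear_map_on (rep_space (subrep \<rho> ?V)) U \<and>
        (\<forall>f\<in>rep_space (subrep \<rho> ?V). \<forall>f'\<in>rep_space (subrep \<rho> ?V). l2_inner (U f) (U f') = l2_inner f f') \<and>
        (\<forall>g\<in>carrier G. \<forall>f\<in>rep_space (subrep \<rho> ?V). U (rep_act (subrep \<rho> ?V) g f) = rep_act (subrep \<rho> ?W) g (U f))"
    using eq unfolding unitarily_equivalent_def by (rule exE)
  have U: "bij_betw U ?V ?W" "linear_map_on ?V U"
    "\<And>f f'. f \<in> ?V \<Longrightarrow> f' \<in> ?V \<Longrightarrow> l2_inner (U f) (U f') = l2_inner f f'"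
    "\<And>g f. g \<in> carrier G \<Longrightarrow> f \<in> ?V \<Longrightarrow> U (ract g f) = ract g (U f)"
  proof -
    have rs: "rep_space (subrep \<rho> A) = A" "rep_act (subrep \<rho> A) = ract" for A by (simp_all add: subrep_def)
    note U1 = U0[unfolded rs]
    show "bij_betw U ?V ?W" "linear_map_on ?V U" using U1 by blast+
    show "l2_inner (U f) (U f') = l2_inner f f'" if "f \<in> ?V" "f' \<in> ?V" for f f' using U1 that by blast
    show "U (ract g f) = ract g (U f)" if "g \<in> carrier G" "f \<in> ?V" for g f using U1 that by blast
  qed
  define T where "T u = fib (U (ext u)) r0" for u
  have e: "ext u \<in> ?V" if "u \<in> P ` funs_on F" for u using that PV Pi by simp
  have UT: "U (ext u) = ext (T u)" if u: "u \<in> P ` funs_on F" for u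
  proof -
    have "U (ext u) \<in> ?W" by (rule bij_betw_apply[OF U(1) e[OF u]])
    then have "U (ext u) \<in> l2 X" using QI by blast
    moreover have "ract k (U (ext u)) = U (ext u)" if "k \<in> K" for k
    proof -
      have "ext u = cut (ext u)" using ext_fib Pi u by blast
      then have "ract k (ext u) = ext u" using ract_cut[OF that] by metis
      then show ?thesis using U(4)[of k "ext u"] K_sub that e[OF u] by auto
    qed
    ultimately have "U (ext u) = cut (U (ext u))" by (rule K_fixed_cut)
    then show ?thesis by (simp add: cut_ext T_def)
  qed
  have TF: "T u \<in> funs_on F" for u by (simp add: T_def fib_funs_on)
  have TQ: "T u \<in> Q ` funs_on F" if u: "u \<in> P ` funs_on F" for u
  proof -
    have "ext (T u) \<in> ?W" using bij_betw_apply[OF U(1) e[OF u]] by (simp only: UT[OF u])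
    then show ?thesis using QV[OF TF] Qi TF by simp
  qed
  have Tip: "ip F (T u) (T v) = ip F u v" if "u \<in> P ` funs_on F" "v \<in> P ` funs_on F" for u v
    using U(3)[OF e[OF that(1)] e[OF that(2)]] UT that ext_inner[OF TF TF] ext_inner Pi by auto
  have "perm_hom E (P ` funs_on F) F T" unfolding perm_hom_def
  proof (intro conjI ballI allI impI TF)
    show "linear_map_on (P ` funs_on F) T" unfolding linear_map_on_def
    proof (intro ballI allI)
      fix f h a b assume fh: "f \<in> P ` funs_on F" "h \<in> P ` funs_on F"
      have "ext (\<lambda>s. a * f s + b * h s) = (\<lambda>r. a * ext f r + b * ext h r)" by (auto simp: ext_def)
      then have "U (ext (\<lambda>s. a * f s + b * h s)) = (\<lambda>r. a * U (ext f) r + b * U (ext h) r)"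
        using linear_map_on_comb[OF U(2) e[OF fh(1)] e[OF fh(2)]] by simp
      then show "T (\<lambda>s. a * f s + b * h s) = (\<lambda>s. a * T f s + b * T h s)"
        by (auto simp: T_def fib_def)
    qed
    fix p u assume p: "p permutes E" and u: "u \<in> P ` funs_on F"
    obtain g where g: "g \<in> carrier G" "\<forall>s\<in>F. act g (gl r0 s) = gl r0 (relabel p s)" using realize[OF p] by blast
    have "T (pact p u) = fib (U (ract g (ext u))) r0" by (simp add: T_def ract_ext[OF g p])
    also have "\<dots> = fib (ract g (ext (T u))) r0" using U(4)[OF g(1) e[OF u]] UT[OF u] by simp
    also have "\<dots> = fib (ext (pact p (T u))) r0" by (simp add: ract_ext[OF g p])
    also have "\<dots> = pact p (T u)" using fib_ext[OF pact_funs_on[OF F_inv p TF] r0] r0_F0 by simp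
    finally show "T (pact p u) = pact p (T u)" .
  qed
  then show ?thesis using TQ Tip by blast
qed

section \<open>Assembling the direct sum\<close>

lemma l2_pairs:
  assumes J: "finite J" and f: "\<And>a. a \<in> J \<Longrightarrow> f a \<in> l2 UNIV"
  shows "(\<lambda>(a, x). if a \<in> J then f a x else 0) \<in> l2 (J \<times> UNIV)"
proof -
  have "(\<lambda>z. (cmod (f (fst z) (snd z)))\<^sup>2) summable_on (SIGMA a:J. UNIV)"
  proof (rule summable_on_SigmaI)
    fix a assume "a \<in> J"
    then show "((\<lambda>x. (cmod (f (fst (a, x)) (snd (a, x))))\<^sup>2) has_sum nsq (f a)) UNIV"
      using nsq_has_sum[OF f] by simp
  qed (use J in auto)
  then have "(\<lambda>z. (cmod (case z of (a, x) \<Rightarrow> if a \<in> J then f a x else 0))\<^sup>2) summable_on UNIV"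
    by (subst summable_on_cong_neutral[where g = "\<lambda>z. (cmod (f (fst z) (snd z)))\<^sup>2" and T = "SIGMA a:J. UNIV"])
       (auto split: if_splits)
  then show ?thesis by (auto simp: l2_def)
qed

lemma l2_inner_pairs:
  assumes J: "finite J" and f: "f \<in> l2 (J \<times> UNIV)" and h: "h \<in> l2 (J \<times> UNIV)"
  shows "l2_inner f h = (\<Sum>a\<in>J. l2_inner (\<lambda>x. f (a, x)) (\<lambda>x. h (a, x)))"
proof -
  have "(\<lambda>z. f z * cnj (h z)) summable_on (SIGMA a:J. UNIV)"
    using l2_mult_summable[OF l2_UNIV[OF f] l2_UNIV[OF h]] by (rule summable_on_subset_banach) simp
  then have "infsum (\<lambda>a. infsum (\<lambda>x. f (a, x) * cnj (h (a, x))) UNIV) J = infsum (\<lambda>z. f z * cnj (h z)) (SIGMA a:J. UNIV)"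
    by (rule infsum_Sigma_banach)
  then show ?thesis using J by (simp add: l2_inner_restrict[OF f]) (simp add: l2_inner_def)
qed

text \<open>Each \<open>\<sigma> a\<close> is a partial isometry with initial projection
  \<open>P a\<close> and adjoint \<open>\<tau> a\<close>; the ranges are mutually orthogonal and the
  range projections add up to the identity. Lifting preserves these relations, so the lifts of the
  \<open>\<tau> a\<close> together form a unitary map onto the direct sum, with the lifts of the
  \<open>\<sigma> a\<close> as its inverse.\<close>

lemma decomposition:
  fixes J :: "'j set"
  assumes J: "finite J"
    and \<sigma>: "\<And>a. a \<in> J \<Longrightarrow> op_on (\<sigma> a)" and \<tau>: "\<And>a. a \<in> J \<Longrightarrow> op_equiv (\<tau> a)" and P: "\<And>a. a \<in> J \<Longrightarrow> op_on (P a)"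
    and adj: "\<And>a u v. a \<in> J \<Longrightarrow> u \<in> funs_on F \<Longrightarrow> v \<in> funs_on F \<Longrightarrow> ip F (\<sigma> a u) v = ip F u (\<tau> a v)"
    and P\<tau>: "\<And>a u. a \<in> J \<Longrightarrow> u \<in> funs_on F \<Longrightarrow> P a (\<tau> a u) = \<tau> a u"
    and \<tau>\<sigma>: "\<And>a b u. a \<in> J \<Longrightarrow> b \<in> J \<Longrightarrow> u \<in> funs_on F \<Longrightarrow> \<tau> a (\<sigma> b u) = (if a = b then P a u else (\<lambda>_. 0))"
    and sum: "\<And>u. u \<in> funs_on F \<Longrightarrow> (\<lambda>s. \<Sum>a\<in>J. \<sigma> a (\<tau> a u) s) = u"
    and PP: "\<And>a u. a \<in> J \<Longrightarrow> u \<in> funs_on F \<Longrightarrow> P a (P a u) = P a u"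
  shows "unitarily_equivalent G \<rho> (direct_sum_rep J (\<lambda>a. subrep \<rho> (lift (P a) ` l2 X)))"
proof -
  let ?D = "direct_sum_rep J (\<lambda>a. subrep \<rho> (lift (P a) ` l2 X))"
  let ?S = "rep_space ?D"
  have S: "H \<in> ?S \<longleftrightarrow> H \<in> l2 (J \<times> UNIV) \<and> (\<forall>a\<in>J. (\<lambda>x. H (a, x)) \<in> lift (P a) ` l2 X)" for H
    by (simp add: direct_sum_rep_def subrep_def)
  have Vi: "f \<in> lift (P a) ` l2 X \<longleftrightarrow> f \<in> l2 X \<and> lift (P a) f = f" if "a \<in> J" for a f
  proof -
    have "lift (P a) ` l2 X = {f \<in> l2 X. lift (P a) f = f}" by (rule lift_image[OF P[OF that]]) (rule PP[OF that])
    then show ?thesis by blast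
  qed
  define U where "U f = (\<lambda>(a, x). if a \<in> J then lift (\<tau> a) f x else 0)" for f
  define U' where "U' H = (\<lambda>x. \<Sum>a\<in>J. lift (\<sigma> a) (\<lambda>y. H (a, y)) x)" for H
  have \<tau>o: "op_on (\<tau> a)" if "a \<in> J" for a using \<tau>[OF that] by (rule op_equiv_on)
  have \<tau>l: "lift (\<tau> a) f \<in> l2 X" if "a \<in> J" "f \<in> l2 X" for a f by (rule lift_l2[OF \<tau>o[OF that(1)] that(2)])
  have Ul: "U f \<in> l2 (J \<times> UNIV)" if "f \<in> l2 X" for f
    unfolding U_def by (rule l2_pairs[OF J]) (use \<tau>l that l2_UNIV in blast)
  have US: "U f \<in> ?S" if f: "f \<in> l2 X" for f
  proof -
    have "lift (\<tau> a) f \<in> lift (P a) ` l2 X" if a: "a \<in> J" for a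
      using \<tau>l[OF a f] lift_lift[OF \<tau>o[OF a], of "P a" f] lift_cong[of "\<lambda>u. P a (\<tau> a u)" "\<tau> a" f] P\<tau>[OF a]
      by (simp add: Vi[OF a])
    then show ?thesis using Ul[OF f] by (simp add: S U_def)
  qed
  have U'l: "U' H \<in> l2 X" if "H \<in> ?S" for H
  proof -
    have "(\<lambda>x. \<Sum>a\<in>J. 1 * lift (\<sigma> a) (\<lambda>y. H (a, y)) x) \<in> l2 X"
      by (rule lin_subspace_sum[OF lin_subspace_l2], rule lift_l2[OF \<sigma>]) (use that S Vi in auto)
    then show ?thesis by (simp add: U'_def)
  qed
  have U'U: "U' (U f) = f" if f: "f \<in> l2 X" for f
  proof -
    have "U' (U f) = (\<lambda>x. \<Sum>a\<in>J. lift (\<lambda>u. \<sigma> a (\<tau> a u)) f x)"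
      unfolding U'_def U_def using lift_lift[OF \<tau>o] by (intro ext sum.cong refl) simp
    also have "\<dots> = lift (\<lambda>u s. \<Sum>a\<in>J. \<sigma> a (\<tau> a u) s) f" by (rule lift_sum_op[symmetric])
    also have "\<dots> = lift (\<lambda>u. u) f" by (rule lift_cong[OF sum])
    also have "\<dots> = f" by (rule lift_id) (rule l2D(1)[OF f])
    finally show ?thesis .
  qed
  have UU': "U (U' H) = H" if H: "H \<in> ?S" for H
  proof
    fix z :: "'j \<times> 'x"
    obtain a x where z: "z = (a, x)" by force
    show "U (U' H) z = H z"
    proof (cases "a \<in> J")
      case True
      have Hb: "(\<lambda>y. H (b, y)) \<in> l2 X" if "b \<in> J" for b using H S Vi that by blast
      have "lift (\<tau> a) (U' H) = (\<lambda>x. \<Sum>b\<in>J. 1 * lift (\<tau> a) (lift (\<sigma> b) (\<lambda>y. H (b, y))) x)"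
        using linear_map_on_sum[OF lin_subspace_l2 lift_linear[OF \<tau>o[OF True], of "l2 X"], of J "\<lambda>b. lift (\<sigma> b) (\<lambda>y. H (b, y))" "\<lambda>_. 1"]
          lift_l2[OF \<sigma> Hb] by (simp add: U'_def)
      also have "\<dots> = (\<lambda>x. \<Sum>b\<in>J. if b = a then lift (P a) (\<lambda>y. H (a, y)) x else 0)"
      proof (intro ext sum.cong refl)
        fix x b assume b: "b \<in> J"
        have "lift (\<tau> a) (lift (\<sigma> b) (\<lambda>y. H (b, y))) = lift (\<lambda>u. if a = b then P a u else (\<lambda>_. 0)) (\<lambda>y. H (b, y))"
          unfolding lift_lift[OF \<sigma>[OF b]] by (rule lift_cong[OF \<tau>\<sigma>[OF True b]])
        also have "\<dots> = (if b = a then lift (P a) (\<lambda>y. H (a, y)) else (\<lambda>_. 0))" by (auto simp: lift_def)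
        finally show "1 * lift (\<tau> a) (lift (\<sigma> b) (\<lambda>y. H (b, y))) x = (if b = a then lift (P a) (\<lambda>y. H (a, y)) x else 0)"
          by simp
      qed
      also have "\<dots> = lift (P a) (\<lambda>y. H (a, y))" using J True by simp
      also have "\<dots> = (\<lambda>y. H (a, y))" using H S Vi True by blast
      finally show ?thesis using True by (simp add: U_def z)
    next
      case False
      have "H (a, x) = 0" by (rule l2D(1)[of H "J \<times> UNIV"]) (use H S False in auto)
      then show ?thesis using False by (simp add: U_def z)
    qed
  qed
  have rs: "rep_space \<rho> = l2 X" by (simp add: permutation_rep_def)
  show ?thesis unfolding unitarily_equivalent_def rs
  proof (intro exI[of _ U] conjI ballI)
    show "bij_betw U (l2 X) ?S" by (rule bij_betwI[where g = U']) (use US U'l U'U UU' in auto)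
    show "linear_map_on (l2 X) U" unfolding linear_map_on_def
    proof (intro ballI allI ext)
      fix f h a b and z :: "'j \<times> 'x" assume fh: "f \<in> l2 X" "h \<in> l2 X"
      obtain j x where z: "z = (j, x)" by force
      show "U (\<lambda>x. a * f x + b * h x) z = a * U f z + b * U h z"
        using linear_map_on_comb[OF lift_linear[OF \<tau>o], of j f "l2 X" h a b] fh by (simp add: U_def z)
    qed
    fix f h assume f: "f \<in> l2 X" and h: "h \<in> l2 X"
    have "l2_inner (U f) (U h) = (\<Sum>a\<in>J. l2_inner (lift (\<tau> a) f) (lift (\<tau> a) h))"
      unfolding l2_inner_pairs[OF J Ul[OF f] Ul[OF h]] by (simp add: U_def)
    also have "\<dots> = (\<Sum>a\<in>J. 1 * l2_inner (lift (\<sigma> a) (lift (\<tau> a) f)) h)"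
      using lift_inner[OF \<sigma> \<tau>o adj \<tau>l[OF _ f] h] by simp
    also have "\<dots> = l2_inner (\<lambda>x. \<Sum>a\<in>J. 1 * lift (\<sigma> a) (lift (\<tau> a) f) x) h"
      by (rule l2_inner_sum_left[symmetric]) (use lift_l2[OF \<sigma> \<tau>l[OF _ f]] l2_UNIV h in blast)+
    also have "(\<lambda>x. \<Sum>a\<in>J. 1 * lift (\<sigma> a) (lift (\<tau> a) f) x) = U' (U f)" by (simp add: U'_def U_def)
    finally show "l2_inner (U f) (U h) = l2_inner f h" using U'U[OF f] by simp
  next
    fix g f assume g: "g \<in> carrier G" and f: "f \<in> l2 X"
    show "U (ract g f) = rep_act ?D g (U f)"
      using lift_ract[OF \<tau> g] by (auto simp: U_def direct_sum_rep_def subrep_def fun_eq_iff)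
  qed
qed

end

section \<open>Representations of finite symmetric groups\<close>

lemma fin_sym_carrier: "p \<in> carrier (fin_sym A) \<longleftrightarrow> p permutes A \<and> finite {x. p x \<noteq> x}"
  by (simp add: fin_sym_def)

lemma fin_sym_mult [simp]: "p \<otimes>\<^bsub>fin_sym A\<^esub> q = p \<circ> q"
  by (simp add: fin_sym_def)

lemma fin_sym_one [simp]: "\<one>\<^bsub>fin_sym A\<^esub> = id"
  by (simp add: fin_sym_def)

lemma fin_sym_inv_closed:
  assumes "p \<in> carrier (fin_sym A)" shows "inv_into UNIV p \<in> carrier (fin_sym A)"
proof -
  have p: "p permutes A" and f: "finite {x. p x \<noteq> x}" using assms by (auto simp: fin_sym_carrier)
  have "{x. inv_into UNIV p x \<noteq> x} \<subseteq> {x. p x \<noteq> x}"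
    using permutes_inverses[OF p] by (auto) metis
  then show ?thesis using finite_subset[OF _ f] permutes_inv[OF p] by (simp add: fin_sym_carrier)
qed

lemma fin_sym_comp_closed:
  assumes "p \<in> carrier (fin_sym A)" "q \<in> carrier (fin_sym A)" shows "p \<circ> q \<in> carrier (fin_sym A)"
proof -
  have "{x. (p \<circ> q) x \<noteq> x} \<subseteq> {x. p x \<noteq> x} \<union> {x. q x \<noteq> x}" by auto
  moreover have "finite ({x. p x \<noteq> x} \<union> {x. q x \<noteq> x})" using assms by (simp add: fin_sym_carrier)
  ultimately have "finite {x. (p \<circ> q) x \<noteq> x}" by (rule finite_subset)
  then show ?thesis using assms by (simp add: fin_sym_carrier permutes_compose)
qed

lemma group_fin_sym: "group (fin_sym A)"
proof (rule groupI)
  show "\<one>\<^bsub>fin_sym A\<^esub> \<in> carrier (fin_sym A)" by (simp add: fin_sym_carrier permutes_id)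
  fix x assume x: "x \<in> carrier (fin_sym A)"
  show "\<exists>y\<in>carrier (fin_sym A). y \<otimes>\<^bsub>fin_sym A\<^esub> x = \<one>\<^bsub>fin_sym A\<^esub>"
    using fin_sym_inv_closed[OF x] permutes_inv_o(2)[of x A] x by (auto simp: fin_sym_carrier)
qed (auto simp: fin_sym_comp_closed o_assoc)

lemma fin_sym_inv:
  assumes p: "p \<in> carrier (fin_sym A)" shows "inv\<^bsub>fin_sym A\<^esub> p = inv_into UNIV p"
  by (rule group.inv_equality[OF group_fin_sym _ p fin_sym_inv_closed[OF p]])
     (use p permutes_inv_o(2)[of p A] in \<open>simp add: fin_sym_carrier\<close>)

lemma fin_sym_finite_carrier: "finite E \<Longrightarrow> p \<in> carrier (fin_sym E) \<longleftrightarrow> p permutes E"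
  using finite_subset[of "{x. p x \<noteq> x}" E] by (auto simp: fin_sym_carrier permutes_def)

lemma perm_action_relabel:
  assumes "\<And>p r. p \<in> carrier (fin_sym A) \<Longrightarrow> r \<in> X \<Longrightarrow> relabel p r \<in> X"
  shows "perm_action (fin_sym A) relabel X"
  by (rule perm_action.intro[OF group_fin_sym]) (use assms in \<open>auto simp: relabel_comp\<close>)

abbreviation sym_rep :: "'a set \<Rightarrow> ('i \<Rightarrow> 'a set) set \<Rightarrow> ('a \<Rightarrow> 'a, 'i \<Rightarrow> 'a set) urep" where
  "sym_rep E X \<equiv> permutation_rep (fin_sym E) relabel X"

lemma perm_action_finite: "finite E \<Longrightarrow> perm_invariant E X \<Longrightarrow> perm_action (fin_sym E) relabel X"
  by (rule perm_action_relabel) (simp add: fin_sym_finite_carrier perm_invariant_def)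

lemma sym_rep_act:
  assumes "finite E" "perm_invariant E X" "p permutes E" "f \<in> funs_on X"
  shows "rep_act (sym_rep E X) p f = pact p f"
proof -
  have "p \<in> carrier (fin_sym E)" using assms by (simp add: fin_sym_finite_carrier)
  then show ?thesis using pact_funs_on[OF assms(2-4)]
    by (auto simp: permutation_rep_def fin_sym_inv pact_def funs_on_def fun_eq_iff)
qed

definition perm_iso :: "'a set \<Rightarrow> ('i \<Rightarrow> 'a set) set \<Rightarrow> (('i \<Rightarrow> 'a set) \<Rightarrow> complex) set \<Rightarrow> ('j \<Rightarrow> 'a set) set \<Rightarrow>
    (('j \<Rightarrow> 'a set) \<Rightarrow> complex) set \<Rightarrow> ((('i \<Rightarrow> 'a set) \<Rightarrow> complex) \<Rightarrow> (('j \<Rightarrow> 'a set) \<Rightarrow> complex)) \<Rightarrow> bool" where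
  "perm_iso E X V Y W \<phi> \<longleftrightarrow> bij_betw \<phi> V W \<and> perm_hom E V Y \<phi> \<and>
     (\<forall>u\<in>V. \<forall>v\<in>V. ip Y (\<phi> u) (\<phi> v) = ip X u v)"

context
  fixes E :: "'a set" and X :: "('i \<Rightarrow> 'a set) set" and Y :: "('j \<Rightarrow> 'a set) set"
    and V :: "(('i \<Rightarrow> 'a set) \<Rightarrow> complex) set" and W :: "(('j \<Rightarrow> 'a set) \<Rightarrow> complex) set"
  assumes finE: "finite E" and finX: "finite X" and finY: "finite Y"
    and X: "perm_invariant E X" and Y: "perm_invariant E Y"
    and V: "perm_submodule E V" "V \<subseteq> funs_on X" and W: "perm_submodule E W" "W \<subseteq> funs_on Y"
begin

text \<open>On finite sets \<open>l2\<close> consists of all functions supported there,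
  \<open>l2_inner\<close> is \<open>ip\<close> and the action is \<open>pact\<close>, so questions
  of equivalence become questions about finite modules.\<close>

lemma unitarily_equivalent_iff_perm_iso:
  "unitarily_equivalent (fin_sym E) (subrep (sym_rep E X) V) (subrep (sym_rep E Y) W) \<longleftrightarrow>
     (\<exists>\<phi>. perm_iso E X V Y W \<phi>)"
proof -
  have rs: "rep_space (subrep \<rho> U) = U" "rep_act (subrep \<rho> U) = rep_act \<rho>"
    for U and \<rho> :: "('g, 'y) urep" by (simp_all add: subrep_def)
  have "(bij_betw U V W \<and> linear_map_on V U \<and>
       (\<forall>f\<in>V. \<forall>f'\<in>V. l2_inner (U f) (U f') = l2_inner f f') \<and>
       (\<forall>g\<in>carrier (fin_sym E). \<forall>f\<in>V. U (rep_act (sym_rep E X) g f) = rep_act (sym_rep E Y) g (U f)))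
    \<longleftrightarrow> perm_iso E X V Y W U" for U
  proof (cases "bij_betw U V W")
    case True
    have UW: "U f \<in> W" if "f \<in> V" for f by (rule bij_betw_apply[OF True that])
    have Vf: "f \<in> funs_on X" if "f \<in> V" for f using V(2) that by blast
    have Uf: "U f \<in> funs_on Y" if "f \<in> V" for f using UW[OF that] W(2) by blast
    have "l2_inner (U f) (U f') = ip Y (U f) (U f')" "l2_inner f f' = ip X f f'" if "f \<in> V" for f f'
      using l2_inner_finite[OF finY Uf[OF that]] l2_inner_finite[OF finX Vf[OF that]] by simp_all
    moreover have "rep_act (sym_rep E X) g f = pact g f" "rep_act (sym_rep E Y) g (U f) = pact g (U f)"
      if "g permutes E" "f \<in> V" for f g
      using sym_rep_act[OF finE X that(1) Vf[OF that(2)]] sym_rep_act[OF finE Y that(1) Uf[OF that(2)]] by simp_all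
    ultimately show ?thesis using True Uf
      by (auto simp: perm_iso_def perm_hom_def fin_sym_finite_carrier[OF finE])
  qed (simp add: perm_iso_def)
  then show ?thesis unfolding unitarily_equivalent_def rs by blast
qed

lemma perm_iso_inv:
  assumes \<phi>: "perm_iso E X V Y W \<phi>" shows "perm_iso E Y W X V (inv_into V \<phi>)"
proof -
  let ?\<psi> = "inv_into V \<phi>"
  have b: "bij_betw \<phi> V W" and h: "perm_hom E V Y \<phi>"
    and i: "\<And>u v. u \<in> V \<Longrightarrow> v \<in> V \<Longrightarrow> ip Y (\<phi> u) (\<phi> v) = ip X u v"
    using \<phi> by (auto simp: perm_iso_def)
  have b': "bij_betw ?\<psi> W V" by (rule bij_betw_inv_into[OF b])
  have \<psi>V: "?\<psi> w \<in> V" if "w \<in> W" for w by (rule bij_betw_apply[OF b' that])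
  have \<phi>\<psi>: "\<phi> (?\<psi> w) = w" if "w \<in> W" for w by (rule bij_betw_inv_into_right[OF b that])
  have \<psi>\<phi>: "?\<psi> (\<phi> v) = v" if "v \<in> V" for v by (rule bij_betw_inv_into_left[OF b that])
  have linV: "lin_subspace V" using V(1) by (simp add: perm_submodule_def)
  have "perm_hom E W X ?\<psi>" unfolding perm_hom_def
  proof (intro conjI ballI allI impI)
    show "?\<psi> u \<in> funs_on X" if "u \<in> W" for u using \<psi>V[OF that] V(2) by blast
    show "linear_map_on W ?\<psi>" unfolding linear_map_on_def
    proof (intro ballI allI)
      fix f g a b assume fg: "f \<in> W" "g \<in> W"
      have "\<phi> (\<lambda>x. a * ?\<psi> f x + b * ?\<psi> g x) = (\<lambda>x. a * f x + b * g x)"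
        using linear_map_on_comb[of V \<phi> "?\<psi> f" "?\<psi> g" a b] h \<psi>V fg \<phi>\<psi> by (simp add: perm_hom_def)
      then show "?\<psi> (\<lambda>x. a * f x + b * g x) = (\<lambda>x. a * ?\<psi> f x + b * ?\<psi> g x)"
        using \<psi>\<phi>[OF lin_subspace_comb[OF linV \<psi>V[OF fg(1)] \<psi>V[OF fg(2)]], of a b] by simp
    qed
    fix p u assume p: "p permutes E" and u: "u \<in> W"
    have "\<phi> (pact p (?\<psi> u)) = pact p u" using h p \<psi>V[OF u] \<phi>\<psi>[OF u] by (simp add: perm_hom_def)
    moreover have "pact p (?\<psi> u) \<in> V" using V(1) p \<psi>V[OF u] by (simp add: perm_submodule_def)
    ultimately show "?\<psi> (pact p u) = pact p (?\<psi> u)" using \<psi>\<phi> by metis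
  qed
  moreover have "ip X (?\<psi> u) (?\<psi> v) = ip Y u v" if "u \<in> W" "v \<in> W" for u v
    using i[OF \<psi>V[OF that(1)] \<psi>V[OF that(2)]] \<phi>\<psi> that by simp
  ultimately show ?thesis using b' by (auto simp: perm_iso_def)
qed

end

lemma perm_irreducibleI:
  assumes finE: "finite E" and finX: "finite X" and X: "perm_invariant E X"
    and V: "perm_submodule E V" "V \<subseteq> funs_on X" "V \<noteq> {\<lambda>_. 0}"
    and irr: "\<And>W. perm_submodule E W \<Longrightarrow> W \<subseteq> V \<Longrightarrow> W = {\<lambda>_. 0} \<or> W = V"
  shows "irreducible_rep (fin_sym E) (subrep (sym_rep E X) V)"
proof -
  interpret perm_action "fin_sym E" relabel X by (rule perm_action_finite[OF finE X])
  have lin: "lin_subspace V" using V(1) by (simp add: perm_submodule_def)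
  have act: "rep_act (sym_rep E X) p f = pact p f" if "p permutes E" "f \<in> V" for p f
    using sym_rep_act[OF finE X that(1)] that(2) V(2) by blast
  have "unitary_rep (fin_sym E) (subrep (sym_rep E X) V)"
  proof (rule unitary_subrep[OF funs_on_closed[OF finX lin V(2)]])
    show "V \<subseteq> l2 X" using V(2) l2_finite[OF finX] by simp
    show "ract g f \<in> V" if "g \<in> carrier (fin_sym E)" "f \<in> V" for g f
      using act V(1) that fin_sym_finite_carrier[OF finE] by (simp add: perm_submodule_def)
  qed
  moreover have "W = {\<lambda>_. 0} \<or> W = V"
    if W: "l2_closed_subspace W" "W \<subseteq> V" "\<forall>g\<in>carrier (fin_sym E). ract g ` W \<subseteq> W" for W
  proof (rule irr[OF _ W(2)])
    have "pact p u \<in> W" if "p permutes E" "u \<in> W" for p u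
      using W(2,3) act[OF that(1), of u] that fin_sym_finite_carrier[OF finE, of p] by force
    then show "perm_submodule E W" using l2_closed_lin[OF W(1)] by (simp add: perm_submodule_def)
  qed
  ultimately show ?thesis unfolding irreducible_rep_def using V(3) by (simp add: subrep_def)
qed

text \<open>A submodule of functions on a finite set is closed by \<open>funs_on_closed\<close>, so
  irreducibility, which is defined by closed subspaces, applies to it.\<close>

lemma perm_irreducibleD:
  assumes finE: "finite E" and finX: "finite X" and X: "perm_invariant E X" and VX: "V \<subseteq> funs_on X"
    and irr: "irreducible_rep (fin_sym E) (subrep (sym_rep E X) V)"
    and W: "perm_submodule E W" "W \<subseteq> V"
  shows "W = {\<lambda>_. 0} \<or> W = V"
proof -
  have WX: "W \<subseteq> funs_on X" using W(2) VX by blast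
  have lin: "lin_subspace W" using W(1) by (simp add: perm_submodule_def)
  have "rep_act (sym_rep E X) p f \<in> W" if "p \<in> carrier (fin_sym E)" "f \<in> W" for p f
    using sym_rep_act[OF finE X] W(1) WX that fin_sym_finite_carrier[OF finE]
    by (metis perm_submodule_def subsetD)
  then show ?thesis using irr W(2) funs_on_closed[OF finX lin WX]
    by (simp add: irreducible_rep_def subrep_def image_subset_iff)
qed

lemma specht_rep_eq: "specht_rep \<mu> E = subrep (sym_rep E (tabloids \<mu> E)) (specht \<mu> E)"
  by (simp add: specht_rep_def specht_def tabloids_def)

lemma specht_nonzero:
  assumes "finite E" "\<mu> \<in> young_diagrams (card E)" shows "\<exists>u\<in>specht \<mu> E. u \<noteq> (\<lambda>_. 0)"
proof -
  obtain t where t: "t \<in> tableaux \<mu> E" using tableaux_nonempty[OF assms] by blast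
  interpret young_tableau \<mu> E t by (rule young_tableauI[OF assms t])
  show ?thesis using e_specht e_tabloid by (intro bexI[of _ e]) auto
qed

text \<open>The orthogonal projection onto the image of \<psi> is written in the orthonormal basis
  transported from the Specht module; irreducibility and type of the image are carried over by
  \<psi>.\<close>

lemma projection_onto_isometric_image:
  assumes finE: "finite E" and mu: "\<mu> \<in> young_diagrams (card E)"
    and finX: "finite X" and X: "perm_invariant E X"
    and \<psi>: "perm_hom E (specht \<mu> E) X \<psi>"
    and iso: "\<And>u v. u \<in> specht \<mu> E \<Longrightarrow> v \<in> specht \<mu> E \<Longrightarrow> ip X (\<psi> u) (\<psi> v) = ip (tabloids \<mu> E) u v"
  shows "\<exists>P. component_projection (fin_sym E) (sym_rep E X) (specht_rep \<mu> E) P"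
proof -
  let ?S = "specht \<mu> E" let ?T = "tabloids \<mu> E"
  have S: "perm_submodule E ?S" "?S \<subseteq> funs_on ?T"
    using perm_submodule_specht[OF finE mu] specht_funs_on[OF finE mu] by auto
  have finT: "finite ?T" using finE by simp
  obtain d :: nat and b where b: "\<And>i. i < d \<Longrightarrow> b i \<in> ?S" "orthonormal ?T {..<d} b"
    "\<And>u. u \<in> ?S \<Longrightarrow> u = (\<lambda>x. \<Sum>i<d. ip ?T u (b i) * b i x)"
    using orthonormal_basis_exists[OF finT lin_subspace_specht S(2)] by blast
  define W where "W = \<psi> ` ?S"
  have lin: "linear_map_on ?S \<psi>" using \<psi> by (simp add: perm_hom_def)
  have WX: "W \<subseteq> funs_on X" using \<psi> by (auto simp: W_def perm_hom_def)
  have eqv: "\<psi> (pact p u) = pact p (\<psi> u)" if "p permutes E" "u \<in> ?S" for p u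
    using \<psi> that by (simp add: perm_hom_def)
  have pS: "pact p u \<in> ?S" if "p permutes E" "u \<in> ?S" for p u using S(1) that by (simp add: perm_submodule_def)
  have linW: "lin_subspace W" unfolding lin_subspace_def
  proof (intro conjI ballI allI)
    have "(\<lambda>_. 0) \<in> ?S" using lin_subspace_specht by (auto simp: lin_subspace_def)
    then show "(\<lambda>_. 0) \<in> W" using linear_map_on_zero[OF lin] unfolding W_def by (metis imageI)
    fix f g a c assume "f \<in> W" "g \<in> W"
    then obtain u v where uv: "u \<in> ?S" "v \<in> ?S" "f = \<psi> u" "g = \<psi> v" by (auto simp: W_def)
    have "(\<lambda>x. a * f x + c * g x) = \<psi> (\<lambda>x. a * u x + c * v x)"
      unfolding uv(3,4) by (rule linear_map_on_comb[OF lin uv(1,2), symmetric])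
    then show "(\<lambda>x. a * f x + c * g x) \<in> W"
      unfolding W_def using lin_subspace_comb[OF lin_subspace_specht uv(1,2), of a c] by (rule image_eqI)
  qed
  have W: "perm_submodule E W" unfolding perm_submodule_def
    using linW eqv pS by (auto simp: W_def) (metis imageI)
  define P where "P f = (\<lambda>x. \<Sum>i<d. ip X f (\<psi> (b i)) * \<psi> (b i) x)" for f
  have \<psi>sum: "(\<lambda>x. \<Sum>i<d. c i * \<psi> (b i) x) = \<psi> (\<lambda>x. \<Sum>i<d. c i * b i x)" for c
    by (rule linear_map_on_sum[OF lin_subspace_specht lin, symmetric]) (use b in auto)
  have PW: "P f \<in> W" for f
    unfolding P_def \<psi>sum W_def by (intro imageI lin_subspace_sum[OF lin_subspace_specht]) (use b in auto)
  have P\<psi>: "P w = w" if "w \<in> W" for w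
  proof -
    obtain u where u: "u \<in> ?S" "w = \<psi> u" using \<open>w \<in> W\<close> by (auto simp: W_def)
    have "P w = (\<lambda>x. \<Sum>i<d. ip ?T u (b i) * \<psi> (b i) x)"
      unfolding P_def u using iso[OF u(1) b(1)] by (intro ext sum.cong refl) auto
    also have "\<dots> = \<psi> (\<lambda>x. \<Sum>i<d. ip ?T u (b i) * b i x)" by (rule \<psi>sum)
    also have "\<dots> = w" using b(3)[OF u(1)] u(2) by simp
    finally show ?thesis .
  qed
  have sa: "ip X (P f) g = ip X f (P g)" for f g
    unfolding P_def ip_sum_left ip_sum_right by (intro sum.cong refl) (simp add: ip_cnj[of X g])
  \<comment> \<open>Both sides lie in the invariant subspace W, so they may be compared by pairing
    with W, on which the self-adjoint P is the identity.\<close>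
  have Peq: "P (pact p f) = pact p (P f)" if p: "p permutes E" and f: "f \<in> funs_on X" for p f
  proof (rule ip_ext[OF finX PW _ linW WX])
    have inW: "pact p w \<in> W" if "p permutes E" "w \<in> W" for p w using W that by (simp add: perm_submodule_def)
    show "pact p (P f) \<in> W" by (rule inW[OF p PW])
    fix w assume w: "w \<in> W"
    have iw: "pact (inv_into UNIV p) w \<in> W" by (rule inW[OF permutes_inv[OF p] w])
    have "ip X (P (pact p f)) w = ip X (pact p f) w" by (simp add: sa P\<psi>[OF w])
    also have "\<dots> = ip X f (pact (inv_into UNIV p) w)" by (rule ip_pact[OF X p])
    also have "\<dots> = ip X (P f) (pact (inv_into UNIV p) w)" by (simp add: sa P\<psi>[OF iw])
    also have "\<dots> = ip X (pact p (P f)) w" by (rule ip_pact[OF X p, symmetric])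
    finally show "ip X (P (pact p f)) w = ip X (pact p (P f)) w" .
  qed
  have rs: "rep_space (sym_rep E X) = funs_on X" by (simp add: permutation_rep_def l2_finite[OF finX])
  have im: "P ` funs_on X = W"
  proof (intro equalityI subsetI)
    show "w \<in> P ` funs_on X" if "w \<in> W" for w using P\<psi>[OF that] that WX by (metis imageI subsetD)
  qed (use PW in auto)
  have inner: "l2_inner f g = ip X f g" if "f \<in> funs_on X" for f g by (rule l2_inner_finite[OF finX that])
  have inj: "inj_on \<psi> ?S"
  proof (rule inj_onI)
    fix u v assume uv: "u \<in> ?S" "v \<in> ?S" "\<psi> u = \<psi> v"
    show "u = v"
      by (rule ip_ext[OF finT uv(1,2) lin_subspace_specht S(2)]) (use iso uv in metis)
  qed
  have "perm_iso E ?T ?S X W \<psi>" using inj iso \<psi> by (auto simp: perm_iso_def bij_betw_def W_def)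
  then have "perm_iso E X W ?T ?S (inv_into ?S \<psi>)"
    by (rule perm_iso_inv[OF finE finT finX perm_invariant_tabloids X S W WX])
  then have equiv: "unitarily_equivalent (fin_sym E) (subrep (sym_rep E X) W) (specht_rep \<mu> E)"
    unfolding specht_rep_eq
    using unitarily_equivalent_iff_perm_iso[OF finE finX finT X perm_invariant_tabloids W WX S] by blast
  have irr: "irreducible_rep (fin_sym E) (subrep (sym_rep E X) W)"
  proof (rule perm_irreducibleI[OF finE finX X W WX])
    obtain u where u: "u \<in> ?S" "u \<noteq> (\<lambda>_. 0)" using specht_nonzero[OF finE mu] by blast
    have "ip X (\<psi> u) (\<psi> u) \<noteq> 0" using iso[OF u(1) u(1)] ip_self_eq_0[OF finT] u S(2) by auto
    then have "\<psi> u \<noteq> (\<lambda>_. 0)" by (auto simp: ip_def)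
    then show "W \<noteq> {\<lambda>_. 0}" using u(1) by (auto simp: W_def)
    fix W' assume W': "perm_submodule E W'" "W' \<subseteq> W"
    show "W' = {\<lambda>_. 0} \<or> W' = W"
    proof (cases "W' \<subseteq> {\<lambda>_. 0}")
      case True
      then show ?thesis using W'(1) by (auto simp: perm_submodule_def lin_subspace_def)
    next
      case False
      then obtain w where w: "w \<in> W'" "w \<noteq> (\<lambda>_. 0)" by blast
      define U where "U = {u \<in> ?S. \<psi> u \<in> W'}"
      obtain u where u': "u \<in> ?S" "w = \<psi> u" using w W'(2) by (auto simp: W_def)
      have lin': "lin_subspace W'" using W'(1) by (simp add: perm_submodule_def)
      have "(\<lambda>_. 0) \<in> ?S" using lin_subspace_specht by (auto simp: lin_subspace_def)
      then have \<psi>0: "\<psi> (\<lambda>_. 0) = (\<lambda>_. 0)" using linear_map_on_zero[OF lin] by blast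
      have "perm_submodule E U" unfolding perm_submodule_def lin_subspace_def
      proof (intro conjI ballI allI impI)
        show "(\<lambda>_. 0) \<in> U" using \<psi>0 lin' lin_subspace_specht[of \<mu> E] by (simp add: U_def lin_subspace_def)
        show "(\<lambda>x. a * f x + c * g x) \<in> U" if "f \<in> U" "g \<in> U" for f g a c
          using that linear_map_on_comb[OF lin, of f g a c] lin_subspace_comb[OF lin', of "\<psi> f" "\<psi> g" a c]
            lin_subspace_comb[OF lin_subspace_specht, of f \<mu> E g a c] by (simp add: U_def)
        show "pact p f \<in> U" if "p permutes E" "f \<in> U" for p f
          using that eqv[of p f] pS[of p f] W'(1) by (simp add: U_def perm_submodule_def)
      qed
      moreover have "U \<subseteq> ?S" "u \<in> U" using u' w by (auto simp: U_def)
      moreover have "u \<noteq> (\<lambda>_. 0)" using u' w(2) \<psi>0 by auto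
      ultimately have "U = ?S" using specht_irreducible[OF finE mu] by blast
      then have "W \<subseteq> W'" by (auto simp: W_def U_def)
      then show ?thesis using W'(2) by blast
    qed
  qed
  have act: "rep_act (sym_rep E X) p f = pact p f" if "p permutes E" "f \<in> funs_on X" for p f
    by (rule sym_rep_act[OF finE X that])
  have "component_projection (fin_sym E) (sym_rep E X) (specht_rep \<mu> E) P"
    unfolding component_projection_def rs im
  proof (intro conjI ballI irr equiv WX)
    show "linear_map_on (funs_on X) P"
      by (simp add: linear_map_on_def P_def ip_comb_left algebra_simps sum.distrib sum_distrib_left)
    show "P (P f) = P f" for f by (rule P\<psi>[OF PW])
    show "l2_inner (P f) f' = l2_inner f (P f')" if "f \<in> funs_on X" for f f'
      using inner[OF that] inner[of "P f"] PW WX sa by auto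
    show "P (rep_act (sym_rep E X) g f) = rep_act (sym_rep E X) g (P f)"
      if "g \<in> carrier (fin_sym E)" "f \<in> funs_on X" for g f
    proof -
      have g: "g permutes E" using that fin_sym_finite_carrier[OF finE] by blast
      have "P f \<in> funs_on X" using PW WX by blast
      then show ?thesis using act[OF g] Peq[OF g] that(2) by simp
    qed
  qed
  then show ?thesis by blast
qed

section \<open>Adjoints and partial isometries on the fibre\<close>

context fibred_rep
begin

definition adj :: "((('i \<Rightarrow> 'a set) \<Rightarrow> complex) \<Rightarrow> (('i \<Rightarrow> 'a set) \<Rightarrow> complex)) \<Rightarrow>
    (('i \<Rightarrow> 'a set) \<Rightarrow> complex) \<Rightarrow> (('i \<Rightarrow> 'a set) \<Rightarrow> complex)" where
  "adj T v = (\<lambda>s. if s \<in> F then ip F v (T (delta s)) else 0)"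

lemma adj_funs_on: "adj T v \<in> funs_on F" by (simp add: adj_def funs_on_def)

lemma adj_op_on: "op_on (adj T)"
  unfolding op_on_def using adj_funs_on
  by (auto simp: linear_map_on_def adj_def ip_comb_left fun_eq_iff)

lemma ip_adj:
  assumes "op_on T" "u \<in> funs_on F" shows "ip F (T u) v = ip F u (adj T v)"
proof -
  have "ip F (T u) v = (\<Sum>s\<in>F. u s * ip F (T (delta s)) v)"
    by (subst op_kernel[OF assms]) (rule ip_sum_left)
  also have "\<dots> = ip F u (adj T v)" unfolding ip_def[of F u]
    by (intro sum.cong refl) (simp add: adj_def ip_cnj[of F v])
  finally show ?thesis .
qed

lemma ip_ext_right:
  assumes "u \<in> funs_on F" "v \<in> funs_on F" "\<And>w. w \<in> funs_on F \<Longrightarrow> ip F w u = ip F w v" shows "u = v"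
  by (rule ip_ext[OF finF assms(1,2) lin_subspace_funs_on subset_refl]) (metis assms(3) ip_cnj)

lemma adj_op_equiv:
  assumes T: "op_equiv T" shows "op_equiv (adj T)"
  unfolding op_equiv_def
proof (intro conjI adj_op_on allI impI)
  fix p v assume p: "p permutes E" and v: "v \<in> funs_on F"
  let ?i = "inv_into UNIV p"
  have i: "?i permutes E" by (rule permutes_inv[OF p])
  have To: "op_on T" by (rule op_equiv_on[OF T])
  show "adj T (pact p v) = pact p (adj T v)"
  proof (rule ip_ext_right[OF adj_funs_on pact_funs_on[OF F_inv p adj_funs_on]])
    fix w assume w: "w \<in> funs_on F"
    have iw: "pact ?i w \<in> funs_on F" by (rule pact_funs_on[OF F_inv i w])
    have "ip F w (adj T (pact p v)) = ip F (T w) (pact p v)" by (rule ip_adj[OF To w, symmetric])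
    also have "\<dots> = ip F (pact ?i (T w)) v" using ip_pact[OF F_inv i, of "T w" v] by (simp add: permutes_inv_inv[OF p])
    also have "\<dots> = ip F (T (pact ?i w)) v" using T i w by (simp add: op_equiv_def)
    also have "\<dots> = ip F (pact ?i w) (adj T v)" by (rule ip_adj[OF To iw])
    also have "\<dots> = ip F w (pact p (adj T v))" using ip_pact[OF F_inv i, of w] by (simp add: permutes_inv_inv[OF p])
    finally show "ip F w (adj T (pact p v)) = ip F w (pact p (adj T v))" .
  qed
qed

text \<open>The part of \<open>component_projection\<close> that passes through the fibrewise lift;
  irreducibility and the isomorphism type are used separately.\<close>

definition component :: "((('i \<Rightarrow> 'a set) \<Rightarrow> complex) \<Rightarrow> (('i \<Rightarrow> 'a set) \<Rightarrow> complex)) \<Rightarrow> bool" where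
  "component P \<longleftrightarrow> op_equiv P \<and> (\<forall>u\<in>funs_on F. P (P u) = P u) \<and>
     (\<forall>u\<in>funs_on F. \<forall>v\<in>funs_on F. ip F (P u) v = ip F u (P v))"

text \<open>The projections \<open>P a\<close> are given in advance and may coincide for several a,
  while \<open>\<psi> a\<close> places the copies in orthogonal positions. The composite
  \<open>\<sigma> a\<close> carries the range of \<open>P a\<close> through the abstract module
  \<open>S a\<close> isometrically onto copy number a, and vanishes on the orthogonal
  complement.\<close>

lemma decomposition_from_isometries:
  fixes J :: "'j set"
  assumes J: "finite J" and P: "\<And>a. a \<in> J \<Longrightarrow> component (P a)"
    and S: "\<And>a. a \<in> J \<Longrightarrow> perm_submodule E (S a)"
    and \<psi>: "\<And>a. a \<in> J \<Longrightarrow> perm_hom E (S a) F (\<psi> a)"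
    and \<psi>ip: "\<And>a b u v. a \<in> J \<Longrightarrow> b \<in> J \<Longrightarrow> u \<in> S a \<Longrightarrow> v \<in> S b \<Longrightarrow>
        ip F (\<psi> a u) (\<psi> b v) = (if a = b then ip (T a) u v else 0)"
    and \<psi>on: "\<And>f. f \<in> funs_on F \<Longrightarrow> \<exists>v. (\<forall>a\<in>J. v a \<in> S a) \<and> f = (\<lambda>r. \<Sum>a\<in>J. \<psi> a (v a) r)"
    and \<eta>: "\<And>a. a \<in> J \<Longrightarrow> perm_iso E F (P a ` funs_on F) (T a) (S a) (\<eta> a)"
  shows "unitarily_equivalent G \<rho> (direct_sum_rep J (\<lambda>a. subrep \<rho> (lift (P a) ` l2 X)))"
proof -
  define \<sigma> where "\<sigma> a u = \<psi> a (\<eta> a (P a u))" for a u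
  have Pe: "op_equiv (P a)" and idem: "\<And>u. u \<in> funs_on F \<Longrightarrow> P a (P a u) = P a u"
    and sa: "\<And>u v. u \<in> funs_on F \<Longrightarrow> v \<in> funs_on F \<Longrightarrow> ip F (P a u) v = ip F u (P a v)" if "a \<in> J" for a
    using P[OF that] by (auto simp: component_def)
  have Pf: "P a u \<in> funs_on F" if "a \<in> J" "u \<in> funs_on F" for a u
    using Pe[OF that(1)] that(2) by (simp add: op_equiv_def op_on_def)
  have Plin: "linear_map_on (funs_on F) (P a)" if "a \<in> J" for a
    using Pe[OF that] by (simp add: op_equiv_def op_on_def)
  have \<eta>b: "bij_betw (\<eta> a) (P a ` funs_on F) (S a)" and \<eta>lin: "linear_map_on (P a ` funs_on F) (\<eta> a)"
    and \<eta>ip: "\<And>u v. u \<in> P a ` funs_on F \<Longrightarrow> v \<in> P a ` funs_on F \<Longrightarrow> ip (T a) (\<eta> a u) (\<eta> a v) = ip F u v"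
    and \<eta>eq: "\<And>p u. p permutes E \<Longrightarrow> u \<in> P a ` funs_on F \<Longrightarrow> \<eta> a (pact p u) = pact p (\<eta> a u)" if "a \<in> J" for a
    using \<eta>[OF that] by (auto simp: perm_iso_def perm_hom_def)
  have \<eta>S: "\<eta> a (P a u) \<in> S a" if "a \<in> J" "u \<in> funs_on F" for a u
    using bij_betw_apply[OF \<eta>b[OF that(1)]] that(2) by blast
  have \<sigma>e: "op_equiv (\<sigma> a)" if a: "a \<in> J" for a
    unfolding op_equiv_def op_on_def
  proof (intro conjI ballI allI impI)
    show "\<sigma> a u \<in> funs_on F" if "u \<in> funs_on F" for u
      using \<psi>[OF a] \<eta>S[OF a that] by (simp add: \<sigma>_def perm_hom_def)
    show "linear_map_on (funs_on F) (\<sigma> a)" unfolding linear_map_on_def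
    proof (intro ballI allI)
      fix f h c d assume fh: "f \<in> funs_on F" "h \<in> funs_on F"
      have "P a (\<lambda>x. c * f x + d * h x) = (\<lambda>x. c * P a f x + d * P a h x)"
        by (rule linear_map_on_comb[OF Plin[OF a] fh])
      then have "\<eta> a (P a (\<lambda>x. c * f x + d * h x)) = (\<lambda>x. c * \<eta> a (P a f) x + d * \<eta> a (P a h) x)"
        using linear_map_on_comb[OF \<eta>lin[OF a], of "P a f" "P a h" c d] fh by simp
      then show "\<sigma> a (\<lambda>x. c * f x + d * h x) = (\<lambda>x. c * \<sigma> a f x + d * \<sigma> a h x)"
        using linear_map_on_comb[of "S a" "\<psi> a" "\<eta> a (P a f)" "\<eta> a (P a h)" c d] \<psi>[OF a] \<eta>S[OF a] fh
        by (simp add: \<sigma>_def perm_hom_def)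
    qed
    fix p u assume p: "p permutes E" and u: "u \<in> funs_on F"
    have "P a (pact p u) = pact p (P a u)" using Pe[OF a] p u by (simp add: op_equiv_def)
    then show "\<sigma> a (pact p u) = pact p (\<sigma> a u)"
      using \<eta>eq[OF a p, of "P a u"] \<psi>[OF a] \<eta>S[OF a u] p u by (simp add: \<sigma>_def perm_hom_def)
  qed
  have \<sigma>o: "op_on (\<sigma> a)" if "a \<in> J" for a by (rule op_equiv_on[OF \<sigma>e[OF that]])
  have \<sigma>f: "\<sigma> a u \<in> funs_on F" if "a \<in> J" "u \<in> funs_on F" for a u
    using \<sigma>o[OF that(1)] that(2) by (simp add: op_on_def)
  have \<sigma>ip: "ip F (\<sigma> a u) (\<sigma> b v) = (if a = b then ip F u (P a v) else 0)"
    if ab: "a \<in> J" "b \<in> J" and uv: "u \<in> funs_on F" "v \<in> funs_on F" for a b u v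
  proof -
    have "ip F (\<sigma> a u) (\<sigma> b v) = (if a = b then ip (T a) (\<eta> a (P a u)) (\<eta> b (P b v)) else 0)"
      unfolding \<sigma>_def by (rule \<psi>ip[OF ab \<eta>S[OF ab(1) uv(1)] \<eta>S[OF ab(2) uv(2)]])
    also have "\<dots> = (if a = b then ip F (P a u) (P a v) else 0)"
      using \<eta>ip[OF ab(1), of "P a u" "P a v"] uv by auto
    also have "\<dots> = (if a = b then ip F u (P a v) else 0)"
      using sa[OF ab(1) uv(1) Pf[OF ab(1) uv(2)]] idem[OF ab(1) uv(2)] by auto
    finally show ?thesis .
  qed
  define \<tau> where "\<tau> a = adj (\<sigma> a)" for a
  have \<tau>f: "\<tau> a v \<in> funs_on F" for a v unfolding \<tau>_def by (rule adj_funs_on)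
  have \<sigma>\<tau>: "ip F (\<sigma> a u) v = ip F u (\<tau> a v)" if "a \<in> J" "u \<in> funs_on F" for a u v
    unfolding \<tau>_def by (rule ip_adj[OF \<sigma>o[OF that(1)] that(2)])
  have \<sigma>P: "\<sigma> a (P a u) = \<sigma> a u" if "a \<in> J" "u \<in> funs_on F" for a u using idem[OF that] by (simp add: \<sigma>_def)
  have P\<tau>: "P a (\<tau> a v) = \<tau> a v" if a: "a \<in> J" for a v
  proof (rule ip_ext_right[OF Pf[OF a \<tau>f] \<tau>f])
    fix w assume w: "w \<in> funs_on F"
    have "ip F w (P a (\<tau> a v)) = ip F (P a w) (\<tau> a v)" by (rule sa[OF a w \<tau>f, symmetric])
    also have "\<dots> = ip F (\<sigma> a (P a w)) v" by (rule \<sigma>\<tau>[OF a Pf[OF a w], symmetric])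
    also have "\<dots> = ip F w (\<tau> a v)" by (simp add: \<sigma>P[OF a w] \<sigma>\<tau>[OF a w])
    finally show "ip F w (P a (\<tau> a v)) = ip F w (\<tau> a v)" .
  qed
  have \<tau>\<sigma>: "\<tau> a (\<sigma> b u) = (if a = b then P a u else (\<lambda>_. 0))"
    if ab: "a \<in> J" "b \<in> J" and u: "u \<in> funs_on F" for a b u
  proof (rule ip_ext_right[OF \<tau>f])
    show "(if a = b then P a u else (\<lambda>_. 0)) \<in> funs_on F" using Pf[OF ab(1) u] by (auto simp: funs_on_def)
    fix w assume w: "w \<in> funs_on F"
    have "ip F w (\<tau> a (\<sigma> b u)) = ip F (\<sigma> a w) (\<sigma> b u)" by (rule \<sigma>\<tau>[OF ab(1) w, symmetric])
    also have "\<dots> = (if a = b then ip F w (P a u) else 0)" by (rule \<sigma>ip[OF ab w u])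
    also have "\<dots> = ip F w (if a = b then P a u else (\<lambda>_. 0))" by (simp add: ip_def)
    finally show "ip F w (\<tau> a (\<sigma> b u)) = ip F w (if a = b then P a u else (\<lambda>_. 0))" .
  qed
  have sum: "(\<lambda>s. \<Sum>a\<in>J. \<sigma> a (\<tau> a f) s) = f" if f: "f \<in> funs_on F" for f
  proof -
    obtain v where v: "\<forall>a\<in>J. v a \<in> S a" "f = (\<lambda>r. \<Sum>a\<in>J. \<psi> a (v a) r)" using \<psi>on[OF f] by blast
    \<comment> \<open>Pulling the components of f back through \<open>\<eta> a\<close> writes f as a
      sum of vectors \<open>\<sigma> b (h b)\<close>; the orthogonality relations then show that
      \<open>\<tau> a\<close> recovers \<open>h a\<close>.\<close>
    have "\<exists>h. h \<in> funs_on F \<and> P a h = h \<and> \<eta> a h = v a" if a: "a \<in> J" for a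
    proof -
      have "v a \<in> \<eta> a ` P a ` funs_on F" using \<eta>b[OF a] v(1) a by (simp add: bij_betw_def)
      then obtain u where "u \<in> funs_on F" "v a = \<eta> a (P a u)" by blast
      then show ?thesis using Pf[OF a] idem[OF a] by (intro exI[of _ "P a u"]) simp
    qed
    then have "\<forall>a\<in>J. \<exists>h. h \<in> funs_on F \<and> P a h = h \<and> \<eta> a h = v a" by blast
    from bchoice[OF this] obtain h where h: "\<And>a. a \<in> J \<Longrightarrow> h a \<in> funs_on F" "\<And>a. a \<in> J \<Longrightarrow> P a (h a) = h a"
      "\<And>a. a \<in> J \<Longrightarrow> \<eta> a (h a) = v a" by blast
    have fh: "f = (\<lambda>r. \<Sum>b\<in>J. 1 * \<sigma> b (h b) r)" using v(2) h by (simp add: \<sigma>_def)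
    have "\<tau> a f = h a" if a: "a \<in> J" for a
    proof -
      have \<tau>l: "linear_map_on (funs_on F) (\<tau> a)" using adj_op_on by (simp add: \<tau>_def op_on_def)
      have "\<tau> a f = \<tau> a (\<lambda>r. \<Sum>b\<in>J. 1 * \<sigma> b (h b) r)" using fh by simp
      also have "\<dots> = (\<lambda>r. \<Sum>b\<in>J. 1 * \<tau> a (\<sigma> b (h b)) r)"
        by (rule linear_map_on_sum[where T = "\<tau> a" and S = "funs_on F" and f = "\<lambda>b. \<sigma> b (h b)" and c = "\<lambda>_. 1",
            OF lin_subspace_funs_on \<tau>l]) (rule \<sigma>f, assumption, rule h(1))
      also have "\<dots> = (\<lambda>r. \<Sum>b\<in>J. if b = a then h a r else 0)"
        using \<tau>\<sigma>[OF a _ h(1)] h(2) by (intro ext sum.cong refl) auto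
      also have "\<dots> = h a" using J a by simp
      finally show ?thesis .
    qed
    then show ?thesis using fh by simp
  qed
  show ?thesis
  proof (rule decomposition[where \<sigma> = \<sigma> and \<tau> = \<tau>])
    show "op_equiv (\<tau> a)" if "a \<in> J" for a unfolding \<tau>_def by (rule adj_op_equiv[OF \<sigma>e[OF that]])
  qed (rule J \<sigma>o op_equiv_on[OF Pe] \<sigma>\<tau> P\<tau> \<tau>\<sigma> sum idem; assumption)+
qed

end

section \<open>The space of ordered partitions\<close>

lemma permutes_extend:
  assumes "bij_betw f E E" shows "(\<lambda>x. if x \<in> E then f x else x) permutes E"
proof (rule bij_imp_permutes)
  show "bij_betw (\<lambda>x. if x \<in> E then f x else x) E E"
    using assms by (rule bij_betw_cong[THEN iffD1, rotated]) simp
qed simp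

lemma ordered_partitions_transitive:
  assumes finE: "finite E" and r: "r \<in> ordered_partitions I m E" and s: "s \<in> ordered_partitions I m E"
  shows "\<exists>q. q permutes E \<and> s = relabel q r"
proof -
  have "\<exists>f. bij_betw f (r i) (s i)" if "i \<in> I" for i
    using r s that by (intro finite_same_card_bij) (auto simp: ordered_partitions_def)
  then have "\<forall>i\<in>I. \<exists>f. bij_betw f (r i) (s i)" by blast
  from bchoice[OF this] obtain f where f: "\<And>i. i \<in> I \<Longrightarrow> bij_betw (f i) (r i) (s i)" by blast
  define blk where "blk x = (SOME i. i \<in> I \<and> x \<in> r i)" for x
  have blk: "blk x = i" if "i \<in> I" "x \<in> r i" for x i
  proof -
    have "blk x \<in> I \<and> x \<in> r (blk x)" unfolding blk_def by (rule someI[of _ i]) (use that in blast)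
    moreover have "disjoint_family_on r I" using r by (simp add: ordered_partitions_def)
    ultimately show ?thesis using that unfolding disjoint_family_on_def by blast
  qed
  have sub: "r i \<subseteq> E" "s i \<subseteq> E" if "i \<in> I" for i using r s that by (auto simp: ordered_partitions_def)
  define q where "q x = f (blk x) x" for x
  have qi: "q ` r i = s i" if "i \<in> I" for i
    using f[OF that] blk[OF that] by (auto simp: q_def bij_betw_def)
  have E: "\<exists>i\<in>I. x \<in> r i" if "x \<in> E" for x using r that by (auto simp: ordered_partitions_def)
  have "inj_on q E"
  proof (rule inj_onI)
    fix x y assume xy: "x \<in> E" "y \<in> E" "q x = q y"
    obtain i j where i: "i \<in> I" "x \<in> r i" and j: "j \<in> I" "y \<in> r j" using E xy by blast
    have "q x \<in> s i" "q y \<in> s j" using qi i j by blast+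
    moreover have "disjoint_family_on s I" using s by (simp add: ordered_partitions_def)
    ultimately have "i = j" using xy(3) i(1) j(1) unfolding disjoint_family_on_def by (metis disjoint_iff)
    then show "x = y" using f[OF i(1)] xy(3) i j blk by (auto simp: q_def bij_betw_def inj_on_def)
  qed
  moreover have "q ` E \<subseteq> E" using E qi sub by blast
  ultimately have "bij_betw q E E" using endo_inj_surj[OF finE] by (simp add: bij_betw_def)
  then have "(\<lambda>x. if x \<in> E then q x else x) permutes E" by (rule permutes_extend)
  moreover have "s = relabel (\<lambda>x. if x \<in> E then q x else x) r"
  proof
    fix i show "s i = relabel (\<lambda>x. if x \<in> E then q x else x) r i"
    proof (cases "i \<in> I")
      case True
      have "(\<lambda>x. if x \<in> E then q x else x) ` r i = q ` r i" using sub[OF True] by (intro image_cong) auto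
      then show ?thesis using qi[OF True] by (simp add: relabel_def)
    qed (use r s in \<open>simp add: ordered_partitions_def relabel_def\<close>)
  qed
  ultimately show ?thesis by blast
qed

text \<open>The simplifier would turn the ground set \<open>{1..}\<close> of \<open>S_pos\<close> into \<open>{Suc 0..}\<close>.\<close>

declare One_nat_def [simp del]

lemma id_fin_sym: "id \<in> carrier (fin_sym A)"
  by (simp add: fin_sym_carrier permutes_id)

locale block_partition =
  fixes \<P> :: "nat set set"
  assumes partition: "partition_on {1..} \<P>" and fin: "finite (finite_blocks \<P>)"
begin

abbreviation "E \<equiv> finite_part \<P>"
abbreviation "F \<equiv> X_fin \<P>"
abbreviation "X \<equiv> X_space \<P>"
abbreviation "b \<equiv> fibre_bij \<P>"

definition base :: "nat set \<Rightarrow> nat set" where "base = (\<lambda>A. if A \<in> \<P> then A else {})"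

text \<open>This and \<open>coord\<close> are the two expressions inside \<open>lift_proj\<close>,
  so that the operator \<open>lift\<close> of the fibration is literally
  \<open>lift_proj \<P>\<close>.\<close>

definition glue :: "(nat set \<Rightarrow> nat set) \<Rightarrow> (nat set \<Rightarrow> nat set) \<Rightarrow> nat set \<Rightarrow> nat set" where
  "glue r s = (\<lambda>A. if A \<in> finite_blocks \<P> then b r ` s A else r A)"

definition coord :: "(nat set \<Rightarrow> nat set) \<Rightarrow> nat set \<Rightarrow> nat set" where
  "coord r = (\<lambda>A. if A \<in> finite_blocks \<P> then inv_into E (b r) ` r A else {})"

definition base_fin :: "nat set \<Rightarrow> nat set" where "base_fin = (\<lambda>A. if A \<in> finite_blocks \<P> then A else {})"

definition infinite_part :: "nat set" where "infinite_part = \<Union>(infinite_blocks \<P>)"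

lemma block_disjoint: "A \<in> \<P> \<Longrightarrow> B \<in> \<P> \<Longrightarrow> A \<noteq> B \<Longrightarrow> A \<inter> B = {}"
  using partition by (auto simp: partition_on_def disjoint_def)

lemma Union_blocks: "\<Union>\<P> = {1..}" using partition by (simp add: partition_on_def)

lemma blocks_split: "\<P> = finite_blocks \<P> \<union> infinite_blocks \<P>"
  by (auto simp: finite_blocks_def infinite_blocks_def)

lemma fin_blockD: "A \<in> finite_blocks \<P> \<Longrightarrow> A \<in> \<P>" "A \<in> finite_blocks \<P> \<Longrightarrow> finite A"
  "A \<in> finite_blocks \<P> \<Longrightarrow> A \<subseteq> E"
  by (auto simp: finite_blocks_def finite_part_def)

lemma inf_blockD: "A \<in> infinite_blocks \<P> \<Longrightarrow> A \<in> \<P>" "A \<in> infinite_blocks \<P> \<Longrightarrow> infinite A"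
  "A \<in> infinite_blocks \<P> \<Longrightarrow> A \<notin> finite_blocks \<P>"
  by (auto simp: finite_blocks_def infinite_blocks_def)

lemma inf_block_E: "A \<in> infinite_blocks \<P> \<Longrightarrow> A \<inter> E = {}"
  using block_disjoint unfolding finite_part_def finite_blocks_def infinite_blocks_def by blast

lemma E_infinite_part: "E \<union> infinite_part = {1..}" "E \<inter> infinite_part = {}"
proof -
  show "E \<union> infinite_part = {1..}"
    unfolding finite_part_def infinite_part_def Union_Un_distrib[symmetric] blocks_split[symmetric]
    by (rule Union_blocks)
  show "E \<inter> infinite_part = {}" using inf_block_E by (auto simp: infinite_part_def)
qed

lemma finite_E: "finite E"
  using fin by (auto simp: finite_part_def finite_blocks_def)

lemma F_eq: "F = ordered_partitions (finite_blocks \<P>) card E"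
  by (simp add: X_fin_def ordered_partitions_def)

lemma base_fin_F: "base_fin \<in> F"
  using block_disjoint fin_blockD
  by (auto simp: F_eq ordered_partitions_def base_fin_def disjoint_family_on_def finite_part_def)

lemma F_invariant: "perm_invariant E F"
  unfolding F_eq by (rule perm_invariant_ordered_partitions)

lemma F_sub: "s \<in> F \<Longrightarrow> A \<in> finite_blocks \<P> \<Longrightarrow> s A \<subseteq> E"
  by (auto simp: F_eq ordered_partitions_def)

lemma F_transitive: "s \<in> F \<Longrightarrow> \<exists>q. q permutes E \<and> s = relabel q base_fin"
  using ordered_partitions_transitive[OF finite_E] base_fin_F unfolding F_eq by blast

lemma X_eq: "X = (\<lambda>g. relabel g base) ` carrier S_pos"
  by (simp add: X_space_def base_def)

lemma X_iff: "r \<in> X \<longleftrightarrow> (\<exists>g\<in>carrier S_pos. r = relabel g base)"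
  by (auto simp: X_eq)

lemma E_perm_carrier: "p permutes E \<Longrightarrow> p \<in> carrier S_pos"
  using E_infinite_part finite_subset[of "{x. p x \<noteq> x}" E] finite_E permutes_subset[of p E "{1..}"]
  by (auto simp: fin_sym_carrier permutes_def)

lemma carrier_permutes: "g \<in> carrier S_pos \<Longrightarrow> g permutes {1..}"
  by (simp add: fin_sym_carrier)

lemma X_invariant: "g \<in> carrier S_pos \<Longrightarrow> r \<in> X \<Longrightarrow> relabel g r \<in> X"
  unfolding X_iff using fin_sym_comp_closed relabel_comp by metis

text \<open>Identifies the set in the definition of \<open>fibre_bij\<close> with an injective image
  of the finite part, so the choice operator there has a witness.\<close>

lemma complement_image:
  assumes g: "g \<in> carrier S_pos"
  shows "{1..} - (\<Union>A\<in>infinite_blocks \<P>. relabel g base A) = g ` E"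
proof -
  have p: "g permutes {1..}" by (rule carrier_permutes[OF g])
  have "(\<Union>A\<in>infinite_blocks \<P>. relabel g base A) = g ` infinite_part"
    using inf_blockD(1) by (auto simp: relabel_def base_def infinite_part_def)
  moreover have "{1..} = g ` {1..}" using permutes_image[OF p] by simp
  ultimately have "{1..} - (\<Union>A\<in>infinite_blocks \<P>. relabel g base A) = g ` ({1..} - infinite_part)"
    using image_set_diff[OF permutes_inj[OF p]] by metis
  also have "{1..} - infinite_part = E" using E_infinite_part by blast
  finally show ?thesis .
qed

lemma b_bij: assumes g: "g \<in> carrier S_pos" shows "bij_betw (b (relabel g base)) E (g ` E)"
proof -
  have "bij_betw g E (g ` E)" using permutes_inj_on[OF carrier_permutes[OF g]] by (simp add: bij_betw_def)
  then show ?thesis unfolding fibre_bij_def complement_image[OF g] by (rule someI[where P = "\<lambda>b. bij_betw b E (g ` E)"])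
qed

text \<open>The choice sees only the infinite blocks. Hence it returns the same bijection throughout
  a fibre, which is what makes \<open>coord\<close> a coordinate.\<close>

lemma b_cong: "(\<And>A. A \<in> infinite_blocks \<P> \<Longrightarrow> r A = r' A) \<Longrightarrow> b r = b r'"
  unfolding fibre_bij_def by (simp cong: SUP_cong)

lemma b_glue: "b (glue r s) = b r"
  by (rule b_cong) (simp add: glue_def inf_blockD(3))

lemma image_E_perm: "p permutes E \<Longrightarrow> A \<in> infinite_blocks \<P> \<Longrightarrow> p ` A = A"
proof -
  assume p: "p permutes E" and A: "A \<in> infinite_blocks \<P>"
  have "p x = x" if "x \<in> A" for x using inf_block_E[OF A] permutes_not_in[OF p] that by blast
  then show ?thesis by simp
qed

text \<open>Only the finite set E is rearranged before g is applied, so the result still differs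
  from \<open>base\<close> by a finite permutation.\<close>

lemma glue_in: assumes r: "r \<in> X" and s: "s \<in> F" shows "glue r s \<in> X"
proof -
  obtain g where g: "g \<in> carrier S_pos" "r = relabel g base" using r X_iff by blast
  obtain q where q: "q permutes E" "s = relabel q base_fin" using F_transitive[OF s] by blast
  have pg: "g permutes {1..}" by (rule carrier_permutes[OF g(1)])
  have b: "bij_betw (b r) E (g ` E)" using b_bij g by simp
  have ig: "bij_betw (inv_into UNIV g) (g ` E) E"
    using permutes_inj[OF permutes_inv[OF pg]] permutes_inverses(2)[OF pg]
    by (auto simp: bij_betw_def image_image intro: inj_on_subset)
  \<comment> \<open>After composition with g this is \<open>b r\<close> after q on E, as
    \<open>glue\<close> demands, while the infinite blocks only feel g.\<close>
  let ?f = "inv_into UNIV g \<circ> (b r \<circ> q)"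
  let ?p = "\<lambda>x. if x \<in> E then ?f x else x"
  have "bij_betw ?f E E"
    by (rule bij_betw_trans[OF bij_betw_trans[OF permutes_imp_bij[OF q(1)] b] ig])
  then have p: "?p permutes E" by (rule permutes_extend)
  have gp: "g \<circ> ?p \<in> carrier S_pos" by (rule fin_sym_comp_closed[OF g(1) E_perm_carrier[OF p]])
  have "glue r s A = relabel (g \<circ> ?p) base A" for A
  proof -
    consider "A \<in> finite_blocks \<P>" | "A \<in> infinite_blocks \<P>" | "A \<notin> \<P>" using blocks_split by blast
    then show ?thesis
    proof cases
      case 1
      have "(g \<circ> ?p) ` A = (b r \<circ> q) ` A"
        using fin_blockD(3)[OF 1] permutes_inverses(1)[OF pg] by (intro image_cong) auto
      then show ?thesis using 1 fin_blockD(1)[OF 1] q by (simp add: glue_def relabel_def base_def base_fin_def image_comp)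
    next
      case 2
      have "(g \<circ> ?p) ` A = g ` ?p ` A" by (simp only: image_comp)
      then show ?thesis using 2 image_E_perm[OF p 2] inf_blockD[OF 2] g
        by (simp add: glue_def relabel_def base_def)
    next
      case 3
      then show ?thesis using fin_blockD(1) g by (auto simp: glue_def relabel_def base_def)
    qed
  qed
  then have "glue r s = relabel (g \<circ> ?p) base" by blast
  then show ?thesis using gp X_iff by blast
qed

lemma coord_in: assumes r: "r \<in> X" shows "coord r \<in> F"
proof -
  obtain g where g: "g \<in> carrier S_pos" "r = relabel g base" using r X_iff by blast
  have b: "bij_betw (b r) E (g ` E)" using b_bij g by simp
  let ?f = "inv_into E (b r) \<circ> g"
  have "bij_betw g E (g ` E)" using permutes_inj_on[OF carrier_permutes[OF g(1)]] by (simp add: bij_betw_def)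
  then have "bij_betw ?f E E" by (rule bij_betw_trans[OF _ bij_betw_inv_into[OF b]])
  then have p: "(\<lambda>x. if x \<in> E then ?f x else x) permutes E" by (rule permutes_extend)
  have "coord r = relabel (\<lambda>x. if x \<in> E then ?f x else x) base_fin"
  proof
    fix A
    have "(\<lambda>x. if x \<in> E then ?f x else x) ` A = ?f ` A" if "A \<in> finite_blocks \<P>"
      using fin_blockD(3)[OF that] by (intro image_cong) auto
    then show "coord r A = relabel (\<lambda>x. if x \<in> E then ?f x else x) base_fin A"
      using g(2) fin_blockD(1) by (simp add: coord_def relabel_def base_fin_def base_def image_comp)
  qed
  then show ?thesis using F_invariant p base_fin_F by (simp add: perm_invariant_def)
qed

lemma b_inj: assumes r: "r \<in> X" shows "inj_on (b r) E"
  using r b_bij by (auto simp: X_iff bij_betw_def)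

lemma X_block_b: assumes r: "r \<in> X" and A: "A \<in> finite_blocks \<P>" shows "r A \<subseteq> b r ` E"
proof -
  obtain g where g: "g \<in> carrier S_pos" "r = relabel g base" using r X_iff by blast
  have "b r ` E = g ` E" using b_bij[OF g(1)] g(2) by (simp add: bij_betw_def)
  then show ?thesis using g(2) fin_blockD[OF A] by (auto simp: relabel_def base_def)
qed

lemma coord_glue: assumes r: "r \<in> X" and s: "s \<in> F" shows "coord (glue r s) = s"
proof
  fix A
  show "coord (glue r s) A = s A"
  proof (cases "A \<in> finite_blocks \<P>")
    case True
    then show ?thesis using inv_into_image_cancel[OF b_inj[OF r] F_sub[OF s True]]
      by (simp add: coord_def b_glue) (simp add: glue_def)
  next
    case False
    then show ?thesis using s by (simp add: coord_def F_eq ordered_partitions_def)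
  qed
qed

lemma glue_coord: assumes r: "r \<in> X" shows "glue r (coord r) = r"
proof
  fix A show "glue r (coord r) A = r A"
  proof (cases "A \<in> finite_blocks \<P>")
    case True
    then show ?thesis using image_inv_into_cancel[OF refl X_block_b[OF r True]]
      by (simp add: glue_def coord_def)
  qed (simp add: glue_def)
qed

lemma glue_glue: "glue (glue r s) s' = glue r s'"
  by (rule ext) (simp add: glue_def[of "glue r s"] b_glue, simp add: glue_def)

text \<open>The bijections chosen for the two fibres need not correspond under g; the permutation p
  of E is their discrepancy.\<close>

lemma relabel_glue:
  assumes g: "g \<in> carrier S_pos" and r: "r \<in> X"
  shows "\<exists>p. p permutes E \<and> (\<forall>s\<in>F. relabel g (glue r s) = glue (relabel g r) (relabel p s))"
proof -
  obtain k where k: "k \<in> carrier S_pos" "r = relabel k base" using r X_iff by blast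
  have gk: "g \<circ> k \<in> carrier S_pos" "relabel g r = relabel (g \<circ> k) base"
    using fin_sym_comp_closed[OF g k(1)] k(2) by (auto simp: relabel_comp)
  let ?b = "b r" and ?c = "b (relabel g r)"
  have b: "bij_betw ?b E (k ` E)" using b_bij[OF k(1)] k(2) by simp
  have c: "bij_betw ?c E ((g \<circ> k) ` E)" using b_bij[OF gk(1)] gk(2) by simp
  have "bij_betw g (k ` E) ((g \<circ> k) ` E)"
    using permutes_inj_on[OF carrier_permutes[OF g]] by (simp add: bij_betw_def image_comp)
  from bij_betw_trans[OF bij_betw_trans[OF b this] bij_betw_inv_into[OF c]]
  have f: "bij_betw (inv_into E ?c \<circ> (g \<circ> ?b)) E E" .
  let ?p = "\<lambda>x. if x \<in> E then (inv_into E ?c \<circ> (g \<circ> ?b)) x else x"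
  have p: "?p permutes E" by (rule permutes_extend[OF f])
  have cp: "?c (?p x) = g (?b x)" if "x \<in> E" for x
  proof -
    have "?b x \<in> k ` E" by (rule bij_betw_apply[OF b that])
    then have "g (?b x) \<in> ?c ` E" using bij_betw_imp_surj_on[OF c] by (auto simp: image_comp[symmetric])
    then show ?thesis using that by (simp add: f_inv_into_f)
  qed
  have "relabel g (glue r s) = glue (relabel g r) (relabel ?p s)" if s: "s \<in> F" for s
  proof
    fix A
    show "relabel g (glue r s) A = glue (relabel g r) (relabel ?p s) A"
    proof (cases "A \<in> finite_blocks \<P>")
      case True
      have "g ` ?b ` s A = ?c ` ?p ` s A" unfolding image_image
        by (intro image_cong refl cp[symmetric]) (use F_sub[OF s True] in blast)
      then show ?thesis using True by (simp add: relabel_def glue_def)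
    qed (simp add: relabel_def glue_def)
  qed
  then show ?thesis using p by blast
qed

lemma base_X: "base \<in> X"
  unfolding X_iff using id_fin_sym relabel_id by metis

lemma b_base: "bij_betw (b base) E E"
  using b_bij[OF id_fin_sym] by simp

text \<open>The bijection chosen for the base fibre is some bijection of E onto itself, not
  necessarily the identity, so p has to be conjugated by it.\<close>

lemma relabel_glue_base:
  assumes p: "p permutes E"
  shows "\<exists>g\<in>carrier S_pos. \<forall>s\<in>F. relabel g (glue base s) = glue base (relabel p s)"
proof -
  let ?b = "b base"
  let ?f = "?b \<circ> (p \<circ> inv_into E ?b)"
  have "bij_betw ?f E E"
    by (rule bij_betw_trans[OF bij_betw_trans[OF bij_betw_inv_into[OF b_base] permutes_imp_bij[OF p]] b_base])
  then have g: "(\<lambda>x. if x \<in> E then ?f x else x) permutes E" by (rule permutes_extend)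
  let ?g = "\<lambda>x. if x \<in> E then ?f x else x"
  have gb: "?g (?b x) = ?b (p x)" if "x \<in> E" for x
  proof -
    have "?b x \<in> E" using b_base that by (auto simp: bij_betw_def)
    then show ?thesis using that b_base by (simp add: bij_betw_inv_into_left)
  qed
  have "relabel ?g (glue base s) = glue base (relabel p s)" if s: "s \<in> F" for s
  proof
    fix A
    consider "A \<in> finite_blocks \<P>" | "A \<in> infinite_blocks \<P>" | "A \<notin> \<P>" using blocks_split by blast
    then show "relabel ?g (glue base s) A = glue base (relabel p s) A"
    proof cases
      case 1
      have "?g ` ?b ` s A = ?b ` p ` s A" unfolding image_image
        by (intro image_cong refl gb) (use F_sub[OF s 1] in blast)
      then show ?thesis using 1 by (simp add: relabel_def glue_def)
    next
      case 2
      then show ?thesis using image_E_perm[OF g 2] inf_blockD[OF 2] by (simp add: relabel_def glue_def base_def)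
    next
      case 3
      then show ?thesis using fin_blockD(1) by (auto simp: relabel_def glue_def base_def)
    qed
  qed
  then show ?thesis using E_perm_carrier[OF g] by blast
qed

section \<open>Permutations that fix the base fibre pointwise\<close>

definition K :: "(nat \<Rightarrow> nat) set" where
  "K = {k \<in> carrier S_pos. (\<forall>x\<in>E. k x = x) \<and> (\<forall>A\<in>infinite_blocks \<P>. k ` A = A)}"

lemma K_glue_base: assumes k: "k \<in> K" and s: "s \<in> F" shows "relabel k (glue base s) = glue base s"
proof
  fix A
  consider "A \<in> finite_blocks \<P>" | "A \<in> infinite_blocks \<P>" | "A \<notin> \<P>" using blocks_split by blast
  then show "relabel k (glue base s) A = glue base s A"
  proof cases
    case 1
    have "b base ` s A \<subseteq> E" using b_base F_sub[OF s 1] by (auto simp: bij_betw_def)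
    then have "k ` b base ` s A = b base ` s A" using k by (force simp: K_def image_iff)
    then show ?thesis using 1 by (simp add: relabel_def glue_def)
  next
    case 2
    then show ?thesis using k inf_blockD[OF 2] by (simp add: relabel_def glue_def base_def K_def)
  next
    case 3
    then show ?thesis using fin_blockD(1) by (auto simp: relabel_def glue_def base_def)
  qed
qed

text \<open>The points are moved one at a time by a transposition inside the infinite block that
  contains the current image; infinity of the block supplies a fresh target.\<close>

lemma K_avoid:
  assumes "finite S" "S \<subseteq> infinite_part" "finite D"
  shows "\<exists>k\<in>K. k ` S \<inter> D = {}"
  using assms(1,2)
proof (induction S rule: finite_induct)
  case empty
  have "id \<in> K" using id_fin_sym by (simp add: K_def)
  then show ?case by blast
next
  case (insert x S)
  then obtain k where k: "k \<in> K" "k ` S \<inter> D = {}" by auto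
  have kp: "k permutes {1..}" by (rule carrier_permutes) (use k(1) in \<open>simp add: K_def\<close>)
  obtain A where A: "A \<in> infinite_blocks \<P>" "x \<in> A" using insert.prems by (auto simp: infinite_part_def)
  let ?y = "k x"
  have y: "?y \<in> A" using k(1) A by (auto simp: K_def)
  have "infinite (A - (D \<union> k ` S))" using inf_blockD(2)[OF A(1)] assms(3) insert.hyps(1) by simp
  then obtain z where z: "z \<in> A" "z \<notin> D" "z \<notin> k ` S" using infinite_imp_nonempty by blast
  let ?t = "Transposition.transpose ?y z"
  have A1: "A \<subseteq> {1..}" using inf_blockD(1)[OF A(1)] Union_blocks by blast
  have "?t permutes {1..}" using y z A1 by (intro permutes_swap_id) auto
  moreover have "finite {w. ?t w \<noteq> w}" by (rule finite_subset[of _ "{?y, z}"]) (auto simp: transpose_def)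
  ultimately have tG: "?t \<in> carrier S_pos" by (simp add: fin_sym_carrier)
  have tE: "?t w = w" if "w \<in> E" for w using inf_block_E[OF A(1)] y z that by (auto simp: transpose_def)
  have tB: "?t ` B = B" if "B \<in> infinite_blocks \<P>" for B
  proof -
    have "?y \<in> B \<longleftrightarrow> z \<in> B" using block_disjoint[of A B] A(1) that inf_blockD(1) y z by blast
    then show ?thesis by (rule transpose_image_eq)
  qed
  have "(?t \<circ> k) ` B = B" if "B \<in> infinite_blocks \<P>" for B
    unfolding image_comp[symmetric] using k(1) that tB[OF that] by (simp add: K_def)
  then have "?t \<circ> k \<in> K" using k(1) tE fin_sym_comp_closed[OF tG] by (simp add: K_def)
  moreover have "(?t \<circ> k) ` insert x S \<inter> D = {}"
  proof -
    have "?t w = w" if "w \<in> k ` S" for w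
    proof -
      have "w \<noteq> ?y" using that insert.hyps(2) permutes_inj[OF kp] by (auto simp: inj_def)
      then show ?thesis using that z by (auto simp: transpose_def)
    qed
    then show ?thesis using k(2) z by auto
  qed
  ultimately show ?case by blast
qed

text \<open>Both \<open>r\<close> and \<open>relabel k r\<close> agree with \<open>base\<close> outside \<open>D\<close>, and \<open>k\<close> pushes \<open>D - E\<close> out of \<open>D\<close>.\<close>

lemma K_moves_X:
  assumes S: "finite S" "S \<subseteq> X - glue base ` F"
  shows "\<exists>k\<in>K. relabel k ` S \<inter> S = {}"
proof -
  have "\<forall>r\<in>S. \<exists>g. g \<in> carrier S_pos \<and> r = relabel g base" using S X_iff by blast
  from bchoice[OF this] obtain g where g: "\<And>r. r \<in> S \<Longrightarrow> g r \<in> carrier S_pos" "\<And>r. r \<in> S \<Longrightarrow> r = relabel (g r) base"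
    by blast
  define D where "D = (\<Union>r\<in>S. {x. g r x \<noteq> x})"
  have D: "finite D" using S(1) g(1) by (auto simp: D_def fin_sym_carrier)
  have agree: "x \<in> r A \<longleftrightarrow> x \<in> A" if "r \<in> S" "x \<notin> D" "A \<in> \<P>" for r x A
  proof -
    have gx: "g r x = x" using that by (auto simp: D_def)
    have "r A = g r ` A" using g(2)[OF that(1)] that(3) by (metis base_def relabel_def)
    moreover have "x \<in> g r ` A \<longleftrightarrow> x \<in> A"
      using gx permutes_inj[OF carrier_permutes[OF g(1)[OF that(1)]]] by (metis image_iff injD)
    ultimately show ?thesis by simp
  qed
  obtain k where k: "k \<in> K" "k ` (D \<inter> infinite_part) \<inter> D = {}" using K_avoid[of "D \<inter> infinite_part" D] D by auto
  have kp: "k permutes {1..}" by (rule carrier_permutes) (use k(1) in \<open>simp add: K_def\<close>)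
  have "relabel k r \<notin> S" if r: "r \<in> S" for r
  proof
    assume r': "relabel k r \<in> S"
    obtain h where h: "h \<in> carrier S_pos" "r = relabel h base" using g r by blast
    have hp: "h permutes {1..}" by (rule carrier_permutes[OF h(1)])
    have ag: "x \<in> r A \<longleftrightarrow> x \<in> A" if A: "A \<in> infinite_blocks \<P>" and x: "x \<in> infinite_part" for x A
    proof (cases "x \<in> D")
      case True
      then have kx: "k x \<notin> D" using k(2) x by blast
      have "x \<in> r A \<longleftrightarrow> k x \<in> relabel k r A"
        using permutes_inj[OF kp] by (auto simp: relabel_def inj_image_mem_iff)
      also have "\<dots> \<longleftrightarrow> k x \<in> A" by (rule agree[OF r' kx inf_blockD(1)[OF A]])
      also have "\<dots> \<longleftrightarrow> k x \<in> k ` A" using k(1) A by (simp add: K_def)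
      also have "\<dots> \<longleftrightarrow> x \<in> A" using permutes_inj[OF kp] by (simp add: inj_image_mem_iff)
      finally show ?thesis .
    next
      case False
      then show ?thesis by (rule agree[OF r _ inf_blockD(1)[OF A]])
    qed
    have compl: "{1..} - (\<Union>A\<in>infinite_blocks \<P>. r A) = h ` E" using complement_image[OF h(1)] h(2) by simp
    have "infinite_part \<subseteq> (\<Union>A\<in>infinite_blocks \<P>. r A)"
    proof
      fix x assume x: "x \<in> infinite_part"
      then obtain A where "A \<in> infinite_blocks \<P>" "x \<in> A" by (auto simp: infinite_part_def)
      then show "x \<in> (\<Union>A\<in>infinite_blocks \<P>. r A)" using ag x by blast
    qed
    \<comment> \<open>Since the infinite blocks of r cover \<open>infinite_part\<close>, its finite
      blocks lie in E, and by finiteness they fill E. So r has the same infinite blocks as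
      \<open>base\<close> and belongs to the excluded base fibre.\<close>
    then have "h ` E \<subseteq> E" using compl E_infinite_part by blast
    then have hE: "h ` E = E" by (rule endo_inj_surj[OF finite_E _ permutes_inj_on[OF hp]])
    have "r A = A" if A: "A \<in> infinite_blocks \<P>" for A
    proof -
      have rA: "r A = h ` A" using h(2) inf_blockD(1)[OF A] by (simp add: relabel_def base_def)
      have disj: "h ` A \<inter> E = {}" using inf_block_E[OF A] hE image_Int[OF permutes_inj[OF hp], of A E] by simp
      have "h ` A \<subseteq> {1..}"
      proof -
        have "A \<subseteq> {1..}" using inf_blockD(1)[OF A] Union_blocks by blast
        then show ?thesis using permutes_image[OF hp] by blast
      qed
      then have "r A \<subseteq> infinite_part" using disj unfolding rA E_infinite_part(1)[symmetric] by blast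
      moreover have "A \<subseteq> infinite_part" using A by (auto simp: infinite_part_def)
      ultimately show ?thesis using ag[OF A] by blast
    qed
    then have same: "r A = base A" if "A \<in> infinite_blocks \<P>" for A
      using that inf_blockD(1)[OF that] by (simp add: base_def)
    have "b r = b base" by (rule b_cong) (rule same)
    have rX: "r \<in> X" using S r by blast
    have "glue base (coord r) = glue r (coord r)"
    proof
      fix A
      consider "A \<in> finite_blocks \<P>" | "A \<in> infinite_blocks \<P>" | "A \<notin> \<P>" using blocks_split by blast
      then show "glue base (coord r) A = glue r (coord r) A"
      proof cases
        case 3
        then show ?thesis using h(2) fin_blockD(1) by (auto simp: glue_def relabel_def base_def)
      qed (auto simp: glue_def \<open>b r = b base\<close> same dest: inf_blockD(3))
    qed
    then have "r = glue base (coord r)" using glue_coord[OF rX] by simp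
    then show False using S r coord_in[OF rX] by blast
  qed
  then show ?thesis using k(1) by blast
qed

lemma fibred_rep_blocks: "fibred_rep S_pos relabel X F coord glue E K base"
proof -
  interpret perm_action S_pos relabel X by (rule perm_action_relabel) (rule X_invariant)
  show ?thesis
  proof unfold_locales
    show "finite F" unfolding F_eq by (rule finite_ordered_partitions[OF fin finite_E])
    show "\<exists>g\<in>carrier S_pos. relabel g r \<in> glue base ` F" if r: "r \<in> X" for r
    proof -
      obtain h where h: "h \<in> carrier S_pos" "r = relabel h base" using r X_iff by blast
      have "relabel (inv_into UNIV h) r = base" using relabel_inv(1)[OF carrier_permutes[OF h(1)]] h(2) by simp
      moreover have "base \<in> glue base ` F" using glue_coord[OF base_X] coord_in[OF base_X] by (metis imageI)
      ultimately show ?thesis using fin_sym_inv_closed[OF h(1)] by metis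
    qed
    show "K \<subseteq> carrier S_pos" by (auto simp: K_def)
  qed (rule coord_in glue_in coord_glue glue_coord glue_glue F_invariant relabel_glue base_X relabel_glue_base
      K_glue_base K_moves_X; assumption)+
qed

section \<open>The orbit of the base point as the coset space\<close>

definition coset :: "(nat set \<Rightarrow> nat set) \<Rightarrow> (nat \<Rightarrow> nat) set" where
  "coset r = {g \<in> carrier S_pos. relabel g base = r}"

lemma young_subgroup_iff: "h \<in> young_subgroup \<P> \<longleftrightarrow> h \<in> carrier S_pos \<and> relabel h base = base"
proof -
  have "relabel h base = base \<longleftrightarrow> (\<forall>A\<in>\<P>. h ` A = A)"
    unfolding fun_eq_iff relabel_def base_def Ball_def by (simp split: if_split)
  then show ?thesis by (simp add: young_subgroup_def)
qed

lemma coset_relabel: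
  assumes g: "g \<in> carrier S_pos" shows "coset (relabel g base) = g <#\<^bsub>S_pos\<^esub> young_subgroup \<P>"
proof -
  have gp: "g permutes {1..}" by (rule carrier_permutes[OF g])
  have "k \<in> coset (relabel g base) \<longleftrightarrow> k \<in> g <#\<^bsub>S_pos\<^esub> young_subgroup \<P>" for k
  proof
    assume k: "k \<in> coset (relabel g base)"
    let ?h = "inv_into UNIV g \<circ> k"
    have "?h \<in> carrier S_pos" using k fin_sym_comp_closed[OF fin_sym_inv_closed[OF g]] by (simp add: coset_def)
    moreover have "relabel ?h base = base"
      using k relabel_inv(1)[OF gp] by (simp add: coset_def relabel_comp[symmetric])
    moreover have "k = g \<circ> ?h" using permutes_inv_o(1)[OF gp] by (simp add: o_assoc)
    ultimately show "k \<in> g <#\<^bsub>S_pos\<^esub> young_subgroup \<P>"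
      using young_subgroup_iff by (auto simp: l_coset_def)
  next
    assume "k \<in> g <#\<^bsub>S_pos\<^esub> young_subgroup \<P>"
    then obtain h where "h \<in> young_subgroup \<P>" "k = g \<circ> h" by (auto simp: l_coset_def)
    then show "k \<in> coset (relabel g base)"
      using g young_subgroup_iff fin_sym_comp_closed by (auto simp: coset_def relabel_comp[symmetric])
  qed
  then show ?thesis by blast
qed

lemma coset_bij: "bij_betw coset X (lcosets\<^bsub>S_pos\<^esub> (young_subgroup \<P>))"
  unfolding bij_betw_def
proof
  show "inj_on coset X"
  proof (rule inj_onI)
    fix r s assume r: "r \<in> X" and eq: "coset r = coset s"
    obtain g where "g \<in> carrier S_pos" "r = relabel g base" using r X_iff by blast
    then have "g \<in> coset s" using eq by (auto simp: coset_def)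
    then show "r = s" using \<open>r = relabel g base\<close> by (simp add: coset_def)
  qed
  have "coset ` X = (\<lambda>g. coset (relabel g base)) ` carrier S_pos"
    unfolding X_eq image_image ..
  also have "\<dots> = (\<lambda>g. g <#\<^bsub>S_pos\<^esub> young_subgroup \<P>) ` carrier S_pos"
    by (intro image_cong refl coset_relabel)
  finally show "coset ` X = lcosets\<^bsub>S_pos\<^esub> (young_subgroup \<P>)" unfolding LCOSETS_def by blast
qed

lemma coset_equivariant:
  assumes g: "g \<in> carrier S_pos" and r: "r \<in> X"
  shows "coset (relabel g r) = g <#\<^bsub>S_pos\<^esub> coset r"
proof -
  obtain h where h: "h \<in> carrier S_pos" "r = relabel h base" using r X_iff by blast
  have "coset (relabel g r) = (g \<circ> h) <#\<^bsub>S_pos\<^esub> young_subgroup \<P>"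
    using coset_relabel[OF fin_sym_comp_closed[OF g h(1)]] h(2) by (simp add: relabel_comp)
  also have "\<dots> = g <#\<^bsub>S_pos\<^esub> (h <#\<^bsub>S_pos\<^esub> young_subgroup \<P>)"
    by (auto simp: l_coset_def o_assoc)
  finally show ?thesis using coset_relabel[OF h(1)] h(2) by simp
qed

text \<open>The arbitrary \<sigma> builds in transitivity: pullback along \<open>coset_bij\<close>
  is composed with the given equivalence.\<close>

lemma I_rep_equivalent:
  assumes eq: "unitarily_equivalent S_pos (permutation_rep S_pos relabel X) \<sigma>"
  shows "unitarily_equivalent S_pos (I_rep \<P>) \<sigma>"
proof -
  interpret perm_action S_pos relabel X by (rule perm_action_relabel) (rule X_invariant)
  let ?L = "lcosets\<^bsub>S_pos\<^esub> (young_subgroup \<P>)"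
  define V where "V f = (\<lambda>r. if r \<in> X then f (coset r) else 0)" for f :: "(nat \<Rightarrow> nat) set \<Rightarrow> complex"
  define V' where "V' f = (\<lambda>c. if c \<in> ?L then f (inv_into X coset c) else 0)" for f :: "(nat set \<Rightarrow> nat set) \<Rightarrow> complex"
  have rsL: "rep_space (I_rep \<P>) = l2 ?L" by (simp add: I_rep_def quasi_regular_rep_def permutation_rep_def)
  have actL: "rep_act (I_rep \<P>) g f = (\<lambda>c. if c \<in> ?L then f (inv\<^bsub>S_pos\<^esub> g <#\<^bsub>S_pos\<^esub> c) else 0)" for g f
    by (simp add: I_rep_def quasi_regular_rep_def permutation_rep_def)
  have rs: "rep_space \<rho> = l2 X" by (simp add: permutation_rep_def)
  have cL: "coset r \<in> ?L" if "r \<in> X" for r by (rule bij_betw_apply[OF coset_bij that])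
  have Vl: "V f \<in> l2 X" if f: "f \<in> l2 ?L" for f
  proof -
    have "(\<lambda>c. (cmod (f c))\<^sup>2) summable_on ?L" using l2D(2)[OF f] by (rule summable_on_subset_banach) simp
    then have "(\<lambda>r. (cmod (f (coset r)))\<^sup>2) summable_on X"
      using summable_on_reindex_bij_betw[OF coset_bij, of "\<lambda>c. (cmod (f c))\<^sup>2"] by simp
    then have "(\<lambda>r. (cmod (V f r))\<^sup>2) summable_on UNIV"
      by (subst summable_on_cong_neutral[where g = "\<lambda>r. (cmod (f (coset r)))\<^sup>2" and T = X]) (auto simp: V_def)
    then show ?thesis by (simp add: l2_def) (simp add: V_def)
  qed
  have V'l: "V' f \<in> l2 ?L" if f: "f \<in> l2 X" for f
  proof -
    have "(\<lambda>r. (cmod (f r))\<^sup>2) summable_on X" using l2D(2)[OF f] by (rule summable_on_subset_banach) simp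
    then have "(\<lambda>c. (cmod (f (inv_into X coset c)))\<^sup>2) summable_on ?L"
      using summable_on_reindex_bij_betw[OF bij_betw_inv_into[OF coset_bij], of "\<lambda>r. (cmod (f r))\<^sup>2"] by simp
    then have "(\<lambda>c. (cmod (V' f c))\<^sup>2) summable_on UNIV"
      by (subst summable_on_cong_neutral[where g = "\<lambda>c. (cmod (f (inv_into X coset c)))\<^sup>2" and T = ?L]) (auto simp: V'_def)
    then show ?thesis by (simp add: l2_def) (simp add: V'_def)
  qed
  have V'V: "V' (V f) = f" if "f \<in> l2 ?L" for f
    using bij_betw_inv_into_right[OF coset_bij] bij_betw_apply[OF bij_betw_inv_into[OF coset_bij]] l2D(1)[OF that]
    by (auto simp: V_def V'_def fun_eq_iff)
  have VV': "V (V' f) = f" if "f \<in> l2 X" for f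
    using bij_betw_inv_into_left[OF coset_bij] cL l2D(1)[OF that] by (intro ext) (auto simp: V_def V'_def)
  have Vb: "bij_betw V (l2 ?L) (l2 X)" by (rule bij_betwI[where g = V']) (auto simp: Vl V'l V'V VV')
  have Vlin: "V (\<lambda>x. a * f x + c * h x) = (\<lambda>x. a * V f x + c * V h x)" for a c f h
    by (auto simp: V_def)
  have Vin: "l2_inner (V f) (V h) = l2_inner f h" if f: "f \<in> l2 ?L" for f h
  proof -
    have "l2_inner (V f) (V h) = (\<Sum>\<^sub>\<infinity>r\<in>X. f (coset r) * cnj (h (coset r)))"
      unfolding l2_inner_restrict[OF Vl[OF f]] by (intro infsum_cong) (simp add: V_def)
    also have "\<dots> = l2_inner f h"
      using infsum_reindex_bij_betw[OF coset_bij, of "\<lambda>c. f c * cnj (h c)"] l2_inner_restrict[OF f] by simp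
    finally show ?thesis .
  qed
  have Veq: "V (rep_act (I_rep \<P>) g f) = ract g (V f)" if g: "g \<in> carrier S_pos" for g f
  proof
    fix r
    have i: "inv\<^bsub>S_pos\<^esub> g \<in> carrier S_pos" using g group.inv_closed[OF group_fin_sym] by blast
    show "V (rep_act (I_rep \<P>) g f) r = ract g (V f) r"
      using coset_equivariant[OF i] act_in[OF i] cL by (simp add: V_def actL ract)
  qed
  obtain U where U: "bij_betw U (l2 X) (rep_space \<sigma>) \<and> linear_map_on (l2 X) U \<and>
        (\<forall>f\<in>l2 X. \<forall>f'\<in>l2 X. l2_inner (U f) (U f') = l2_inner f f') \<and>
        (\<forall>g\<in>carrier S_pos. \<forall>f\<in>l2 X. U (ract g f) = rep_act \<sigma> g (U f))"
    using eq unfolding unitarily_equivalent_def rs by (rule exE)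
  show ?thesis unfolding unitarily_equivalent_def rsL
  proof (intro exI[of _ "U \<circ> V"] conjI ballI)
    show "bij_betw (U \<circ> V) (l2 ?L) (rep_space \<sigma>)" using bij_betw_trans[OF Vb] U by blast
    show "linear_map_on (l2 ?L) (U \<circ> V)" unfolding linear_map_on_def
    proof (intro ballI allI)
      fix f h a c assume "f \<in> l2 ?L" "h \<in> l2 ?L"
      then show "(U \<circ> V) (\<lambda>x. a * f x + c * h x) = (\<lambda>y. a * (U \<circ> V) f y + c * (U \<circ> V) h y)"
        using linear_map_on_comb[of "l2 X" U "V f" "V h" a c] U Vl by (simp add: Vlin)
    qed
    show "l2_inner ((U \<circ> V) f) ((U \<circ> V) h) = l2_inner f h" if "f \<in> l2 ?L" "h \<in> l2 ?L" for f h
      using U Vl that Vin by simp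
    show "(U \<circ> V) (rep_act (I_rep \<P>) g f) = rep_act \<sigma> g ((U \<circ> V) f)" if "g \<in> carrier S_pos" "f \<in> l2 ?L" for g f
      using U Vl that Veq by simp
  qed
qed

end

section \<open>The decomposition of the induced representation\<close>

context block_partition
begin

sublocale fibred_rep S_pos relabel X F coord glue E K base
  by (rule fibred_rep_blocks)

abbreviation "shape \<equiv> block_shape \<P>"

abbreviation is_component where
  "is_component \<mu> \<equiv> component_projection (fin_sym E) (I_fin_rep \<P>) (specht_rep \<mu> E)"

lemma pi_rep_eq: "pi_rep \<P> Q = subrep (permutation_rep S_pos relabel X) (lift Q ` l2 X)"
proof -
  have "lift_proj \<P> Q = lift Q"
    unfolding fun_eq_iff lift_proj_def lift_def fib_def glue_def coord_def Let_def by simp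
  then show ?thesis by (simp add: pi_rep_def)
qed

lemma mset_shape: "mset shape = image_mset card (mset_set (finite_blocks \<P>))"
  by (simp add: block_shape_def)

lemma sum_list_shape: "sum_list shape = card E"
proof -
  have "sum_list shape = (\<Sum>A\<in>finite_blocks \<P>. card A)"
    by (simp add: sum_mset_sum_list[symmetric] mset_shape sum_unfold_sum_mset)
  also have "\<dots> = card E" unfolding finite_part_def
    by (rule card_Union_disjoint[symmetric]) (use block_disjoint fin_blockD in \<open>auto simp: pairwise_def disjnt_def\<close>)
  finally show ?thesis .
qed

lemma sorted_shape: "sorted_wrt (\<ge>) shape"
  by (simp add: block_shape_def sorted_wrt_rev)

text \<open>\<open>young_rule\<close> needs the blocks numbered in the order of the parts of the
  diagram, whereas the blocks themselves serve as indices of ordered partitions.\<close>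

lemma shape_enumeration:
  obtains \<iota> where "bij_betw \<iota> {..<length shape} (finite_blocks \<P>)"
    "\<And>k. k < length shape \<Longrightarrow> card (\<iota> k) = shape ! k"
proof -
  obtain xs where xs: "set xs = finite_blocks \<P>" "distinct xs" using finite_distinct_list[OF fin] by blast
  have "mset shape = mset (map card xs)" using mset_set_set[OF xs(2)] xs(1) by (simp add: mset_shape)
  from mset_eq_permutation[OF this] obtain p
    where p: "p permutes {..<length (map card xs)}" "permute_list p (map card xs) = shape" by blast
  have len: "length shape = length xs" using p(2) by (metis length_map length_permute_list)
  have "bij_betw (\<lambda>k. xs ! p k) {..<length shape} (finite_blocks \<P>)"
    using bij_betw_trans[OF permutes_imp_bij[OF p(1)] bij_betw_nth[OF xs(2) _ xs(1)[symmetric]]]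
    by (simp add: len comp_def)
  moreover have "card (xs ! p k) = shape ! k" if "k < length shape" for k
  proof -
    have k: "k < length (map card xs)" using that len by simp
    have "shape ! k = map card xs ! p k" using permute_list_nth[OF p(1) k] p(2) by simp
    then show ?thesis using permutes_in_image[OF p(1), of k] k by simp
  qed
  ultimately show thesis by (rule that)
qed

lemma sym_rep_space: "rep_space (I_fin_rep \<P>) = funs_on F"
  by (simp add: I_fin_rep_def permutation_rep_def l2_finite[OF finF])

lemma I_fin_act: "p permutes E \<Longrightarrow> u \<in> funs_on F \<Longrightarrow> rep_act (I_fin_rep \<P>) p u = pact p u"
  unfolding I_fin_rep_def by (rule sym_rep_act[OF finite_E F_inv])

lemma is_component_component:
  assumes Q: "is_component \<mu> Q" shows "component Q"
proof -
  have sub: "\<forall>u\<in>funs_on F. Q u \<in> funs_on F" and lin: "linear_map_on (funs_on F) Q"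
    and idem: "\<forall>u\<in>funs_on F. Q (Q u) = Q u"
    and sa: "\<forall>u\<in>funs_on F. \<forall>v\<in>funs_on F. l2_inner (Q u) v = l2_inner u (Q v)"
    and eq: "\<forall>p\<in>carrier (fin_sym E). \<forall>u\<in>funs_on F. Q (rep_act (I_fin_rep \<P>) p u) = rep_act (I_fin_rep \<P>) p (Q u)"
    using Q unfolding component_projection_def sym_rep_space image_subset_iff by - (elim conjE, assumption)+
  show ?thesis unfolding component_def op_equiv_def op_on_def
  proof (intro conjI allI impI ballI)
    show "Q (pact p u) = pact p (Q u)" if p: "p permutes E" and u: "u \<in> funs_on F" for p u
    proof -
      have "p \<in> carrier (fin_sym E)" using p finite_E by (simp add: fin_sym_finite_carrier)
      then have "Q (rep_act (I_fin_rep \<P>) p u) = rep_act (I_fin_rep \<P>) p (Q u)" using eq u by blast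
      then show ?thesis using sub u by (simp add: I_fin_act[OF p])
    qed
    show "ip F (Q u) v = ip F u (Q v)" if "u \<in> funs_on F" "v \<in> funs_on F" for u v
      using sa sub that l2_inner_finite[OF finF, of "Q u" v] l2_inner_finite[OF finF, of u "Q v"] by simp
  qed (use sub lin idem in blast)+
qed

lemma component_image:
  assumes Q: "component Q"
  shows "u \<in> Q ` funs_on F \<longleftrightarrow> u \<in> funs_on F \<and> Q u = u"
  by (rule image_P_iff) (use Q in \<open>auto simp: component_def\<close>)

lemma component_submodule:
  assumes Q: "component Q" shows "perm_submodule E (Q ` funs_on F)"
proof -
  have e: "op_equiv Q" using Q by (simp add: component_def)
  have l: "linear_map_on (funs_on F) Q" using e by (simp add: op_equiv_def op_on_def)
  have z: "(\<lambda>_. 0) \<in> funs_on F" by (simp add: funs_on_def)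
  show ?thesis unfolding perm_submodule_def lin_subspace_def
  proof (intro conjI ballI allI impI)
    show "(\<lambda>_. 0) \<in> Q ` funs_on F" using linear_map_on_zero[OF l z] z by (simp add: component_image[OF Q])
    show "(\<lambda>x. a * f x + b * g x) \<in> Q ` funs_on F" if "f \<in> Q ` funs_on F" "g \<in> Q ` funs_on F" for f g a b
      using that linear_map_on_comb[OF l, of f g a b] lin_subspace_comb[OF lin_subspace_funs_on, of f F g a b]
      by (simp add: component_image[OF Q])
    show "pact p u \<in> Q ` funs_on F" if p: "p permutes E" and "u \<in> Q ` funs_on F" for p u
      using that e pact_funs_on[OF F_inv p] by (simp add: component_image[OF Q] op_equiv_def)
  qed
qed

lemma component_subset: "component Q \<Longrightarrow> Q ` funs_on F \<subseteq> funs_on F"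
  using component_image by blast

lemma is_component_iso:
  assumes mu: "\<mu> \<in> young_diagrams (card E)" and Q: "is_component \<mu> Q"
  shows "\<exists>\<eta>. perm_iso E F (Q ` funs_on F) (tabloids \<mu> E) (specht \<mu> E) \<eta>"
proof -
  have c: "component Q" by (rule is_component_component[OF Q])
  have "unitarily_equivalent (fin_sym E) (subrep (sym_rep E F) (Q ` funs_on F))
      (subrep (sym_rep E (tabloids \<mu> E)) (specht \<mu> E))"
    using Q unfolding component_projection_def sym_rep_space specht_rep_eq by (simp add: I_fin_rep_def)
  then show ?thesis
    using unitarily_equivalent_iff_perm_iso[OF finite_E finF finite_tabloids[OF finite_E] F_inv
        perm_invariant_tabloids component_submodule[OF c] component_subset[OF c] perm_submodule_specht[OF finite_E mu] specht_funs_on[OF finite_E mu]]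
    by simp
qed

lemma pi_rep_irreducible:
  assumes Q: "is_component \<mu> Q" shows "irreducible_rep S_pos (pi_rep \<P> Q)"
proof -
  have c: "component Q" by (rule is_component_component[OF Q])
  have irr: "irreducible_rep (fin_sym E) (subrep (sym_rep E F) (Q ` funs_on F))"
    using Q unfolding component_projection_def sym_rep_space by (simp add: I_fin_rep_def)
  show ?thesis unfolding pi_rep_eq
  proof (rule V_irreducible)
    show "W = {\<lambda>_. 0} \<or> W = Q ` funs_on F" if "perm_submodule E W" "W \<subseteq> Q ` funs_on F" for W
      by (rule perm_irreducibleD[OF finite_E finF F_inv component_subset[OF c] irr that])
    show "Q ` funs_on F \<noteq> {\<lambda>_. 0}" using irr by (simp add: irreducible_rep_def subrep_def)
  qed (use c in \<open>simp_all add: component_def\<close>)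
qed

text \<open>By \<open>V_equivalent\<close> an equivalence would restrict to an isometric
  homomorphism between the two finite components. Its image vectors then come from Specht modules of
  two different shapes, so \<open>specht_ip_distinct\<close> makes them orthogonal to
  themselves.\<close>

lemma pi_rep_inequivalent:
  assumes mu: "\<mu> \<in> young_diagrams (card E)" and nu: "\<nu> \<in> young_diagrams (card E)" and ne: "\<mu> \<noteq> \<nu>"
    and Q: "is_component \<mu> Q" and R: "is_component \<nu> R"
  shows "\<not> unitarily_equivalent S_pos (pi_rep \<P> Q) (pi_rep \<P> R)"
proof
  assume eq: "unitarily_equivalent S_pos (pi_rep \<P> Q) (pi_rep \<P> R)"
  have c: "component Q" by (rule is_component_component[OF Q])
  have d: "component R" by (rule is_component_component[OF R])
  let ?V = "Q ` funs_on F" and ?W = "R ` funs_on F"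
  have "\<exists>T. perm_hom E ?V F T \<and> (\<forall>u\<in>?V. T u \<in> ?W) \<and> (\<forall>u\<in>?V. \<forall>v\<in>?V. ip F (T u) (T v) = ip F u v)"
    by (rule V_equivalent[OF _ _ _ _ eq[unfolded pi_rep_eq]]) (use c d in \<open>simp_all add: component_def\<close>)
  then obtain T where T: "perm_hom E ?V F T" "\<forall>u\<in>?V. T u \<in> ?W"
    "\<forall>u\<in>?V. \<forall>v\<in>?V. ip F (T u) (T v) = ip F u v" by (elim exE conjE) (rule that)
  have "\<exists>\<theta>. perm_iso E (tabloids \<kappa> E) (specht \<kappa> E) F (S ` funs_on F) \<theta>" if k: "\<kappa> \<in> young_diagrams (card E)" and S: "is_component \<kappa> S" for \<kappa> S
  proof -
    have s: "component S" by (rule is_component_component[OF S])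
    obtain \<eta> where "perm_iso E F (S ` funs_on F) (tabloids \<kappa> E) (specht \<kappa> E) \<eta>"
      using is_component_iso[OF k S] by (rule exE)
    from perm_iso_inv[OF finite_E finF finite_tabloids[OF finite_E] F_inv perm_invariant_tabloids
        component_submodule[OF s] component_subset[OF s] perm_submodule_specht[OF finite_E k] specht_funs_on[OF finite_E k] this]
    show ?thesis by blast
  qed
  note iso = this
  obtain \<theta> where \<theta>: "perm_iso E (tabloids \<mu> E) (specht \<mu> E) F ?V \<theta>" using iso[OF mu Q] by (rule exE)
  obtain \<theta>' where \<theta>': "perm_iso E (tabloids \<nu> E) (specht \<nu> E) F ?W \<theta>'" using iso[OF nu R] by (rule exE)
  have \<theta>V: "\<theta> u \<in> ?V" if "u \<in> specht \<mu> E" for u using \<theta> that by (auto simp: perm_iso_def bij_betw_def)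
  have hom: "perm_hom E (specht \<mu> E) F (\<lambda>u. T (\<theta> u))"
    unfolding perm_hom_def
  proof (intro conjI ballI allI impI)
    show "T (\<theta> u) \<in> funs_on F" if "u \<in> specht \<mu> E" for u using T(1) \<theta>V[OF that] unfolding perm_hom_def by blast
    have "linear_map_on (specht \<mu> E) \<theta>" "linear_map_on ?V T"
      using \<theta> T(1) by (simp_all add: perm_iso_def perm_hom_def)
    then show "linear_map_on (specht \<mu> E) (\<lambda>u. T (\<theta> u))"
      unfolding linear_map_on_def[of "specht \<mu> E"] by (auto simp: linear_map_on_comb[of ?V T] \<theta>V)
    show "T (\<theta> (pact p u)) = pact p (T (\<theta> u))" if "p permutes E" "u \<in> specht \<mu> E" for p u
    proof -
      have "\<theta> (pact p u) = pact p (\<theta> u)" using \<theta> that by (simp add: perm_iso_def perm_hom_def)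
      moreover have "T (pact p (\<theta> u)) = pact p (T (\<theta> u))"
        using T(1) \<theta>V[OF that(2)] that(1) unfolding perm_hom_def by blast
      ultimately show ?thesis by simp
    qed
  qed
  obtain u where u: "u \<in> specht \<mu> E" "u \<noteq> (\<lambda>_. 0)" using specht_nonzero[OF finite_E mu] by blast
  have "T (\<theta> u) \<in> \<theta>' ` specht \<nu> E" using bspec[OF T(2) \<theta>V[OF u(1)]] \<theta>' by (simp add: perm_iso_def bij_betw_def)
  then obtain v where v: "v \<in> specht \<nu> E" "T (\<theta> u) = \<theta>' v" by blast
  have "perm_hom E (specht \<nu> E) F \<theta>'" using \<theta>' by (simp add: perm_iso_def)
  from specht_ip_distinct[OF finite_E mu nu ne F_inv hom this u(1) v(1)]
  have "ip F (T (\<theta> u)) (T (\<theta> u)) = 0" by (simp add: v(2))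
  moreover have "ip F (T (\<theta> u)) (T (\<theta> u)) = ip (tabloids \<mu> E) u u"
    using T(3) \<theta>V[OF u(1)] \<theta> u(1) unfolding perm_iso_def by metis
  ultimately have "u = (\<lambda>_. 0)"
    using ip_self_eq_0[OF finite_tabloids[OF finite_E] subsetD[OF specht_funs_on[OF finite_E mu] u(1)]] by simp
  then show False using u(2) by simp
qed

abbreviation "J \<equiv> SIGMA \<mu>:young_diagrams (card E). {..<kostka \<mu> shape}"

text \<open>A diagram that does not dominate has Kostka number 0 and contributes no index, so the
  restriction to dominating diagrams leaves the index set unchanged.\<close>

lemma dominant_index: "(SIGMA \<mu>:{\<mu> \<in> young_diagrams (card E). dominates \<mu> shape}. {..<kostka \<mu> shape}) = J"
  using kostka_pos_dominates by fastforce

lemma I_fin_decomposition: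
  "\<exists>\<psi>. (\<forall>a\<in>J. perm_hom E (specht (fst a) E) F (\<psi> a)) \<and>
     (\<forall>a\<in>J. \<forall>b\<in>J. \<forall>u\<in>specht (fst a) E. \<forall>v\<in>specht (fst b) E.
        ip F (\<psi> a u) (\<psi> b v) = (if a = b then ip (tabloids (fst a) E) u v else 0)) \<and>
     (\<forall>f\<in>funs_on F. \<exists>v. (\<forall>a\<in>J. v a \<in> specht (fst a) E) \<and> f = (\<lambda>r. \<Sum>a\<in>J. \<psi> a (v a) r))"
proof -
  obtain \<iota> where \<iota>: "bij_betw \<iota> {..<length shape} (finite_blocks \<P>)"
    "\<And>k. k < length shape \<Longrightarrow> card (\<iota> k) = shape ! k" using shape_enumeration by blast
  show ?thesis
  proof (rule young_rule[where m = card, OF finite_E \<iota> sum_list_shape, folded F_eq])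
    fix \<psi>
    assume "\<And>a. a \<in> J \<Longrightarrow> perm_hom E (specht (fst a) E) F (\<psi> a)"
      and "\<And>a b u v. a \<in> J \<Longrightarrow> b \<in> J \<Longrightarrow> u \<in> specht (fst a) E \<Longrightarrow> v \<in> specht (fst b) E \<Longrightarrow>
        ip F (\<psi> a u) (\<psi> b v) = (if a = b then ip (tabloids (fst a) E) u v else 0)"
      and "\<And>f. f \<in> funs_on F \<Longrightarrow> \<exists>v. (\<forall>a\<in>J. v a \<in> specht (fst a) E) \<and> f = (\<lambda>r. \<Sum>a\<in>J. \<psi> a (v a) r)"
    then show ?thesis by (intro exI[of _ \<psi>] conjI ballI) simp_all
  qed
qed

lemma component_exists:
  assumes mu: "\<mu> \<in> young_diagrams (card E)" and dom: "dominates \<mu> shape"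
  shows "\<exists>Q. is_component \<mu> Q"
proof -
  obtain \<psi> where \<psi>: "\<forall>a\<in>J. perm_hom E (specht (fst a) E) F (\<psi> a)"
    "\<forall>a\<in>J. \<forall>b\<in>J. \<forall>u\<in>specht (fst a) E. \<forall>v\<in>specht (fst b) E.
        ip F (\<psi> a u) (\<psi> b v) = (if a = b then ip (tabloids (fst a) E) u v else 0)"
    "\<forall>f\<in>funs_on F. \<exists>v. (\<forall>a\<in>J. v a \<in> specht (fst a) E) \<and> f = (\<lambda>r. \<Sum>a\<in>J. \<psi> a (v a) r)"
    using I_fin_decomposition by (elim exE conjE) (rule that)
  \<comment> \<open>Dominance makes the Kostka number positive, so copy number 0 is present.\<close>
  have a: "(\<mu>, 0) \<in> J" using dominates_kostka_pos[of \<mu> shape] mu dom sorted_shape by (simp add: sum_list_shape)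
  show ?thesis unfolding I_fin_rep_def
  proof (rule projection_onto_isometric_image[OF finite_E mu finF F_inv])
    show "perm_hom E (specht \<mu> E) F (\<psi> (\<mu>, 0))" using bspec[OF \<psi>(1) a] by simp
    show "ip F (\<psi> (\<mu>, 0) u) (\<psi> (\<mu>, 0) v) = ip (tabloids \<mu> E) u v" if "u \<in> specht \<mu> E" "v \<in> specht \<mu> E" for u v
      using bspec[OF bspec[OF \<psi>(2) a] a] that by simp
  qed
qed

lemma I_rep_decomposition:
  assumes Q: "\<And>\<mu>. \<mu> \<in> young_diagrams (card E) \<Longrightarrow> dominates \<mu> shape \<Longrightarrow> is_component \<mu> (Q \<mu>)"
  shows "unitarily_equivalent S_pos (I_rep \<P>) (direct_sum_rep J (\<lambda>a. pi_rep \<P> (Q (fst a))))"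
proof (rule I_rep_equivalent)
  obtain \<psi> where \<psi>: "\<forall>a\<in>J. perm_hom E (specht (fst a) E) F (\<psi> a)"
    "\<forall>a\<in>J. \<forall>b\<in>J. \<forall>u\<in>specht (fst a) E. \<forall>v\<in>specht (fst b) E.
        ip F (\<psi> a u) (\<psi> b v) = (if a = b then ip (tabloids (fst a) E) u v else 0)"
    "\<forall>f\<in>funs_on F. \<exists>v. (\<forall>a\<in>J. v a \<in> specht (fst a) E) \<and> f = (\<lambda>r. \<Sum>a\<in>J. \<psi> a (v a) r)"
    using I_fin_decomposition by (elim exE conjE) (rule that)
  \<comment> \<open>An index in J witnesses a positive Kostka number, hence dominance, as the
    hypothesis on Q requires.\<close>
  have c: "is_component (fst a) (Q (fst a))" if "a \<in> J" for a
    using that Q[of "fst a"] kostka_pos_dominates[of "fst a" "card E" shape] by auto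
  have "\<forall>a\<in>J. \<exists>\<eta>. perm_iso E F (Q (fst a) ` funs_on F) (tabloids (fst a) E) (specht (fst a) E) \<eta>"
  proof
    fix a assume a: "a \<in> J"
    then have "fst a \<in> young_diagrams (card E)" by auto
    then show "\<exists>\<eta>. perm_iso E F (Q (fst a) ` funs_on F) (tabloids (fst a) E) (specht (fst a) E) \<eta>"
      by (rule is_component_iso) (rule c[OF a])
  qed
  from bchoice[OF this] obtain \<eta>
    where \<eta>: "\<And>a. a \<in> J \<Longrightarrow> perm_iso E F (Q (fst a) ` funs_on F) (tabloids (fst a) E) (specht (fst a) E) (\<eta> a)"
    by blast
  have S: "perm_submodule E (specht (fst a) E)" if "a \<in> J" for a
    using that by (intro perm_submodule_specht[OF finite_E]) auto
  have J: "finite J" by (rule finite_SigmaI) simp_all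
  show "unitarily_equivalent S_pos (permutation_rep S_pos relabel X) (direct_sum_rep J (\<lambda>a. pi_rep \<P> (Q (fst a))))"
    unfolding pi_rep_eq
    by (rule decomposition_from_isometries[where \<psi> = \<psi> and \<eta> = \<eta> and S = "\<lambda>a. specht (fst a) E" and
          T = "\<lambda>a. tabloids (fst a) E"])
      (rule J is_component_component[OF c] S bspec[OF \<psi>(1)]
        bspec[OF bspec[OF bspec[OF bspec[OF \<psi>(2)]]]] bspec[OF \<psi>(3)] \<eta>; assumption)+
qed

end

theorem theorem2:
  fixes \<P> :: "nat set set"
  assumes partition: "partition_on {1..} \<P>"
    and fin: "finite (finite_blocks \<P>)"
  shows "let shape = block_shape \<P>;
             E = finite_part \<P>;
             N = sum_list shape;
             M = {\<mu> \<in> young_diagrams N. dominates \<mu> shape};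
             is_proj = (\<lambda>\<mu>. component_projection (fin_sym E) (I_fin_rep \<P>) (specht_rep \<mu> E))
         in (\<forall>\<mu>\<in>M. \<exists>P. is_proj \<mu> P) \<and>
            (\<forall>P. (\<forall>\<mu>\<in>M. is_proj \<mu> (P \<mu>)) \<longrightarrow>
               (\<forall>\<mu>\<in>M. irreducible_rep S_pos (pi_rep \<P> (P \<mu>))) \<and>
               (\<forall>\<mu>\<in>M. \<forall>\<nu>\<in>M. \<mu> \<noteq> \<nu> \<longrightarrow>
                  \<not> unitarily_equivalent S_pos (pi_rep \<P> (P \<mu>)) (pi_rep \<P> (P \<nu>))) \<and>
               unitarily_equivalent S_pos (I_rep \<P>)
                 (direct_sum_rep (SIGMA \<mu>:M. {..<kostka \<mu> shape}) (\<lambda>(\<mu>, j). pi_rep \<P> (P \<mu>))))"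
proof -
  interpret block_partition \<P> by unfold_locales (fact partition fin)+
  show ?thesis unfolding Let_def sum_list_shape dominant_index case_prod_beta
    using component_exists pi_rep_irreducible pi_rep_inequivalent I_rep_decomposition by blast
qed

end
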